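(* Let $A$ be an AF-algebra and let $E$ be a Bratteli diagram for $A$. Then $A$ is Morita equivalent to the graph algebra $C^*(E)$.
   Context: **Directed graphs.** A directed graph $E$ consists of countable sets $E^0$ (vertices) and $E^1$ (edges) and functions $r,s:E^1\to E^0$ giving the range and source of each edge. It is row-finite if each vertex emits at most finitely many edges, i.e. $s^{-1}(v)$ is finite for every $v\in E^0$. **Graph algebras.** For a row-finite directed graph $E$, a Cuntz-Krieger $E$-family in a $C^*$-algebra consists of mutually orthogonal projections $\{p_v:v\in E^0\}$ and partial isometries $\{s_e:e\in E^1\}$ satisfying $s_e^*s_e=p_{r(e)}$ for all $e\in E^1$, and $p_v=\sum_{e\in s^{-1}(v)}s_es_e^*$ whenever $s^{-1}(v)\neq\emptyset$. The graph algebra $C^*(E)$ is the universal $C^*$-algebra generated by a Cuntz-Krieger $E$-family. **Bratteli diagrams.** A Bratteli diagram is a directed graph $E$ such that: $E^0$ is the disjoint union of finite sets $V_n$ ($n=1,2,\dots$); every edge with source in $V_n$ has range in $V_{n+1}$; and each $v\in E^0$ is labelled with a positive integer $d_v$ satisfying $d_v\ge\sum_{e\in r^{-1}(v)}d_{s(e)}$. (In particular, such a graph is row-finite.) The graph algebra $C^*(E)$ of a Bratteli diagram is that of its underlying directed graph. $E$ is a Bratteli diagram for a sequence of $C^*$-algebras $A_1\subset A_2\subset\cdots$ if each $A_n$ is isomorphic to $\bigoplus_{v\in V_n}M_{d_v}(\mathbb{C})$ and, under these identifications, for $v\in V_n$ and $w\in V_{n+1}$ the embedding of the summand $M_{d_v}(\mathbb{C})\subset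 A_n$ in the summand $M_{d_w}(\mathbb{C})\subset A_{n+1}$ (the inclusion $A_n\subset A_{n+1}$ restricted to the first summand and followed by projection onto the second) scales the (unnormalized) trace by $\#(s^{-1}(v)\cap r^{-1}(w))$, i.e. has multiplicity equal to the number of edges from $v$ to $w$. The inclusions are not required to be unital. $E$ is a Bratteli diagram for an AF-algebra $A$ if there is a sequence of $C^*$-subalgebras $A_1\subset A_2\subset\cdots$ of $A$ such that $A=\overline{\bigcup_n A_n}$ and $E$ is a Bratteli diagram for $\{A_n\}$. **Morita equivalence** is meant in the sense of $C^*$-algebras (Rieffel's strong Morita equivalence, i.e. existence of an imprimitivity bimodule). *)

theory Defs
  imports
    "HOL-Analysis.Analysis"
    "Graph_Theory.Digraph"
    "Jordan_Normal_Form.Schur_Decomposition"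
    "Jordan_Normal_Form.VS_Connect"
begin

section \<open>C*-algebras\<close>

text \<open>
  The algebras are not assumed to have a unit; the inherited record field \<open>one\<close> is
  never used. The scalars are \<open>class_ring\<close> at type \<^typ>\<open>complex\<close>.
\<close>

record 'a star_algebra = "(complex, 'a) module" +
  star :: "'a \<Rightarrow> 'a"

record 'a cstar = "'a star_algebra" +
  nrm :: "'a \<Rightarrow> real"

locale complex_star_algebra = vectorspace class_ring A
  for A :: "('a, 'm) star_algebra_scheme" (structure) +
  assumes mult_closed: "\<lbrakk>x \<in> carrier A; y \<in> carrier A\<rbrakk> \<Longrightarrow> x \<otimes> y \<in> carrier A"
    and mult_assoc: "\<lbrakk>x \<in> carrier A; y \<in> carrier A; z \<in> carrier A\<rbrakk>
          \<Longrightarrow> (x \<otimes> y) \<otimes> z = x \<otimes> (y \<otimes> z)"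
    and mult_l_distr: "\<lbrakk>x \<in> carrier A; y \<in> carrier A; z \<in> carrier A\<rbrakk>
          \<Longrightarrow> (x \<oplus> y) \<otimes> z = x \<otimes> z \<oplus> y \<otimes> z"
    and mult_r_distr: "\<lbrakk>x \<in> carrier A; y \<in> carrier A; z \<in> carrier A\<rbrakk>
          \<Longrightarrow> z \<otimes> (x \<oplus> y) = z \<otimes> x \<oplus> z \<otimes> y"
    and smult_mult_l: "\<lbrakk>x \<in> carrier A; y \<in> carrier A\<rbrakk> \<Longrightarrow> (c \<odot> x) \<otimes> y = c \<odot> (x \<otimes> y)"
    and smult_mult_r: "\<lbrakk>x \<in> carrier A; y \<in> carrier A\<rbrakk> \<Longrightarrow> x \<otimes> (c \<odot> y) = c \<odot> (x \<otimes> y)"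
    and star_closed: "x \<in> carrier A \<Longrightarrow> star A x \<in> carrier A"
    and star_star: "x \<in> carrier A \<Longrightarrow> star A (star A x) = x"
    and star_add: "\<lbrakk>x \<in> carrier A; y \<in> carrier A\<rbrakk> \<Longrightarrow> star A (x \<oplus> y) = star A x \<oplus> star A y"
    and star_smult: "x \<in> carrier A \<Longrightarrow> star A (c \<odot> x) = cnj c \<odot> star A x"
    and star_mult: "\<lbrakk>x \<in> carrier A; y \<in> carrier A\<rbrakk> \<Longrightarrow> star A (x \<otimes> y) = star A y \<otimes> star A x"

text \<open>Completeness of \<open>X\<close> in the metric \<open>(x, y) \<mapsto> N (x - y)\<close>.\<close>

definition complete_wrt :: "('x, 'm) ring_scheme \<Rightarrow> ('x \<Rightarrow> real) \<Rightarrow> bool" where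
  "complete_wrt X N \<longleftrightarrow>
     (\<forall>x :: nat \<Rightarrow> 'x. (\<forall>n. x n \<in> carrier X) \<and>
        (\<forall>\<epsilon>>0. \<exists>M. \<forall>m\<ge>M. \<forall>n\<ge>M. N (x m \<ominus>\<^bsub>X\<^esub> x n) < \<epsilon>) \<longrightarrow>
        (\<exists>l\<in>carrier X. (\<lambda>n. N (x n \<ominus>\<^bsub>X\<^esub> l)) \<longlonglongrightarrow> 0))"

locale cstar_algebra = complex_star_algebra A
  for A :: "('a, 'm) cstar_scheme" (structure) +
  assumes nrm_nonneg: "x \<in> carrier A \<Longrightarrow> 0 \<le> nrm A x"
    and nrm_eq_0_iff: "x \<in> carrier A \<Longrightarrow> nrm A x = 0 \<longleftrightarrow> x = \<zero>"
    and nrm_triangle: "\<lbrakk>x \<in> carrier A; y \<in> carrier A\<rbrakk> \<Longrightarrow> nrm A (x \<oplus> y) \<le> nrm A x + nrm A y"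
    and nrm_smult: "x \<in> carrier A \<Longrightarrow> nrm A (c \<odot> x) = cmod c * nrm A x"
    and nrm_mult: "\<lbrakk>x \<in> carrier A; y \<in> carrier A\<rbrakk> \<Longrightarrow> nrm A (x \<otimes> y) \<le> nrm A x * nrm A y"
    and cstar_identity: "x \<in> carrier A \<Longrightarrow> nrm A (star A x \<otimes> x) = (nrm A x)\<^sup>2"
    and nrm_complete: "complete_wrt A (nrm A)"

definition norm_closure :: "('a, 'm) cstar_scheme \<Rightarrow> 'a set \<Rightarrow> 'a set" where
  "norm_closure A S = {x \<in> carrier A. \<forall>\<epsilon>>0. \<exists>y\<in>S. nrm A (x \<ominus>\<^bsub>A\<^esub> y) < \<epsilon>}"

definition cstar_subalgebra :: "'a set \<Rightarrow> ('a, 'm) cstar_scheme \<Rightarrow> bool" where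
  "cstar_subalgebra S A \<longleftrightarrow>
     S \<subseteq> carrier A \<and> \<zero>\<^bsub>A\<^esub> \<in> S \<and>
     (\<forall>x\<in>S. \<forall>y\<in>S. x \<oplus>\<^bsub>A\<^esub> y \<in> S) \<and>
     (\<forall>c. \<forall>x\<in>S. c \<odot>\<^bsub>A\<^esub> x \<in> S) \<and>
     (\<forall>x\<in>S. \<forall>y\<in>S. x \<otimes>\<^bsub>A\<^esub> y \<in> S) \<and>
     (\<forall>x\<in>S. star A x \<in> S) \<and>
     norm_closure A S \<subseteq> S"

definition star_hom ::
    "('a, 'm) star_algebra_scheme \<Rightarrow> ('b, 'n) star_algebra_scheme \<Rightarrow> ('a \<Rightarrow> 'b) set" where
  "star_hom A B = {f \<in> carrier A \<rightarrow> carrier B.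
     (\<forall>x\<in>carrier A. \<forall>y\<in>carrier A. f (x \<oplus>\<^bsub>A\<^esub> y) = f x \<oplus>\<^bsub>B\<^esub> f y) \<and>
     (\<forall>c. \<forall>x\<in>carrier A. f (c \<odot>\<^bsub>A\<^esub> x) = c \<odot>\<^bsub>B\<^esub> f x) \<and>
     (\<forall>x\<in>carrier A. \<forall>y\<in>carrier A. f (x \<otimes>\<^bsub>A\<^esub> y) = f x \<otimes>\<^bsub>B\<^esub> f y) \<and>
     (\<forall>x\<in>carrier A. f (star A x) = star B (f x))}"

definition star_iso ::
    "('a, 'm) star_algebra_scheme \<Rightarrow> ('b, 'n) star_algebra_scheme \<Rightarrow> ('a \<Rightarrow> 'b) set" where
  "star_iso A B = {f \<in> star_hom A B. bij_betw f (carrier A) (carrier B)}"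

definition af_algebra :: "'a cstar \<Rightarrow> bool" where
  "af_algebra A \<longleftrightarrow> cstar_algebra A \<and>
     (\<exists>S :: nat \<Rightarrow> 'a set.
        (\<forall>n. cstar_subalgebra (S n) A \<and> vectorspace.fin_dim class_ring (A\<lparr>carrier := S n\<rparr>)) \<and>
        (\<forall>n. S n \<subseteq> S (Suc n)) \<and>
        norm_closure A (\<Union>n. S n) = carrier A)"


section \<open>Graph algebras\<close>

text \<open>The source and range maps are \<^const>\<open>tail\<close> and \<^const>\<open>head\<close>.\<close>

locale directed_graph = wf_digraph +
  assumes countable_verts: "countable (verts G)"
    and countable_arcs: "countable (arcs G)"

locale row_finite_graph = directed_graph +
  assumes row_finite: "v \<in> verts G \<Longrightarrow> finite (out_arcs G v)"

definition ck_family ::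
    "('v, 'e) pre_digraph \<Rightarrow> ('b, 'm) star_algebra_scheme \<Rightarrow> ('v \<Rightarrow> 'b) \<Rightarrow> ('e \<Rightarrow> 'b) \<Rightarrow> bool" where
  "ck_family E B p s \<longleftrightarrow>
     (\<forall>v\<in>verts E. p v \<in> carrier B \<and> p v \<otimes>\<^bsub>B\<^esub> p v = p v \<and> star B (p v) = p v) \<and>
     (\<forall>v\<in>verts E. \<forall>w\<in>verts E. v \<noteq> w \<longrightarrow> p v \<otimes>\<^bsub>B\<^esub> p w = \<zero>\<^bsub>B\<^esub>) \<and>
     (\<forall>e\<in>arcs E. s e \<in> carrier B \<and> s e \<otimes>\<^bsub>B\<^esub> star B (s e) \<otimes>\<^bsub>B\<^esub> s e = s e) \<and>
     (\<forall>e\<in>arcs E. star B (s e) \<otimes>\<^bsub>B\<^esub> s e = p (head E e)) \<and>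
     (\<forall>v\<in>verts E. out_arcs E v \<noteq> {} \<longrightarrow>
        p v = (\<Oplus>\<^bsub>B\<^esub>e\<in>out_arcs E v. s e \<otimes>\<^bsub>B\<^esub> star B (s e)))"

text \<open>
  HOL cannot quantify over all C*-algebras of all types inside a formula, so the universal property
  ranges over the C*-algebras whose elements lie in the type below. Nothing is lost: a C*-algebra
  generated by a Cuntz-Krieger family of a countable graph is separable, so it has at most
  continuum many elements and has an isomorphic copy in this type.
\<close>

type_synonym cstar_universe = "(nat \<Rightarrow> complex) \<Rightarrow> nat \<Rightarrow> complex"

definition graph_algebra ::
    "('v, 'e) pre_digraph \<Rightarrow> 'b cstar \<Rightarrow> ('v \<Rightarrow> 'b) \<Rightarrow> ('e \<Rightarrow> 'b) \<Rightarrow> bool" where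
  "graph_algebra E B p s \<longleftrightarrow>
     row_finite_graph E \<and> cstar_algebra B \<and> ck_family E B p s \<and>
     (\<forall>S. cstar_subalgebra S B \<and> p ` verts E \<subseteq> S \<and> s ` arcs E \<subseteq> S \<longrightarrow> S = carrier B) \<and>
     (\<forall>(C :: cstar_universe cstar) q t. cstar_algebra C \<and> ck_family E C q t \<longrightarrow>
        (\<exists>\<pi>\<in>star_hom B C. (\<forall>v\<in>verts E. \<pi> (p v) = q v) \<and> (\<forall>e\<in>arcs E. \<pi> (s e) = t e)))"


section \<open>Bratteli diagrams\<close>

text \<open>
  The levels are numbered from 0. The finiteness of \<open>in_arcs E v\<close>, which the inequality
  on the labels presupposes, is explicit because sums over infinite sets are 0 in HOL.
\<close>

locale bratteli_diagram = directed_graph E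
  for E :: "('v, 'e) pre_digraph" and V :: "nat \<Rightarrow> 'v set" and d :: "'v \<Rightarrow> nat" +
  assumes verts_levels: "verts E = (\<Union>n. V n)"
    and disjoint_levels: "disjoint_family V"
    and finite_levels: "finite (V n)"
    and arcs_levels: "\<lbrakk>e \<in> arcs E; tail E e \<in> V n\<rbrakk> \<Longrightarrow> head E e \<in> V (Suc n)"
    and label_pos: "v \<in> verts E \<Longrightarrow> 0 < d v"
    and finite_in_arcs: "v \<in> verts E \<Longrightarrow> finite (in_arcs E v)"
    and label_ge: "v \<in> verts E \<Longrightarrow> (\<Sum>e\<in>in_arcs E v. d (tail E e)) \<le> d v"

definition matrix_sum :: "'v set \<Rightarrow> ('v \<Rightarrow> nat) \<Rightarrow> ('v \<Rightarrow> complex mat) star_algebra" where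
  "matrix_sum W d =
     \<lparr>carrier = (\<Pi>\<^sub>E v\<in>W. carrier_mat (d v) (d v)),
      mult = (\<lambda>x y. \<lambda>v\<in>W. x v * y v),
      one = (\<lambda>v\<in>W. 1\<^sub>m (d v)),
      zero = (\<lambda>v\<in>W. 0\<^sub>m (d v) (d v)),
      add = (\<lambda>x y. \<lambda>v\<in>W. x v + y v),
      smult = (\<lambda>c x. \<lambda>v\<in>W. c \<cdot>\<^sub>m x v),
      star = (\<lambda>x. \<lambda>v\<in>W. mat_adjoint (x v))\<rparr>"

definition mat_trace :: "complex mat \<Rightarrow> complex" where
  "mat_trace M = (\<Sum>i<dim_row M. M $$ (i, i))"

text \<open>
  \<open>As n\<close> is the \<open>n\<close>-th algebra of the increasing sequence. In the last clause \<open>a\<close> ranges over the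
  summand of \<open>As n\<close> that corresponds to \<open>v\<close>.
\<close>

definition bratteli_diagram_for_seq ::
    "('v, 'e) pre_digraph \<Rightarrow> (nat \<Rightarrow> 'v set) \<Rightarrow> ('v \<Rightarrow> nat) \<Rightarrow> (nat \<Rightarrow> 'a cstar) \<Rightarrow> bool" where
  "bratteli_diagram_for_seq E V d As \<longleftrightarrow>
     bratteli_diagram E V d \<and>
     (\<exists>\<phi> :: nat \<Rightarrow> 'a \<Rightarrow> 'v \<Rightarrow> complex mat.
        (\<forall>n. \<phi> n \<in> star_iso (As n) (matrix_sum (V n) d)) \<and>
        (\<forall>n. \<forall>v\<in>V n. \<forall>w\<in>V (Suc n). \<forall>a\<in>carrier (As n).
           (\<forall>u\<in>V n - {v}. \<phi> n a u = 0\<^sub>m (d u) (d u)) \<longrightarrow>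
           mat_trace (\<phi> (Suc n) a w) =
             of_nat (card (out_arcs E v \<inter> in_arcs E w)) * mat_trace (\<phi> n a v)))"

definition bratteli_diagram_for ::
    "('v, 'e) pre_digraph \<Rightarrow> (nat \<Rightarrow> 'v set) \<Rightarrow> ('v \<Rightarrow> nat) \<Rightarrow> 'a cstar \<Rightarrow> bool" where
  "bratteli_diagram_for E V d A \<longleftrightarrow>
     (\<exists>S :: nat \<Rightarrow> 'a set.
        (\<forall>n. cstar_subalgebra (S n) A) \<and>
        (\<forall>n. S n \<subseteq> S (Suc n)) \<and>
        norm_closure A (\<Union>n. S n) = carrier A \<and>
        bratteli_diagram_for_seq E V d (\<lambda>n. A\<lparr>carrier := S n\<rparr>))"


section \<open>Morita equivalence\<close>

definition positive_elem :: "('a, 'm) star_algebra_scheme \<Rightarrow> 'a \<Rightarrow> bool" where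
  "positive_elem A a \<longleftrightarrow> (\<exists>b\<in>carrier A. a = star A b \<otimes>\<^bsub>A\<^esub> b)"

locale full_right_hilbert_module =
  B: cstar_algebra B + X: vectorspace class_ring X
  for B :: "('b, 'm) cstar_scheme" and X :: "(complex, 'x, 'n) module_scheme" +
  fixes act :: "'x \<Rightarrow> 'b \<Rightarrow> 'x" and ip :: "'x \<Rightarrow> 'x \<Rightarrow> 'b"
  assumes act_closed: "\<lbrakk>x \<in> carrier X; b \<in> carrier B\<rbrakk> \<Longrightarrow> act x b \<in> carrier X"
    and act_add_l: "\<lbrakk>x \<in> carrier X; y \<in> carrier X; b \<in> carrier B\<rbrakk>
          \<Longrightarrow> act (x \<oplus>\<^bsub>X\<^esub> y) b = act x b \<oplus>\<^bsub>X\<^esub> act y b"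
    and act_add_r: "\<lbrakk>x \<in> carrier X; b \<in> carrier B; c \<in> carrier B\<rbrakk>
          \<Longrightarrow> act x (b \<oplus>\<^bsub>B\<^esub> c) = act x b \<oplus>\<^bsub>X\<^esub> act x c"
    and act_mult: "\<lbrakk>x \<in> carrier X; b \<in> carrier B; c \<in> carrier B\<rbrakk>
          \<Longrightarrow> act x (b \<otimes>\<^bsub>B\<^esub> c) = act (act x b) c"
    and act_smult_l: "\<lbrakk>x \<in> carrier X; b \<in> carrier B\<rbrakk>
          \<Longrightarrow> act (k \<odot>\<^bsub>X\<^esub> x) b = k \<odot>\<^bsub>X\<^esub> act x b"
    and act_smult_r: "\<lbrakk>x \<in> carrier X; b \<in> carrier B\<rbrakk>
          \<Longrightarrow> act x (k \<odot>\<^bsub>B\<^esub> b) = k \<odot>\<^bsub>X\<^esub> act x b"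
    and ip_closed: "\<lbrakk>x \<in> carrier X; y \<in> carrier X\<rbrakk> \<Longrightarrow> ip x y \<in> carrier B"
    and ip_add: "\<lbrakk>x \<in> carrier X; y \<in> carrier X; z \<in> carrier X\<rbrakk>
          \<Longrightarrow> ip x (y \<oplus>\<^bsub>X\<^esub> z) = ip x y \<oplus>\<^bsub>B\<^esub> ip x z"
    and ip_smult: "\<lbrakk>x \<in> carrier X; y \<in> carrier X\<rbrakk>
          \<Longrightarrow> ip x (k \<odot>\<^bsub>X\<^esub> y) = k \<odot>\<^bsub>B\<^esub> ip x y"
    and ip_act: "\<lbrakk>x \<in> carrier X; y \<in> carrier X; b \<in> carrier B\<rbrakk>
          \<Longrightarrow> ip x (act y b) = ip x y \<otimes>\<^bsub>B\<^esub> b"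
    and ip_star: "\<lbrakk>x \<in> carrier X; y \<in> carrier X\<rbrakk> \<Longrightarrow> star B (ip x y) = ip y x"
    and ip_pos: "x \<in> carrier X \<Longrightarrow> positive_elem B (ip x x)"
    and ip_definite: "\<lbrakk>x \<in> carrier X; ip x x = \<zero>\<^bsub>B\<^esub>\<rbrakk> \<Longrightarrow> x = \<zero>\<^bsub>X\<^esub>"
    and ip_complete: "complete_wrt X (\<lambda>x. sqrt (nrm B (ip x x)))"
    and ip_full: "norm_closure B
          (LinearCombinations.module.span class_ring B
            {ip x y | x y. x \<in> carrier X \<and> y \<in> carrier X}) = carrier B"

locale full_left_hilbert_module =
  A: cstar_algebra A + X: vectorspace class_ring X
  for A :: "('a, 'm) cstar_scheme" and X :: "(complex, 'x, 'n) module_scheme" +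
  fixes act :: "'a \<Rightarrow> 'x \<Rightarrow> 'x" and ip :: "'x \<Rightarrow> 'x \<Rightarrow> 'a"
  assumes act_closed: "\<lbrakk>a \<in> carrier A; x \<in> carrier X\<rbrakk> \<Longrightarrow> act a x \<in> carrier X"
    and act_add_r: "\<lbrakk>a \<in> carrier A; x \<in> carrier X; y \<in> carrier X\<rbrakk>
          \<Longrightarrow> act a (x \<oplus>\<^bsub>X\<^esub> y) = act a x \<oplus>\<^bsub>X\<^esub> act a y"
    and act_add_l: "\<lbrakk>a \<in> carrier A; b \<in> carrier A; x \<in> carrier X\<rbrakk>
          \<Longrightarrow> act (a \<oplus>\<^bsub>A\<^esub> b) x = act a x \<oplus>\<^bsub>X\<^esub> act b x"
    and act_mult: "\<lbrakk>a \<in> carrier A; b \<in> carrier A; x \<in> carrier X\<rbrakk>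
          \<Longrightarrow> act (a \<otimes>\<^bsub>A\<^esub> b) x = act a (act b x)"
    and act_smult_r: "\<lbrakk>a \<in> carrier A; x \<in> carrier X\<rbrakk>
          \<Longrightarrow> act a (k \<odot>\<^bsub>X\<^esub> x) = k \<odot>\<^bsub>X\<^esub> act a x"
    and act_smult_l: "\<lbrakk>a \<in> carrier A; x \<in> carrier X\<rbrakk>
          \<Longrightarrow> act (k \<odot>\<^bsub>A\<^esub> a) x = k \<odot>\<^bsub>X\<^esub> act a x"
    and ip_closed: "\<lbrakk>x \<in> carrier X; y \<in> carrier X\<rbrakk> \<Longrightarrow> ip x y \<in> carrier A"
    and ip_add: "\<lbrakk>x \<in> carrier X; y \<in> carrier X; z \<in> carrier X\<rbrakk>
          \<Longrightarrow> ip (x \<oplus>\<^bsub>X\<^esub> y) z = ip x z \<oplus>\<^bsub>A\<^esub> ip y z"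
    and ip_smult: "\<lbrakk>x \<in> carrier X; y \<in> carrier X\<rbrakk>
          \<Longrightarrow> ip (k \<odot>\<^bsub>X\<^esub> x) y = k \<odot>\<^bsub>A\<^esub> ip x y"
    and ip_act: "\<lbrakk>a \<in> carrier A; x \<in> carrier X; y \<in> carrier X\<rbrakk>
          \<Longrightarrow> ip (act a x) y = a \<otimes>\<^bsub>A\<^esub> ip x y"
    and ip_star: "\<lbrakk>x \<in> carrier X; y \<in> carrier X\<rbrakk> \<Longrightarrow> star A (ip x y) = ip y x"
    and ip_pos: "x \<in> carrier X \<Longrightarrow> positive_elem A (ip x x)"
    and ip_definite: "\<lbrakk>x \<in> carrier X; ip x x = \<zero>\<^bsub>A\<^esub>\<rbrakk> \<Longrightarrow> x = \<zero>\<^bsub>X\<^esub>"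
    and ip_complete: "complete_wrt X (\<lambda>x. sqrt (nrm A (ip x x)))"
    and ip_full: "norm_closure A
          (LinearCombinations.module.span class_ring A
            {ip x y | x y. x \<in> carrier X \<and> y \<in> carrier X}) = carrier A"

record ('a, 'b, 'x) bimodule = "(complex, 'x) module" +
  lact :: "'a \<Rightarrow> 'x \<Rightarrow> 'x"
  ract :: "'x \<Rightarrow> 'b \<Rightarrow> 'x"
  linner :: "'x \<Rightarrow> 'x \<Rightarrow> 'a"
  rinner :: "'x \<Rightarrow> 'x \<Rightarrow> 'b"

definition imprimitivity_bimodule ::
    "'a cstar \<Rightarrow> 'b cstar \<Rightarrow> ('a, 'b, 'x) bimodule \<Rightarrow> bool" where
  "imprimitivity_bimodule A B X \<longleftrightarrow>
     full_left_hilbert_module A X (lact X) (linner X) \<and>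
     full_right_hilbert_module B X (ract X) (rinner X) \<and>
     (\<forall>a\<in>carrier A. \<forall>b\<in>carrier B. \<forall>x\<in>carrier X.
        ract X (lact X a x) b = lact X a (ract X x b)) \<and>
     (\<forall>a\<in>carrier A. \<forall>x\<in>carrier X. \<forall>y\<in>carrier X.
        rinner X (lact X a x) y = rinner X x (lact X (star A a) y)) \<and>
     (\<forall>b\<in>carrier B. \<forall>x\<in>carrier X. \<forall>y\<in>carrier X.
        linner X (ract X x b) y = linner X x (ract X y (star B b))) \<and>
     (\<forall>x\<in>carrier X. \<forall>y\<in>carrier X. \<forall>z\<in>carrier X.
        lact X (linner X x y) z = ract X x (rinner X y z))"

text \<open>
  Again a type has to be fixed for the elements of the bimodule, and it is large enough for every
  imprimitivity bimodule \<open>X\<close> between \<open>A\<close> and \<open>B\<close>. By fullness there is a set \<open>Y\<close> of at most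
  \<open>\<aleph>\<^sub>0 |A|\<close> elements of \<open>X\<close> whose left inner products span a dense subspace of \<open>A\<close>. Because
  \<open>\<langle>y, y'\<rangle>\<^sub>A x = y \<langle>y', x\<rangle>\<^sub>B\<close>, the span of \<open>Y B\<close> is dense in \<open>X\<close>. So \<open>X\<close> has a dense subset
  of at most \<open>\<aleph>\<^sub>0 |A| |B|\<close> elements and at most as many elements as there are sequences
  in \<open>A \<times> B\<close> (if \<open>A\<close> or \<open>B\<close> is zero, so is \<open>X\<close>).
\<close>

definition morita_equivalent :: "'a cstar \<Rightarrow> 'b cstar \<Rightarrow> bool" where
  "morita_equivalent A B \<longleftrightarrow>
     (\<exists>X :: ('a, 'b, nat \<Rightarrow> 'a \<times> 'b) bimodule. imprimitivity_bimodule A B X)"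

end

theory Submission
  imports Defs
begin

text \<open>Extend the diagram by fictitious paths ending at \<open>v\<close>, one for each unit of the deficiency
  \<open>d v - (\<Sum>e\<in>r\<^sup>-\<^sup>1(v). d (s e))\<close>. Then \<open>A n\<close> has matrix units \<open>\<theta> \<mu> \<nu>\<close> indexed by pairs of extended
  paths to the same vertex of level \<open>n\<close>, which can be chosen such that
  \<open>\<theta> \<mu> \<nu> = (\<Sum>e. \<theta> (\<mu>e) (\<nu>e))\<close>; \<open>C*(E)\<close> is generated by the matrix units
  \<open>s\<^sub>\<mu> s\<^sub>\<nu>\<^sup>*\<close> indexed by pairs of paths in \<open>E\<close>, and these satisfy the same relation. Both algebras are
  therefore isometric to algebras of operators on square-summable functions of infinite paths, where
  \<open>\<theta> \<mu> \<nu>\<close> replaces the initial segment \<open>\<nu>\<close> by \<open>\<mu>\<close>. Using \<open>\<mu>\<close> of the first kind and \<open>\<nu>\<close> of the second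
  gives an off-diagonal block, which is the imprimitivity bimodule.\<close>

text \<open>The relations of a Cuntz-Krieger family do not mention products of the range projections
  of two edges with a common source; only their sum is known to be a projection. Orthogonality,
  without which \<open>s\<^sub>\<mu> s\<^sub>\<nu>\<^sup>*\<close> would not multiply like matrix
  units, is therefore a matter of positivity. Positivity returns with the bimodule:
  \<open>x * adj x\<close> is formed from an operator \<open>x\<close> outside the copy of
  \<open>A\<close>, yet it must be \<open>star A b \<otimes> b\<close> for some \<open>b\<close> in
  \<open>A\<close>. Both points rest on a square root constructed inside an algebra without unit.
  The isometries are not produced by universality. A finite-dimensional C*-algebra has only one
  C*-norm, so on each level the norm is determined by the matrix units as soon as none of them
  vanishes. In \<open>A\<close> this holds because they are built from orthonormal bases. In the
  graph algebra it comes down to nonzero vertex projections, and here universality enters, by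
  comparison with the operators on paths. That comparison needs infinite paths from every vertex;
  the trace condition and the injectivity of the inclusions exclude sinks.\<close>

no_notation scalar_prod (infix \<open>\<bullet>\<close> 70)

section \<open>The Hilbert space of square-summable sequences\<close>

typedef ell2 = "{x :: nat \<Rightarrow> complex. (\<lambda>n. (norm (x n))\<^sup>2) summable_on UNIV}"
  by (rule exI[of _ "\<lambda>_. 0"]) simp

setup_lifting type_definition_ell2

lemma square_summable_add:
  fixes x y :: "nat \<Rightarrow> complex"
  assumes "(\<lambda>n. (norm (x n))\<^sup>2) summable_on UNIV" "(\<lambda>n. (norm (y n))\<^sup>2) summable_on UNIV"
  shows "(\<lambda>n. (norm (x n + y n))\<^sup>2) summable_on UNIV"
proof (rule summable_on_comparison_test)
  show "(\<lambda>n. 2 * (norm (x n))\<^sup>2 + 2 * (norm (y n))\<^sup>2) summable_on UNIV"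
    by (intro summable_on_add summable_on_cmult_right assms)
  fix n
  have "(norm (x n + y n))\<^sup>2 \<le> (norm (x n) + norm (y n))\<^sup>2"
    by (intro power_mono norm_triangle_ineq) auto
  also have "\<dots> \<le> 2 * (norm (x n))\<^sup>2 + 2 * (norm (y n))\<^sup>2"
    using sum_squares_bound[of "norm (x n)" "norm (y n)"] by (simp add: power2_sum)
  finally show "(norm (x n + y n))\<^sup>2 \<le> 2 * (norm (x n))\<^sup>2 + 2 * (norm (y n))\<^sup>2" .
qed auto

text \<open>Polarization writes the products as combinations of three summable families of
  squares.\<close>

lemma square_summable_inner:
  fixes x y :: "nat \<Rightarrow> complex"
  assumes "(\<lambda>n. (norm (x n))\<^sup>2) summable_on UNIV" "(\<lambda>n. (norm (y n))\<^sup>2) summable_on UNIV"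
  shows "(\<lambda>n. x n \<bullet> y n) summable_on UNIV"
proof -
  have "(\<lambda>n. (norm (x n + y n))\<^sup>2) summable_on UNIV"
    by (rule square_summable_add[OF assms])
  then have "(\<lambda>n. ((norm (x n + y n))\<^sup>2 + - 1 * (norm (x n))\<^sup>2 + - 1 * (norm (y n))\<^sup>2) * (1/2)) summable_on UNIV"
    by (intro summable_on_add summable_on_cmult_right summable_on_cmult_left assms)
  moreover have "(\<lambda>n. ((norm (x n + y n))\<^sup>2 + - 1 * (norm (x n))\<^sup>2 + - 1 * (norm (y n))\<^sup>2) * (1/2)) = (\<lambda>n. x n \<bullet> y n)"
    by (rule ext) (simp add: dot_norm)
  ultimately show ?thesis by simp
qed

instantiation ell2 :: real_vector
begin

lift_definition zero_ell2 :: ell2 is "\<lambda>_. 0" by simp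

lift_definition plus_ell2 :: "ell2 \<Rightarrow> ell2 \<Rightarrow> ell2" is "\<lambda>x y n. x n + y n"
  by (rule square_summable_add)

lift_definition uminus_ell2 :: "ell2 \<Rightarrow> ell2" is "\<lambda>x n. - x n" by simp

definition minus_ell2 :: "ell2 \<Rightarrow> ell2 \<Rightarrow> ell2" where "minus_ell2 x y = x + - y"

lift_definition scaleR_ell2 :: "real \<Rightarrow> ell2 \<Rightarrow> ell2" is "\<lambda>r x n. r *\<^sub>R x n"
  by (simp add: power_mult_distrib summable_on_cmult_right)

instance
  by standard ((unfold minus_ell2_def)?; transfer; simp add: fun_eq_iff algebra_simps)+

end

instantiation ell2 :: real_inner
begin

text \<open>The real part of the usual inner product. Together with the operator
  \<open>ell2_i\<close> below it determines the complex one, so the theory of real inner product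
  spaces applies.\<close>

lift_definition inner_ell2 :: "ell2 \<Rightarrow> ell2 \<Rightarrow> real" is "\<lambda>x y. \<Sum>\<^sub>\<infinity>n. x n \<bullet> y n" .

definition norm_ell2 :: "ell2 \<Rightarrow> real" where "norm_ell2 x = sqrt (x \<bullet> x)"
definition sgn_ell2 :: "ell2 \<Rightarrow> ell2" where "sgn_ell2 x = inverse (norm x) *\<^sub>R x"
definition dist_ell2 :: "ell2 \<Rightarrow> ell2 \<Rightarrow> real" where "dist_ell2 x y = norm (x - y)"
definition uniformity_ell2 :: "(ell2 \<times> ell2) filter" where
  "uniformity_ell2 = (INF e\<in>{0<..}. principal {(x, y). dist x y < e})"
definition open_ell2 :: "ell2 set \<Rightarrow> bool" where
  "open_ell2 U = (\<forall>x\<in>U. \<forall>\<^sub>F (x', y) in uniformity. x' = x \<longrightarrow> y \<in> U)"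

instance
proof
  show "x \<bullet> y = y \<bullet> x" for x y :: ell2
    by transfer (simp add: inner_commute)
  show "(x + y) \<bullet> z = x \<bullet> z + y \<bullet> z" for x y z :: ell2
    by transfer (simp add: inner_add_left infsum_add square_summable_inner)
  show "(r *\<^sub>R x) \<bullet> y = r * (x \<bullet> y)" for r and x y :: ell2
    by transfer (simp add: infsum_cmult_right square_summable_inner)
  show "0 \<le> x \<bullet> x" for x :: ell2
    by transfer (simp add: infsum_nonneg)
  show "x \<bullet> x = 0 \<longleftrightarrow> x = 0" for x :: ell2
  proof transfer
    fix x :: "nat \<Rightarrow> complex"
    assume x: "(\<lambda>n. (norm (x n))\<^sup>2) summable_on UNIV"
    show "(\<Sum>\<^sub>\<infinity>n. x n \<bullet> x n) = 0 \<longleftrightarrow> x = (\<lambda>_. 0)"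
    proof
      assume "(\<Sum>\<^sub>\<infinity>n. x n \<bullet> x n) = 0"
      then have "x n \<bullet> x n = 0" for n
        using nonneg_infsum_le_0D[of "\<lambda>n. x n \<bullet> x n" UNIV n] square_summable_inner[OF x x] by simp
      then show "x = (\<lambda>_. 0)" by (simp add: fun_eq_iff)
    qed simp
  qed
qed (simp_all add: norm_ell2_def sgn_ell2_def dist_ell2_def uniformity_ell2_def open_ell2_def)

end

lemma ell2_eqI: "(\<And>n. Rep_ell2 x n = Rep_ell2 y n) \<Longrightarrow> x = y"
  by (metis Rep_ell2_inject ext)

lemma norm_ell2_square: "(norm x)\<^sup>2 = (\<Sum>\<^sub>\<infinity>n. (norm (Rep_ell2 x n))\<^sup>2)"
  by (simp add: power2_norm_eq_inner inner_ell2.rep_eq)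

lemma summable_ell2: "(\<lambda>n. (norm (Rep_ell2 x n))\<^sup>2) summable_on A"
  using Rep_ell2[of x] by (auto intro: summable_on_subset_banach)

lemma Rep_ell2_minus: "Rep_ell2 (x - y) n = Rep_ell2 x n - Rep_ell2 y n"
  unfolding minus_ell2_def by transfer simp

lemma sum_le_norm_ell2: "finite F \<Longrightarrow> (\<Sum>n\<in>F. (norm (Rep_ell2 x n))\<^sup>2) \<le> (norm x)\<^sup>2"
  unfolding norm_ell2_square
  by (intro finite_sum_le_infsum summable_ell2) auto

lemma norm_Rep_ell2_le: "norm (Rep_ell2 x n) \<le> norm x"
  using sum_le_norm_ell2[of "{n}" x] by (auto intro: power2_le_imp_le)

text \<open>The coordinatewise limit is the candidate. Bounds on finite partial sums survive the
  limit and yield both its square-summability and convergence in norm.\<close>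

instance ell2 :: banach
proof
  fix X :: "nat \<Rightarrow> ell2"
  assume X: "Cauchy X"
  have "Cauchy (\<lambda>k. Rep_ell2 (X k) n)" for n
  proof (rule CauchyI)
    fix e :: real assume "0 < e"
    with X obtain M where "\<And>k l. k \<ge> M \<Longrightarrow> l \<ge> M \<Longrightarrow> norm (X k - X l) < e"
      by (meson CauchyD)
    then show "\<exists>M. \<forall>k\<ge>M. \<forall>l\<ge>M. norm (Rep_ell2 (X k) n - Rep_ell2 (X l) n) < e"
      by (metis Rep_ell2_minus norm_Rep_ell2_le order.strict_trans1)
  qed
  then obtain x where x: "\<And>n. (\<lambda>k. Rep_ell2 (X k) n) \<longlonglongrightarrow> x n"
    by (meson Cauchy_convergent_iff convergent_def)
  \<comment> \<open>Over a finite set the limit in the second index may be taken term by term while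
    \<open>k\<close> stays fixed.\<close>
  have close: "\<exists>M. \<forall>k\<ge>M. \<forall>F. finite F \<longrightarrow> (\<Sum>n\<in>F. (norm (Rep_ell2 (X k) n - x n))\<^sup>2) \<le> e\<^sup>2"
    if "0 < e" for e :: real
  proof -
    obtain M where M: "\<And>k l. k \<ge> M \<Longrightarrow> l \<ge> M \<Longrightarrow> norm (X k - X l) < e"
      using CauchyD[OF X, of e] \<open>0 < e\<close> by blast
    have "(\<Sum>n\<in>F. (norm (Rep_ell2 (X k) n - x n))\<^sup>2) \<le> e\<^sup>2" if "k \<ge> M" "finite F" for k F
    proof (rule LIMSEQ_le_const2)
      show "(\<lambda>l. \<Sum>n\<in>F. (norm (Rep_ell2 (X k) n - Rep_ell2 (X l) n))\<^sup>2)
          \<longlonglongrightarrow> (\<Sum>n\<in>F. (norm (Rep_ell2 (X k) n - x n))\<^sup>2)"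
        by (intro tendsto_intros x)
      have "(\<Sum>n\<in>F. (norm (Rep_ell2 (X k) n - Rep_ell2 (X l) n))\<^sup>2) \<le> e\<^sup>2" if "l \<ge> M" for l
        using sum_le_norm_ell2[OF \<open>finite F\<close>, of "X k - X l"]
          power_mono[OF less_imp_le[OF M[OF \<open>k \<ge> M\<close> that]] norm_ge_zero, of 2]
        by (simp add: Rep_ell2_minus)
      then show "\<exists>N. \<forall>l\<ge>N. (\<Sum>n\<in>F. (norm (Rep_ell2 (X k) n - Rep_ell2 (X l) n))\<^sup>2) \<le> e\<^sup>2"
        by blast
    qed
    then show ?thesis by blast
  qed
  have diff_summable: "(\<lambda>n. (norm (Rep_ell2 (X k) n - x n))\<^sup>2) summable_on UNIV"
    if "\<forall>F. finite F \<longrightarrow> (\<Sum>n\<in>F. (norm (Rep_ell2 (X k) n - x n))\<^sup>2) \<le> e\<^sup>2" for k e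
    using that by (intro nonneg_bdd_above_summable_on bdd_aboveI2[where M = "e\<^sup>2"]) auto
  obtain k where "(\<lambda>n. (norm (Rep_ell2 (X k) n - x n))\<^sup>2) summable_on UNIV"
  proof -
    obtain k where "\<forall>F. finite F \<longrightarrow> (\<Sum>n\<in>F. (norm (Rep_ell2 (X k) n - x n))\<^sup>2) \<le> 1\<^sup>2"
      using close[of 1] by auto
    from that[OF diff_summable[OF this]] show thesis .
  qed
  then have "(\<lambda>n. (norm (- (Rep_ell2 (X k) n - x n)))\<^sup>2) summable_on UNIV"
    by (simp only: norm_minus_cancel)
  from square_summable_add[OF summable_ell2[of "X k"] this]
  have x2: "(\<lambda>n. (norm (x n))\<^sup>2) summable_on UNIV"
    by simp
  define y where "y = Abs_ell2 x"
  have Rep_y: "Rep_ell2 y = x"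
    unfolding y_def using x2 by (simp add: Abs_ell2_inverse)
  have "X \<longlonglongrightarrow> y"
  proof (rule LIMSEQ_I)
    fix e :: real assume "0 < e"
    then obtain M where M: "\<forall>k\<ge>M. \<forall>F. finite F \<longrightarrow> (\<Sum>n\<in>F. (norm (Rep_ell2 (X k) n - x n))\<^sup>2) \<le> (e/2)\<^sup>2"
      using close[of "e/2"] by auto
    have "norm (X k - y) < e" if "k \<ge> M" for k
    proof -
      have "(norm (X k - y))\<^sup>2 \<le> (e/2)\<^sup>2"
        unfolding norm_ell2_square Rep_ell2_minus Rep_y using M that
        by (intro infsum_le_finite_sums diff_summable[where e = "e/2"]) auto
      then have "norm (X k - y) \<le> e/2"
        using \<open>0 < e\<close> by (auto intro: power2_le_imp_le)
      with \<open>0 < e\<close> show ?thesis by simp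
    qed
    then show "\<exists>M. \<forall>k\<ge>M. norm (X k - y) < e" by blast
  qed
  then show "convergent X" by (rule convergentI)
qed

lift_definition ell2_i :: "ell2 \<Rightarrow> ell2" is "\<lambda>x n. \<i> * x n" by (simp add: norm_mult)

lemma ell2_i_add: "ell2_i (x + y) = ell2_i x + ell2_i y"
  by transfer (simp add: algebra_simps)

lemma ell2_i_scaleR: "ell2_i (r *\<^sub>R x) = r *\<^sub>R ell2_i x"
  by transfer simp

lemma ell2_i_i: "ell2_i (ell2_i x) = - x"
  by transfer simp

lemma inner_ell2_i: "ell2_i x \<bullet> y = - (x \<bullet> ell2_i y)"
  by transfer (simp add: inner_complex_def infsum_uminus[symmetric] algebra_simps)

lemma norm_ell2_i: "norm (ell2_i x) = norm x"
  by (simp add: norm_eq_sqrt_inner inner_ell2_i ell2_i_i)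

section \<open>Complex-linear operators with an adjoint\<close>

text \<open>The existence of an adjoint is built into the type, which replaces an appeal to the
  Riesz representation theorem. For an operator commuting with \<open>ell2_i\<close>, the adjoint
  for the real inner product is also the adjoint for the complex one.\<close>

typedef cop = "{T :: ell2 \<Rightarrow>\<^sub>L ell2. (\<forall>x. T (ell2_i x) = ell2_i (T x)) \<and>
    (\<exists>S :: ell2 \<Rightarrow>\<^sub>L ell2. \<forall>x y. T x \<bullet> y = x \<bullet> S y)}"
  by (rule exI[of _ 0]) (auto simp: ell2_i_scaleR[of 0, simplified] intro: exI[of _ 0])

setup_lifting type_definition_cop

instantiation cop :: real_algebra_1
begin

lift_definition zero_cop :: cop is 0
  by (auto simp: ell2_i_scaleR[of 0, simplified] intro: exI[of _ 0])

lift_definition one_cop :: cop is id_blinfun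
  by (auto intro: exI[of _ id_blinfun])

lift_definition plus_cop :: "cop \<Rightarrow> cop \<Rightarrow> cop" is "(+)"
  by (auto simp: blinfun.add_left inner_add_left ell2_i_add) (metis blinfun.add_left inner_add_right)

lift_definition scaleR_cop :: "real \<Rightarrow> cop \<Rightarrow> cop" is "scaleR"
  by (auto simp: blinfun.scaleR_left ell2_i_scaleR) (metis blinfun.scaleR_left inner_scaleR_right)

definition uminus_cop :: "cop \<Rightarrow> cop" where "uminus_cop T = (- 1) *\<^sub>R T"

definition minus_cop :: "cop \<Rightarrow> cop \<Rightarrow> cop" where "minus_cop S T = S + (- 1) *\<^sub>R T"

lift_definition times_cop :: "cop \<Rightarrow> cop \<Rightarrow> cop" is "(o\<^sub>L)"
  by auto (metis blinfun_apply_blinfun_compose)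

instance
proof
  show "(0::cop) \<noteq> 1"
  proof transfer
    have "Abs_ell2 (\<lambda>n. if n = 0 then 1 else 0) \<noteq> 0"
    proof -
      have "(\<lambda>n::nat. (norm (if n = 0 then 1 else 0 :: complex))\<^sup>2) summable_on UNIV"
        by (rule summable_on_cong_neutral[where S = "{0}", THEN iffD1]) auto
      then have "Rep_ell2 (Abs_ell2 (\<lambda>n. if n = 0 then 1 else 0)) = (\<lambda>n. if n = 0 then 1 else 0)"
        by (simp add: Abs_ell2_inverse)
      then show ?thesis by (metis zero_ell2.rep_eq zero_neq_one)
    qed
    then have "blinfun_apply 0 (Abs_ell2 (\<lambda>n. if n = 0 then 1 else 0))
        \<noteq> blinfun_apply id_blinfun (Abs_ell2 (\<lambda>n. if n = 0 then 1 else 0))"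
      by (simp add: blinfun.zero_left)
    then show "(0 :: ell2 \<Rightarrow>\<^sub>L ell2) \<noteq> id_blinfun" by fastforce
  qed
qed ((unfold uminus_cop_def minus_cop_def)?; transfer;
    auto intro!: blinfun_eqI simp: blinfun.bilinear_simps algebra_simps)+

end

definition capp :: "cop \<Rightarrow> ell2 \<Rightarrow> ell2" where "capp T = blinfun_apply (Rep_cop T)"

lemma cop_eqI: "(\<And>x. capp S x = capp T x) \<Longrightarrow> S = T"
  unfolding capp_def by (metis Rep_cop_inject blinfun_eqI)

lemma Rep_cop_minus: "Rep_cop (S - T) = Rep_cop S - Rep_cop T"
  unfolding minus_cop_def plus_cop.rep_eq scaleR_cop.rep_eq by simp

lemma Rep_cop_uminus: "Rep_cop (- T) = - Rep_cop T"
  using Rep_cop_minus[of 0 T] by (simp add: zero_cop.rep_eq)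

lemma capp_simps:
  "capp 0 x = 0" "capp 1 x = x" "capp (S + T) x = capp S x + capp T x" "capp (r *\<^sub>R T) x = r *\<^sub>R capp T x"
  "capp (S * T) x = capp S (capp T x)" "capp (S - T) x = capp S x - capp T x" "capp (- T) x = - capp T x"
  "capp T (x + y) = capp T x + capp T y" "capp T (r *\<^sub>R x) = r *\<^sub>R capp T x" "capp T 0 = 0"
  "capp T (x - y) = capp T x - capp T y" "capp T (- x) = - capp T x"
  unfolding capp_def Rep_cop_minus
  by (simp_all add: Rep_cop_uminus zero_cop.rep_eq one_cop.rep_eq plus_cop.rep_eq scaleR_cop.rep_eq times_cop.rep_eq
      blinfun.bilinear_simps)

lemma capp_i: "capp T (ell2_i x) = ell2_i (capp T x)"
  unfolding capp_def using Rep_cop[of T] by simp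

instantiation cop :: real_normed_algebra_1
begin

lift_definition norm_cop :: "cop \<Rightarrow> real" is norm .
definition sgn_cop :: "cop \<Rightarrow> cop" where "sgn_cop x = inverse (norm x) *\<^sub>R x"
definition dist_cop :: "cop \<Rightarrow> cop \<Rightarrow> real" where "dist_cop x y = norm (x - y)"
definition uniformity_cop :: "(cop \<times> cop) filter" where
  "uniformity_cop = (INF e\<in>{0<..}. principal {(x, y). dist x y < e})"
definition open_cop :: "cop set \<Rightarrow> bool" where
  "open_cop U = (\<forall>x\<in>U. \<forall>\<^sub>F (x', y) in uniformity. x' = x \<longrightarrow> y \<in> U)"

instance
proof
  show "norm (S + T) \<le> norm S + norm T" for S T :: cop
    by transfer (rule norm_triangle_ineq)
  show "norm (S * T) \<le> norm S * norm T" for S T :: cop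
    by transfer (rule norm_blinfun_compose)
  show "norm T = 0 \<longleftrightarrow> T = 0" for T :: cop
    by transfer simp
  show "norm (a *\<^sub>R T) = \<bar>a\<bar> * norm T" for a and T :: cop
    by transfer simp
  have "\<exists>x::ell2. x \<noteq> 0"
  proof (rule ccontr)
    assume "\<nexists>x::ell2. x \<noteq> 0"
    then have "(0::cop) = 1" by (intro cop_eqI) (metis)
    then show False by simp
  qed
  then obtain x :: ell2 where x: "x \<noteq> 0" by blast
  show "norm (1::cop) = 1"
  proof transfer
    have "norm x \<le> norm (id_blinfun :: ell2 \<Rightarrow>\<^sub>L ell2) * norm x"
      by (metis blinfun_apply_id_blinfun id_apply norm_blinfun)
    with x have "1 \<le> norm (id_blinfun :: ell2 \<Rightarrow>\<^sub>L ell2)" by simp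
    moreover have "norm (id_blinfun :: ell2 \<Rightarrow>\<^sub>L ell2) \<le> 1"
      by (rule norm_blinfun_bound) auto
    ultimately show "norm (id_blinfun :: ell2 \<Rightarrow>\<^sub>L ell2) = 1" by simp
  qed
qed (simp_all add: sgn_cop_def dist_cop_def uniformity_cop_def open_cop_def)

end

section \<open>Norm bounds, adjoints and the C*-identity for operators\<close>

lemma norm_capp: "norm (capp T x) \<le> norm T * norm x"
  unfolding capp_def norm_cop.rep_eq by (rule norm_blinfun)

lemma norm_cop_bound: "0 \<le> b \<Longrightarrow> (\<And>x. norm (capp T x) \<le> b * norm x) \<Longrightarrow> norm T \<le> b"
  unfolding capp_def norm_cop.rep_eq by (rule norm_blinfun_bound)

lemma cop_of_blinfun:
  assumes "\<And>x. blinfun_apply T (ell2_i x) = ell2_i (blinfun_apply T x)"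
    and "\<And>x y. blinfun_apply T x \<bullet> y = x \<bullet> blinfun_apply S y"
  shows "capp (Abs_cop T) = blinfun_apply T" "Rep_cop (Abs_cop T) = T"
proof -
  show "Rep_cop (Abs_cop T) = T"
    by (rule Abs_cop_inverse) (use assms in blast)
  then show "capp (Abs_cop T) = blinfun_apply T"
    by (simp add: capp_def)
qed

text \<open>An adjoint commutes with \<open>ell2_i\<close> because \<open>ell2_i\<close> is
  skew-adjoint, so it lies in the type again; nondegeneracy of the inner product makes it
  unique.\<close>

lemma adj_ex1: "\<exists>!S. \<forall>x y. capp T x \<bullet> y = x \<bullet> capp S y"
proof -
  obtain S where S: "\<And>x y. capp T x \<bullet> y = x \<bullet> blinfun_apply S y"
    unfolding capp_def using Rep_cop[of T] by blast
  have "blinfun_apply S (ell2_i y) = ell2_i (blinfun_apply S y)" for y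
  proof -
    have "x \<bullet> blinfun_apply S (ell2_i y) = x \<bullet> ell2_i (blinfun_apply S y)" for x
      by (metis S capp_i inner_ell2_i minus_minus)
    then show ?thesis using vector_eq_rdot[of "blinfun_apply S (ell2_i y)" "ell2_i (blinfun_apply S y)"]
      by (simp add: inner_commute)
  qed
  moreover have "blinfun_apply S x \<bullet> y = x \<bullet> blinfun_apply (Rep_cop T) y" for x y
    using S unfolding capp_def by (metis inner_commute)
  ultimately have "capp (Abs_cop S) = blinfun_apply S"
    by (rule cop_of_blinfun(1))
  then have "\<forall>x y. capp T x \<bullet> y = x \<bullet> capp (Abs_cop S) y" using S by simp
  moreover have "R = R'" if "\<forall>x y. capp T x \<bullet> y = x \<bullet> capp R y" "\<forall>x y. capp T x \<bullet> y = x \<bullet> capp R' y" for R R'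
  proof (rule cop_eqI)
    fix y
    have "x \<bullet> capp R y = x \<bullet> capp R' y" for x using that by metis
    then show "capp R y = capp R' y"
      using vector_eq_rdot[of "capp R y" "capp R' y"] by (simp add: inner_commute)
  qed
  ultimately show ?thesis by blast
qed

definition adj :: "cop \<Rightarrow> cop" where "adj T = (THE S. \<forall>x y. capp T x \<bullet> y = x \<bullet> capp S y)"

lemma inner_adj: "capp T x \<bullet> y = x \<bullet> capp (adj T) y"
  using theI'[OF adj_ex1[of T]] unfolding adj_def by blast

lemma adj_eqI: "(\<And>x y. capp T x \<bullet> y = x \<bullet> capp S y) \<Longrightarrow> adj T = S"
  using adj_ex1[of T] inner_adj[of T] by blast

lemma adj_adj: "adj (adj T) = T"
  by (rule adj_eqI) (metis inner_adj inner_commute)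

lemma adj_add: "adj (S + T) = adj S + adj T"
  by (rule adj_eqI) (simp add: capp_simps inner_add_left inner_add_right inner_adj)

lemma adj_scaleR: "adj (r *\<^sub>R T) = r *\<^sub>R adj T"
  by (rule adj_eqI) (simp add: capp_simps inner_adj)

lemma adj_mult: "adj (S * T) = adj T * adj S"
  by (rule adj_eqI) (simp add: capp_simps inner_adj)

lemma adj_zero: "adj 0 = 0"
  by (rule adj_eqI) (simp add: capp_simps)

lemma adj_minus: "adj (S - T) = adj S - adj T"
  by (rule adj_eqI) (simp add: capp_simps inner_diff_left inner_diff_right inner_adj)

lemma norm_capp_square: "(norm (capp T x))\<^sup>2 = x \<bullet> capp (adj T * T) x"
  by (simp add: power2_norm_eq_inner inner_adj capp_simps)

text \<open>Cauchy-Schwarz applied to \<open>x \<bullet> capp (adj T * T) x\<close>, which is the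
  squared norm of \<open>capp T x\<close>.\<close>

lemma norm_square_le: "(norm T)\<^sup>2 \<le> norm (adj T * T)"
proof -
  have "norm T \<le> sqrt (norm (adj T * T))"
  proof (rule norm_cop_bound)
    fix x
    have "(norm (capp T x))\<^sup>2 \<le> norm x * norm (capp (adj T * T) x)"
      unfolding norm_capp_square using Cauchy_Schwarz_ineq2[of x "capp (adj T * T) x"] by linarith
    also have "\<dots> \<le> norm x * (norm (adj T * T) * norm x)"
      by (intro mult_left_mono norm_capp) auto
    finally have "(norm (capp T x))\<^sup>2 \<le> (sqrt (norm (adj T * T)) * norm x)\<^sup>2"
      by (simp add: power_mult_distrib power2_eq_square algebra_simps)
    then show "norm (capp T x) \<le> sqrt (norm (adj T * T)) * norm x"
      by (rule power2_le_imp_le) simp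
  qed simp
  then show ?thesis
    by (metis norm_ge_zero power_mono real_sqrt_ge_zero real_sqrt_pow2)
qed

text \<open>Cancelling \<open>norm T\<close> in \<open>norm_square_le\<close> gives one inequality;
  the double adjoint gives the other.\<close>

lemma norm_adj: "norm (adj T) = norm T"
proof -
  have le: "norm T \<le> norm (adj T)" for T
  proof (cases "T = 0")
    case False
    have "norm T * norm T \<le> norm (adj T) * norm T"
      using norm_square_le[of T] norm_mult_ineq[of "adj T" T] by (simp add: power2_eq_square)
    with False show ?thesis by simp
  qed simp
  show ?thesis using le[of T] le[of "adj T"] by (simp add: adj_adj)
qed

lemma norm_adj_mult: "norm (adj T * T) = (norm T)\<^sup>2"
  using norm_square_le[of T] norm_mult_ineq[of "adj T" T] by (simp add: norm_adj power2_eq_square)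

text \<open>A limit of operators has to be given an adjoint. Taking adjoints is isometric, so the
  adjoints converge as well, and their limit is adjoint to the limit.\<close>

instance cop :: banach
proof
  fix X :: "nat \<Rightarrow> cop"
  assume X: "Cauchy X"
  have lim: "\<exists>L. (\<lambda>n. Rep_cop (Y n)) \<longlonglongrightarrow> L" if "Cauchy Y" for Y :: "nat \<Rightarrow> cop"
  proof -
    have "Cauchy (\<lambda>n. Rep_cop (Y n))"
      using that unfolding Cauchy_iff by (simp add: Rep_cop_minus[symmetric] norm_cop.rep_eq[symmetric])
    then show ?thesis using Cauchy_convergent_iff convergent_def by blast
  qed
  have "Cauchy (\<lambda>n. adj (X n))"
    using X unfolding Cauchy_iff by (simp add: adj_minus[symmetric] norm_adj)
  then obtain S where S: "(\<lambda>n. Rep_cop (adj (X n))) \<longlonglongrightarrow> S"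
    using lim by blast
  obtain T where T: "(\<lambda>n. Rep_cop (X n)) \<longlonglongrightarrow> T"
    using lim[OF X] by blast
  have T': "(\<lambda>n. capp (X n) x) \<longlonglongrightarrow> blinfun_apply T x" for x
    unfolding capp_def by (intro blinfun.tendsto T tendsto_const)
  have S': "(\<lambda>n. capp (adj (X n)) x) \<longlonglongrightarrow> blinfun_apply S x" for x
    unfolding capp_def by (intro blinfun.tendsto S tendsto_const)
  have "bounded_linear ell2_i"
    by (rule bounded_linear_intro[where K = 1]) (auto simp: ell2_i_add ell2_i_scaleR norm_ell2_i)
  then have "(\<lambda>n. ell2_i (capp (X n) x)) \<longlonglongrightarrow> ell2_i (blinfun_apply T x)" for x
    by (rule bounded_linear.tendsto) (rule T')
  then have "blinfun_apply T (ell2_i x) = ell2_i (blinfun_apply T x)" for x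
    using T'[of "ell2_i x"] unfolding capp_i by (rule LIMSEQ_unique[rotated])
  moreover have "blinfun_apply T x \<bullet> y = x \<bullet> blinfun_apply S y" for x y
  proof (rule LIMSEQ_unique)
    show "(\<lambda>n. capp (X n) x \<bullet> y) \<longlonglongrightarrow> blinfun_apply T x \<bullet> y"
      by (intro tendsto_intros T')
    show "(\<lambda>n. capp (X n) x \<bullet> y) \<longlonglongrightarrow> x \<bullet> blinfun_apply S y"
      unfolding inner_adj by (intro tendsto_intros S')
  qed
  ultimately have "Rep_cop (Abs_cop T) = T" by (rule cop_of_blinfun(2))
  then have "X \<longlonglongrightarrow> Abs_cop T"
    using T unfolding LIMSEQ_iff by (simp add: norm_cop.rep_eq Rep_cop_minus)
  then show "convergent X" by (rule convergentI)
qed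

section \<open>Complex scalars\<close>

definition ell2_iop :: cop where
  "ell2_iop = Abs_cop (Blinfun ell2_i)"

lemma capp_ell2_iop: "capp ell2_iop = ell2_i"
proof -
  have bl: "bounded_linear ell2_i"
    by (rule bounded_linear_intro[where K = 1]) (auto simp: ell2_i_add ell2_i_scaleR norm_ell2_i)
  then have ap: "blinfun_apply (Blinfun ell2_i) = ell2_i"
    by (rule bounded_linear_Blinfun_apply)
  have "capp (Abs_cop (Blinfun ell2_i)) = blinfun_apply (Blinfun ell2_i)"
    by (rule cop_of_blinfun(1)[where S = "- Blinfun ell2_i"])
      (simp_all add: ap blinfun.bilinear_simps inner_ell2_i)
  then show ?thesis by (simp add: ell2_iop_def ap)
qed

lemma ell2_iop_square: "ell2_iop * ell2_iop = - 1"
  by (rule cop_eqI) (simp add: capp_simps capp_ell2_iop ell2_i_i)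

lemma ell2_iop_commute: "ell2_iop * T = T * ell2_iop"
  by (rule cop_eqI) (simp add: capp_simps capp_ell2_iop capp_i)

lemma adj_ell2_iop: "adj ell2_iop = - ell2_iop"
  by (rule adj_eqI) (simp add: capp_simps capp_ell2_iop inner_ell2_i)

text \<open>The scalar \<open>a + b i\<close> acts as \<open>a + b ell2_iop\<close>. Since
  \<open>ell2_iop\<close> is central with square \<open>- 1\<close>, this is a complex vector space
  and multiplication is complex bilinear.\<close>

definition cscale :: "complex \<Rightarrow> cop \<Rightarrow> cop" where
  "cscale c T = Re c *\<^sub>R T + Im c *\<^sub>R (ell2_iop * T)"

lemma cscale_simps [simp]: "cscale 1 T = T" "cscale 0 T = 0" "cscale c 0 = 0" "cscale (-1) T = - T"
  by (simp_all add: cscale_def)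

lemma cscale_cscale: "cscale a (cscale b T) = cscale (a * b) T"
proof -
  have "ell2_iop * (ell2_iop * T) = - T" for T
    by (simp add: mult.assoc[symmetric] ell2_iop_square)
  then show ?thesis by (simp add: cscale_def algebra_simps)
qed

lemma cscale_add_left: "cscale (a + b) T = cscale a T + cscale b T"
  by (simp add: cscale_def algebra_simps)

lemma cscale_add_right: "cscale a (S + T) = cscale a S + cscale a T"
  by (simp add: cscale_def algebra_simps)

lemma cscale_mult_left: "cscale c S * T = cscale c (S * T)"
  by (simp add: cscale_def algebra_simps)

lemma cscale_mult_right: "S * cscale c T = cscale c (S * T)"
proof -
  have "S * (ell2_iop * T) = ell2_iop * (S * T)"
    by (metis ell2_iop_commute mult.assoc)
  then show ?thesis by (simp add: cscale_def algebra_simps)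
qed

lemma adj_cscale: "adj (cscale c T) = cscale (cnj c) (adj T)"
  by (simp add: cscale_def adj_add adj_scaleR adj_mult adj_ell2_iop ell2_iop_commute)

text \<open>\<open>capp T x\<close> and \<open>ell2_i (capp T x)\<close> are orthogonal and of equal
  length, so Pythagoras computes the norm pointwise. The lower bound is the upper one for
  \<open>inverse c\<close>.\<close>

lemma norm_cscale: "norm (cscale c T) = cmod c * norm T"
proof -
  have le: "norm (cscale c T) \<le> cmod c * norm T" for c T
  proof (rule norm_cop_bound)
    fix x
    have "capp T x \<bullet> ell2_i (capp T x) = 0"
      using inner_ell2_i[of "capp T x" "capp T x"] by (simp add: inner_commute)
    then have "(norm (capp (cscale c T) x))\<^sup>2 = (cmod c * norm (capp T x))\<^sup>2"
      by (simp add: cscale_def capp_simps capp_ell2_iop norm_ell2_i power_mult_distrib cmod_power2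
          power2_norm_eq_inner inner_add_left inner_add_right inner_commute algebra_simps)
        (simp add: dot_square_norm norm_ell2_i power2_eq_square)
    then have "norm (capp (cscale c T) x) = cmod c * norm (capp T x)"
      by (simp add: power2_eq_iff_nonneg)
    also have "\<dots> \<le> cmod c * (norm T * norm x)"
      by (intro mult_left_mono norm_capp) simp
    finally show "norm (capp (cscale c T) x) \<le> cmod c * norm T * norm x"
      by (simp add: mult.assoc)
  qed simp
  show ?thesis
  proof (cases "c = 0")
    case False
    have "norm T \<le> cmod (inverse c) * norm (cscale c T)"
      using le[of "inverse c" "cscale c T"] False by (simp add: cscale_cscale)
    with le[of c T] False show ?thesis by (simp add: norm_divide field_simps)
  qed simp
qed

interpretation cop: vector_space cscale
  by standard (simp_all add: cscale_cscale cscale_add_left cscale_add_right)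

lemma cspan_adj:
  assumes "T \<in> cop.span S" shows "adj T \<in> cop.span (adj ` S)"
  using assms
proof (induction rule: cop.span_induct_alt)
  case base then show ?case by (simp add: adj_zero cop.span_zero)
next
  case (step c x y)
  then show ?case by (auto simp: adj_add adj_cscale intro!: cop.span_add cop.span_scale intro: cop.span_base)
qed

lemma cspan_mult:
  assumes "S \<in> cop.span U" "T \<in> cop.span W" and "\<And>u w. u \<in> U \<Longrightarrow> w \<in> W \<Longrightarrow> u * w \<in> cop.span Z"
  shows "S * T \<in> cop.span Z"
  using assms(1)
proof (induction rule: cop.span_induct_alt)
  case base then show ?case by (simp add: cop.span_zero)
next
  case (step c x y)
  have "x * T \<in> cop.span Z"
    using assms(2)
  proof (induction rule: cop.span_induct_alt)
    case base then show ?case by (simp add: cop.span_zero)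
  next
    case (step c' x' y')
    then show ?case using assms(3) \<open>x \<in> U\<close>
      by (simp add: distrib_left cscale_mult_right cop.span_add cop.span_scale)
  qed
  with step show ?case
    by (simp add: distrib_right cscale_mult_left cop.span_add cop.span_scale)
qed

lemma tendsto_cscale: "X \<longlonglongrightarrow> T \<Longrightarrow> (\<lambda>n. cscale c (X n)) \<longlonglongrightarrow> cscale c T"
  unfolding cscale_def by (intro tendsto_intros)

lemma tendsto_adj: "X \<longlonglongrightarrow> T \<Longrightarrow> (\<lambda>n. adj (X n)) \<longlonglongrightarrow> adj T"
  unfolding LIMSEQ_iff by (simp add: adj_minus[symmetric] norm_adj)

section \<open>Copies of spaces of operators as algebraic structures\<close>

text \<open>Transport of structure along an injection. It serves twice: for all operators, to place
  them in a prescribed type, and for a closed space of off-diagonal operators, to make it the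
  bimodule.\<close>

locale op_copy =
  fixes W :: "cop set" and j :: "cop \<Rightarrow> 'c" and R :: "(complex, 'c, 'm) module_scheme" (structure)
  assumes subspace: "cop.subspace W"
    and inj: "inj_on j W"
    and carrier_copy: "carrier R = j ` W"
    and zero_copy: "\<zero> = j 0"
    and add_copy: "\<lbrakk>S \<in> W; T \<in> W\<rbrakk> \<Longrightarrow> j S \<oplus> j T = j (S + T)"
    and smult_copy: "T \<in> W \<Longrightarrow> c \<odot> j T = j (cscale c T)"
begin

lemma W_closed [simp, intro]:
  "0 \<in> W" "\<lbrakk>S \<in> W; T \<in> W\<rbrakk> \<Longrightarrow> S + T \<in> W" "T \<in> W \<Longrightarrow> cscale c T \<in> W"
  "T \<in> W \<Longrightarrow> - T \<in> W" "\<lbrakk>S \<in> W; T \<in> W\<rbrakk> \<Longrightarrow> S - T \<in> W"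
  by (simp_all add: cop.subspace_0[OF subspace] cop.subspace_add[OF subspace] cop.subspace_scale[OF subspace]
      cop.subspace_neg[OF subspace] cop.subspace_diff[OF subspace])

lemma vectorspace_copy: "vectorspace class_ring R"
proof -
  have "abelian_group R"
  proof (rule abelian_groupI)
    show "\<exists>y\<in>carrier R. y \<oplus> x = \<zero>" if "x \<in> carrier R" for x
    proof -
      obtain T where T: "T \<in> W" "x = j T" using \<open>x \<in> carrier R\<close> by (auto simp: carrier_copy)
      then have "j (- T) \<oplus> x = \<zero>" by (simp add: add_copy zero_copy)
      with T show ?thesis by (auto simp: carrier_copy)
    qed
  qed (auto simp: carrier_copy zero_copy add_copy ac_simps)
  moreover have "cring (class_ring :: complex ring)"
    using class_field.field_axioms class_cring.cring_axioms by blast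
  ultimately have "Module.module class_ring R"
    by (intro moduleI) (auto simp: carrier_copy add_copy smult_copy cscale_cscale
        cscale_add_left cscale_add_right)
  then show ?thesis
    by (intro vectorspace.intro class_field)
qed

lemma minus_copy: "\<lbrakk>S \<in> W; T \<in> W\<rbrakk> \<Longrightarrow> j S \<ominus> j T = j (S - T)"
proof -
  assume ST: "S \<in> W" "T \<in> W"
  interpret vectorspace class_ring R by (rule vectorspace_copy)
  have "j (- T) \<oplus> j T = \<zero>" using ST by (simp add: add_copy zero_copy)
  then have "\<ominus> j T = j (- T)"
    using ST by (intro M.minus_equality) (auto simp: carrier_copy)
  with ST show "j S \<ominus> j T = j (S - T)"
    by (simp add: a_minus_def add_copy)
qed

lemma finsum_copy:
  assumes "finite F" "\<And>i. i \<in> F \<Longrightarrow> f i \<in> W"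
  shows "(\<Oplus>i\<in>F. j (f i)) = j (\<Sum>i\<in>F. f i) \<and> (\<Sum>i\<in>F. f i) \<in> W"
  using assms
proof (induction F rule: finite_induct)
  case empty
  interpret vectorspace class_ring R by (rule vectorspace_copy)
  show ?case by (simp add: zero_copy)
next
  case (insert i F)
  interpret vectorspace class_ring R by (rule vectorspace_copy)
  have "(\<Oplus>k\<in>insert i F. j (f k)) = j (f i) \<oplus> (\<Oplus>k\<in>F. j (f k))"
    using insert by (intro M.finsum_insert) (auto simp: carrier_copy)
  with insert show ?case by (simp add: add_copy)
qed

lemma complete_copy:
  assumes "closed W" and N: "\<And>T. T \<in> W \<Longrightarrow> N (j T) = norm T"
  shows "complete_wrt R N"
  unfolding complete_wrt_def
proof (intro allI impI, elim conjE)
  fix x :: "nat \<Rightarrow> 'c"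
  assume "\<forall>n. x n \<in> carrier R"
    and cauchy: "\<forall>\<epsilon>>0. \<exists>M. \<forall>m\<ge>M. \<forall>n\<ge>M. N (x m \<ominus> x n) < \<epsilon>"
  then have "\<forall>n. \<exists>T. T \<in> W \<and> x n = j T" by (auto simp: carrier_copy)
  then obtain X where X: "\<And>n. X n \<in> W" "\<And>n. x n = j (X n)" by metis
  have "Cauchy X"
    using cauchy by (simp add: Cauchy_iff X minus_copy N)
  then obtain L where L: "X \<longlonglongrightarrow> L"
    using Cauchy_convergent_iff convergent_def by blast
  have "L \<in> W" using closed_sequentially[OF \<open>closed W\<close> _ L] X by blast
  have "(\<lambda>n. X n - L) \<longlonglongrightarrow> 0" using L by (rule LIM_zero)
  then have "(\<lambda>n. norm (X n - L)) \<longlonglongrightarrow> 0" by (rule tendsto_norm_zero)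
  with \<open>L \<in> W\<close> show "\<exists>l\<in>carrier R. (\<lambda>n. N (x n \<ominus> l)) \<longlonglongrightarrow> 0"
    by (intro bexI[of _ "j L"]) (auto simp: X minus_copy N carrier_copy)
qed

end

text \<open>The target type is left open: \<open>id\<close> gives the operators themselves, an
  injection into \<open>cstar_universe\<close> gives a copy to which the universal property of a
  graph algebra applies.\<close>

definition op_algebra :: "(cop \<Rightarrow> 'c) \<Rightarrow> 'c cstar" where
  "op_algebra j =
    \<lparr>carrier = range j,
     mult = (\<lambda>x y. j (inv_into UNIV j x * inv_into UNIV j y)),
     one = j 1,
     zero = j 0,
     add = (\<lambda>x y. j (inv_into UNIV j x + inv_into UNIV j y)),
     smult = (\<lambda>c x. j (cscale c (inv_into UNIV j x))),
     star = (\<lambda>x. j (adj (inv_into UNIV j x))),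
     nrm = (\<lambda>x. norm (inv_into UNIV j x))\<rparr>"

lemma op_algebra_simps:
  assumes "inj j"
  shows "carrier (op_algebra j) = range j"
    "j S \<otimes>\<^bsub>op_algebra j\<^esub> j T = j (S * T)"
    "\<zero>\<^bsub>op_algebra j\<^esub> = j 0"
    "j S \<oplus>\<^bsub>op_algebra j\<^esub> j T = j (S + T)"
    "c \<odot>\<^bsub>op_algebra j\<^esub> j T = j (cscale c T)"
    "star (op_algebra j) (j T) = j (adj T)"
    "nrm (op_algebra j) (j T) = norm T"
  using assms by (simp_all add: op_algebra_def)

lemma op_copy_op_algebra:
  assumes "inj j" shows "op_copy UNIV j (op_algebra j)"
  using assms by unfold_locales (simp_all add: op_algebra_simps)

lemma op_algebra_finsum:
  assumes "inj j" "finite F" shows "(\<Oplus>\<^bsub>op_algebra j\<^esub>i\<in>F. j (f i)) = j (\<Sum>i\<in>F. f i)"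
  using op_copy.finsum_copy[OF op_copy_op_algebra[OF assms(1)] assms(2)] by simp

lemma cstar_algebra_op_algebra:
  assumes "inj j" shows "cstar_algebra (op_algebra j)"
proof -
  interpret op_copy UNIV j "op_algebra j" by (rule op_copy_op_algebra[OF assms])
  note simps = op_algebra_simps[OF assms]
  show ?thesis
  proof (intro cstar_algebra.intro complex_star_algebra.intro vectorspace_copy
      cstar_algebra_axioms.intro complex_star_algebra_axioms.intro complete_copy)
  qed (auto simp: simps algebra_simps cscale_mult_left cscale_mult_right adj_adj adj_add adj_cscale
      adj_mult norm_triangle_ineq norm_cscale norm_mult_ineq norm_adj_mult inj_eq[OF assms])
qed

section \<open>Elementary C*-algebra theory\<close>

text \<open>A number above 1 has unbounded powers. This turns an estimate with a multiplicative
  constant, once available for all the powers \<open>2 ^ k\<close>, into one with constant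
  1.\<close>

lemma le_one_of_powers_bounded:
  fixes x :: real
  assumes "\<And>k. x ^ (2 ^ k) \<le> K"
  shows "x \<le> 1"
proof (rule ccontr)
  assume "\<not> x \<le> 1"
  then have x: "1 < x" by simp
  then obtain n where n: "K < x ^ n" using real_arch_pow by blast
  have "x ^ n \<le> x ^ (2 ^ n)"
    using x by (intro power_increasing) (auto simp: less_imp_le)
  with assms[of n] n show False by simp
qed

section \<open>Computation rules in star algebras\<close>

context complex_star_algebra
begin

lemma smul_closed [simp, intro]: "x \<in> carrier A \<Longrightarrow> c \<odot> x \<in> carrier A"
  and smul_add_l: "x \<in> carrier A \<Longrightarrow> (a + b) \<odot> x = a \<odot> x \<oplus> b \<odot> x"
  and smul_add_r: "\<lbrakk>x \<in> carrier A; y \<in> carrier A\<rbrakk> \<Longrightarrow> a \<odot> (x \<oplus> y) = a \<odot> x \<oplus> a \<odot> y"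
  and smul_smul: "x \<in> carrier A \<Longrightarrow> a \<odot> (b \<odot> x) = (a * b) \<odot> x"
  and smul_one [simp]: "x \<in> carrier A \<Longrightarrow> 1 \<odot> x = x"
  and smul_zero [simp]: "x \<in> carrier A \<Longrightarrow> 0 \<odot> x = \<zero>" "c \<odot> \<zero> = \<zero>"
  using smult_closed[of c x] smult_l_distr[of a b x] smult_r_distr[of a x y] smult_assoc1[of a b x]
    smult_one[of x] smult_l_null[of x] smult_r_null[of c]
  by simp_all

lemma uminus_eq_smul: "x \<in> carrier A \<Longrightarrow> \<ominus> x = (-1) \<odot> x"
  using smul_add_l[of x "-1" 1] by (intro M.minus_equality) auto

lemma minus_eq_smul: "y \<in> carrier A \<Longrightarrow> x \<ominus> y = x \<oplus> (-1) \<odot> y"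
  by (simp add: a_minus_def uminus_eq_smul)

lemma minus_closed' [simp, intro]: "\<lbrakk>x \<in> carrier A; y \<in> carrier A\<rbrakk> \<Longrightarrow> x \<ominus> y \<in> carrier A"
  by (rule M.minus_closed)

lemma smul_minus: "\<lbrakk>x \<in> carrier A; y \<in> carrier A\<rbrakk> \<Longrightarrow> c \<odot> (x \<ominus> y) = c \<odot> x \<ominus> c \<odot> y"
  by (simp add: minus_eq_smul smul_add_r smul_smul)

declare mult_closed [simp, intro] star_closed [simp, intro]

lemma mult_zero [simp]: "x \<in> carrier A \<Longrightarrow> \<zero> \<otimes> x = \<zero>" "x \<in> carrier A \<Longrightarrow> x \<otimes> \<zero> = \<zero>"
  using smult_mult_l[of x x 0] smult_mult_r[of x x 0]
  by (metis M.zero_closed mult_closed smul_zero(1) smult_mult_l, metis M.zero_closed mult_closed smul_zero(1) smult_mult_r)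

lemma star_zero [simp]: "star A \<zero> = \<zero>"
  using star_smult[of \<zero> 0] by simp

lemma mult_minus_l: "\<lbrakk>x \<in> carrier A; y \<in> carrier A; z \<in> carrier A\<rbrakk> \<Longrightarrow> (x \<ominus> y) \<otimes> z = x \<otimes> z \<ominus> y \<otimes> z"
  by (simp add: minus_eq_smul mult_l_distr smult_mult_l)

lemma mult_minus_r: "\<lbrakk>x \<in> carrier A; y \<in> carrier A; z \<in> carrier A\<rbrakk> \<Longrightarrow> z \<otimes> (x \<ominus> y) = z \<otimes> x \<ominus> z \<otimes> y"
  by (simp add: minus_eq_smul mult_r_distr smult_mult_r)

lemma star_minus: "\<lbrakk>x \<in> carrier A; y \<in> carrier A\<rbrakk> \<Longrightarrow> star A (x \<ominus> y) = star A x \<ominus> star A y"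
  by (simp add: minus_eq_smul star_add star_smult)

text \<open>Ordered rewriting can leave one or two summands between \<open>x\<close> and its
  negative; these rules still cancel the pair.\<close>

lemma add_cancel:
  assumes "x \<in> carrier A" "y \<in> carrier A" "z \<in> carrier A" "w \<in> carrier A"
  shows "x \<oplus> (y \<oplus> (\<ominus> x \<oplus> z)) = y \<oplus> z" "x \<oplus> (y \<oplus> \<ominus> x) = y"
    "\<ominus> x \<oplus> (y \<oplus> (x \<oplus> z)) = y \<oplus> z" "\<ominus> x \<oplus> (y \<oplus> x) = y"
    "x \<oplus> (y \<oplus> (w \<oplus> (\<ominus> x \<oplus> z))) = y \<oplus> (w \<oplus> z)" "x \<oplus> (y \<oplus> (w \<oplus> \<ominus> x)) = y \<oplus> w"
    "x \<oplus> (\<ominus> x \<oplus> y) = y" "\<ominus> x \<oplus> (x \<oplus> y) = y"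
proof -
  have *: "x \<oplus> (\<ominus> x \<oplus> u) = u" "\<ominus> x \<oplus> (x \<oplus> u) = u" if "u \<in> carrier A" for u
    using that assms by (simp_all add: M.r_neg1 M.r_neg2)
  have "x \<oplus> (y \<oplus> (\<ominus> x \<oplus> z)) = x \<oplus> (\<ominus> x \<oplus> (y \<oplus> z))"
    "x \<oplus> (y \<oplus> \<ominus> x) = x \<oplus> (\<ominus> x \<oplus> y)"
    "\<ominus> x \<oplus> (y \<oplus> (x \<oplus> z)) = \<ominus> x \<oplus> (x \<oplus> (y \<oplus> z))" "\<ominus> x \<oplus> (y \<oplus> x) = \<ominus> x \<oplus> (x \<oplus> y)"
    "x \<oplus> (y \<oplus> (w \<oplus> (\<ominus> x \<oplus> z))) = x \<oplus> (\<ominus> x \<oplus> (y \<oplus> (w \<oplus> z)))"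
    "x \<oplus> (y \<oplus> (w \<oplus> \<ominus> x)) = x \<oplus> (\<ominus> x \<oplus> (y \<oplus> w))"
    using assms by (simp_all add: M.a_ac)
  with * assms show "x \<oplus> (y \<oplus> (\<ominus> x \<oplus> z)) = y \<oplus> z" "x \<oplus> (y \<oplus> \<ominus> x) = y"
    "\<ominus> x \<oplus> (y \<oplus> (x \<oplus> z)) = y \<oplus> z" "\<ominus> x \<oplus> (y \<oplus> x) = y"
    "x \<oplus> (y \<oplus> (w \<oplus> (\<ominus> x \<oplus> z))) = y \<oplus> (w \<oplus> z)" "x \<oplus> (y \<oplus> (w \<oplus> \<ominus> x)) = y \<oplus> w"
    "x \<oplus> (\<ominus> x \<oplus> y) = y" "\<ominus> x \<oplus> (x \<oplus> y) = y"
    by simp_all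
qed

lemma minus_add_minus: "\<lbrakk>x \<in> carrier A; y \<in> carrier A; z \<in> carrier A\<rbrakk> \<Longrightarrow> (x \<ominus> y) \<oplus> (y \<ominus> z) = x \<ominus> z"
  by (simp add: a_minus_def M.a_ac M.r_neg1 M.r_neg2)

lemma add_minus_add:
  "\<lbrakk>x \<in> carrier A; y \<in> carrier A; x' \<in> carrier A; y' \<in> carrier A\<rbrakk>
    \<Longrightarrow> (x \<oplus> y) \<ominus> (x' \<oplus> y') = (x \<ominus> x') \<oplus> (y \<ominus> y')"
  by (simp add: a_minus_def M.a_ac M.minus_add)

lemma minus_self [simp]: "x \<in> carrier A \<Longrightarrow> x \<ominus> x = \<zero>"
  by (simp add: a_minus_def M.r_neg)

lemma minus_zero [simp]: "x \<in> carrier A \<Longrightarrow> x \<ominus> \<zero> = x"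
  by (simp add: a_minus_def)

lemma minus_eq_zero_iff: "\<lbrakk>x \<in> carrier A; y \<in> carrier A\<rbrakk> \<Longrightarrow> x \<ominus> y = \<zero> \<longleftrightarrow> x = y"
  by (metis M.add.inv_solve_right M.l_zero M.zero_closed a_minus_def)

lemma finsum_mult_l:
  assumes "finite F" "x \<in> carrier A" "\<And>i. i \<in> F \<Longrightarrow> f i \<in> carrier A"
  shows "x \<otimes> (\<Oplus>i\<in>F. f i) = (\<Oplus>i\<in>F. x \<otimes> f i)"
  using assms
proof (induction F rule: finite_induct)
  case (insert i F)
  moreover have "(\<Oplus>i\<in>F. f i) \<in> carrier A" using insert by (intro M.finsum_closed) auto
  ultimately show ?case by (simp add: mult_r_distr Pi_def)
qed simp

lemma finsum_mult_r:
  assumes "finite F" "x \<in> carrier A" "\<And>i. i \<in> F \<Longrightarrow> f i \<in> carrier A"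
  shows "(\<Oplus>i\<in>F. f i) \<otimes> x = (\<Oplus>i\<in>F. f i \<otimes> x)"
  using assms
proof (induction F rule: finite_induct)
  case (insert i F)
  moreover have "(\<Oplus>i\<in>F. f i) \<in> carrier A" using insert by (intro M.finsum_closed) auto
  ultimately show ?case by (simp add: mult_l_distr Pi_def)
qed simp

end

section \<open>Norm estimates and convergent sequences\<close>

context cstar_algebra
begin

lemma nrm_zero [simp]: "nrm A \<zero> = 0"
  using nrm_eq_0_iff[of \<zero>] by simp

lemma nrm_minus_commute: "\<lbrakk>x \<in> carrier A; y \<in> carrier A\<rbrakk> \<Longrightarrow> nrm A (x \<ominus> y) = nrm A (y \<ominus> x)"
  using nrm_smult[of "y \<ominus> x" "-1"] by (simp add: minus_eq_smul smul_add_r smul_smul M.a_comm)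

lemma nrm_triangle_minus: "\<lbrakk>x \<in> carrier A; y \<in> carrier A\<rbrakk> \<Longrightarrow> nrm A (x \<ominus> y) \<le> nrm A x + nrm A y"
  using nrm_triangle[of x "(-1) \<odot> y"] by (simp add: minus_eq_smul nrm_smult)

lemma nrm_triangle_via:
  "\<lbrakk>x \<in> carrier A; y \<in> carrier A; z \<in> carrier A\<rbrakk> \<Longrightarrow> nrm A (x \<ominus> z) \<le> nrm A (x \<ominus> y) + nrm A (y \<ominus> z)"
  using nrm_triangle[of "x \<ominus> y" "y \<ominus> z"] by (simp add: minus_add_minus)

lemma nrm_triangle_rev: "\<lbrakk>x \<in> carrier A; y \<in> carrier A\<rbrakk> \<Longrightarrow> \<bar>nrm A x - nrm A y\<bar> \<le> nrm A (x \<ominus> y)"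
  using nrm_triangle_via[of x y \<zero>] nrm_triangle_via[of y x \<zero>] nrm_minus_commute[of x y] by simp

lemma nrm_star: "x \<in> carrier A \<Longrightarrow> nrm A (star A x) = nrm A x"
proof -
  have le: "nrm A x \<le> nrm A (star A x)" if "x \<in> carrier A" for x
  proof (cases "nrm A x = 0")
    case False
    have "nrm A x * nrm A x \<le> nrm A (star A x) * nrm A x"
      using cstar_identity[OF that] nrm_mult[of "star A x" x] that by (simp add: power2_eq_square)
    with False nrm_nonneg[OF that] show ?thesis by simp
  qed (simp add: that nrm_nonneg)
  show "x \<in> carrier A \<Longrightarrow> nrm A (star A x) = nrm A x"
    using le[of x] le[of "star A x"] by (simp add: star_star)
qed

lemma star_mult_self_eq_zero: "x \<in> carrier A \<Longrightarrow> star A x \<otimes> x = \<zero> \<Longrightarrow> x = \<zero>"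
  using cstar_identity[of x] nrm_eq_0_iff[of x] by simp

text \<open>The choice \<open>y = star A x\<close> suffices, by the C*-identity. In the zero algebra
  the hypothesis holds for negative \<open>r\<close> as well, hence the second alternative.\<close>

lemma nrm_le_of_left_mult:
  assumes x: "x \<in> carrier A" and r: "\<And>y. y \<in> carrier A \<Longrightarrow> nrm A (x \<otimes> y) \<le> r * nrm A y" 
  shows "nrm A x \<le> r \<or> x = \<zero>"
proof -
  have "nrm A x * nrm A x \<le> r * nrm A x"
    using r[of "star A x"] cstar_identity[of "star A x"] x
    by (simp add: star_star nrm_star power2_eq_square)
  then show ?thesis
    using nrm_nonneg[OF x] nrm_eq_0_iff[OF x] by (cases "nrm A x = 0") auto
qed

definition conv :: "(nat \<Rightarrow> 'a) \<Rightarrow> 'a \<Rightarrow> bool" where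
  "conv x l \<longleftrightarrow> (\<forall>n. x n \<in> carrier A) \<and> l \<in> carrier A \<and> (\<lambda>n. nrm A (x n \<ominus> l)) \<longlonglongrightarrow> 0"

lemma convD: assumes "conv x l" shows "x n \<in> carrier A" "l \<in> carrier A" "(\<lambda>n. nrm A (x n \<ominus> l)) \<longlonglongrightarrow> 0"
  using assms by (auto simp: conv_def)

lemma convI:
  assumes "\<And>n. x n \<in> carrier A" "l \<in> carrier A"
    and "\<And>n. nrm A (x n \<ominus> l) \<le> b n" "b \<longlonglongrightarrow> 0"
  shows "conv x l"
proof -
  have "\<forall>\<^sub>F n in sequentially. 0 \<le> nrm A (x n \<ominus> l)" "\<forall>\<^sub>F n in sequentially. nrm A (x n \<ominus> l) \<le> b n"
    using assms(1,2,3) by (simp_all add: nrm_nonneg)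
  from tendsto_sandwich[OF this tendsto_const assms(4)] show ?thesis
    unfolding conv_def using assms(1,2) by simp
qed

lemma conv_const: "x \<in> carrier A \<Longrightarrow> conv (\<lambda>_. x) x"
  by (rule convI[where b = "\<lambda>_. 0"]) auto

lemma conv_Suc: "conv x l \<Longrightarrow> conv (\<lambda>n. x (Suc n)) l"
  unfolding conv_def by (auto dest: LIMSEQ_Suc)

lemma conv_add:
  assumes x: "conv x l" and y: "conv y m" shows "conv (\<lambda>n. x n \<oplus> y n) (l \<oplus> m)"
proof (rule convI)
  show "nrm A ((x n \<oplus> y n) \<ominus> (l \<oplus> m)) \<le> nrm A (x n \<ominus> l) + nrm A (y n \<ominus> m)" for n
    using convD(1,2)[OF x] convD(1,2)[OF y]
    by (simp add: add_minus_add nrm_triangle)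
  show "(\<lambda>n. nrm A (x n \<ominus> l) + nrm A (y n \<ominus> m)) \<longlonglongrightarrow> 0"
    using tendsto_add[OF convD(3)[OF x] convD(3)[OF y]] by simp
qed (use convD(1,2)[OF x] convD(1,2)[OF y] in auto)

lemma conv_nrm: assumes x: "conv x l" shows "(\<lambda>n. nrm A (x n)) \<longlonglongrightarrow> nrm A l"
proof (rule LIM_zero_cancel, rule tendsto_rabs_zero_cancel)
  have "\<bar>nrm A (x n) - nrm A l\<bar> \<le> nrm A (x n \<ominus> l)" for n
    using convD(1,2)[OF x] by (rule nrm_triangle_rev)
  then show "(\<lambda>n. \<bar>nrm A (x n) - nrm A l\<bar>) \<longlonglongrightarrow> 0"
    by (intro tendsto_sandwich[OF _ _ tendsto_const convD(3)[OF x]] eventuallyI) auto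
qed

lemma conv_mult:
  assumes x: "conv x l" and y: "conv y m" shows "conv (\<lambda>n. x n \<otimes> y n) (l \<otimes> m)"
proof (rule convI)
  note c = convD(1,2)[OF x] convD(1,2)[OF y]
  show "nrm A (x n \<otimes> y n \<ominus> l \<otimes> m) \<le> nrm A (x n \<ominus> l) * nrm A (y n) + nrm A l * nrm A (y n \<ominus> m)" for n
  proof -
    have "nrm A (x n \<otimes> y n \<ominus> l \<otimes> m) \<le> nrm A (x n \<otimes> y n \<ominus> l \<otimes> y n) + nrm A (l \<otimes> y n \<ominus> l \<otimes> m)"
      using c by (intro nrm_triangle_via) auto
    also have "\<dots> = nrm A ((x n \<ominus> l) \<otimes> y n) + nrm A (l \<otimes> (y n \<ominus> m))"
      using c by (simp add: mult_minus_l mult_minus_r)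
    also have "\<dots> \<le> nrm A (x n \<ominus> l) * nrm A (y n) + nrm A l * nrm A (y n \<ominus> m)"
      using c by (intro add_mono nrm_mult) auto
    finally show ?thesis .
  qed
  show "(\<lambda>n. nrm A (x n \<ominus> l) * nrm A (y n) + nrm A l * nrm A (y n \<ominus> m)) \<longlonglongrightarrow> 0"
    using tendsto_add[OF tendsto_mult[OF convD(3)[OF x] conv_nrm[OF y]]
        tendsto_mult[OF tendsto_const convD(3)[OF y]]] by simp
qed (use convD(1,2)[OF x] convD(1,2)[OF y] in auto)

lemma conv_smul:
  assumes c: "c \<longlonglongrightarrow> k" and x: "conv x l" shows "conv (\<lambda>n. c n \<odot> x n) (k \<odot> l)"
proof (rule convI)
  note cl = convD(1,2)[OF x]
  show "nrm A (c n \<odot> x n \<ominus> k \<odot> l) \<le> cmod (c n) * nrm A (x n \<ominus> l) + cmod (c n - k) * nrm A l" for n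
  proof -
    have "nrm A (c n \<odot> x n \<ominus> k \<odot> l) \<le> nrm A (c n \<odot> x n \<ominus> c n \<odot> l) + nrm A (c n \<odot> l \<ominus> k \<odot> l)"
      using cl by (intro nrm_triangle_via) auto
    also have "c n \<odot> l \<ominus> k \<odot> l = (c n - k) \<odot> l"
      using cl smul_add_l[of l "c n" "- k"] by (simp add: minus_eq_smul smul_smul)
    finally show ?thesis using cl by (simp add: smul_minus[symmetric] nrm_smult)
  qed
  have "(\<lambda>n. cmod (c n - k)) \<longlonglongrightarrow> 0"
    by (intro tendsto_norm_zero LIM_zero c)
  then show "(\<lambda>n. cmod (c n) * nrm A (x n \<ominus> l) + cmod (c n - k) * nrm A l) \<longlonglongrightarrow> 0"
    by - (rule tendsto_eq_intros convD(3)[OF x] c | assumption | simp)+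
qed (use convD(1,2)[OF x] in auto)

lemma conv_minus:
  assumes x: "conv x l" and y: "conv y m" shows "conv (\<lambda>n. x n \<ominus> y n) (l \<ominus> m)"
  using conv_add[OF x conv_smul[OF tendsto_const[of "-1"] y]] convD[OF x] convD[OF y]
  by (simp add: minus_eq_smul)

lemma conv_star: assumes x: "conv x l" shows "conv (\<lambda>n. star A (x n)) (star A l)"
  by (rule convI[where b = "\<lambda>n. nrm A (x n \<ominus> l)"])
    (use convD[OF x] in \<open>auto simp: star_minus[symmetric] nrm_star\<close>)

lemma conv_unique: assumes "conv x l" "conv x m" shows "l = m"
proof -
  have "conv (\<lambda>n. x n \<ominus> x n) (l \<ominus> m)" by (rule conv_minus[OF assms])
  then have "conv (\<lambda>n. \<zero>) (l \<ominus> m)" using convD(1)[OF assms(1)] by simp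
  from conv_nrm[OF this] have "nrm A (l \<ominus> m) = 0" by (simp add: LIMSEQ_const_iff)
  then show ?thesis
    using convD(2)[OF assms(1)] convD(2)[OF assms(2)] nrm_eq_0_iff minus_eq_zero_iff by blast
qed

text \<open>The distances are dominated by increments of a convergent scalar sequence, so the
  sequence is Cauchy.\<close>

lemma conv_of_Cauchy:
  assumes "\<And>n. x n \<in> carrier A"
    and "\<And>m n. m \<le> n \<Longrightarrow> nrm A (x n \<ominus> x m) \<le> b n - b m" and "convergent b"
  shows "\<exists>l. conv x l"
proof -
  have "\<exists>M. \<forall>m\<ge>M. \<forall>n\<ge>M. nrm A (x m \<ominus> x n) < \<epsilon>" if "\<epsilon> > 0" for \<epsilon>
  proof -
    obtain M where M: "\<And>m n. m \<ge> M \<Longrightarrow> n \<ge> M \<Longrightarrow> \<bar>b m - b n\<bar> < \<epsilon>"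
      using \<open>convergent b\<close> \<open>\<epsilon> > 0\<close> unfolding Cauchy_convergent_iff[symmetric] Cauchy_iff by (metis real_norm_def)
    have "nrm A (x m \<ominus> x n) < \<epsilon>" if "m \<ge> M" "n \<ge> M" for m n
      using M[OF that] assms(2)[of m n] assms(2)[of n m] nrm_minus_commute[OF assms(1) assms(1), of m n]
      by (cases "m \<le> n") auto
    then show ?thesis by blast
  qed
  then show ?thesis
    using nrm_complete assms(1) unfolding complete_wrt_def conv_def by blast
qed

text \<open>If \<open>\<parallel>1 - a\<parallel> \<le> 1\<close> then \<open>h \<mapsto> ((1 - a) + h\<^sup>2) / 2\<close>, iterated from \<open>0\<close>, converges to
  \<open>1 - \<surd>a\<close>: the increments are dominated by those of the scalar iteration \<open>t \<mapsto> (1 + t\<^sup>2) / 2\<close>.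
  There is no unit, so the iteration is carried out on \<open>f = t - h\<close>.\<close>

primrec sqrt_scalar :: "nat \<Rightarrow> real" where
  "sqrt_scalar 0 = 0"
| "sqrt_scalar (Suc k) = (1 + (sqrt_scalar k)\<^sup>2) / 2"

primrec sqrt_iter :: "'a \<Rightarrow> nat \<Rightarrow> 'a" where
  "sqrt_iter a 0 = \<zero>"
| "sqrt_iter a (Suc k) = (1/2) \<odot> a \<oplus> (complex_of_real (sqrt_scalar k) \<odot> sqrt_iter a k
      \<ominus> (1/2) \<odot> (sqrt_iter a k \<otimes> sqrt_iter a k))"

end

section \<open>Convergence of the square root iteration\<close>

context cstar_algebra
begin

lemma sqrt_scalar_bounds: "0 \<le> sqrt_scalar k \<and> sqrt_scalar k \<le> 1 \<and> sqrt_scalar k \<le> sqrt_scalar (Suc k)"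
proof (induction k)
  case (Suc k)
  then have "0 \<le> sqrt_scalar (Suc k)" "sqrt_scalar (Suc k) \<le> 1"
    by (simp_all add: power_le_one)
  moreover have "2 * x \<le> 1 + x\<^sup>2" for x :: real
    using sum_squares_bound[of x 1] by simp
  then have "2 * sqrt_scalar (Suc k) \<le> 1 + (sqrt_scalar (Suc k))\<^sup>2" .
  then have "sqrt_scalar (Suc k) \<le> sqrt_scalar (Suc (Suc k))"
    by (subst sqrt_scalar.simps(2)[of "Suc k"]) simp
  ultimately show ?case by blast
qed simp

lemma sqrt_scalar_incseq: "incseq sqrt_scalar"
  using sqrt_scalar_bounds by (intro incseq_SucI) blast

text \<open>The fixed-point equation \<open>L = (1 + L^2) / 2\<close> has the single solution
  1.\<close>

lemma sqrt_scalar_LIMSEQ: "sqrt_scalar \<longlonglongrightarrow> 1"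
proof -
  have "bdd_above (range sqrt_scalar)"
    using sqrt_scalar_bounds by (auto intro!: bdd_aboveI2[of _ _ 1] simp del: sqrt_scalar.simps)
  with sqrt_scalar_incseq obtain L where L: "sqrt_scalar \<longlonglongrightarrow> L"
    using LIMSEQ_incseq_SUP by blast
  have "(\<lambda>k. sqrt_scalar (Suc k)) \<longlonglongrightarrow> (1 + L\<^sup>2) / 2"
    unfolding sqrt_scalar.simps by (intro tendsto_intros L) simp
  with LIMSEQ_Suc[OF L] have "L = (1 + L\<^sup>2) / 2" by (rule LIMSEQ_unique)
  then have "(L - 1)\<^sup>2 = 0" by (simp add: power2_eq_square algebra_simps)
  with L show ?thesis by simp
qed

lemma sqrt_iter_closed [simp]: "a \<in> carrier A \<Longrightarrow> sqrt_iter a k \<in> carrier A"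
  by (induction k) auto

text \<open>Each iterate is a polynomial in \<open>a\<close>. The commutation survives in the limit
  and later makes two square roots commute.\<close>

lemma sqrt_iter_commute:
  assumes "a \<in> carrier A" "b \<in> carrier A" "a \<otimes> b = b \<otimes> a"
  shows "sqrt_iter a k \<otimes> b = b \<otimes> sqrt_iter a k"
proof (induction k)
  case (Suc k)
  define f where "f = sqrt_iter a k"
  have f: "f \<in> carrier A" "f \<otimes> b = b \<otimes> f" using assms Suc by (simp_all add: f_def)
  have "f \<otimes> f \<otimes> b = b \<otimes> (f \<otimes> f)"
    using f assms by (metis mult_assoc)
  with f assms show ?case
    by (simp add: f_def[symmetric] mult_l_distr mult_r_distr mult_minus_l mult_minus_r smult_mult_l smult_mult_r)
qed (use assms in simp)

lemma sqrt_iter_star: "a \<in> carrier A \<Longrightarrow> star A a = a \<Longrightarrow> star A (sqrt_iter a k) = sqrt_iter a k"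
  by (induction k) (simp_all add: star_add star_minus star_smult star_mult)

text \<open>Left multiplication by \<open>h = t - f\<close>, which makes sense although the scalar
  \<open>t\<close> is not an element of the algebra.\<close>

definition sqrt_op :: "'a \<Rightarrow> nat \<Rightarrow> 'a \<Rightarrow> 'a" where
  "sqrt_op a k y = complex_of_real (sqrt_scalar k) \<odot> y \<ominus> sqrt_iter a k \<otimes> y"

lemma sqrt_op_closed [simp]: "\<lbrakk>a \<in> carrier A; y \<in> carrier A\<rbrakk> \<Longrightarrow> sqrt_op a k y \<in> carrier A"
  by (simp add: sqrt_op_def)

lemma sqrt_op_minus:
  "\<lbrakk>a \<in> carrier A; x \<in> carrier A; y \<in> carrier A\<rbrakk> \<Longrightarrow> sqrt_op a k (x \<ominus> y) = sqrt_op a k x \<ominus> sqrt_op a k y"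
  unfolding sqrt_op_def
  by (simp add: minus_eq_smul smul_add_r smul_smul mult_r_distr smult_mult_r M.a_ac mult.commute)

text \<open>The recursion \<open>h' = ((1 - a) + h h) / 2\<close>, recovered from the one for
  \<open>f\<close>.\<close>

lemma sqrt_op_Suc:
  assumes a: "a \<in> carrier A" and y: "y \<in> carrier A"
  shows "sqrt_op a (Suc k) y = (1/2) \<odot> ((y \<ominus> a \<otimes> y) \<oplus> sqrt_op a k (sqrt_op a k y))"
proof -
  define f t where "f = sqrt_iter a k" and "t = complex_of_real (sqrt_scalar k)"
  have f: "f \<in> carrier A" using a by (simp add: f_def)
  define u v w where "u = a \<otimes> y" and "v = f \<otimes> y" and "w = f \<otimes> (f \<otimes> y)"
  have uvw: "u \<in> carrier A" "v \<in> carrier A" "w \<in> carrier A" using a y f by (simp_all add: u_def v_def w_def)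
  have collect: "c \<odot> x \<oplus> (d \<odot> x \<oplus> z) = (c + d) \<odot> x \<oplus> z" "c \<odot> x \<oplus> d \<odot> x = (c + d) \<odot> x"
    if "x \<in> carrier A" "z \<in> carrier A" for c d x z
    using that by (simp_all add: smul_add_l M.a_assoc)
  have "sqrt_op a (Suc k) y = ((1 + t\<^sup>2) / 2) \<odot> y \<ominus> ((1/2) \<odot> u \<oplus> (t \<odot> v \<ominus> (1/2) \<odot> w))"
    using a y f
    by (simp add: sqrt_op_def f_def[symmetric] t_def u_def v_def w_def mult_l_distr mult_minus_l
        smult_mult_l mult_assoc)
  also have "\<dots> = (t\<^sup>2 / 2) \<odot> y \<oplus> ((1/2) \<odot> y \<oplus> ((-1/2) \<odot> u \<oplus> ((-t) \<odot> v \<oplus> (1/2) \<odot> w)))"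
    using uvw y
    by (simp add: minus_eq_smul smul_add_r smul_smul add_divide_distrib smul_add_l M.a_ac)
  also have "\<dots> = (1/2) \<odot> ((y \<ominus> u) \<oplus> (t \<odot> (t \<odot> y \<ominus> v) \<ominus> (t \<odot> v \<ominus> w)))"
    using uvw y
    apply (simp add: minus_eq_smul smul_add_r smul_smul power2_eq_square)
    apply (simp add: M.a_ac)
    apply (simp add: collect M.a_lcomm)
    done
  also have "(t \<odot> (t \<odot> y \<ominus> v) \<ominus> (t \<odot> v \<ominus> w)) = sqrt_op a k (sqrt_op a k y)"
    using a y f by (simp add: sqrt_op_def f_def[symmetric] t_def[symmetric] v_def w_def mult_minus_r smult_mult_r)
  finally show ?thesis by (simp add: u_def)
qed

text \<open>Induction using \<open>h' h' - h h = h' (h' - h) + (h' - h) h\<close>; the scalars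
  satisfy the matching identity \<open>t'^2 - t^2 = t' (t' - t) + (t' - t) t\<close>.\<close>

lemma sqrt_op_bounds:
  assumes a: "a \<in> carrier A" and contr: "\<And>y. y \<in> carrier A \<Longrightarrow> nrm A (y \<ominus> a \<otimes> y) \<le> nrm A y"
  shows "(\<forall>y\<in>carrier A. nrm A (sqrt_op a k y) \<le> sqrt_scalar k * nrm A y) \<and>
    (\<forall>y\<in>carrier A. nrm A (sqrt_op a (Suc k) y \<ominus> sqrt_op a k y) \<le> (sqrt_scalar (Suc k) - sqrt_scalar k) * nrm A y)"
proof (induction k)
  case 0
  have zero: "sqrt_op a 0 y = \<zero>" if "y \<in> carrier A" for y
    using that by (simp add: sqrt_op_def)
  have "nrm A (sqrt_op a (Suc 0) y) \<le> (1/2) * nrm A y" if "y \<in> carrier A" for y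
    using contr[OF that] a that by (simp add: sqrt_op_Suc zero nrm_smult)
  with zero a show ?case by simp
next
  case (Suc k)
  define t where "t = sqrt_scalar k"
  define t' where "t' = sqrt_scalar (Suc k)"
  have t: "0 \<le> t" "t \<le> t'" "t' = (1 + t\<^sup>2) / 2" "sqrt_scalar (Suc (Suc k)) = (1 + t'\<^sup>2) / 2"
    using sqrt_scalar_bounds[of k] by (simp_all add: t_def t'_def)
  define H where "H = sqrt_op a k"
  define H' where "H' = sqrt_op a (Suc k)"
  have cl: "H y \<in> carrier A" "H' y \<in> carrier A" if "y \<in> carrier A" for y
    using a that by (simp_all add: H_def H'_def del: sqrt_iter.simps)
  have IH: "nrm A (H y) \<le> t * nrm A y" "nrm A (H' y \<ominus> H y) \<le> (t' - t) * nrm A y" if "y \<in> carrier A" for y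
    using Suc that by (auto simp: H_def H'_def t_def t'_def)
  have bound: "nrm A (H' y) \<le> t' * nrm A y" if y: "y \<in> carrier A" for y
  proof -
    have "nrm A (H (H y)) \<le> t * (t * nrm A y)"
      using IH(1)[OF cl(1)[OF y]] mult_left_mono[OF IH(1)[OF y] t(1)] by linarith
    then have "nrm A ((y \<ominus> a \<otimes> y) \<oplus> H (H y)) \<le> nrm A y + t * (t * nrm A y)"
      using nrm_triangle[of "y \<ominus> a \<otimes> y" "H (H y)"] contr[OF y] y a cl by fastforce
    then show ?thesis
      using y a cl[OF cl(1)[OF y]] unfolding H'_def sqrt_op_Suc[OF a y] H_def[symmetric]
      by (simp add: nrm_smult t(3) power2_eq_square field_simps)
  qed
  have "nrm A (sqrt_op a (Suc (Suc k)) y \<ominus> H' y) \<le> (sqrt_scalar (Suc (Suc k)) - t') * nrm A y" if y: "y \<in> carrier A" for y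
  proof -
    note [simp] = cl y a
    have "sqrt_op a (Suc (Suc k)) y \<ominus> H' y = (1/2) \<odot> (((y \<ominus> a \<otimes> y) \<oplus> H' (H' y)) \<ominus> ((y \<ominus> a \<otimes> y) \<oplus> H (H y)))"
      unfolding H'_def sqrt_op_Suc[OF a y] unfolding H'_def[symmetric] H_def[symmetric]
      by (simp add: smul_minus)
    also have "\<dots> = (1/2) \<odot> (H' (H' y) \<ominus> H (H y))"
      by (simp add: add_minus_add)
    finally have "nrm A (sqrt_op a (Suc (Suc k)) y \<ominus> H' y) = (1/2) * nrm A (H' (H' y) \<ominus> H (H y))"
      by (simp add: nrm_smult)
    also have "nrm A (H' (H' y) \<ominus> H (H y)) \<le> nrm A (H' (H' y) \<ominus> H' (H y)) + nrm A (H' (H y) \<ominus> H (H y))"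
      by (intro nrm_triangle_via) auto
    also have "H' (H' y) \<ominus> H' (H y) = H' (H' y \<ominus> H y)"
      using sqrt_op_minus[OF a, of "H' y" "H y" "Suc k"] by (simp add: H'_def[symmetric] del: sqrt_iter.simps)
    also have "nrm A (H' (H' y \<ominus> H y)) \<le> t' * ((t' - t) * nrm A y)"
      using bound[of "H' y \<ominus> H y"] mult_left_mono[OF IH(2)[OF y], of t'] t by fastforce
    also have "nrm A (H' (H y) \<ominus> H (H y)) \<le> (t' - t) * (t * nrm A y)"
      using IH(2)[of "H y"] mult_left_mono[OF IH(1)[OF y], of "t' - t"] t by fastforce
    finally have le: "nrm A (sqrt_op a (Suc (Suc k)) y \<ominus> H' y)
        \<le> (1/2) * (t' * ((t' - t) * nrm A y) + (t' - t) * (t * nrm A y))" by simp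
    have "(1/2) * (t' * ((t' - t) * nrm A y) + (t' - t) * (t * nrm A y)) = (t'\<^sup>2 - t\<^sup>2) / 2 * nrm A y"
      by (simp add: power2_eq_square field_simps)
    moreover have "t\<^sup>2 = 2 * t' - 1" using t(3) by simp
    ultimately have "(1/2) * (t' * ((t' - t) * nrm A y) + (t' - t) * (t * nrm A y)) = ((1 + t'\<^sup>2) / 2 - t') * nrm A y"
      by (simp add: field_simps)
    with le show ?thesis unfolding t(4) by simp
  qed
  with bound show ?case by (simp add: H'_def t'_def del: sqrt_iter.simps sqrt_scalar.simps)
qed

text \<open>Since \<open>f = t - h\<close> and \<open>h\<close> moves at most as far as
  \<open>t\<close>, two iterates differ by at most twice the difference of the scalars. The limit is
  a fixed point of the recursion with \<open>t = 1\<close>, that is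
  \<open>g = a/2 + g - g g/2\<close>.\<close>

lemma sqrt_exists:
  assumes a: "a \<in> carrier A" "star A a = a" and contr: "\<And>y. y \<in> carrier A \<Longrightarrow> nrm A (y \<ominus> a \<otimes> y) \<le> nrm A y"
  shows "\<exists>f\<in>carrier A. star A f = f \<and> f \<otimes> f = a \<and> (\<forall>b\<in>carrier A. a \<otimes> b = b \<otimes> a \<longrightarrow> f \<otimes> b = b \<otimes> f)"
proof -
  define t f where "t = (\<lambda>k. complex_of_real (sqrt_scalar k))" and "f = sqrt_iter a"
  have f: "f k \<in> carrier A" for k using a by (simp add: f_def)
  have diff: "nrm A (sqrt_op a n y \<ominus> sqrt_op a m y) \<le> (sqrt_scalar n - sqrt_scalar m) * nrm A y"
    if "m \<le> n" and y: "y \<in> carrier A" for m n y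
    using \<open>m \<le> n\<close>
  proof (induction n rule: dec_induct)
    case (step n)
    have "nrm A (sqrt_op a (Suc n) y \<ominus> sqrt_op a m y)
        \<le> nrm A (sqrt_op a (Suc n) y \<ominus> sqrt_op a n y) + nrm A (sqrt_op a n y \<ominus> sqrt_op a m y)"
      using a y by (intro nrm_triangle_via) auto
    also have "\<dots> \<le> (sqrt_scalar (Suc n) - sqrt_scalar n) * nrm A y + (sqrt_scalar n - sqrt_scalar m) * nrm A y"
      using step.IH sqrt_op_bounds[OF a(1) contr, of n] y by (intro add_mono) auto
    finally show ?case by (simp add: algebra_simps del: sqrt_scalar.simps)
  qed (use a y in simp)
  have "nrm A (f n \<ominus> f m) \<le> 2 * sqrt_scalar n - 2 * sqrt_scalar m" if "m \<le> n" for m n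
  proof -
    have ts: "sqrt_scalar m \<le> sqrt_scalar n"
      using sqrt_scalar_incseq that by (rule incseqD)
    have "nrm A ((f n \<ominus> f m) \<otimes> y) \<le> (2 * (sqrt_scalar n - sqrt_scalar m)) * nrm A y" if y: "y \<in> carrier A" for y
    proof -
      have "(f n \<ominus> f m) \<otimes> y = (t n - t m) \<odot> y \<ominus> (sqrt_op a n y \<ominus> sqrt_op a m y)"
      proof -
        define u v p q where "u = f n \<otimes> y" and "v = f m \<otimes> y" and "p = t n \<odot> y" and "q = t m \<odot> y"
        have c: "u \<in> carrier A" "v \<in> carrier A" "p \<in> carrier A" "q \<in> carrier A"
          using f y by (simp_all add: u_def v_def p_def q_def)
        have "(t n - t m) \<odot> y = p \<ominus> q"
          using y smul_add_l[of y "t n" "- t m"] by (simp add: p_def q_def minus_eq_smul smul_smul)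
        moreover have "u \<ominus> v = (p \<ominus> q) \<ominus> ((p \<ominus> u) \<ominus> (q \<ominus> v))"
          using c by (simp add: a_minus_def M.a_ac M.minus_add add_cancel)
        ultimately show ?thesis
          using f y unfolding sqrt_op_def f_def[symmetric]
          by (simp add: mult_minus_l u_def v_def p_def q_def t_def)
      qed
      then have "nrm A ((f n \<ominus> f m) \<otimes> y) \<le> nrm A ((t n - t m) \<odot> y) + nrm A (sqrt_op a n y \<ominus> sqrt_op a m y)"
        using y a by (simp add: nrm_triangle_minus)
      also have "nrm A ((t n - t m) \<odot> y) = (sqrt_scalar n - sqrt_scalar m) * nrm A y"
        using y ts by (simp add: nrm_smult t_def flip: of_real_diff)
      finally show ?thesis using diff[OF \<open>m \<le> n\<close> y] by (simp add: algebra_simps)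
    qed
    from nrm_le_of_left_mult[OF _ this] f ts show ?thesis by auto
  qed
  moreover have "convergent (\<lambda>n. 2 * sqrt_scalar n)"
    using tendsto_mult_left[OF sqrt_scalar_LIMSEQ, of 2] convergentI by blast
  ultimately obtain g where g: "conv f g"
    using conv_of_Cauchy[of f "\<lambda>n. 2 * sqrt_scalar n"] f by blast
  have t: "t \<longlonglongrightarrow> 1"
    unfolding t_def using tendsto_of_real[OF sqrt_scalar_LIMSEQ, where 'a = complex] by simp
  have "conv (\<lambda>k. f (Suc k)) ((1/2) \<odot> a \<oplus> (1 \<odot> g \<ominus> (1/2) \<odot> (g \<otimes> g)))"
    unfolding f_def sqrt_iter.simps unfolding f_def[symmetric] t_def[THEN fun_cong, symmetric]
    by (intro conv_add conv_minus conv_smul[OF t] conv_smul[OF tendsto_const] conv_mult conv_const g a)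
  with conv_Suc[OF g] have "g = (1/2) \<odot> a \<oplus> (1 \<odot> g \<ominus> (1/2) \<odot> (g \<otimes> g))"
    by (rule conv_unique)
  moreover have gc: "g \<in> carrier A" using convD(2)[OF g] .
  ultimately have eq: "g = g \<oplus> ((1/2) \<odot> a \<ominus> (1/2) \<odot> (g \<otimes> g))"
    using a by (simp add: a_minus_def M.a_ac)
  have "(1/2) \<odot> a \<ominus> (1/2) \<odot> (g \<otimes> g) = \<zero>"
    using eq a gc M.add.r_cancel_one'[of g "(1/2) \<odot> a \<ominus> (1/2) \<odot> (g \<otimes> g)"] by simp
  then have "2 \<odot> ((1/2) \<odot> a) = 2 \<odot> ((1/2) \<odot> (g \<otimes> g))"
    using a gc by (simp add: minus_eq_zero_iff)
  then have "g \<otimes> g = a" using a gc by (simp add: smul_smul)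
  moreover have "star A g = g"
    using conv_star[OF g] g a by (intro conv_unique[of f]) (simp_all add: f_def sqrt_iter_star)
  moreover have "g \<otimes> b = b \<otimes> g" if "b \<in> carrier A" "a \<otimes> b = b \<otimes> a" for b
    using conv_mult[OF g conv_const[OF that(1)]] conv_mult[OF conv_const[OF that(1)] g]
      sqrt_iter_commute[OF a(1) that] by (intro conv_unique[of "\<lambda>k. f k \<otimes> b"]) (simp_all add: f_def)
  ultimately show ?thesis using gc by blast
qed

end

text \<open>An order-free substitute for positivity: \<open>\<parallel>t - a\<parallel> \<le> t\<close>.\<close>

context cstar_algebra
begin

definition pos :: "'a \<Rightarrow> bool" where
  "pos a \<longleftrightarrow> a \<in> carrier A \<and> star A a = a \<and>
    (\<exists>t>0. \<forall>y\<in>carrier A. nrm A (complex_of_real t \<odot> y \<ominus> a \<otimes> y) \<le> t * nrm A y)"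

lemma pos_zero: "pos \<zero>"
  unfolding pos_def by (auto intro!: exI[of _ 1])

text \<open>The bounds for \<open>s - a\<close> and \<open>t - b\<close> add up to one for
  \<open>(s + t) - (a + b)\<close>.\<close>

lemma pos_add:
  assumes "pos a" "pos b" shows "pos (a \<oplus> b)"
proof -
  obtain s t where ab: "a \<in> carrier A" "b \<in> carrier A" "star A a = a" "star A b = b" and st: "s > 0" "t > 0"
    and s: "\<And>y. y \<in> carrier A \<Longrightarrow> nrm A (complex_of_real s \<odot> y \<ominus> a \<otimes> y) \<le> s * nrm A y"
    and t: "\<And>y. y \<in> carrier A \<Longrightarrow> nrm A (complex_of_real t \<odot> y \<ominus> b \<otimes> y) \<le> t * nrm A y"
    using assms unfolding pos_def by blast
  have "nrm A (complex_of_real (s + t) \<odot> y \<ominus> (a \<oplus> b) \<otimes> y) \<le> (s + t) * nrm A y" if y: "y \<in> carrier A" for y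
  proof -
    have "complex_of_real (s + t) \<odot> y \<ominus> (a \<oplus> b) \<otimes> y
        = (complex_of_real s \<odot> y \<ominus> a \<otimes> y) \<oplus> (complex_of_real t \<odot> y \<ominus> b \<otimes> y)"
      using y ab by (simp add: smul_add_l mult_l_distr add_minus_add)
    then have "nrm A (complex_of_real (s + t) \<odot> y \<ominus> (a \<oplus> b) \<otimes> y)
        \<le> nrm A (complex_of_real s \<odot> y \<ominus> a \<otimes> y) + nrm A (complex_of_real t \<odot> y \<ominus> b \<otimes> y)"
      using y ab by (simp add: nrm_triangle)
    with s[OF y] t[OF y] show ?thesis by (simp add: algebra_simps)
  qed
  then show ?thesis
    unfolding pos_def using ab st by (auto simp: star_add intro!: exI[of _ "s + t"])
qed

lemma pos_finsum:
  assumes "finite F" "\<And>i. i \<in> F \<Longrightarrow> pos (f i)" shows "pos (\<Oplus>i\<in>F. f i)"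
  using assms
proof (induction F rule: finite_induct)
  case (insert i F)
  moreover have "f k \<in> carrier A" if "k \<in> insert i F" for k using insert that by (auto simp: pos_def)
  ultimately show ?case by (simp add: Pi_def pos_add)
qed (simp add: pos_zero)

text \<open>Division by \<open>t\<close> reduces to the normalized situation of
  \<open>sqrt_exists\<close>; the root is then scaled by \<open>sqrt t\<close>.\<close>

lemma pos_sqrt:
  assumes "pos a"
  shows "\<exists>f\<in>carrier A. star A f = f \<and> f \<otimes> f = a \<and> (\<forall>b\<in>carrier A. a \<otimes> b = b \<otimes> a \<longrightarrow> f \<otimes> b = b \<otimes> f)"
proof -
  obtain t where a: "a \<in> carrier A" "star A a = a" and t: "t > 0"
    and b: "\<And>y. y \<in> carrier A \<Longrightarrow> nrm A (complex_of_real t \<odot> y \<ominus> a \<otimes> y) \<le> t * nrm A y"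
    using assms unfolding pos_def by blast
  define a' where "a' = complex_of_real (1/t) \<odot> a"
  have a': "a' \<in> carrier A" "star A a' = a'" using a by (simp_all add: a'_def star_smult)
  have "nrm A (y \<ominus> a' \<otimes> y) \<le> nrm A y" if y: "y \<in> carrier A" for y
  proof -
    have "y \<ominus> a' \<otimes> y = complex_of_real (1/t) \<odot> (complex_of_real t \<odot> y \<ominus> a \<otimes> y)"
      using y a t by (simp add: a'_def smult_mult_l smul_minus smul_smul)
    then have "nrm A (y \<ominus> a' \<otimes> y) = (1/t) * nrm A (complex_of_real t \<odot> y \<ominus> a \<otimes> y)"
      using y a t by (simp add: nrm_smult norm_divide)
    also have "\<dots> \<le> (1/t) * (t * nrm A y)"
      using b[OF y] t by (intro mult_left_mono) auto
    finally show ?thesis using t by simp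
  qed
  from sqrt_exists[OF a' this] obtain f where f: "f \<in> carrier A" "star A f = f" "f \<otimes> f = a'"
    and comm: "\<And>b. b \<in> carrier A \<Longrightarrow> a' \<otimes> b = b \<otimes> a' \<Longrightarrow> f \<otimes> b = b \<otimes> f" by blast
  define g where "g = complex_of_real (sqrt t) \<odot> f"
  have "g \<otimes> g = (complex_of_real (sqrt t) * complex_of_real (sqrt t)) \<odot> a'"
    using f by (simp add: g_def smult_mult_l smult_mult_r) (simp add: smul_smul a'(1))
  also have "complex_of_real (sqrt t) * complex_of_real (sqrt t) = complex_of_real t"
    using t by (simp flip: of_real_mult)
  also have "complex_of_real t \<odot> a' = a" using a t by (simp add: a'_def smul_smul flip: of_real_mult)
  finally have "g \<otimes> g = a" .
  moreover have "g \<otimes> b = b \<otimes> g" if "b \<in> carrier A" "a \<otimes> b = b \<otimes> a" for b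
    using comm[OF that(1)] that f a by (simp add: g_def a'_def smult_mult_l smult_mult_r)
  moreover have "star A g = g" "g \<in> carrier A" using f by (simp_all add: g_def star_smult)
  ultimately show ?thesis by blast
qed

text \<open>Let \<open>g g = a\<close> and \<open>h h = - a\<close>. The roots commute, as
  \<open>g\<close> commutes with whatever commutes with \<open>a\<close>, so
  \<open>u = g + i h\<close> satisfies \<open>star A u \<otimes> u = a - a = 0\<close>. Hence
  \<open>u\<close> and its adjoint \<open>g - i h\<close> vanish, and so does their sum
  \<open>2 g\<close>.\<close>

lemma pos_antisym:
  assumes "pos a" "pos (\<ominus> a)" shows "a = \<zero>"
proof -
  have a: "a \<in> carrier A" using assms by (simp add: pos_def)
  obtain g where g: "g \<in> carrier A" "star A g = g" "g \<otimes> g = a"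
    and comm: "\<And>b. b \<in> carrier A \<Longrightarrow> a \<otimes> b = b \<otimes> a \<Longrightarrow> g \<otimes> b = b \<otimes> g"
    using pos_sqrt[OF assms(1)] by blast
  obtain h where h: "h \<in> carrier A" "star A h = h" "h \<otimes> h = \<ominus> a"
    using pos_sqrt[OF assms(2)] by blast
  have ha: "a = (-1) \<odot> (h \<otimes> h)" using h a by (simp add: uminus_eq_smul smul_smul)
  have "a \<otimes> h = h \<otimes> a" using h unfolding ha by (simp add: smult_mult_l smult_mult_r mult_assoc)
  then have gh: "g \<otimes> h = h \<otimes> g" by (rule comm[OF h(1)])
  define u where "u = g \<oplus> \<i> \<odot> h"
  have "star A u \<otimes> u = (g \<oplus> (- \<i>) \<odot> h) \<otimes> (g \<oplus> \<i> \<odot> h)"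
    using g h by (simp add: u_def star_add star_smult)
  also have "\<dots> = (a \<oplus> \<i> \<odot> (h \<otimes> g)) \<oplus> ((- \<i>) \<odot> (h \<otimes> g) \<oplus> (\<ominus> a))"
  proof -
    have "(g \<oplus> (- \<i>) \<odot> h) \<otimes> (g \<oplus> \<i> \<odot> h)
        = (g \<otimes> g \<oplus> \<i> \<odot> (g \<otimes> h)) \<oplus> ((- \<i>) \<odot> (h \<otimes> g) \<oplus> ((- \<i>) * \<i>) \<odot> (h \<otimes> h))"
      using g(1) h(1) by (simp add: mult_l_distr mult_r_distr smult_mult_l smult_mult_r smul_smul smul_add_r M.a_ac)
    then show ?thesis using g h by (simp add: gh a)
  qed
  also have "(- \<i>) \<odot> (h \<otimes> g) = \<ominus> (\<i> \<odot> (h \<otimes> g))"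
    using g h by (simp add: uminus_eq_smul smul_smul)
  also have "(a \<oplus> \<i> \<odot> (h \<otimes> g)) \<oplus> (\<ominus> (\<i> \<odot> (h \<otimes> g)) \<oplus> (\<ominus> a)) = \<zero>"
    using g h a by (simp add: M.a_ac add_cancel M.r_neg)
  finally have "star A u \<otimes> u = \<zero>" .
  moreover have "u \<in> carrier A" using g h by (simp add: u_def)
  ultimately have u0: "u = \<zero>" by (rule star_mult_self_eq_zero[rotated])
  then have "g \<oplus> (- \<i>) \<odot> h = \<zero>"
  proof -
    have "star A u = \<zero>" using u0 by simp
    then show ?thesis using g h by (simp add: u_def star_add star_smult)
  qed
  with u0 have "(g \<oplus> \<i> \<odot> h) \<oplus> (g \<oplus> (- \<i>) \<odot> h) = \<zero>" by (simp add: u_def)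
  then have "2 \<odot> g = \<zero>"
  proof -
    have "(g \<oplus> \<i> \<odot> h) \<oplus> (g \<oplus> (- \<i>) \<odot> h) = (g \<oplus> g) \<oplus> (\<i> \<odot> h \<oplus> (- \<i>) \<odot> h)"
      using g h by (simp add: M.a_ac)
    also have "\<i> \<odot> h \<oplus> (- \<i>) \<odot> h = \<zero>" using h smul_add_l[of h \<i> "- \<i>"] by simp
    also have "g \<oplus> g = 2 \<odot> g" using g smul_add_l[of g 1 1] by simp
    finally show ?thesis using g \<open>(g \<oplus> \<i> \<odot> h) \<oplus> (g \<oplus> (- \<i>) \<odot> h) = \<zero>\<close> by simp
  qed
  then have "(1/2) \<odot> (2 \<odot> g) = \<zero>" by simp
  with g have "g = \<zero>" by (simp add: smul_smul)
  with g show ?thesis by simp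
qed

text \<open>Put \<open>r n = nrm A ((T ^^ n) y) / nrm A y\<close>. Symmetry and submultiplicativity
  of the norm give \<open>(r n)^2 \<le> r (2 * n)\<close>, so \<open>r 1 ^ (2 ^ k)\<close> stays
  below \<open>K\<close> for all \<open>k\<close>, which forces \<open>r 1 \<le> 1\<close>.\<close>

lemma contraction_of_bounded_powers:
  assumes T: "\<And>y. y \<in> carrier A \<Longrightarrow> T y \<in> carrier A"
    and sym: "\<And>y w. y \<in> carrier A \<Longrightarrow> w \<in> carrier A \<Longrightarrow> star A (T y) \<otimes> w = star A y \<otimes> T w"
    and K: "\<And>n y. y \<in> carrier A \<Longrightarrow> nrm A ((T ^^ n) y) \<le> K * nrm A y"
    and y: "y \<in> carrier A"
  shows "nrm A (T y) \<le> nrm A y"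
proof (cases "nrm A y = 0")
  case True
  then have "nrm A (T y) \<le> 0" using K[of y 1] y by simp
  with True show ?thesis by simp
next
  case False
  then have pos: "nrm A y > 0" using nrm_nonneg[OF y] by simp
  have cl: "(T ^^ n) w \<in> carrier A" if "w \<in> carrier A" for n w using that T by (induction n) auto
  have symn: "star A ((T ^^ n) w) \<otimes> v = star A w \<otimes> (T ^^ n) v" if "w \<in> carrier A" "v \<in> carrier A" for n v w
    using that
  proof (induction n arbitrary: v)
    case (Suc n)
    then show ?case using T cl by (simp add: sym) (metis funpow_swap1)
  qed simp
  have sq: "(nrm A ((T ^^ n) y) / nrm A y)\<^sup>2 \<le> nrm A ((T ^^ (2 * n)) y) / nrm A y" for n
  proof -
    have "(nrm A ((T ^^ n) y))\<^sup>2 = nrm A (star A y \<otimes> (T ^^ n) ((T ^^ n) y))"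
      using cl[OF y] by (simp add: cstar_identity[symmetric] symn y)
    also have "(T ^^ n) ((T ^^ n) y) = (T ^^ (2 * n)) y" by (simp add: mult_2 funpow_add)
    also have "nrm A (star A y \<otimes> (T ^^ (2 * n)) y) \<le> nrm A y * nrm A ((T ^^ (2 * n)) y)"
      using nrm_mult[of "star A y"] cl[OF y] y by (simp add: nrm_star)
    finally show ?thesis using pos by (simp add: power_divide field_simps power2_eq_square)
  qed
  have "(nrm A (T y) / nrm A y) ^ (2 ^ k) \<le> nrm A ((T ^^ (2 ^ k)) y) / nrm A y" for k
  proof (induction k)
    case (Suc k)
    have "(nrm A (T y) / nrm A y) ^ (2 ^ Suc k) = ((nrm A (T y) / nrm A y) ^ (2 ^ k))\<^sup>2"
      by (simp add: power_mult[symmetric] mult.commute)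
    also have "\<dots> \<le> (nrm A ((T ^^ (2 ^ k)) y) / nrm A y)\<^sup>2"
      using Suc pos nrm_nonneg[OF T[OF y]] by (intro power_mono) auto
    also have "\<dots> \<le> nrm A ((T ^^ (2 ^ Suc k)) y) / nrm A y" using sq[of "2 ^ k"] by simp
    finally show ?case .
  qed simp
  moreover have "nrm A ((T ^^ n) y) / nrm A y \<le> K" for n
    using K[OF y, of n] pos by (simp add: field_simps)
  ultimately have "nrm A (T y) / nrm A y \<le> 1"
    by (intro le_one_of_powers_bounded[of _ K]) (rule order_trans)
  with pos show ?thesis by (simp add: field_simps)
qed

section \<open>Projections and their compressions\<close>

definition projection :: "'a \<Rightarrow> bool" where
  "projection q \<longleftrightarrow> q \<in> carrier A \<and> q \<otimes> q = q \<and> star A q = q"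

text \<open>Both \<open>z = q \<otimes> y\<close> and \<open>z = y \<ominus> q \<otimes> y\<close>
  satisfy \<open>star A z \<otimes> z = star A y \<otimes> z\<close>, whence
  \<open>\<parallel>z\<parallel>^2 \<le> \<parallel>y\<parallel>
  \<parallel>z\<parallel>\<close>.\<close>

lemma projection_contraction:
  assumes q: "projection q" and y: "y \<in> carrier A"
  shows "nrm A (y \<ominus> q \<otimes> y) \<le> nrm A y" "nrm A (q \<otimes> y) \<le> nrm A y"
proof -
  have c: "q \<in> carrier A" "q \<otimes> q = q" "star A q = q" using q by (auto simp: projection_def)
  have le: "nrm A z \<le> nrm A y" if z: "z \<in> carrier A" "star A z \<otimes> z = star A y \<otimes> z" for z
  proof -
    have "nrm A z * nrm A z \<le> nrm A y * nrm A z"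
      using cstar_identity[OF z(1)] nrm_mult[of "star A y" z] z y by (simp add: nrm_star power2_eq_square)
    then show ?thesis using nrm_nonneg[OF z(1)] nrm_nonneg[OF y] by (cases "nrm A z = 0") auto
  qed
  have qq: "q \<otimes> (q \<otimes> w) = q \<otimes> w" if "w \<in> carrier A" for w using c that by (metis mult_assoc)
  show "nrm A (q \<otimes> y) \<le> nrm A y"
    using c y qq by (intro le) (auto simp: star_mult mult_assoc)
  show "nrm A (y \<ominus> q \<otimes> y) \<le> nrm A y"
  proof (rule le)
    have "star A q \<otimes> (y \<ominus> q \<otimes> y) = \<zero>" using c y qq by (simp add: mult_minus_r)
    then show "star A (y \<ominus> q \<otimes> y) \<otimes> (y \<ominus> q \<otimes> y) = star A y \<otimes> (y \<ominus> q \<otimes> y)"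
      using c y by (simp add: star_minus star_mult mult_minus_l mult_assoc)
  qed (use c y in auto)
qed

text \<open>Think of \<open>c = q (1 - R) q\<close> with a contraction \<open>R\<close>. Then
  \<open>T = 1 - c\<close> has the powers \<open>(1 - q) + (q R)^n q\<close>, both parts being
  contractions, so all powers are bounded by 2. As \<open>T\<close> is symmetric, it is itself a
  contraction, and the constant 1 witnesses \<open>pos c\<close>.\<close>

lemma pos_compression:
  assumes q: "projection q"
    and R: "\<And>z. z \<in> carrier A \<Longrightarrow> R z \<in> carrier A" "\<And>z. z \<in> carrier A \<Longrightarrow> nrm A (R z) \<le> nrm A z"
    and sym: "\<And>y w. y \<in> carrier A \<Longrightarrow> w \<in> carrier A \<Longrightarrow> star A (R y) \<otimes> w = star A y \<otimes> R w"
    and c: "c \<in> carrier A" "star A c = c" "\<And>y. y \<in> carrier A \<Longrightarrow> c \<otimes> y = q \<otimes> y \<ominus> q \<otimes> R (q \<otimes> y)"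
  shows "pos c"
proof -
  have qc: "q \<in> carrier A" "q \<otimes> q = q" "star A q = q" using q by (auto simp: projection_def)
  have qq: "q \<otimes> (q \<otimes> w) = q \<otimes> w" if "w \<in> carrier A" for w using qc that by (metis mult_assoc)
  define T where "T = (\<lambda>y. y \<ominus> c \<otimes> y)"
  define z where "z = (\<lambda>y n. ((\<lambda>v. q \<otimes> R v) ^^ n) (q \<otimes> y))"
  have z: "z y n \<in> carrier A" "q \<otimes> z y n = z y n" "nrm A (z y n) \<le> nrm A y" if y: "y \<in> carrier A" for y n
  proof (induction n)
    case 0
    { case 1 then show ?case using qc y by (simp add: z_def) }
    { case 2 then show ?case using qc y qq by (simp add: z_def) }
    { case 3 then show ?case using projection_contraction[OF q y] by (simp add: z_def) }
  next
    case (Suc n)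
    { case 1 then show ?case using Suc qc y R by (simp add: z_def) }
    { case 2 then show ?case using Suc qc y R qq by (simp add: z_def) }
    { case 3 then show ?case using Suc projection_contraction(2)[OF q, of "R (z y n)"] R(1)[of "z y n"] R(2)[of "z y n"]
        by (simp add: z_def) }
  qed
  have Tn: "(T ^^ n) y = (y \<ominus> q \<otimes> y) \<oplus> z y n" if y: "y \<in> carrier A" for n y
  proof (induction n)
    case 0
    then show ?case using y qc by (simp add: z_def a_minus_def M.a_assoc M.l_neg)
  next
    case (Suc n)
    define w where "w = (y \<ominus> q \<otimes> y) \<oplus> z y n"
    have w: "w \<in> carrier A" using y qc z[OF y] by (simp add: w_def)
    have qw: "q \<otimes> w = z y n" using y qc z[OF y] qq by (simp add: w_def mult_r_distr mult_minus_r)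
    have "T w = w \<ominus> (z y n \<ominus> q \<otimes> R (z y n))"
      using w by (simp add: T_def c(3) qw)
    also have "\<dots> = (y \<ominus> q \<otimes> y) \<oplus> q \<otimes> R (z y n)"
      using y qc z[OF y] R by (simp add: w_def a_minus_def M.a_ac M.minus_add M.r_neg1 M.r_neg2)
    finally show ?case using Suc by (simp add: w_def z_def)
  qed
  have "nrm A (T y) \<le> nrm A y" if y: "y \<in> carrier A" for y
  proof (rule contraction_of_bounded_powers[where K = 2, OF _ _ _ y])
    show "T y \<in> carrier A" if "y \<in> carrier A" for y using that c(1) by (simp add: T_def)
    show "star A (T y) \<otimes> w = star A y \<otimes> T w" if "y \<in> carrier A" "w \<in> carrier A" for y w
      using that c(1,2) by (simp add: T_def star_minus star_mult mult_minus_l mult_minus_r mult_assoc)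
    show "nrm A ((T ^^ n) y) \<le> 2 * nrm A y" if "y \<in> carrier A" for n y
      using nrm_triangle[of "y \<ominus> q \<otimes> y" "z y n"] projection_contraction(1)[OF q that] z[OF that] that qc
      by (simp add: Tn) (use z(3)[OF that, of n] in linarith)
  qed
  then show ?thesis unfolding pos_def using c(1,2) by (auto simp: T_def intro!: exI[of _ 1])
qed

text \<open>The contraction to be compressed is the complement of \<open>p\<close> in the first
  claim and \<open>p\<close> itself in the second.\<close>

lemma pos_projection_compression:
  assumes q: "projection q" and p: "projection p"
  shows "pos (q \<otimes> p \<otimes> q)" "pos (q \<ominus> q \<otimes> p \<otimes> q)"
proof -
  have qc: "q \<in> carrier A" "q \<otimes> q = q" "star A q = q" using q by (auto simp: projection_def)
  have pc: "p \<in> carrier A" "p \<otimes> p = p" "star A p = p" using p by (auto simp: projection_def)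
  have qq: "q \<otimes> (q \<otimes> w) = q \<otimes> w" if "w \<in> carrier A" for w using qc that by (metis mult_assoc)
  show "pos (q \<otimes> p \<otimes> q)"
  proof (rule pos_compression[OF q, where R = "\<lambda>z. z \<ominus> p \<otimes> z"])
    show "q \<otimes> p \<otimes> q \<otimes> y = q \<otimes> y \<ominus> q \<otimes> (q \<otimes> y \<ominus> p \<otimes> (q \<otimes> y))" if "y \<in> carrier A" for y
    proof -
      have "q \<otimes> (q \<otimes> y \<ominus> p \<otimes> (q \<otimes> y)) = q \<otimes> y \<ominus> q \<otimes> (p \<otimes> (q \<otimes> y))"
        using that qc(1) pc(1) qq by (simp add: mult_minus_r)
      then show ?thesis
        using that qc(1) pc(1) by (simp add: mult_assoc a_minus_def M.minus_add add_cancel)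
    qed
  qed (use qc pc projection_contraction[OF p] in
      \<open>auto simp: star_mult star_minus mult_assoc mult_minus_l mult_minus_r\<close>)
  show "pos (q \<ominus> q \<otimes> p \<otimes> q)"
  proof (rule pos_compression[OF q, where R = "\<lambda>z. p \<otimes> z"])
    show "(q \<ominus> q \<otimes> p \<otimes> q) \<otimes> y = q \<otimes> y \<ominus> q \<otimes> (p \<otimes> (q \<otimes> y))" if "y \<in> carrier A" for y
      using that qc(1) pc(1) by (simp add: mult_assoc mult_minus_l)
  qed (use qc pc projection_contraction[OF p] in
      \<open>auto simp: star_mult star_minus mult_assoc mult_minus_l mult_minus_r\<close>)
qed

text \<open>Compressing \<open>p\<close> by \<open>q f\<close> leaves \<open>0 = (q f - q f p q f) + (\<Sum>e \<noteq> f. q f q e q f)\<close>, a sum of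
  positive elements.\<close>

lemma projections_orthogonal:
  assumes F: "finite F" and q: "\<And>e. e \<in> F \<Longrightarrow> projection (q e)" and p: "projection (\<Oplus>e\<in>F. q e)"
    and ef: "e \<in> F" "f \<in> F" "e \<noteq> f"
  shows "q e \<otimes> q f = \<zero>"
proof -
  define p where "p = (\<Oplus>e\<in>F. q e)"
  have qc: "q i \<in> carrier A" "q i \<otimes> q i = q i" "star A (q i) = q i" if "i \<in> F" for i
    using q[OF that] by (auto simp: projection_def)
  define c where "c = (\<lambda>i. q f \<otimes> q i \<otimes> q f)"
  have c: "pos (c i)" "c i \<in> carrier A" if "i \<in> F" for i
    using pos_projection_compression(1)[OF q q, OF ef(2) that] qc[OF that] qc[OF ef(2)] by (auto simp: c_def)
  define r where "r = (\<Oplus>i\<in>F - {e} - {f}. c i)"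
  define d where "d = q f \<ominus> q f \<otimes> p \<otimes> q f"
  have pd: "pos d" using pos_projection_compression(2)[OF q assms(3)] ef by (simp add: d_def p_def)
  have pr: "pos r" unfolding r_def using F c by (intro pos_finsum) auto
  have cl: "r \<in> carrier A" "d \<in> carrier A" using pr pd by (auto simp: pos_def)
  have "q f \<otimes> p \<otimes> q f = (\<Oplus>i\<in>F. c i)"
    using F qc ef by (simp add: p_def c_def finsum_mult_l finsum_mult_r)
  also have "F = insert e (insert f (F - {e} - {f}))" using ef by auto
  also have "(\<Oplus>i\<in>insert e (insert f (F - {e} - {f})). c i) = c e \<oplus> (c f \<oplus> r)"
  proof -
    have "(\<Oplus>i\<in>insert f (F - {e} - {f}). c i) = c f \<oplus> r"
      unfolding r_def using F c ef by (intro M.finsum_insert) auto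
    moreover have "(\<Oplus>i\<in>insert e (insert f (F - {e} - {f})). c i) = c e \<oplus> (\<Oplus>i\<in>insert f (F - {e} - {f}). c i)"
      using F c ef by (intro M.finsum_insert) auto
    ultimately show ?thesis by simp
  qed
  also have "c f = q f" using qc[OF ef(2)] by (simp add: c_def)
  finally have "d = q f \<ominus> (c e \<oplus> (q f \<oplus> r))" by (simp add: d_def)
  then have "\<ominus> c e = d \<oplus> r"
    using c(2)[OF ef(1)] qc(1)[OF ef(2)] cl(1) 
    by (simp add: a_minus_def M.minus_add M.a_ac add_cancel)
  \<comment> \<open>Both \<open>c e\<close> and its negative are positive. Moreover \<open>c e =
    star A (q e \<otimes> q f) \<otimes> (q e \<otimes> q f)\<close>, so that the C*-identity then
    finishes the proof.\<close>
  then have "c e = \<zero>"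
    using c(1)[OF ef(1)] pos_add[OF pd pr] by (intro pos_antisym) auto
  then have "star A (q e \<otimes> q f) \<otimes> (q e \<otimes> q f) = \<zero>"
  proof -
    have "q e \<otimes> (q e \<otimes> q f) = q e \<otimes> q f"
      using qc[OF ef(1)] qc[OF ef(2)] mult_assoc[of "q e" "q e" "q f"] by simp
    then have "star A (q e \<otimes> q f) \<otimes> (q e \<otimes> q f) = c e"
      using qc[OF ef(1)] qc[OF ef(2)] unfolding c_def by (simp add: star_mult mult_assoc)
    then show ?thesis using \<open>c e = \<zero>\<close> by simp
  qed
  moreover have "q e \<otimes> q f \<in> carrier A" using qc(1)[OF ef(1)] qc(1)[OF ef(2)] by simp
  ultimately show ?thesis by (rule star_mult_self_eq_zero[rotated])
qed

end

section \<open>Isometric extension\<close>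

context complex_star_algebra
begin

lemma finsum_add:
  assumes "\<And>i. i \<in> F \<Longrightarrow> f i \<in> carrier A" "\<And>i. i \<in> F \<Longrightarrow> g i \<in> carrier A"
  shows "(\<Oplus>i\<in>F. f i \<oplus> g i) = (\<Oplus>i\<in>F. f i) \<oplus> (\<Oplus>i\<in>F. g i)"
  using assms by (intro M.finsum_addf) auto

lemma finsum_single:
  assumes "finite F" "k \<in> F" "f k \<in> carrier A" "\<And>i. i \<in> F \<Longrightarrow> i \<noteq> k \<Longrightarrow> f i = \<zero>"
  shows "(\<Oplus>i\<in>F. f i) = f k"
proof -
  have "(\<Oplus>i\<in>F. f i) = (\<Oplus>i\<in>F. if k = i then f i else \<zero>)"
    using assms by (intro M.finsum_cong') auto
  also have "\<dots> = f k"
    using assms by (intro M.finsum_singleton) (auto, metis M.zero_closed)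
  finally show ?thesis .
qed

text \<open>Linear extension of a correspondence of generators, kept as a relation: that it is
  single-valued follows only later, from the equality of norms.\<close>

inductive_set pair_span :: "('a \<times> cop) set \<Rightarrow> ('a \<times> cop) set" for G where
  zero: "(\<zero>, 0) \<in> pair_span G"
| step: "(x, T) \<in> pair_span G \<Longrightarrow> (y, S) \<in> G \<Longrightarrow> (c \<odot> y \<oplus> x, cscale c S + T) \<in> pair_span G"

context
  fixes G :: "('a \<times> cop) set" assumes G: "fst ` G \<subseteq> carrier A"
begin

lemma pair_span_closed: "(x, T) \<in> pair_span G \<Longrightarrow> x \<in> carrier A"
  by (induction rule: pair_span.induct) (use G in force)+

lemma pair_span_base: "(y, S) \<in> G \<Longrightarrow> (y, S) \<in> pair_span G"
  using pair_span.step[OF pair_span.zero, of y S G 1] G by force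

lemma pair_span_add:
  "(x, T) \<in> pair_span G \<Longrightarrow> (x', T') \<in> pair_span G \<Longrightarrow> (x \<oplus> x', T + T') \<in> pair_span G"
proof (induction rule: pair_span.induct)
  case zero then show ?case using pair_span_closed by simp
next
  case (step x T y S c)
  have "y \<in> carrier A" using step(2) G by force
  then show ?case
    using pair_span.step[OF step.IH[OF step.prems] step(2), of c] pair_span_closed[OF step(1)] pair_span_closed[OF step.prems]
    by (simp add: M.a_assoc add.assoc)
qed

lemma pair_span_smul: "(x, T) \<in> pair_span G \<Longrightarrow> (k \<odot> x, cscale k T) \<in> pair_span G"
proof (induction rule: pair_span.induct)
  case zero then show ?case using pair_span.zero by simp
next
  case (step x T y S c)
  have "y \<in> carrier A" using step(2) G by force
  then show ?case
    using pair_span.step[OF step.IH step(2), of "k * c"] pair_span_closed[OF step(1)]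
    by (simp add: smul_add_r smul_smul cscale_add_right cscale_cscale)
qed

lemma pair_span_finsum:
  assumes "finite F" "\<And>i. i \<in> F \<Longrightarrow> (f i, g i) \<in> pair_span G"
  shows "((\<Oplus>i\<in>F. f i), (\<Sum>i\<in>F. g i)) \<in> pair_span G"
  using assms
proof (induction F rule: finite_induct)
  case empty show ?case using pair_span.zero by simp
next
  case (insert i F)
  then have "(\<Oplus>i\<in>insert i F. f i) = f i \<oplus> (\<Oplus>i\<in>F. f i)"
    using pair_span_closed by (intro M.finsum_insert) auto
  with insert show ?case using pair_span_add[of "f i" "g i"] by simp
qed

lemma pair_span_star:
  assumes "\<And>y S. (y, S) \<in> G \<Longrightarrow> (star A y, adj S) \<in> G"
  shows "(x, T) \<in> pair_span G \<Longrightarrow> (star A x, adj T) \<in> pair_span G"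
proof (induction rule: pair_span.induct)
  case zero then show ?case using pair_span.zero by (simp add: adj_zero)
next
  case (step x T y S c)
  have "y \<in> carrier A" using step(2) G by force
  then show ?case
    using pair_span.step[OF step.IH assms[OF step(2)], of "cnj c"] pair_span_closed[OF step(1)]
    by (simp add: star_add star_smult adj_add adj_cscale)
qed

lemma pair_span_mult:
  assumes "\<And>y S y' S'. (y, S) \<in> G \<Longrightarrow> (y', S') \<in> G \<Longrightarrow> (y \<otimes> y', S * S') \<in> pair_span G"
    and "(x, T) \<in> pair_span G" "(x', T') \<in> pair_span G"
  shows "(x \<otimes> x', T * T') \<in> pair_span G"
  using assms(2)
proof (induction rule: pair_span.induct)
  case zero
  then show ?case using pair_span.zero pair_span_closed[OF assms(3)] by simp
next
  case (step x T y S c)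
  have y: "y \<in> carrier A" using step(2) G by force
  have "(y \<otimes> x', S * T') \<in> pair_span G"
    using assms(3)
  proof (induction rule: pair_span.induct)
    case zero
    then show ?case using pair_span.zero y by simp
  next
    case (step x' T' y' S' c')
    have y': "y' \<in> carrier A" using step(2) G by force
    show ?case
      using pair_span_add[OF pair_span_smul[OF assms(1)[OF \<open>(y, S) \<in> G\<close> step(2)], of c'] step.IH]
        y y' pair_span_closed[OF step(1)]
      by (simp add: mult_r_distr smult_mult_r distrib_left cscale_mult_right)
  qed
  from pair_span_add[OF pair_span_smul[OF this, of c] step.IH]
  show ?case using y pair_span_closed[OF step(1)] pair_span_closed[OF assms(3)]
    by (simp add: mult_l_distr smult_mult_l distrib_right cscale_mult_left)
qed

lemma snd_pair_span: "snd ` pair_span G = cop.span (snd ` G)"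
proof
  have "T \<in> cop.span (snd ` G)" if "(x, T) \<in> pair_span G" for x T
    using that
  proof (induction rule: pair_span.induct)
    case (step x T y S c)
    then have "S \<in> snd ` G" by force
    with step show ?case by (simp add: cop.span_add cop.span_scale cop.span_base)
  qed (rule cop.span_zero)
  then show "snd ` pair_span G \<subseteq> cop.span (snd ` G)" by auto
next
  have "\<exists>x. (x, T) \<in> pair_span G" if "T \<in> cop.span (snd ` G)" for T
    using that
  proof (induction rule: cop.span_induct_alt)
    case base
    then show ?case using pair_span.zero by blast
  next
    case (step c S T)
    then obtain x y where "(x, T) \<in> pair_span G" "(y, S) \<in> G" by auto
    from pair_span.step[OF this] show ?case by blast
  qed
  then show "cop.span (snd ` G) \<subseteq> snd ` pair_span G" by force
qed

end

end

lemma (in complex_star_algebra) pair_span_subset: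
  assumes G: "fst ` G \<subseteq> carrier A" and H: "fst ` H \<subseteq> carrier A" and GH: "G \<subseteq> pair_span H"
  shows "pair_span G \<subseteq> pair_span H"
proof -
  have "(x, T) \<in> pair_span H" if "(x, T) \<in> pair_span G" for x T
    using that
  proof (induction rule: pair_span.induct)
    case zero show ?case by (rule pair_span.zero)
  next
    case (step x T y S c)
    then have "(y, S) \<in> pair_span H" using GH by blast
    then show ?case using pair_span_add[OF H pair_span_smul[OF H]] step.IH by blast
  qed
  then show ?thesis by auto
qed

text \<open>A relation between \<open>A\<close> and the operators that is a \<open>*\<close>-algebra, preserves norms and has dense
  domain is the graph of an isometric \<open>*\<close>-homomorphism on its domain, which extends to \<open>A\<close>.\<close>

locale isometric_relation = cstar_algebra A for A :: "('a, 'm) cstar_scheme" (structure) +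
  fixes G :: "('a \<times> cop) set"
  assumes rel_closed: "(x, T) \<in> G \<Longrightarrow> x \<in> carrier A"
    and rel_zero: "(\<zero>, 0) \<in> G"
    and rel_add: "(x, T) \<in> G \<Longrightarrow> (y, S) \<in> G \<Longrightarrow> (x \<oplus> y, T + S) \<in> G"
    and rel_smul: "(x, T) \<in> G \<Longrightarrow> (c \<odot> x, cscale c T) \<in> G"
    and rel_mult: "(x, T) \<in> G \<Longrightarrow> (y, S) \<in> G \<Longrightarrow> (x \<otimes> y, T * S) \<in> G"
    and rel_star: "(x, T) \<in> G \<Longrightarrow> (star A x, adj T) \<in> G"
    and rel_norm: "(x, T) \<in> G \<Longrightarrow> nrm A x = norm T"
    and rel_dense: "norm_closure A (fst ` G) = carrier A"
begin

text \<open>The closure of \<open>G\<close> in the product of \<open>A\<close> and the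
  operators.\<close>

definition ext_rel :: "'a \<Rightarrow> cop \<Rightarrow> bool" where
  "ext_rel a T \<longleftrightarrow> (\<exists>x X. (\<forall>n. (x n, X n) \<in> G) \<and> conv x a \<and> X \<longlonglongrightarrow> T)"

lemma ext_relD: "ext_rel a T \<Longrightarrow> a \<in> carrier A"
  unfolding ext_rel_def using convD(2) by blast

lemma ext_rel_base: "(x, T) \<in> G \<Longrightarrow> ext_rel x T"
  unfolding ext_rel_def
  by (rule exI[of _ "\<lambda>_. x"], rule exI[of _ "\<lambda>_. T"]) (simp add: conv_const rel_closed)

lemma ext_rel_norm: assumes "ext_rel a T" shows "nrm A a = norm T"
proof -
  obtain x X where xX: "\<And>n. (x n, X n) \<in> G" "conv x a" "X \<longlonglongrightarrow> T"
    using assms unfolding ext_rel_def by blast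
  have "nrm A (x n) = norm (X n)" for n using xX(1) by (rule rel_norm)
  then have "(\<lambda>n. norm (X n)) \<longlonglongrightarrow> nrm A a" "(\<lambda>n. norm (X n)) \<longlonglongrightarrow> norm T"
    using conv_nrm[OF xX(2)] tendsto_norm[OF xX(3)] by simp_all
  then show ?thesis by (rule LIMSEQ_unique)
qed

lemma ext_rel_add: assumes "ext_rel a T" "ext_rel b S" shows "ext_rel (a \<oplus> b) (T + S)"
proof -
  obtain x X where "\<And>n. (x n, X n) \<in> G" "conv x a" "X \<longlonglongrightarrow> T"
    using assms unfolding ext_rel_def by blast
  moreover obtain y Y where "\<And>n. (y n, Y n) \<in> G" "conv y b" "Y \<longlonglongrightarrow> S"
    using assms unfolding ext_rel_def by blast
  ultimately show ?thesis
    unfolding ext_rel_def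
    by (intro exI[of _ "\<lambda>n. x n \<oplus> y n"] exI[of _ "\<lambda>n. X n + Y n"]) (simp add: rel_add conv_add tendsto_add)
qed

lemma ext_rel_mult: assumes "ext_rel a T" "ext_rel b S" shows "ext_rel (a \<otimes> b) (T * S)"
proof -
  obtain x X where "\<And>n. (x n, X n) \<in> G" "conv x a" "X \<longlonglongrightarrow> T"
    using assms unfolding ext_rel_def by blast
  moreover obtain y Y where "\<And>n. (y n, Y n) \<in> G" "conv y b" "Y \<longlonglongrightarrow> S"
    using assms unfolding ext_rel_def by blast
  ultimately show ?thesis
    unfolding ext_rel_def
    by (intro exI[of _ "\<lambda>n. x n \<otimes> y n"] exI[of _ "\<lambda>n. X n * Y n"]) (simp add: rel_mult conv_mult tendsto_mult)
qed

lemma ext_rel_smul: assumes "ext_rel a T" shows "ext_rel (c \<odot> a) (cscale c T)"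
proof -
  obtain x X where "\<And>n. (x n, X n) \<in> G" "conv x a" "X \<longlonglongrightarrow> T"
    using assms unfolding ext_rel_def by blast
  then show ?thesis
    unfolding ext_rel_def
    by (intro exI[of _ "\<lambda>n. c \<odot> x n"] exI[of _ "\<lambda>n. cscale c (X n)"])
      (simp add: rel_smul conv_smul tendsto_cscale)
qed

lemma ext_rel_star: assumes "ext_rel a T" shows "ext_rel (star A a) (adj T)"
proof -
  obtain x X where "\<And>n. (x n, X n) \<in> G" "conv x a" "X \<longlonglongrightarrow> T"
    using assms unfolding ext_rel_def by blast
  then show ?thesis
    unfolding ext_rel_def
    by (intro exI[of _ "\<lambda>n. star A (x n)"] exI[of _ "\<lambda>n. adj (X n)"])
      (simp add: rel_star conv_star tendsto_adj)
qed

lemma ext_rel_minus: "ext_rel a T \<Longrightarrow> ext_rel b S \<Longrightarrow> ext_rel (a \<ominus> b) (T - S)"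
  using ext_rel_add[OF _ ext_rel_smul[of b S "-1"], of a T] ext_relD by (simp add: minus_eq_smul)

text \<open>Norm preservation, applied to the pair \<open>(a \<ominus> a, T - S)\<close>.\<close>

lemma ext_rel_unique: "ext_rel a T \<Longrightarrow> ext_rel a S \<Longrightarrow> T = S"
  using ext_rel_norm[OF ext_rel_minus, of a T a S] ext_relD by simp

lemma rel_minus: "(x, T) \<in> G \<Longrightarrow> (y, S) \<in> G \<Longrightarrow> (x \<ominus> y, T - S) \<in> G"
  using rel_add[OF _ rel_smul[of y S "-1"], of x T] rel_closed by (simp add: minus_eq_smul)

text \<open>Approximants of \<open>a\<close> from the domain form a Cauchy sequence; their isometric
  images converge because the operators are complete.\<close>

lemma ext_rel_total: assumes a: "a \<in> carrier A" shows "\<exists>T. ext_rel a T"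
proof -
  have "\<forall>n. \<exists>x X. (x, X) \<in> G \<and> nrm A (a \<ominus> x) < inverse (real (Suc n))"
  proof
    fix n
    have "a \<in> norm_closure A (fst ` G)" using a rel_dense by simp
    moreover have "inverse (real (Suc n)) > 0" by simp
    ultimately have "\<exists>x\<in>fst ` G. nrm A (a \<ominus> x) < inverse (real (Suc n))"
      unfolding norm_closure_def by blast
    then show "\<exists>x X. (x, X) \<in> G \<and> nrm A (a \<ominus> x) < inverse (real (Suc n))" by auto
  qed
  then obtain x X where xX: "\<And>n. (x n, X n) \<in> G" and lt: "\<And>n. nrm A (a \<ominus> x n) < inverse (real (Suc n))"
    by metis
  have x: "conv x a"
  proof (rule convI)
    show "nrm A (x n \<ominus> a) \<le> inverse (real (Suc n))" for n
      using lt[of n] nrm_minus_commute[OF a rel_closed[OF xX]] by simp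
  qed (use a xX rel_closed LIMSEQ_inverse_real_of_nat in auto)
  have "Cauchy X"
    unfolding Cauchy_iff
  proof (intro allI impI)
    fix e :: real assume "e > 0"
    then obtain M where M: "\<And>n. n \<ge> M \<Longrightarrow> nrm A (x n \<ominus> a) < e/2"
      using order_tendstoD(2)[OF convD(3)[OF x], of "e/2"] unfolding eventually_sequentially by auto
    have "norm (X m - X n) < e" if "m \<ge> M" "n \<ge> M" for m n
    proof -
      have c: "x m \<in> carrier A" "x n \<in> carrier A" using xX rel_closed by blast+
      have "norm (X m - X n) = nrm A (x m \<ominus> x n)" using rel_norm[OF rel_minus[OF xX xX]] by simp
      also have "\<dots> \<le> nrm A (x m \<ominus> a) + nrm A (a \<ominus> x n)" using c a by (intro nrm_triangle_via)
      also have "\<dots> < e" using M[OF that(1)] M[OF that(2)] nrm_minus_commute[OF a c(2)] by simp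
      finally show ?thesis .
    qed
    then show "\<exists>M. \<forall>m\<ge>M. \<forall>n\<ge>M. norm (X m - X n) < e" by blast
  qed
  then obtain T where "X \<longlonglongrightarrow> T" using Cauchy_convergent_iff convergent_def by blast
  with x xX show ?thesis unfolding ext_rel_def by blast
qed

text \<open>The same argument in the other direction, with completeness of \<open>A\<close>.\<close>

lemma ext_rel_onto: assumes T: "T \<in> closure (snd ` G)" shows "\<exists>a. ext_rel a T"
proof -
  obtain X where X: "\<And>n. X n \<in> snd ` G" "X \<longlonglongrightarrow> T"
    using T closure_sequential by blast
  then have "\<forall>n. \<exists>x. (x, X n) \<in> G" by force
  then obtain x where x: "\<And>n. (x n, X n) \<in> G" by metis
  have "\<exists>l\<in>carrier A. (\<lambda>n. nrm A (x n \<ominus> l)) \<longlonglongrightarrow> 0"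
  proof -
    have "\<exists>M. \<forall>m\<ge>M. \<forall>n\<ge>M. nrm A (x m \<ominus> x n) < \<epsilon>" if "\<epsilon> > 0" for \<epsilon>
      using LIMSEQ_imp_Cauchy[OF X(2)] that rel_norm[OF rel_minus[OF x x]] unfolding Cauchy_iff by simp
    then show ?thesis
      using nrm_complete x rel_closed unfolding complete_wrt_def by blast
  qed
  then obtain a where "conv x a" using x rel_closed unfolding conv_def by blast
  with x X(2) show ?thesis unfolding ext_rel_def by blast
qed

lemma ext_rel_closure: "ext_rel a T \<Longrightarrow> T \<in> closure (snd ` G)"
  unfolding ext_rel_def closure_sequential by force

definition iso :: "'a \<Rightarrow> cop" where "iso a = (THE T. ext_rel a T)"

lemma iso_eqI: "ext_rel a T \<Longrightarrow> iso a = T"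
  unfolding iso_def using ext_rel_unique by blast

lemma ext_rel_iso: "a \<in> carrier A \<Longrightarrow> ext_rel a (iso a)"
  using ext_rel_total iso_eqI by blast

end

text \<open>Injectivity and the preservation of zero are consequences of the norm clause.\<close>

definition isometric_embedding :: "('a, 'm) cstar_scheme \<Rightarrow> ('a \<Rightarrow> cop) \<Rightarrow> bool" where
  "isometric_embedding A \<psi> \<longleftrightarrow>
    (\<forall>x\<in>carrier A. \<forall>y\<in>carrier A. \<psi> (x \<oplus>\<^bsub>A\<^esub> y) = \<psi> x + \<psi> y \<and> \<psi> (x \<otimes>\<^bsub>A\<^esub> y) = \<psi> x * \<psi> y) \<and>
    (\<forall>c. \<forall>x\<in>carrier A. \<psi> (c \<odot>\<^bsub>A\<^esub> x) = cscale c (\<psi> x)) \<and>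
    (\<forall>x\<in>carrier A. \<psi> (star A x) = adj (\<psi> x) \<and> norm (\<psi> x) = nrm A x)"

lemma (in isometric_relation) isometric_extension:
  "\<exists>\<psi>. isometric_embedding A \<psi> \<and> \<psi> ` carrier A = closure (snd ` G) \<and> (\<forall>(x, T)\<in>G. \<psi> x = T)"
proof (intro exI conjI)
  show "isometric_embedding A iso"
    unfolding isometric_embedding_def
    by (auto intro!: iso_eqI ext_rel_add ext_rel_mult ext_rel_smul ext_rel_star ext_rel_iso
        simp: ext_rel_norm[OF ext_rel_iso])
  show "iso ` carrier A = closure (snd ` G)"
    using ext_rel_closure[OF ext_rel_iso] ext_rel_onto iso_eqI ext_relD by (auto simp: image_iff) metis
  show "\<forall>(x, T)\<in>G. iso x = T"
    using iso_eqI ext_rel_base by auto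
qed

lemma op_simps:
  "carrier (op_algebra id) = UNIV" "S \<otimes>\<^bsub>op_algebra id\<^esub> T = S * T" "\<zero>\<^bsub>op_algebra id\<^esub> = 0"
  "S \<oplus>\<^bsub>op_algebra id\<^esub> T = S + T" "c \<odot>\<^bsub>op_algebra id\<^esub> T = cscale c T" "star (op_algebra id) T = adj T"
  "nrm (op_algebra id) T = norm T" "finite F \<Longrightarrow> (\<Oplus>\<^bsub>op_algebra id\<^esub>i\<in>F. f i) = sum f F"
  using op_algebra_simps[of "id :: cop \<Rightarrow> cop"] op_algebra_finsum[of "id :: cop \<Rightarrow> cop" F f]
  by simp_all

section \<open>Norm closures of star subalgebras\<close>

context cstar_algebra
begin

lemma norm_closure_conv:
  assumes S: "S \<subseteq> carrier A"
  shows "x \<in> norm_closure A S \<longleftrightarrow> (\<exists>y. (\<forall>n. y n \<in> S) \<and> conv y x)"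
proof
  assume x: "x \<in> norm_closure A S"
  then have xc: "x \<in> carrier A" by (simp add: norm_closure_def)
  have "\<forall>n. \<exists>y\<in>S. nrm A (x \<ominus> y) < inverse (real (Suc n))"
    using x by (simp add: norm_closure_def)
  then obtain y where y: "\<And>n. y n \<in> S" "\<And>n. nrm A (x \<ominus> y n) < inverse (real (Suc n))" by metis
  have yc: "y n \<in> carrier A" for n using y(1) S by blast
  have "conv y x"
  proof (rule convI[OF yc xc])
    show "nrm A (y n \<ominus> x) \<le> inverse (real (Suc n))" for n
      using y(2)[of n] nrm_minus_commute[OF xc yc, of n] by simp
  qed (rule LIMSEQ_inverse_real_of_nat)
  with y(1) show "\<exists>y. (\<forall>n. y n \<in> S) \<and> conv y x" by blast
next
  assume "\<exists>y. (\<forall>n. y n \<in> S) \<and> conv y x"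
  then obtain y where y: "\<And>n. y n \<in> S" "conv y x" by blast
  have "\<exists>z\<in>S. nrm A (x \<ominus> z) < e" if e: "e > 0" for e
  proof -
    obtain n where "nrm A (y n \<ominus> x) < e"
      using order_tendstoD(2)[OF convD(3)[OF y(2)] e] unfolding eventually_sequentially by blast
    then show ?thesis
      using y(1) nrm_minus_commute[OF convD(1)[OF y(2)] convD(2)[OF y(2)]] by metis
  qed
  then show "x \<in> norm_closure A S" using convD(2)[OF y(2)] by (simp add: norm_closure_def)
qed

lemma norm_closureI: "S \<subseteq> carrier A \<Longrightarrow> conv y x \<Longrightarrow> (\<And>n. y n \<in> S) \<Longrightarrow> x \<in> norm_closure A S"
  using norm_closure_conv by blast

lemma norm_closure_superset: "S \<subseteq> carrier A \<Longrightarrow> S \<subseteq> norm_closure A S"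
  by (auto intro!: norm_closureI conv_const)

lemma norm_closure_idem: "S \<subseteq> carrier A \<Longrightarrow> norm_closure A (norm_closure A S) \<subseteq> norm_closure A S"
proof
  fix x assume S: "S \<subseteq> carrier A" and x: "x \<in> norm_closure A (norm_closure A S)"
  have xc: "x \<in> carrier A" using x by (simp add: norm_closure_def)
  have "\<exists>z\<in>S. nrm A (x \<ominus> z) < e" if e: "e > 0" for e
  proof -
    have "e/2 > 0" using e by simp
    then obtain y where y: "y \<in> norm_closure A S" "nrm A (x \<ominus> y) < e/2"
      using x unfolding norm_closure_def[of A "norm_closure A S"] by blast
    obtain z where z: "z \<in> S" "nrm A (y \<ominus> z) < e/2"
      using y(1) \<open>e/2 > 0\<close> unfolding norm_closure_def by blast
    have "y \<in> carrier A" "z \<in> carrier A" using y(1) z(1) S by (auto simp: norm_closure_def)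
    then have "nrm A (x \<ominus> z) < e" using nrm_triangle_via[OF xc, of y z] y z by simp
    with z(1) show ?thesis by blast
  qed
  with xc show "x \<in> norm_closure A S" by (simp add: norm_closure_def)
qed

lemma norm_closure_subalgebra:
  assumes S: "S \<subseteq> carrier A" "\<zero> \<in> S" "\<And>x y. x \<in> S \<Longrightarrow> y \<in> S \<Longrightarrow> x \<oplus> y \<in> S" "\<And>c x. x \<in> S \<Longrightarrow> c \<odot> x \<in> S"
    "\<And>x y. x \<in> S \<Longrightarrow> y \<in> S \<Longrightarrow> x \<otimes> y \<in> S" "\<And>x. x \<in> S \<Longrightarrow> star A x \<in> S"
  shows "cstar_subalgebra (norm_closure A S) A"
  unfolding cstar_subalgebra_def
proof (intro conjI ballI allI)
  note cl = norm_closure_conv[OF S(1)]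
  show "norm_closure A S \<subseteq> carrier A" by (auto simp: norm_closure_def)
  show "\<zero> \<in> norm_closure A S" using norm_closure_superset[OF S(1)] S(2) by blast
  show "norm_closure A (norm_closure A S) \<subseteq> norm_closure A S" by (rule norm_closure_idem[OF S(1)])
  fix x assume "x \<in> norm_closure A S"
  then obtain u where u: "\<And>n. u n \<in> S" "conv u x" unfolding cl by blast
  show "c \<odot> x \<in> norm_closure A S" for c
    by (rule norm_closureI[OF S(1) conv_smul[OF tendsto_const u(2)] S(4)[OF u(1)]])
  show "star A x \<in> norm_closure A S"
    by (rule norm_closureI[OF S(1) conv_star[OF u(2)] S(6)[OF u(1)]])
  fix y assume "y \<in> norm_closure A S"
  then obtain v where v: "\<And>n. v n \<in> S" "conv v y" unfolding cl by blast
  show "x \<oplus> y \<in> norm_closure A S"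
    by (rule norm_closureI[OF S(1) conv_add[OF u(2) v(2)] S(3)[OF u(1) v(1)]])
  show "x \<otimes> y \<in> norm_closure A S"
    by (rule norm_closureI[OF S(1) conv_mult[OF u(2) v(2)] S(5)[OF u(1) v(1)]])
qed

end

section \<open>Systems of matrix units\<close>

text \<open>\<open>P n\<close> indexes the matrix units at level \<open>n\<close>, \<open>v = end \<mu>\<close> being the block that \<open>\<mu>\<close> belongs to;
  passing to the next level replaces \<open>\<mu>\<close> by its extensions by the edges that start in \<open>end \<mu>\<close>.\<close>

locale unit_system = cstar_algebra A for A :: "('a, 'm) cstar_scheme" (structure) +
  fixes P :: "nat \<Rightarrow> 'p set" and endp :: "'p \<Rightarrow> 'v" and out :: "'v \<Rightarrow> 'e set" and ext :: "'p \<Rightarrow> 'e \<Rightarrow> 'p"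
    and \<theta> :: "'p \<Rightarrow> 'p \<Rightarrow> 'a"
  assumes finite_P: "finite (P n)"
    and finite_out: "\<mu> \<in> P n \<Longrightarrow> finite (out (endp \<mu>))"
    and ext_P: "\<mu> \<in> P n \<Longrightarrow> e \<in> out (endp \<mu>) \<Longrightarrow> ext \<mu> e \<in> P (Suc n)"
    and ext_end: "\<mu> \<in> P n \<Longrightarrow> \<nu> \<in> P n \<Longrightarrow> endp \<mu> = endp \<nu> \<Longrightarrow> e \<in> out (endp \<mu>) \<Longrightarrow> endp (ext \<mu> e) = endp (ext \<nu> e)"
    and unit_closed: "\<mu> \<in> P n \<Longrightarrow> \<nu> \<in> P n \<Longrightarrow> endp \<mu> = endp \<nu> \<Longrightarrow> \<theta> \<mu> \<nu> \<in> carrier A"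
    and unit_star: "\<mu> \<in> P n \<Longrightarrow> \<nu> \<in> P n \<Longrightarrow> endp \<mu> = endp \<nu> \<Longrightarrow> star A (\<theta> \<mu> \<nu>) = \<theta> \<nu> \<mu>"
    and unit_mult: "\<mu> \<in> P n \<Longrightarrow> \<nu> \<in> P n \<Longrightarrow> \<rho> \<in> P n \<Longrightarrow> \<sigma> \<in> P n \<Longrightarrow> endp \<mu> = endp \<nu> \<Longrightarrow> endp \<rho> = endp \<sigma> \<Longrightarrow>
      \<theta> \<mu> \<nu> \<otimes> \<theta> \<rho> \<sigma> = (if \<nu> = \<rho> then \<theta> \<mu> \<sigma> else \<zero>)"
    and unit_refine: "\<mu> \<in> P n \<Longrightarrow> \<nu> \<in> P n \<Longrightarrow> endp \<mu> = endp \<nu> \<Longrightarrow>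
      \<theta> \<mu> \<nu> = (\<Oplus>e\<in>out (endp \<mu>). \<theta> (ext \<mu> e) (ext \<nu> e))"
    and unit_nonzero: "\<mu> \<in> P n \<Longrightarrow> \<theta> \<mu> \<mu> \<noteq> \<zero>"
begin

text \<open>\<open>\<theta> \<nu> \<nu>\<close> is a nonzero projection, hence of norm 1, and it
  equals \<open>star A (\<theta> \<mu> \<nu>) \<otimes> \<theta> \<mu> \<nu>\<close>.\<close>

lemma nrm_unit: 
  assumes "\<mu> \<in> P n" "\<nu> \<in> P n" "endp \<mu> = endp \<nu>" shows "nrm A (\<theta> \<mu> \<nu>) = 1"
proof -
  have diag: "nrm A (\<theta> \<nu> \<nu>) = 1" if "\<nu> \<in> P n" for \<nu>
  proof -
    have c: "\<theta> \<nu> \<nu> \<in> carrier A" using unit_closed that by blast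
    have "nrm A (\<theta> \<nu> \<nu>) = (nrm A (\<theta> \<nu> \<nu>))\<^sup>2"
      using cstar_identity[OF c] unit_star[OF that that] unit_mult[OF that that that that] by simp
    moreover have "nrm A (\<theta> \<nu> \<nu>) \<noteq> 0" using unit_nonzero[OF that] nrm_eq_0_iff[OF c] by simp
    ultimately show ?thesis by (simp add: power2_eq_square)
  qed
  have "(nrm A (\<theta> \<mu> \<nu>))\<^sup>2 = 1"
    using cstar_identity[OF unit_closed[OF assms]] unit_star[OF assms] unit_mult[of \<nu> n \<mu> \<mu> \<nu>] assms diag[OF assms(2)]
    by simp
  then show ?thesis
    using nrm_nonneg[OF unit_closed[OF assms]] by (simp add: power2_eq_1_iff)
qed

definition unit_index :: "nat \<Rightarrow> ('p \<times> 'p) set" where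
  "unit_index n = {(\<mu>, \<nu>). \<mu> \<in> P n \<and> \<nu> \<in> P n \<and> endp \<mu> = endp \<nu>}"

lemma finite_unit_index: "finite (unit_index n)"
  by (rule finite_subset[of _ "P n \<times> P n"]) (auto simp: unit_index_def finite_P)

definition comb :: "nat \<Rightarrow> ('p \<times> 'p \<Rightarrow> complex) \<Rightarrow> 'a" where
  "comb n c = (\<Oplus>i\<in>unit_index n. c i \<odot> \<theta> (fst i) (snd i))"

lemma unit_index_closed: "i \<in> unit_index n \<Longrightarrow> \<theta> (fst i) (snd i) \<in> carrier A"
  using unit_closed by (auto simp: unit_index_def)

lemma comb_closed: "comb n c \<in> carrier A"
  unfolding comb_def using unit_index_closed by (intro M.finsum_closed) auto

lemma nrm_comb_le: "nrm A (comb n c) \<le> (\<Sum>i\<in>unit_index n. cmod (c i))"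
proof -
  have "nrm A (\<Oplus>i\<in>F. c i \<odot> \<theta> (fst i) (snd i)) \<le> (\<Sum>i\<in>F. cmod (c i))"
    if "F \<subseteq> unit_index n" for F
    using finite_subset[OF that finite_unit_index] that
  proof (induction F rule: finite_induct)
    case (insert i F)
    have c: "\<theta> (fst k) (snd k) \<in> carrier A" if "k \<in> insert i F" for k
      using unit_index_closed insert.prems that by blast
    have "nrm A (\<Oplus>i\<in>insert i F. c i \<odot> \<theta> (fst i) (snd i))
        = nrm A (c i \<odot> \<theta> (fst i) (snd i) \<oplus> (\<Oplus>i\<in>F. c i \<odot> \<theta> (fst i) (snd i)))"
      using insert c by (subst M.finsum_insert) auto
    also have "\<dots> \<le> nrm A (c i \<odot> \<theta> (fst i) (snd i)) + nrm A (\<Oplus>i\<in>F. c i \<odot> \<theta> (fst i) (snd i))"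
      using c by (intro nrm_triangle M.finsum_closed) auto
    also have "nrm A (c i \<odot> \<theta> (fst i) (snd i)) = cmod (c i)"
      using c insert.prems nrm_unit by (auto simp: nrm_smult unit_index_def)
    finally show ?case using insert by simp
  qed simp
  then show ?thesis unfolding comb_def by blast
qed

text \<open>Multiplication by \<open>\<theta> \<mu> \<mu>\<close> on the left and by
  \<open>\<theta> \<nu> \<nu>\<close> on the right, both of norm 1, isolates the coefficient at
  \<open>(\<mu>, \<nu>)\<close>.\<close>

lemma coeff_le_nrm_comb:
  assumes "k \<in> unit_index n" shows "cmod (c k) \<le> nrm A (comb n c)"
proof -
  obtain \<mu> \<nu> where k: "k = (\<mu>, \<nu>)" "\<mu> \<in> P n" "\<nu> \<in> P n" "endp \<mu> = endp \<nu>"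
    using assms by (auto simp: unit_index_def)
  note cl = unit_closed[OF k(2,2) refl] unit_closed[OF k(3,3) refl]
  have "\<theta> \<mu> \<mu> \<otimes> comb n c \<otimes> \<theta> \<nu> \<nu> = (\<Oplus>i\<in>unit_index n. \<theta> \<mu> \<mu> \<otimes> (c i \<odot> \<theta> (fst i) (snd i)) \<otimes> \<theta> \<nu> \<nu>)"
    unfolding comb_def using cl unit_index_closed finite_unit_index
    by (simp add: finsum_mult_l finsum_mult_r)
  also have "\<dots> = \<theta> \<mu> \<mu> \<otimes> (c k \<odot> \<theta> (fst k) (snd k)) \<otimes> \<theta> \<nu> \<nu>"
  proof (rule finsum_single[OF finite_unit_index assms])
    fix i assume i: "i \<in> unit_index n" "i \<noteq> k"
    then obtain \<rho> \<sigma> where i': "i = (\<rho>, \<sigma>)" "\<rho> \<in> P n" "\<sigma> \<in> P n" "endp \<rho> = endp \<sigma>"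
      by (auto simp: unit_index_def)
    show "\<theta> \<mu> \<mu> \<otimes> (c i \<odot> \<theta> (fst i) (snd i)) \<otimes> \<theta> \<nu> \<nu> = \<zero>"
      using i' i(2) k cl unit_closed[OF i'(2,3,4)] unit_mult[OF k(2,2) i'(2,3)] unit_mult[OF k(2) i'(3) k(3,3)]
      by (auto simp: smult_mult_l smult_mult_r)
  qed (use cl unit_index_closed[OF assms] in auto)
  also have "\<dots> = c k \<odot> \<theta> \<mu> \<nu>"
    using k cl unit_closed[OF k(2,3,4)] unit_mult[OF k(2,2,2,3)] unit_mult[OF k(2,3,3,3)]
    by (simp add: smult_mult_l smult_mult_r)
  finally have "cmod (c k) = nrm A (\<theta> \<mu> \<mu> \<otimes> comb n c \<otimes> \<theta> \<nu> \<nu>)"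
    using nrm_unit[OF k(2,3,4)] unit_closed[OF k(2,3,4)] by (simp add: nrm_smult)
  also have "\<dots> \<le> nrm A (\<theta> \<mu> \<mu> \<otimes> comb n c) * nrm A (\<theta> \<nu> \<nu>)"
    using cl comb_closed by (intro nrm_mult) auto
  also have "\<dots> \<le> nrm A (\<theta> \<mu> \<mu>) * nrm A (comb n c) * nrm A (\<theta> \<nu> \<nu>)"
    using cl comb_closed by (intro mult_right_mono nrm_mult nrm_nonneg) auto
  finally show ?thesis using nrm_unit k by simp
qed

end

text \<open>Two systems with the same index data, an abstract one and one of operators;
  \<open>dense\<close> says that the abstract units generate \<open>A\<close> as a
  C*-algebra.\<close>

locale unit_system_pair = unit_system A P endp out ext \<theta> + Op: unit_system "op_algebra id" P endp out ext \<Theta>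
  for A :: "('a, 'm) cstar_scheme" (structure) and P :: "nat \<Rightarrow> 'p set" and endp :: "'p \<Rightarrow> 'v"
    and out :: "'v \<Rightarrow> 'e set" and ext :: "'p \<Rightarrow> 'e \<Rightarrow> 'p" and \<theta> :: "'p \<Rightarrow> 'p \<Rightarrow> 'a" and \<Theta> :: "'p \<Rightarrow> 'p \<Rightarrow> cop" +
  assumes dense: "\<And>S. cstar_subalgebra S A \<Longrightarrow>
    (\<And>n \<mu> \<nu>. \<mu> \<in> P n \<Longrightarrow> \<nu> \<in> P n \<Longrightarrow> endp \<mu> = endp \<nu> \<Longrightarrow> \<theta> \<mu> \<nu> \<in> S) \<Longrightarrow> S = carrier A"
begin

definition level_units :: "nat \<Rightarrow> ('a \<times> cop) set" where
  "level_units n = {(\<theta> \<mu> \<nu>, \<Theta> \<mu> \<nu>) | \<mu> \<nu>. \<mu> \<in> P n \<and> \<nu> \<in> P n \<and> endp \<mu> = endp \<nu>}"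

definition level_rel :: "nat \<Rightarrow> ('a \<times> cop) set" where
  "level_rel n = pair_span (level_units n)"

lemma level_units_closed: "fst ` level_units n \<subseteq> carrier A"
  using unit_closed by (auto simp: level_units_def)

text \<open>Related elements have the same coefficients, so both norms can be compared with one and
  the same coefficient norm.\<close>

lemma level_rel_comb:
  "(x, T) \<in> level_rel n \<Longrightarrow> \<exists>c. x = comb n c \<and> T = Op.comb n c"
  unfolding level_rel_def
proof (induction rule: pair_span.induct)
  case zero
  have "comb n (\<lambda>_. 0) = \<zero>" unfolding comb_def
    using unit_index_closed by (subst M.finsum_cong'[of _ _ "\<lambda>_. \<zero>"]) auto
  moreover have "Op.comb n (\<lambda>_. 0) = 0" unfolding Op.comb_def
    by (simp add: op_simps Op.finite_unit_index)
  ultimately show ?case by metis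
next
  case (step x T y S k)
  then obtain c where c: "x = comb n c" "T = Op.comb n c" by blast
  obtain \<mu> \<nu> where y: "y = \<theta> \<mu> \<nu>" "S = \<Theta> \<mu> \<nu>" and i: "(\<mu>, \<nu>) \<in> unit_index n"
    using step(2) by (auto simp: level_units_def unit_index_def)
  have yc: "y \<in> carrier A" using unit_index_closed[OF i] y by simp
  define c' where "c' = (\<lambda>i. (if i = (\<mu>, \<nu>) then k else 0))"
  have "comb n (\<lambda>i. c' i + c i) = comb n c' \<oplus> comb n c"
  proof -
    have "comb n (\<lambda>i. c' i + c i) = (\<Oplus>i\<in>unit_index n. c' i \<odot> \<theta> (fst i) (snd i) \<oplus> c i \<odot> \<theta> (fst i) (snd i))"
      unfolding comb_def using unit_index_closed by (intro M.finsum_cong') (auto simp: smul_add_l)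
    also have "\<dots> = comb n c' \<oplus> comb n c"
      unfolding comb_def using unit_index_closed by (intro finsum_add) auto
    finally show ?thesis .
  qed
  moreover have "comb n c' = k \<odot> y"
  proof -
    have "comb n c' = c' (\<mu>, \<nu>) \<odot> \<theta> (fst (\<mu>, \<nu>)) (snd (\<mu>, \<nu>))"
      unfolding comb_def using unit_index_closed
      by (intro finsum_single[OF finite_unit_index i]) (auto simp: c'_def yc[unfolded y])
    then show ?thesis by (simp add: c'_def y)
  qed
  moreover have "Op.comb n (\<lambda>i. c' i + c i) = Op.comb n c' + Op.comb n c"
    unfolding Op.comb_def by (simp add: op_simps Op.finite_unit_index cscale_add_left sum.distrib)
  moreover have "Op.comb n c' = cscale k S"
  proof -
    have "Op.comb n c' = (\<Sum>i\<in>unit_index n. if i = (\<mu>, \<nu>) then cscale k S else 0)"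
      unfolding Op.comb_def op_simps(8)[OF Op.finite_unit_index] op_simps
      by (rule sum.cong) (auto simp: c'_def y)
    then show ?thesis using i by (simp add: finite_unit_index)
  qed
  ultimately show ?case unfolding c by metis
qed

lemma level_rel_mult:
  "(x, T) \<in> level_rel n \<Longrightarrow> (y, S) \<in> level_rel n \<Longrightarrow> (x \<otimes> y, T * S) \<in> level_rel n"
  unfolding level_rel_def
proof (rule pair_span_mult[OF level_units_closed])
  fix y S y' S' assume "(y, S) \<in> level_units n" "(y', S') \<in> level_units n"
  then obtain \<mu> \<nu> \<rho> \<sigma> where *: "y = \<theta> \<mu> \<nu>" "S = \<Theta> \<mu> \<nu>" "y' = \<theta> \<rho> \<sigma>" "S' = \<Theta> \<rho> \<sigma>"
      "\<mu> \<in> P n" "\<nu> \<in> P n" "\<rho> \<in> P n" "\<sigma> \<in> P n" "endp \<mu> = endp \<nu>" "endp \<rho> = endp \<sigma>"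
    by (auto simp: level_units_def)
  show "(y \<otimes> y', S * S') \<in> pair_span (level_units n)"
  proof (cases "\<nu> = \<rho>")
    case True
    have "(\<theta> \<mu> \<sigma>, \<Theta> \<mu> \<sigma>) \<in> level_units n" using * True by (auto simp: level_units_def)
    then show ?thesis
      using * True unit_mult[OF *(5-10)] Op.unit_mult[OF *(5-10)] pair_span_base[OF level_units_closed]
      by (simp add: op_simps)
  next
    case False
    then show ?thesis
      using * unit_mult[OF *(5-10)] Op.unit_mult[OF *(5-10)] pair_span.zero by (simp add: op_simps)
  qed
qed

lemma level_rel_star: "(x, T) \<in> level_rel n \<Longrightarrow> (star A x, adj T) \<in> level_rel n"
  unfolding level_rel_def
proof (rule pair_span_star[OF level_units_closed])
  fix y S assume "(y, S) \<in> level_units n"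
  then obtain \<mu> \<nu> where "y = \<theta> \<mu> \<nu>" "S = \<Theta> \<mu> \<nu>" and m: "\<mu> \<in> P n" "\<nu> \<in> P n" "endp \<mu> = endp \<nu>"
    by (auto simp: level_units_def)
  then have "star A y = \<theta> \<nu> \<mu>" "adj S = \<Theta> \<nu> \<mu>"
    using unit_star[OF m] Op.unit_star[OF m] by (simp_all add: op_simps)
  then show "(star A y, adj S) \<in> level_units n"
    unfolding level_units_def using m by (intro CollectI exI[of _ \<nu>] exI[of _ \<mu>]) simp
qed

lemma level_rel_closed: "(x, T) \<in> level_rel n \<Longrightarrow> x \<in> carrier A"
  unfolding level_rel_def by (rule pair_span_closed[OF level_units_closed])

text \<open>Both systems refine a unit along the same edges, so a pair of units is a sum of pairs of
  units one level up.\<close>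

lemma level_rel_Suc: "level_rel n \<subseteq> level_rel (Suc n)"
  unfolding level_rel_def
proof (rule pair_span_subset[OF level_units_closed level_units_closed], rule subsetI)
  fix z assume "z \<in> level_units n"
  then obtain \<mu> \<nu> where z: "z = (\<theta> \<mu> \<nu>, \<Theta> \<mu> \<nu>)" and m: "\<mu> \<in> P n" "\<nu> \<in> P n" "endp \<mu> = endp \<nu>"
    by (auto simp: level_units_def)
  have fin: "finite (out (endp \<mu>))" using finite_out[OF m(1)] .
  have "z = ((\<Oplus>e\<in>out (endp \<mu>). \<theta> (ext \<mu> e) (ext \<nu> e)), (\<Sum>e\<in>out (endp \<mu>). \<Theta> (ext \<mu> e) (ext \<nu> e)))"
    unfolding z using unit_refine[OF m] Op.unit_refine[OF m] by (simp add: op_simps(8)[OF fin])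
  also have "\<dots> \<in> pair_span (level_units (Suc n))"
  proof (rule pair_span_finsum[OF level_units_closed fin], rule pair_span_base[OF level_units_closed])
    fix e assume "e \<in> out (endp \<mu>)"
    then show "(\<theta> (ext \<mu> e) (ext \<nu> e), \<Theta> (ext \<mu> e) (ext \<nu> e)) \<in> level_units (Suc n)"
      using m ext_P[of \<mu> n e] ext_P[of \<nu> n e] ext_end[OF m] by (auto simp: level_units_def)
  qed
  finally show "z \<in> pair_span (level_units (Suc n))" .
qed

lemma level_rel_mono: "m \<le> n \<Longrightarrow> level_rel m \<subseteq> level_rel n"
  using lift_Suc_mono_le[of level_rel, OF level_rel_Suc] by blast

text \<open>Both norms are equivalent to the coefficient norms, hence to each other; by the C*-identity the
  constants of this equivalence disappear on passing to high powers.\<close>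

lemma level_rel_norm:
  assumes "(x, T) \<in> level_rel n" shows "nrm A x = norm T"
proof -
  \<comment> \<open>The number of units: the sum of the absolute values of the coefficients is at
    most \<open>K\<close> times the largest of them.\<close>
  define K where "K = real (card (unit_index n))"
  have bound: "nrm A y \<le> K * norm S \<and> norm S \<le> K * nrm A y" if yS: "(y, S) \<in> level_rel n" for y S
  proof -
    obtain c where c: "y = comb n c" "S = Op.comb n c" using level_rel_comb[OF yS] by blast
    have "cmod (c i) \<le> norm S \<and> cmod (c i) \<le> nrm A y" if "i \<in> unit_index n" for i
      using coeff_le_nrm_comb[OF that, of c] Op.coeff_le_nrm_comb[of i n c] that
      by (simp add: c op_simps unit_index_def Op.unit_index_def)
    then have "(\<Sum>i\<in>unit_index n. cmod (c i)) \<le> K * norm S" "(\<Sum>i\<in>unit_index n. cmod (c i)) \<le> K * nrm A y"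
      unfolding K_def using sum_bounded_above[of "unit_index n" "\<lambda>i. cmod (c i)"] by auto
    then show ?thesis
      using nrm_comb_le[of n c] Op.nrm_comb_le[of n c] by (simp add: c op_simps)
  qed

  \<comment> \<open>Passing to \<open>star A x \<otimes> x\<close> makes the element self-adjoint,
    after which each squaring squares the norm; hence the exponents \<open>2 ^ Suc k\<close>, which
    begin with 2.\<close>
  have pow: "\<exists>z R. (z, R) \<in> level_rel n \<and> nrm A z = nrm A x ^ (2 ^ Suc k) \<and> norm R = norm T ^ (2 ^ Suc k)
      \<and> star A z = z \<and> adj R = R" for k
  proof (induction k)
    case 0
    have "(star A x \<otimes> x, adj T * T) \<in> level_rel n" by (intro level_rel_mult level_rel_star assms)
    then show ?case
      using level_rel_closed[OF assms]
      by (intro exI[of _ "star A x \<otimes> x"] exI[of _ "adj T * T"])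
        (simp add: cstar_identity norm_adj_mult star_mult star_star adj_mult adj_adj)
  next
    case (Suc k)
    then obtain z R where z: "(z, R) \<in> level_rel n" "nrm A z = nrm A x ^ (2 ^ Suc k)" "norm R = norm T ^ (2 ^ Suc k)"
      "star A z = z" "adj R = R" by blast
    have "nrm A (z \<otimes> z) = (nrm A z)\<^sup>2" "norm (R * R) = (norm R)\<^sup>2"
      using cstar_identity[OF level_rel_closed[OF z(1)]] norm_adj_mult[of R] z(4,5) by simp_all
    moreover have "(a ^ (2 ^ Suc k))\<^sup>2 = a ^ (2 ^ Suc (Suc k))" for a :: real
      by (simp add: power_mult[symmetric] mult.commute)
    ultimately show ?case
      using level_rel_mult[OF z(1) z(1)] z level_rel_closed[OF z(1)]
      by (intro exI[of _ "z \<otimes> z"] exI[of _ "R * R"]) (simp add: star_mult adj_mult)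
  qed
  have le: "a \<le> b" if ab: "0 \<le> a" "0 \<le> b" "\<And>k. a ^ (2 ^ Suc k) \<le> K * b ^ (2 ^ Suc k)" for a b :: real
  proof (cases "b = 0")
    case True
    then show ?thesis using ab(3)[of 0] by simp
  next
    case False
    with ab have b: "b > 0" by simp
    have "(a / b)\<^sup>2 ^ (2 ^ k) \<le> K" for k
    proof -
      have "(a / b)\<^sup>2 ^ (2 ^ k) = a ^ (2 ^ Suc k) / b ^ (2 ^ Suc k)"
        by (simp add: power_divide power_mult[symmetric])
      also have "\<dots> \<le> K" using ab(3)[of k] b by (simp only: divide_le_eq zero_less_power if_True)
      finally show ?thesis .
    qed
    then have "(a / b)\<^sup>2 \<le> 1" by (rule le_one_of_powers_bounded)
    then show ?thesis using ab b by (simp add: power_le_one_iff abs_square_le_1)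
  qed
  have powle: "nrm A x ^ (2 ^ Suc k) \<le> K * norm T ^ (2 ^ Suc k) \<and> norm T ^ (2 ^ Suc k) \<le> K * nrm A x ^ (2 ^ Suc k)" for k
  proof -
    obtain z R where z: "(z, R) \<in> level_rel n" "nrm A z = nrm A x ^ (2 ^ Suc k)" "norm R = norm T ^ (2 ^ Suc k)"
      using pow by blast
    show ?thesis using bound[OF z(1)] unfolding z(2,3) .
  qed
  have nn: "0 \<le> nrm A x" using level_rel_closed[OF assms] by (rule nrm_nonneg)
  show ?thesis
    by (rule antisym; rule le[OF _ _ conjunct1[OF powle]] le[OF _ _ conjunct2[OF powle]]) (simp_all add: nn)
qed

lemma level_rel_common:
  assumes "(x, T) \<in> (\<Union>n. level_rel n)" "(y, S) \<in> (\<Union>n. level_rel n)"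
  obtains n where "(x, T) \<in> level_rel n" "(y, S) \<in> level_rel n"
proof -
  obtain m k where "(x, T) \<in> level_rel m" "(y, S) \<in> level_rel k" using assms by blast
  then have "(x, T) \<in> level_rel (max m k)" "(y, S) \<in> level_rel (max m k)"
    using level_rel_mono[of m "max m k"] level_rel_mono[of k "max m k"] by auto
  then show thesis by (rule that)
qed

text \<open>The relations of all levels together form a star algebra on which norms agree. The
  closure of its domain is a C*-subalgebra containing all units, hence all of \<open>A\<close>, so
  the isometric extension applies.\<close>

lemma ex_isometric_embedding:
  "\<exists>\<psi>. isometric_embedding A \<psi> \<and>
    \<psi> ` carrier A = closure (\<Union>n. cop.span {\<Theta> \<mu> \<nu> | \<mu> \<nu>. \<mu> \<in> P n \<and> \<nu> \<in> P n \<and> endp \<mu> = endp \<nu>}) \<and>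
    (\<forall>n. \<forall>\<mu>\<in>P n. \<forall>\<nu>\<in>P n. endp \<mu> = endp \<nu> \<longrightarrow> \<psi> (\<theta> \<mu> \<nu>) = \<Theta> \<mu> \<nu>)"
proof -
  define G where "G = (\<Union>n. level_rel n)"
  have mem: "(x, T) \<in> level_rel n \<Longrightarrow> (x, T) \<in> G" for x T n by (auto simp: G_def)
  have zero: "(\<zero>, 0) \<in> level_rel n" for n unfolding level_rel_def by (rule pair_span.zero)
  have add: "(x \<oplus> y, T + S) \<in> G" if "(x, T) \<in> G" "(y, S) \<in> G" for x y T S
    using level_rel_common[OF that[unfolded G_def]] mem pair_span_add[OF level_units_closed]
    unfolding level_rel_def by metis
  have mult: "(x \<otimes> y, T * S) \<in> G" if "(x, T) \<in> G" "(y, S) \<in> G" for x y T S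
    using level_rel_common[OF that[unfolded G_def]] mem level_rel_mult by metis
  have smul: "(c \<odot> x, cscale c T) \<in> G" if "(x, T) \<in> G" for x T c
    using that pair_span_smul[OF level_units_closed] unfolding G_def level_rel_def by blast
  have star: "(star A x, adj T) \<in> G" if "(x, T) \<in> G" for x T
    using that level_rel_star unfolding G_def by blast
  have closed: "x \<in> carrier A" if "(x, T) \<in> G" for x T
    using that level_rel_closed unfolding G_def by blast
  have unit: "(\<theta> \<mu> \<nu>, \<Theta> \<mu> \<nu>) \<in> G" if "\<mu> \<in> P n" "\<nu> \<in> P n" "endp \<mu> = endp \<nu>" for n \<mu> \<nu>
  proof (rule mem[of _ _ n])
    have "(\<theta> \<mu> \<nu>, \<Theta> \<mu> \<nu>) \<in> level_units n" using that by (auto simp: level_units_def)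
    then show "(\<theta> \<mu> \<nu>, \<Theta> \<mu> \<nu>) \<in> level_rel n"
      unfolding level_rel_def by (rule pair_span_base[OF level_units_closed])
  qed
  have fstG: "x \<in> fst ` G \<longleftrightarrow> (\<exists>T. (x, T) \<in> G)" for x by force
  have Gc: "fst ` G \<subseteq> carrier A" using closed by (auto simp: fstG)
  have sub: "cstar_subalgebra (norm_closure A (fst ` G)) A"
  proof (rule norm_closure_subalgebra[OF Gc])
    show "\<zero> \<in> fst ` G" using zero mem fstG by blast
    show "x \<oplus> y \<in> fst ` G" if "x \<in> fst ` G" "y \<in> fst ` G" for x y using that add fstG by metis
    show "c \<odot> x \<in> fst ` G" if "x \<in> fst ` G" for c x using that smul fstG by metis
    show "x \<otimes> y \<in> fst ` G" if "x \<in> fst ` G" "y \<in> fst ` G" for x y using that mult fstG by metis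
    show "star A x \<in> fst ` G" if "x \<in> fst ` G" for x using that star fstG by metis
  qed
  have dn: "norm_closure A (fst ` G) = carrier A"
  proof (rule dense[OF sub])
    fix n \<mu> \<nu> assume "\<mu> \<in> P n" "\<nu> \<in> P n" "endp \<mu> = endp \<nu>"
    then have "\<theta> \<mu> \<nu> \<in> fst ` G" using unit fstG by blast
    then show "\<theta> \<mu> \<nu> \<in> norm_closure A (fst ` G)" using norm_closure_superset[OF Gc] by blast
  qed
  interpret isometric_relation A G
    by unfold_locales (use closed mem zero add mult smul star dn level_rel_norm in \<open>auto simp: G_def\<close>)
  have "snd ` G = (\<Union>n. cop.span {\<Theta> \<mu> \<nu> | \<mu> \<nu>. \<mu> \<in> P n \<and> \<nu> \<in> P n \<and> endp \<mu> = endp \<nu>})"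
  proof -
    have "snd ` level_units n = {\<Theta> \<mu> \<nu> | \<mu> \<nu>. \<mu> \<in> P n \<and> \<nu> \<in> P n \<and> endp \<mu> = endp \<nu>}" for n
      by (force simp: level_units_def)
    then show ?thesis
      unfolding G_def image_UN level_rel_def snd_pair_span[OF level_units_closed] by simp
  qed
  then have clos: "closure (snd ` G) = closure (\<Union>n. cop.span {\<Theta> \<mu> \<nu> | \<mu> \<nu>. \<mu> \<in> P n \<and> \<nu> \<in> P n \<and> endp \<mu> = endp \<nu>})"
    by simp
  obtain \<psi> where psi: "isometric_embedding A \<psi>" "\<psi> ` carrier A = closure (snd ` G)" "\<forall>(x, T)\<in>G. \<psi> x = T"
    using isometric_extension by blast
  have "\<psi> (\<theta> \<mu> \<nu>) = \<Theta> \<mu> \<nu>" if "\<mu> \<in> P n" "\<nu> \<in> P n" "endp \<mu> = endp \<nu>" for n \<mu> \<nu>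
    using bspec[OF psi(3) unit[OF that]] by simp
  with psi(1) psi(2)[unfolded clos] show ?thesis by blast
qed

end

section \<open>Partial isometries from partial injections\<close>

definition partial_inj :: "(nat \<Rightarrow> nat option) \<Rightarrow> bool" where
  "partial_inj k \<longleftrightarrow> (\<forall>m m' n. k m = Some n \<longrightarrow> k m' = Some n \<longrightarrow> m = m')"

text \<open>Reindexing along the injection turns the sum into one over a part of the index
  set.\<close>

lemma summable_partial_inj:
  fixes f :: "nat \<Rightarrow> real"
  assumes k: "partial_inj k" and f: "f summable_on UNIV" "\<And>n. 0 \<le> f n"
  shows "(\<lambda>m. case k m of None \<Rightarrow> 0 | Some n \<Rightarrow> f n) summable_on UNIV"
    "(\<Sum>\<^sub>\<infinity>m. case k m of None \<Rightarrow> 0 | Some n \<Rightarrow> f n) \<le> (\<Sum>\<^sub>\<infinity>n. f n)"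
proof -
  define D where "D = {m. k m \<noteq> None}"
  have inj: "inj_on (\<lambda>m. the (k m)) D"
    using k unfolding partial_inj_def D_def inj_on_def by force
  have img: "f summable_on ((\<lambda>m. the (k m)) ` D)" using f(1) by (rule summable_on_subset_banach) simp
  then have "(f \<circ> (\<lambda>m. the (k m))) summable_on D"
    using summable_on_reindex[OF inj] by blast
  also have "?this \<longleftrightarrow> (\<lambda>m. case k m of None \<Rightarrow> 0 | Some n \<Rightarrow> f n) summable_on UNIV"
    by (rule summable_on_cong_neutral) (auto simp: D_def)
  finally show "(\<lambda>m. case k m of None \<Rightarrow> 0 | Some n \<Rightarrow> f n) summable_on UNIV" .
  have "(\<Sum>\<^sub>\<infinity>m. case k m of None \<Rightarrow> 0 | Some n \<Rightarrow> f n) = infsum (f \<circ> (\<lambda>m. the (k m))) D"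
    by (rule infsum_cong_neutral) (auto simp: D_def)
  also have "\<dots> = infsum f ((\<lambda>m. the (k m)) ` D)"
    by (rule infsum_reindex[OF inj, symmetric])
  also have "\<dots> \<le> (\<Sum>\<^sub>\<infinity>n. f n)"
    using f img by (intro infsum_mono_neutral) auto
  finally show "(\<Sum>\<^sub>\<infinity>m. case k m of None \<Rightarrow> 0 | Some n \<Rightarrow> f n) \<le> (\<Sum>\<^sub>\<infinity>n. f n)" .
qed

text \<open>A pullback: if \<open>k m = Some n\<close>, the basis vector at \<open>n\<close> is sent
  to the one at \<open>m\<close>. Accordingly, in a product of such operators the partial map of the
  left factor is applied first.\<close>

definition inj_vec :: "(nat \<Rightarrow> nat option) \<Rightarrow> ell2 \<Rightarrow> ell2" where
  "inj_vec k x = Abs_ell2 (\<lambda>m. case k m of None \<Rightarrow> 0 | Some n \<Rightarrow> Rep_ell2 x n)"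

lemma Rep_inj_vec:
  assumes "partial_inj k"
  shows "Rep_ell2 (inj_vec k x) m = (case k m of None \<Rightarrow> 0 | Some n \<Rightarrow> Rep_ell2 x n)"
proof -
  have "(\<lambda>m. (norm (case k m of None \<Rightarrow> 0 | Some n \<Rightarrow> Rep_ell2 x n))\<^sup>2)
      = (\<lambda>m. case k m of None \<Rightarrow> 0 | Some n \<Rightarrow> (norm (Rep_ell2 x n))\<^sup>2)"
    by (rule ext) (simp split: option.split)
  then have "(\<lambda>m. (norm (case k m of None \<Rightarrow> 0 | Some n \<Rightarrow> Rep_ell2 x n))\<^sup>2) summable_on UNIV"
    using summable_partial_inj(1)[OF assms summable_ell2] by simp
  then show ?thesis unfolding inj_vec_def by (simp add: Abs_ell2_inverse)
qed

lemma norm_inj_vec: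
  assumes "partial_inj k" shows "norm (inj_vec k x) \<le> norm x"
proof -
  have "(norm (inj_vec k x))\<^sup>2 = (\<Sum>\<^sub>\<infinity>m. case k m of None \<Rightarrow> 0 | Some n \<Rightarrow> (norm (Rep_ell2 x n))\<^sup>2)"
    unfolding norm_ell2_square Rep_inj_vec[OF assms] by (rule infsum_cong) (simp split: option.split)
  also have "\<dots> \<le> (norm x)\<^sup>2"
    unfolding norm_ell2_square[of x] by (rule summable_partial_inj(2)[OF assms summable_ell2]) simp
  finally show ?thesis by (rule power2_le_imp_le) simp
qed

definition partial_inverse :: "(nat \<Rightarrow> nat option) \<Rightarrow> nat \<Rightarrow> nat option" where
  "partial_inverse k n = (if \<exists>m. k m = Some n then Some (THE m. k m = Some n) else None)"

lemma partial_inverse_iff: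
  assumes "partial_inj k" shows "partial_inverse k n = Some m \<longleftrightarrow> k m = Some n"
proof -
  have "(THE m. k m = Some n) = m" if "k m = Some n" for m
    using that assms unfolding partial_inj_def by (intro the_equality) auto
  then show ?thesis unfolding partial_inverse_def by auto
qed

lemma partial_inj_inverse: "partial_inj k \<Longrightarrow> partial_inj (partial_inverse k)"
  unfolding partial_inj_def[of "partial_inverse k"] by (simp add: partial_inverse_iff)

text \<open>Both sides are the same sum, taken over the domain of \<open>k\<close> and, after
  reindexing, over its range.\<close>

lemma inner_inj_vec:
  assumes k: "partial_inj k"
  shows "inj_vec k x \<bullet> y = x \<bullet> inj_vec (partial_inverse k) y"
proof -
  define D where "D = {m. k m \<noteq> None}"
  define R where "R = {n. partial_inverse k n \<noteq> None}"
  note k' = partial_inj_inverse[OF k]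
  have inj: "inj_on (\<lambda>m. the (k m)) D"
    using k unfolding partial_inj_def D_def inj_on_def by force
  have R: "R = (\<lambda>m. the (k m)) ` D"
    unfolding R_def D_def by (force simp: partial_inverse_iff[OF k])
  have "inj_vec k x \<bullet> y = (\<Sum>\<^sub>\<infinity>m. Rep_ell2 (inj_vec k x) m \<bullet> Rep_ell2 y m)"
    by (rule inner_ell2.rep_eq)
  also have "\<dots> = (\<Sum>\<^sub>\<infinity>m\<in>D. Rep_ell2 x (the (k m)) \<bullet> Rep_ell2 y m)"
    by (rule infsum_cong_neutral) (auto simp: D_def Rep_inj_vec[OF k])
  also have "\<dots> = (\<Sum>\<^sub>\<infinity>m\<in>D. ((\<lambda>n. Rep_ell2 x n \<bullet> Rep_ell2 (inj_vec (partial_inverse k) y) n) \<circ> (\<lambda>m. the (k m))) m)"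
  proof (rule infsum_cong)
    fix m assume "m \<in> D"
    then have "partial_inverse k (the (k m)) = Some m"
      by (auto simp: D_def partial_inverse_iff[OF k])
    then show "Rep_ell2 x (the (k m)) \<bullet> Rep_ell2 y m
        = ((\<lambda>n. Rep_ell2 x n \<bullet> Rep_ell2 (inj_vec (partial_inverse k) y) n) \<circ> (\<lambda>m. the (k m))) m"
      by (simp add: Rep_inj_vec[OF k'])
  qed
  also have "\<dots> = (\<Sum>\<^sub>\<infinity>n\<in>R. Rep_ell2 x n \<bullet> Rep_ell2 (inj_vec (partial_inverse k) y) n)"
    unfolding R by (subst infsum_reindex[OF inj]) simp
  also have "\<dots> = (\<Sum>\<^sub>\<infinity>n. Rep_ell2 x n \<bullet> Rep_ell2 (inj_vec (partial_inverse k) y) n)"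
    by (rule infsum_cong_neutral) (auto simp: R_def Rep_inj_vec[OF k'])
  also have "\<dots> = x \<bullet> inj_vec (partial_inverse k) y"
    by (rule inner_ell2.rep_eq[symmetric])
  finally show ?thesis .
qed

definition inj_op :: "(nat \<Rightarrow> nat option) \<Rightarrow> cop" where
  "inj_op k = Abs_cop (Blinfun (inj_vec k))"

lemma capp_inj_op:
  assumes k: "partial_inj k" shows "capp (inj_op k) = inj_vec k"
proof -
  have ap: "blinfun_apply (Blinfun (inj_vec k)) = inj_vec k" if "partial_inj k" for k
  proof (rule bounded_linear_Blinfun_apply, rule bounded_linear_intro[where K = 1])
    show "inj_vec k (x + y) = inj_vec k x + inj_vec k y" for x y
      by (rule ell2_eqI) (simp add: Rep_inj_vec[OF that] plus_ell2.rep_eq split: option.split)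
    show "inj_vec k (r *\<^sub>R x) = r *\<^sub>R inj_vec k x" for r x
      by (rule ell2_eqI) (simp add: Rep_inj_vec[OF that] scaleR_ell2.rep_eq split: option.split)
    show "norm (inj_vec k x) \<le> norm x * 1" for x using norm_inj_vec[OF that] by simp
  qed
  have "capp (Abs_cop (Blinfun (inj_vec k))) = blinfun_apply (Blinfun (inj_vec k))"
  proof (rule cop_of_blinfun(1)[where S = "Blinfun (inj_vec (partial_inverse k))"])
    show "blinfun_apply (Blinfun (inj_vec k)) (ell2_i x) = ell2_i (blinfun_apply (Blinfun (inj_vec k)) x)" for x
      unfolding ap[OF k]
      by (rule ell2_eqI) (simp add: Rep_inj_vec[OF k] ell2_i.rep_eq split: option.split)
  qed (simp add: ap k partial_inj_inverse inner_inj_vec)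
  then show ?thesis by (simp add: inj_op_def ap[OF k])
qed

lemma adj_inj_op: "partial_inj k \<Longrightarrow> adj (inj_op k) = inj_op (partial_inverse k)"
  by (rule adj_eqI) (simp add: capp_inj_op partial_inj_inverse inner_inj_vec)

lemma partial_inj_comp:
  "partial_inj k \<Longrightarrow> partial_inj l \<Longrightarrow> partial_inj (\<lambda>m. Option.bind (k m) l)"
  unfolding partial_inj_def by (auto simp: bind_eq_Some_conv)

lemma inj_op_mult:
  assumes "partial_inj k" "partial_inj l"
  shows "inj_op k * inj_op l = inj_op (\<lambda>m. Option.bind (k m) l)"
  by (rule cop_eqI, rule ell2_eqI)
    (simp add: capp_simps capp_inj_op assms partial_inj_comp Rep_inj_vec split: option.split)

lemma inj_op_None: "inj_op (\<lambda>_. None) = 0"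
proof -
  have "partial_inj (\<lambda>_. None)" by (simp add: partial_inj_def)
  then show ?thesis
    by (intro cop_eqI ell2_eqI) (simp add: capp_inj_op Rep_inj_vec capp_simps zero_ell2.rep_eq)
qed

lemma inj_op_nonzero:
  assumes k: "partial_inj k" "k m = Some n" shows "inj_op k \<noteq> 0"
proof
  assume z: "inj_op k = 0"
  define x where "x = Abs_ell2 (\<lambda>i. if i = n then 1 else 0)"
  have "(\<lambda>i. (norm (if i = n then 1 else 0 :: complex))\<^sup>2) summable_on UNIV"
    by (rule summable_on_cong_neutral[where S = "{n}", THEN iffD1]) auto
  then have "Rep_ell2 x n = 1" by (simp add: x_def Abs_ell2_inverse)
  then have "Rep_ell2 (capp (inj_op k) x) m = 1"
    using k by (simp add: capp_inj_op Rep_inj_vec)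
  then show False by (simp add: z capp_simps zero_ell2.rep_eq)
qed

lemma Rep_ell2_sum: "finite F \<Longrightarrow> Rep_ell2 (\<Sum>i\<in>F. f i) m = (\<Sum>i\<in>F. Rep_ell2 (f i) m)"
  by (induction F rule: finite_induct) (simp_all add: zero_ell2.rep_eq plus_ell2.rep_eq)

lemma capp_sum: "finite F \<Longrightarrow> capp (\<Sum>i\<in>F. f i) x = (\<Sum>i\<in>F. capp (f i) x)"
  by (induction F rule: finite_induct) (simp_all add: capp_simps)

text \<open>The graphs of the maps \<open>l i\<close> partition the graph of \<open>k\<close>, so in
  each coordinate at most one summand is nonzero.\<close>

lemma inj_op_sum:
  assumes F: "finite F" and k: "partial_inj k" and l: "\<And>i. i \<in> F \<Longrightarrow> partial_inj (l i)"
    and kl: "\<And>m n. k m = Some n \<longleftrightarrow> (\<exists>i\<in>F. l i m = Some n)"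
    and disj: "\<And>m i i'. i \<in> F \<Longrightarrow> i' \<in> F \<Longrightarrow> l i m \<noteq> None \<Longrightarrow> l i' m \<noteq> None \<Longrightarrow> i = i'"
  shows "inj_op k = (\<Sum>i\<in>F. inj_op (l i))"
proof (rule cop_eqI, rule ell2_eqI)
  fix x m
  have "Rep_ell2 (capp (\<Sum>i\<in>F. inj_op (l i)) x) m = (\<Sum>i\<in>F. case l i m of None \<Rightarrow> 0 | Some n \<Rightarrow> Rep_ell2 x n)"
    using F l by (simp add: capp_sum Rep_ell2_sum capp_inj_op Rep_inj_vec)
  also have "\<dots> = (case k m of None \<Rightarrow> 0 | Some n \<Rightarrow> Rep_ell2 x n)"
  proof (cases "k m")
    case None
    then have "l i m = None" if "i \<in> F" for i using kl that by (metis not_None_eq)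
    with None show ?thesis by simp
  next
    case (Some n)
    then obtain i where i: "i \<in> F" "l i m = Some n" using kl by blast
    have "(\<Sum>i\<in>F. case l i m of None \<Rightarrow> 0 | Some n \<Rightarrow> Rep_ell2 x n)
        = (\<Sum>i'\<in>{i}. case l i' m of None \<Rightarrow> 0 | Some n \<Rightarrow> Rep_ell2 x n)"
      using F i disj[OF _ i(1)] by (intro sum.mono_neutral_right) (auto split: option.split)
    with i Some show ?thesis by simp
  qed
  also have "\<dots> = Rep_ell2 (capp (inj_op k) x) m" by (simp add: capp_inj_op k Rep_inj_vec)
  finally show "Rep_ell2 (capp (inj_op k) x) m = Rep_ell2 (capp (\<Sum>i\<in>F. inj_op (l i)) x) m" ..
qed

section \<open>Paths in a Bratteli diagram\<close>

text \<open>A path \<open>(v, c, l)\<close> starts at \<open>v\<close> and runs through the edges in \<open>l\<close>, last edge first. The label \<open>c\<close>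
  tells apart several fictitious paths that arrive at \<open>v\<close> before it starts.\<close>

type_synonym ('v, 'e) path = "'v \<times> nat \<times> 'e list"

text \<open>As the last edge stands first in the list, the edges are pushed one by one in front of
  the tail \<open>y\<close>.\<close>

primrec conc :: "'e list \<Rightarrow> (nat \<Rightarrow> 'e) \<Rightarrow> nat \<Rightarrow> 'e" where
  "conc [] y = y"
| "conc (e # l) y = conc l (case_nat e y)"

lemma case_nat_inject: "case_nat e y = case_nat e' y' \<longleftrightarrow> e = e' \<and> y = y'"
  by (metis ext nat.case(1) nat.case(2))

lemma conc_inject: "length l = length l' \<Longrightarrow> conc l y = conc l' y' \<longleftrightarrow> l = l' \<and> y = y'"
proof (induction l l' arbitrary: y y' rule: list_induct2)
  case (Cons e l e' l')
  then show ?case by (auto simp: case_nat_inject)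
qed simp

fun glue :: "('v, 'e) path \<Rightarrow> (nat \<Rightarrow> 'e) \<Rightarrow> 'v \<times> nat \<times> (nat \<Rightarrow> 'e)" where
  "glue (v, c, l) y = (v, c, conc l y)"

fun path_ext :: "('v, 'e) path \<Rightarrow> 'e \<Rightarrow> ('v, 'e) path" where
  "path_ext (v, c, l) e = (v, c, e # l)"

lemma glue_ext: "glue (path_ext \<mu> e) y = glue \<mu> (case_nat e y)"
  by (cases \<mu>) simp

lemma path_ext_inject: "path_ext \<mu> e = path_ext \<nu> f \<longleftrightarrow> \<mu> = \<nu> \<and> e = f"
  by (cases \<mu>; cases \<nu>) auto

text \<open>Without sinks an infinite path starts at every vertex, so vectors indexed by infinite
  paths detect every vertex. For the diagram of an algebra the condition is proved in
  \<open>no_sink_algebra\<close>.\<close>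

locale bratteli_paths = bratteli_diagram E V d
  for E :: "('v, 'e) pre_digraph" and V :: "nat \<Rightarrow> 'v set" and d :: "'v \<Rightarrow> nat" +
  assumes no_sink: "v \<in> verts E \<Longrightarrow> out_arcs E v \<noteq> {}"
begin

lemma level_verts: "v \<in> V n \<Longrightarrow> v \<in> verts E"
  using verts_levels by auto

lemma level_unique: "v \<in> V m \<Longrightarrow> v \<in> V n \<Longrightarrow> m = n"
  using disjoint_levels unfolding disjoint_family_on_def by blast

text \<open>The next level is finite and each of its vertices has finitely many incoming
  edges.\<close>

lemma finite_out_arcs: assumes "v \<in> V n" shows "finite (out_arcs E v)"
proof (rule finite_subset)
  show "out_arcs E v \<subseteq> (\<Union>w\<in>V (Suc n). in_arcs E w)"
    using assms arcs_levels by (auto simp: in_arcs_def)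
  show "finite (\<Union>w\<in>V (Suc n). in_arcs E w)"
    using finite_levels finite_in_arcs level_verts by auto
qed

fun path_end :: "('v, 'e) path \<Rightarrow> 'v" where
  "path_end (v, c, []) = v"
| "path_end (v, c, e # l) = head E e"

lemma path_end_ext [simp]: "path_end (path_ext \<mu> e) = head E e"
  by (cases \<mu>) simp

primrec paths :: "('v \<Rightarrow> nat set) \<Rightarrow> nat \<Rightarrow> ('v, 'e) path set" where
  "paths cs 0 = {(v, c, []) | v c. v \<in> V 0 \<and> c \<in> cs v}"
| "paths cs (Suc n) = {(v, c, []) | v c. v \<in> V (Suc n) \<and> c \<in> cs v} \<union>
    {path_ext \<mu> e | \<mu> e. \<mu> \<in> paths cs n \<and> e \<in> out_arcs E (path_end \<mu>)}"

lemma trivial_path: "v \<in> V n \<Longrightarrow> c \<in> cs v \<Longrightarrow> (v, c, []) \<in> paths cs n"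
  by (cases n) auto

lemma path_ext_paths: "\<mu> \<in> paths cs n \<Longrightarrow> e \<in> out_arcs E (path_end \<mu>) \<Longrightarrow> path_ext \<mu> e \<in> paths cs (Suc n)"
  unfolding paths.simps by blast

lemma path_end_level: "\<mu> \<in> paths cs n \<Longrightarrow> path_end \<mu> \<in> V n"
proof (induction n arbitrary: \<mu>)
  case (Suc n)
  then show ?case using arcs_levels by fastforce
qed auto

lemma finite_paths:
  assumes "\<And>v. v \<in> verts E \<Longrightarrow> finite (cs v)" shows "finite (paths cs n)"
proof (induction n)
  have fin: "finite {(v, c, [] :: 'e list) | v c. v \<in> V n \<and> c \<in> cs v}" for n
  proof -
    have "{(v, c, [] :: 'e list) | v c. v \<in> V n \<and> c \<in> cs v} = (\<lambda>(v, c). (v, c, [])) ` (SIGMA v:V n. cs v)"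
      by auto
    then show ?thesis using assms level_verts finite_levels by auto
  qed
  {
    case 0
    then show ?case using fin by simp
  next
    case (Suc n)
    have "{path_ext \<mu> e | \<mu> e. \<mu> \<in> paths cs n \<and> e \<in> out_arcs E (path_end \<mu>)}
        = (\<Union>\<mu>\<in>paths cs n. path_ext \<mu> ` out_arcs E (path_end \<mu>))" by blast
    moreover have "finite (\<Union>\<mu>\<in>paths cs n. path_ext \<mu> ` out_arcs E (path_end \<mu>))"
      using Suc finite_out_arcs path_end_level by blast
    ultimately show ?case using fin[of "Suc n"] by simp
  }
qed

lemma path_length: "(v, c, l) \<in> paths cs n \<Longrightarrow> \<exists>k. v \<in> V k \<and> k + length l = n"
proof (induction n arbitrary: v c l)
  case (Suc n)
  then show ?case
  proof (cases l)
    case (Cons e l')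
    then have "(v, c, l') \<in> paths cs n" using Suc.prems by auto
    from Suc.IH[OF this] Cons show ?thesis by auto
  qed auto
qed auto

section \<open>Infinite paths and the basis that they index\<close>

definition chosen :: "'v \<Rightarrow> 'e" where "chosen v = (SOME e. e \<in> out_arcs E v)"

lemma chosen: "v \<in> verts E \<Longrightarrow> chosen v \<in> out_arcs E v"
  unfolding chosen_def using no_sink by (metis all_not_in_conv someI_ex)

definition std_path :: "'v \<Rightarrow> nat \<Rightarrow> 'e" where
  "std_path v n = chosen (((\<lambda>w. head E (chosen w)) ^^ n) v)"

lemma std_path_unfold: "std_path v = case_nat (chosen v) (std_path (head E (chosen v)))"
proof
  fix n show "std_path v n = case_nat (chosen v) (std_path (head E (chosen v))) n"
    by (cases n) (simp_all add: std_path_def funpow_Suc_right del: funpow.simps(2))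
qed

text \<open>Restricting to the infinite paths that eventually follow the chosen edges keeps the basis countable.\<close>

inductive_set inf_paths :: "('v \<times> (nat \<Rightarrow> 'e)) set" where
  std: "v \<in> verts E \<Longrightarrow> (v, std_path v) \<in> inf_paths"
| step: "(head E e, y) \<in> inf_paths \<Longrightarrow> e \<in> arcs E \<Longrightarrow> (tail E e, case_nat e y) \<in> inf_paths"

lemma inf_path_cases:
  "(v, y) \<in> inf_paths \<Longrightarrow> \<exists>e\<in>out_arcs E v. \<exists>y'. (head E e, y') \<in> inf_paths \<and> y = case_nat e y'"
proof (induction rule: inf_paths.cases)
  case (std v)
  then have "chosen v \<in> out_arcs E v" using chosen by blast
  moreover from this have "(head E (chosen v), std_path (head E (chosen v))) \<in> inf_paths"
    by (intro inf_paths.std) auto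
  ultimately show ?case using std std_path_unfold by blast
next
  case (step e y)
  then show ?case by auto
qed

lemma inf_path_iff:
  "(v, y) \<in> inf_paths \<longleftrightarrow> (\<exists>e\<in>out_arcs E v. \<exists>y'. (head E e, y') \<in> inf_paths \<and> y = case_nat e y')"
  using inf_path_cases inf_paths.step by fastforce

text \<open>An element is determined by finitely many edges and the vertex from which on the chosen
  edges are followed.\<close>

lemma countable_inf_paths: "countable inf_paths"
proof (rule countable_subset)
  let ?f = "\<lambda>(l, v). (if l = [] then v else tail E (hd l), foldr case_nat l (std_path v))"
  show "inf_paths \<subseteq> ?f ` (lists (arcs E) \<times> verts E)"
  proof (rule subrelI)
    fix w y assume "(w, y) \<in> inf_paths"
    then have "\<exists>l\<in>lists (arcs E). \<exists>v\<in>verts E. (w, y) = ?f (l, v)"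
    proof (induction rule: inf_paths.induct)
      case (std v)
      then show ?case by (intro bexI[of _ "[]"] bexI[of _ v]) auto
    next
      case (step e y)
      then obtain l v where l: "l \<in> lists (arcs E)" "v \<in> verts E" "y = foldr case_nat l (std_path v)" by auto
      then show ?case using step(2) by (intro bexI[of _ "e # l"] bexI[of _ v]) auto
    qed
    then show "(w, y) \<in> ?f ` (lists (arcs E) \<times> verts E)" by blast
  qed
  show "countable (?f ` (lists (arcs E) \<times> verts E))"
    by (intro countable_image countable_SIGMA countable_lists countable_arcs countable_verts)
qed

text \<open>All labels occur, so that paths of both kinds act on one and the same Hilbert
  space.\<close>

definition path_basis :: "('v \<times> nat \<times> (nat \<Rightarrow> 'e)) set" where
  "path_basis = {(v, c, y). (v, y) \<in> inf_paths}"

lemma countable_path_basis: "countable path_basis"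
proof (rule countable_subset)
  show "path_basis \<subseteq> (\<lambda>((v, y), c). (v, c, y)) ` (inf_paths \<times> UNIV)"
    unfolding path_basis_def by force
  show "countable ((\<lambda>((v, y), c). (v, c, y)) ` (inf_paths \<times> (UNIV :: nat set)))"
    using countable_inf_paths by (intro countable_image countable_SIGMA) auto
qed

definition pos_of :: "'v \<times> nat \<times> (nat \<Rightarrow> 'e) \<Rightarrow> nat" where "pos_of = to_nat_on path_basis"

lemma pos_of_inject: "z \<in> path_basis \<Longrightarrow> z' \<in> path_basis \<Longrightarrow> pos_of z = pos_of z' \<longleftrightarrow> z = z'"
  unfolding pos_of_def using inj_on_to_nat_on[OF countable_path_basis] by (auto simp: inj_on_def)

lemma glue_path_basis: "\<mu> \<in> paths cs n \<Longrightarrow> (path_end \<mu>, y) \<in> inf_paths \<Longrightarrow> glue \<mu> y \<in> path_basis"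
proof (induction n arbitrary: \<mu> y)
  case 0
  then show ?case by (auto simp: path_basis_def)
next
  case (Suc n)
  consider v c where "\<mu> = (v, c, [])" | \<nu> e where "\<mu> = path_ext \<nu> e" "\<nu> \<in> paths cs n" "e \<in> out_arcs E (path_end \<nu>)"
    using Suc.prems(1) by auto
  then show ?case
  proof cases
    case 1
    then show ?thesis using Suc.prems by (auto simp: path_basis_def)
  next
    case 2
    then have "(path_end \<nu>, case_nat e y) \<in> inf_paths"
      using Suc.prems(2) inf_paths.step[of e y] by auto
    with 2 Suc.IH[of \<nu>] show ?thesis by (simp add: glue_ext)
  qed
qed

text \<open>Paths with the same start that end on the same level have equal length, so the glued
  path can be cut in only one place.\<close>

lemma glue_inject:
  assumes "\<mu> \<in> paths cs n" "\<nu> \<in> paths cs' n" shows "glue \<mu> y = glue \<nu> y' \<longleftrightarrow> \<mu> = \<nu> \<and> y = y'"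
proof -
  obtain v c l where \<mu>: "\<mu> = (v, c, l)" by (cases \<mu>)
  obtain v' c' l' where \<nu>: "\<nu> = (v', c', l')" by (cases \<nu>)
  have "length l = length l'" if "v = v'"
  proof -
    obtain k k' where "v \<in> V k" "k + length l = n" "v' \<in> V k'" "k' + length l' = n"
      using path_length[of v c l cs n] path_length[of v' c' l' cs' n] assms by (auto simp: \<mu> \<nu>)
    then show ?thesis using level_unique[of v k k'] that by simp
  qed
  then show ?thesis by (auto simp: \<mu> \<nu> conc_inject)
qed

text \<open>Because of the pullback convention the map goes from continuations of
  \<open>\<mu>\<close> to those of \<open>\<nu>\<close>; the operator then sends the vector of
  \<open>glue \<nu> y\<close> to that of \<open>glue \<mu> y\<close>.\<close>

definition kmap :: "('v, 'e) path \<Rightarrow> ('v, 'e) path \<Rightarrow> nat \<Rightarrow> nat option" where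
  "kmap \<mu> \<nu> m = (if \<exists>y. (path_end \<mu>, y) \<in> inf_paths \<and> m = pos_of (glue \<mu> y)
    then Some (pos_of (glue \<nu> (THE y. (path_end \<mu>, y) \<in> inf_paths \<and> m = pos_of (glue \<mu> y)))) else None)"

lemma kmap_iff:
  assumes \<mu>: "\<mu> \<in> paths cs n"
  shows "kmap \<mu> \<nu> m = Some k \<longleftrightarrow>
    (\<exists>y. (path_end \<mu>, y) \<in> inf_paths \<and> m = pos_of (glue \<mu> y) \<and> k = pos_of (glue \<nu> y))"
proof -
  have uniq: "y = y'" if "(path_end \<mu>, y) \<in> inf_paths" "(path_end \<mu>, y') \<in> inf_paths" "pos_of (glue \<mu> y) = pos_of (glue \<mu> y')" for y y'
    using that glue_path_basis[OF \<mu>] by (simp add: pos_of_inject glue_inject[OF \<mu> \<mu>])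
  have "(THE y'. (path_end \<mu>, y') \<in> inf_paths \<and> m = pos_of (glue \<mu> y')) = y"
    if "(path_end \<mu>, y) \<in> inf_paths" "m = pos_of (glue \<mu> y)" for y
    using that uniq by (intro the_equality) auto
  then show ?thesis unfolding kmap_def by auto
qed

lemma partial_inj_kmap:
  assumes \<mu>: "\<mu> \<in> paths cs n" and \<nu>: "\<nu> \<in> paths cs' n'" and e: "path_end \<mu> = path_end \<nu>"
  shows "partial_inj (kmap \<mu> \<nu>)"
  unfolding partial_inj_def kmap_iff[OF \<mu>]
  using glue_path_basis[OF \<nu>] e by (auto simp: pos_of_inject glue_inject[OF \<nu> \<nu>])

definition punit :: "('v, 'e) path \<Rightarrow> ('v, 'e) path \<Rightarrow> cop" where
  "punit \<mu> \<nu> = inj_op (kmap \<mu> \<nu>)"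

lemma punit_adj:
  assumes \<mu>: "\<mu> \<in> paths cs n" and \<nu>: "\<nu> \<in> paths cs' n'" and e: "path_end \<mu> = path_end \<nu>"
  shows "adj (punit \<mu> \<nu>) = punit \<nu> \<mu>"
proof -
  have "partial_inverse (kmap \<mu> \<nu>) m = Some k \<longleftrightarrow> kmap \<nu> \<mu> m = Some k" for m k
    unfolding partial_inverse_iff[OF partial_inj_kmap[OF assms]] kmap_iff[OF \<mu>] kmap_iff[OF \<nu>] e by auto
  then have "partial_inverse (kmap \<mu> \<nu>) = kmap \<nu> \<mu>"
    by (intro ext) (metis not_None_eq)
  then show ?thesis
    unfolding punit_def by (simp add: adj_inj_op partial_inj_kmap[OF assms])
qed

lemma punit_mult:
  assumes \<mu>: "\<mu> \<in> paths cs n" and \<nu>: "\<nu> \<in> paths cs2 m" and \<sigma>: "\<sigma> \<in> paths cs3 k"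
    and e: "path_end \<mu> = path_end \<nu>" "path_end \<nu> = path_end \<sigma>"
  shows "punit \<mu> \<nu> * punit \<nu> \<sigma> = punit \<mu> \<sigma>"
proof -
  have "Option.bind (kmap \<mu> \<nu> i) (kmap \<nu> \<sigma>) = Some j \<longleftrightarrow> kmap \<mu> \<sigma> i = Some j" for i j
    unfolding bind_eq_Some_conv kmap_iff[OF \<mu>] kmap_iff[OF \<nu>] using glue_path_basis[OF \<nu>] e
    by (auto simp: pos_of_inject glue_inject[OF \<nu> \<nu>])
  then have "(\<lambda>i. Option.bind (kmap \<mu> \<nu> i) (kmap \<nu> \<sigma>)) = kmap \<mu> \<sigma>"
    by (intro ext) (metis not_None_eq)
  then show ?thesis
    unfolding punit_def using partial_inj_kmap[OF \<mu> \<nu> e(1)] partial_inj_kmap[OF \<nu> \<sigma> e(2)] by (simp add: inj_op_mult)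
qed

text \<open>Either condition keeps the continuations of \<open>\<nu>\<close> and
  \<open>\<rho>\<close> apart. The second one covers vertices on different levels, which occur in
  the Cuntz-Krieger relations.\<close>

lemma punit_mult_zero:
  assumes \<mu>: "\<mu> \<in> paths cs n" and \<nu>: "\<nu> \<in> paths cs2 m" and \<rho>: "\<rho> \<in> paths cs3 m'" and \<sigma>: "\<sigma> \<in> paths cs4 k"
    and e: "path_end \<mu> = path_end \<nu>" "path_end \<rho> = path_end \<sigma>"
    and ne: "(m = m' \<and> \<nu> \<noteq> \<rho>) \<or> fst \<nu> \<noteq> fst \<rho>"
  shows "punit \<mu> \<nu> * punit \<rho> \<sigma> = 0"
proof -
  have gl: "glue \<nu> y \<noteq> glue \<rho> y'" for y y'
    using ne
  proof
    assume "m = m' \<and> \<nu> \<noteq> \<rho>"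
    then show ?thesis using glue_inject[OF \<nu>, of \<rho>] \<rho> by auto
  next
    assume "fst \<nu> \<noteq> fst \<rho>"
    then show ?thesis by (cases \<nu>; cases \<rho>) auto
  qed
  have "Option.bind (kmap \<mu> \<nu> i) (kmap \<rho> \<sigma>) \<noteq> Some j" for i j
    unfolding bind_eq_Some_conv kmap_iff[OF \<mu>] kmap_iff[OF \<rho>] using glue_path_basis[OF \<nu>] glue_path_basis[OF \<rho>] e gl gl[symmetric]
    by (auto simp: pos_of_inject)
  then have "(\<lambda>i. Option.bind (kmap \<mu> \<nu> i) (kmap \<rho> \<sigma>)) = (\<lambda>_. None)"
    by (intro ext) (metis not_None_eq)
  then show ?thesis
    unfolding punit_def using partial_inj_kmap[OF \<mu> \<nu> e(1)] partial_inj_kmap[OF \<rho> \<sigma> e(2)] by (simp add: inj_op_mult inj_op_None)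
qed

text \<open>Every continuation has exactly one first edge, so the continuations split according to
  it.\<close>

lemma punit_refine:
  assumes \<mu>: "\<mu> \<in> paths cs n" and \<nu>: "\<nu> \<in> paths cs' m" and e: "path_end \<mu> = path_end \<nu>"
  shows "punit \<mu> \<nu> = (\<Sum>f\<in>out_arcs E (path_end \<mu>). punit (path_ext \<mu> f) (path_ext \<nu> f))"
  unfolding punit_def
proof (rule inj_op_sum)
  show "finite (out_arcs E (path_end \<mu>))" using finite_out_arcs path_end_level[OF \<mu>] by blast
  show "partial_inj (kmap \<mu> \<nu>)" by (rule partial_inj_kmap[OF assms])
  fix f assume f: "f \<in> out_arcs E (path_end \<mu>)"
  have \<mu>f: "path_ext \<mu> f \<in> paths cs (Suc n)" and \<nu>f: "path_ext \<nu> f \<in> paths cs' (Suc m)"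
    using path_ext_paths \<mu> \<nu> f e by auto
  show "partial_inj (kmap (path_ext \<mu> f) (path_ext \<nu> f))" by (rule partial_inj_kmap[OF \<mu>f \<nu>f]) simp
next
  fix i j
  have "(\<exists>f\<in>out_arcs E (path_end \<mu>). kmap (path_ext \<mu> f) (path_ext \<nu> f) i = Some j) \<longleftrightarrow>
    (\<exists>f\<in>out_arcs E (path_end \<mu>). \<exists>y. (head E f, y) \<in> inf_paths \<and> i = pos_of (glue \<mu> (case_nat f y)) \<and>
      j = pos_of (glue \<nu> (case_nat f y)))"
    using kmap_iff[OF path_ext_paths[OF \<mu>]] by (simp add: glue_ext)
  also have "\<dots> \<longleftrightarrow> kmap \<mu> \<nu> i = Some j"
    unfolding kmap_iff[OF \<mu>] inf_path_iff[of "path_end \<mu>"] by blast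
  finally show "kmap \<mu> \<nu> i = Some j \<longleftrightarrow>
    (\<exists>f\<in>out_arcs E (path_end \<mu>). kmap (path_ext \<mu> f) (path_ext \<nu> f) i = Some j)" ..
next
  fix i f g assume f: "f \<in> out_arcs E (path_end \<mu>)" and g: "g \<in> out_arcs E (path_end \<mu>)"
    and "kmap (path_ext \<mu> f) (path_ext \<nu> f) i \<noteq> None" "kmap (path_ext \<mu> g) (path_ext \<nu> g) i \<noteq> None"
  note \<mu>f = path_ext_paths[OF \<mu> f] and \<mu>g = path_ext_paths[OF \<mu> g]
  obtain y y' where "(path_end (path_ext \<mu> f), y) \<in> inf_paths" "(path_end (path_ext \<mu> g), y') \<in> inf_paths"
      "pos_of (glue (path_ext \<mu> f) y) = pos_of (glue (path_ext \<mu> g) y')"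
    using \<open>kmap (path_ext \<mu> f) (path_ext \<nu> f) i \<noteq> None\<close> \<open>kmap (path_ext \<mu> g) (path_ext \<nu> g) i \<noteq> None\<close>
    by (auto simp: kmap_iff[OF \<mu>f] kmap_iff[OF \<mu>g])
  then show "f = g"
    using glue_path_basis[OF \<mu>f] glue_path_basis[OF \<mu>g] glue_inject[OF \<mu>f \<mu>g] by (simp add: pos_of_inject path_ext_inject)
qed

lemma punit_nonzero: assumes \<mu>: "\<mu> \<in> paths cs n" shows "punit \<mu> \<mu> \<noteq> 0"
proof -
  have "(path_end \<mu>, std_path (path_end \<mu>)) \<in> inf_paths"
    using path_end_level[OF \<mu>] level_verts by (intro inf_paths.std)
  then have "kmap \<mu> \<mu> (pos_of (glue \<mu> (std_path (path_end \<mu>)))) = Some (pos_of (glue \<mu> (std_path (path_end \<mu>))))"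
    unfolding kmap_iff[OF \<mu>] by blast
  then show ?thesis unfolding punit_def using inj_op_nonzero partial_inj_kmap[OF \<mu> \<mu> refl] by blast
qed

lemma unit_system_punit:
  assumes cs: "\<And>v. v \<in> verts E \<Longrightarrow> finite (cs v)"
  shows "unit_system (op_algebra id) (paths cs) path_end (out_arcs E) path_ext punit"
proof (intro unit_system.intro unit_system_axioms.intro)
  show "cstar_algebra (op_algebra (id :: cop \<Rightarrow> cop))" by (rule cstar_algebra_op_algebra) simp
  fix n \<mu> \<nu> assume \<mu>: "\<mu> \<in> paths cs n" 
  show fin: "finite (out_arcs E (path_end \<mu>))" using finite_out_arcs path_end_level[OF \<mu>] by blast
  show "punit \<mu> \<mu> \<noteq> \<zero>\<^bsub>op_algebra id\<^esub>" using punit_nonzero[OF \<mu>] by (simp add: op_simps)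
  show "path_ext \<mu> e \<in> paths cs (Suc n)" if "e \<in> out_arcs E (path_end \<mu>)" for e
    using path_ext_paths[OF \<mu> that] .
  assume \<nu>: "\<nu> \<in> paths cs n" and e: "path_end \<mu> = path_end \<nu>"
  show "star (op_algebra id) (punit \<mu> \<nu>) = punit \<nu> \<mu>" by (simp add: op_simps punit_adj[OF \<mu> \<nu> e])
  show "punit \<mu> \<nu> = (\<Oplus>\<^bsub>op_algebra id\<^esub>e\<in>out_arcs E (path_end \<mu>). punit (path_ext \<mu> e) (path_ext \<nu> e))"
    unfolding op_simps(8)[OF fin] by (rule punit_refine[OF \<mu> \<nu> e])
  fix \<rho> \<sigma> assume \<rho>: "\<rho> \<in> paths cs n" and \<sigma>: "\<sigma> \<in> paths cs n" and e': "path_end \<rho> = path_end \<sigma>"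
  show "punit \<mu> \<nu> \<otimes>\<^bsub>op_algebra id\<^esub> punit \<rho> \<sigma> = (if \<nu> = \<rho> then punit \<mu> \<sigma> else \<zero>\<^bsub>op_algebra id\<^esub>)"
    using punit_mult[OF \<mu> \<nu> \<sigma> e] punit_mult_zero[OF \<mu> \<nu> \<rho> \<sigma> e e'] e' by (cases "\<nu> = \<rho>") (simp_all add: op_simps)
qed (use finite_paths[OF cs] in \<open>auto simp: op_simps\<close>)

end

section \<open>Orthonormal families in finite dimension\<close>

text \<open>Vectors are functions on all natural numbers, of which only the first \<open>d\<close>
  values count.\<close>

definition cdot :: "nat \<Rightarrow> (nat \<Rightarrow> complex) \<Rightarrow> (nat \<Rightarrow> complex) \<Rightarrow> complex" where
  "cdot d x y = (\<Sum>i<d. cnj (x i) * y i)"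

definition orthonormal :: "nat \<Rightarrow> 'x set \<Rightarrow> ('x \<Rightarrow> nat \<Rightarrow> complex) \<Rightarrow> bool" where
  "orthonormal d F U \<longleftrightarrow> (\<forall>a\<in>F. \<forall>b\<in>F. cdot d (U a) (U b) = (if a = b then 1 else 0))"

text \<open>For an orthonormal family, the matrix of the orthogonal projection onto its
  span.\<close>

definition outer :: "'x set \<Rightarrow> ('x \<Rightarrow> nat \<Rightarrow> complex) \<Rightarrow> nat \<Rightarrow> nat \<Rightarrow> complex" where
  "outer F U i j = (\<Sum>a\<in>F. U a i * cnj (U a j))"

lemma cdot_cnj: "cnj (cdot d x y) = cdot d y x"
  by (simp add: cdot_def mult.commute)

lemma cdot_cong: "(\<And>i. i < d \<Longrightarrow> x i = x' i) \<Longrightarrow> (\<And>i. i < d \<Longrightarrow> y i = y' i) \<Longrightarrow> cdot d x y = cdot d x' y'"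
  by (simp add: cdot_def)

lemma cdot_sum: "cdot d x (\<lambda>i. \<Sum>a\<in>F. f a i * k a) = (\<Sum>a\<in>F. cdot d x (f a) * k a)"
proof -
  have "cdot d x (\<lambda>i. \<Sum>a\<in>F. f a i * k a) = (\<Sum>i<d. \<Sum>a\<in>F. cnj (x i) * f a i * k a)"
    by (simp add: cdot_def sum_distrib_left mult.assoc)
  also have "\<dots> = (\<Sum>a\<in>F. \<Sum>i<d. cnj (x i) * f a i * k a)" by (rule sum.swap)
  finally show ?thesis by (simp add: cdot_def sum_distrib_right)
qed

lemma outer_apply: "(\<Sum>j<d. outer F U i j * y j) = (\<Sum>a\<in>F. U a i * cdot d (U a) y)"
proof -
  have "(\<Sum>j<d. outer F U i j * y j) = (\<Sum>j<d. \<Sum>a\<in>F. U a i * (cnj (U a j) * y j))"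
    by (simp add: outer_def sum_distrib_right mult.assoc)
  also have "\<dots> = (\<Sum>a\<in>F. \<Sum>j<d. U a i * (cnj (U a j) * y j))" by (rule sum.swap)
  finally show ?thesis by (simp add: cdot_def sum_distrib_left)
qed

lemma outer_cnj: "cnj (outer F U i j) = outer F U j i"
  by (simp add: outer_def mult.commute)

lemma outer_trace: "(\<Sum>i<d. outer F U i i) = (\<Sum>a\<in>F. cdot d (U a) (U a))"
proof -
  have "(\<Sum>i<d. outer F U i i) = (\<Sum>a\<in>F. \<Sum>i<d. U a i * cnj (U a i))"
    unfolding outer_def by (rule sum.swap)
  then show ?thesis by (simp add: cdot_def mult.commute)
qed

lemma orthonormal_apply:
  assumes "finite F" "orthonormal d F U" "b \<in> F"
  shows "(\<Sum>a\<in>F. U a i * cdot d (U a) (U b)) = U b i"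
proof -
  have "(\<Sum>a\<in>F. U a i * cdot d (U a) (U b)) = (\<Sum>a\<in>F. if a = b then U b i else 0)"
    using assms(2,3) by (intro sum.cong) (auto simp: orthonormal_def)
  with assms(1,3) show ?thesis by simp
qed

lemma orthonormal_outer_zero:
  assumes F: "finite F" "orthonormal d F U" and z: "\<And>i. i < d \<Longrightarrow> (\<Sum>j<d. outer F U i j * x j) = 0" and b: "b \<in> F"
  shows "cdot d (U b) x = 0"
proof -
  have "0 = cdot d (U b) (\<lambda>i. \<Sum>a\<in>F. U a i * cdot d (U a) x)"
    using z unfolding outer_apply by (simp add: cdot_def)
  also have "\<dots> = (\<Sum>a\<in>F. cdot d (U b) (U a) * cdot d (U a) x)" by (rule cdot_sum)
  also have "\<dots> = (\<Sum>a\<in>F. if b = a then cdot d (U b) x else 0)"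
    using F(2) b by (intro sum.cong) (auto simp: orthonormal_def)
  finally show ?thesis using F(1) b by simp
qed

lemma outer_idempotent:
  assumes "finite F" "orthonormal d F U"
  shows "(\<Sum>k<d. outer F U i k * outer F U k j) = outer F U i j"
proof -
  have "outer F U k j = (\<Sum>b\<in>F. U b k * cnj (U b j))" for k by (simp add: outer_def)
  then have "(\<Sum>k<d. outer F U i k * outer F U k j) = (\<Sum>a\<in>F. U a i * cdot d (U a) (\<lambda>k. \<Sum>b\<in>F. U b k * cnj (U b j)))"
    by (simp add: outer_apply)
  also have "\<dots> = (\<Sum>a\<in>F. \<Sum>b\<in>F. U a i * cdot d (U a) (U b) * cnj (U b j))"
    by (simp add: cdot_sum sum_distrib_left mult.assoc)
  also have "\<dots> = (\<Sum>b\<in>F. (\<Sum>a\<in>F. U a i * cdot d (U a) (U b)) * cnj (U b j))"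
    by (subst sum.swap) (simp add: sum_distrib_right)
  also have "\<dots> = outer F U i j"
    unfolding outer_def using orthonormal_apply[OF assms] by (intro sum.cong) auto
  finally show ?thesis .
qed

text \<open>Induction on the trace. A projection of trace 0 vanishes, because its diagonal entries
  are the squared norms of its rows. Otherwise a nonzero column, normalized, is a unit vector fixed
  by \<open>P\<close>, and subtracting its rank-one projection lowers the trace by 1.\<close>

lemma projection_rank_one_decomposition:
  fixes P :: "nat \<Rightarrow> nat \<Rightarrow> complex"
  assumes "\<And>i j. i < d \<Longrightarrow> j < d \<Longrightarrow> (\<Sum>k<d. P i k * P k j) = P i j"
    and "\<And>i j. i < d \<Longrightarrow> j < d \<Longrightarrow> cnj (P i j) = P j i"
    and "(\<Sum>i<d. P i i) = of_nat m"
  shows "\<exists>g. orthonormal d {..<m} g \<and> (\<forall>i<d. \<forall>j<d. P i j = outer {..<m} g i j)"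
  using assms
proof (induction m arbitrary: P)
  case 0
  have sq: "P i i = of_real (\<Sum>k<d. (cmod (P i k))\<^sup>2)" if "i < d" for i
  proof -
    have "P i i = (\<Sum>k<d. P i k * cnj (P i k))" using 0(1)[OF that that] 0(2)[OF that] by simp
    then show ?thesis by (simp add: complex_norm_square[symmetric])
  qed
  have "complex_of_real (\<Sum>i<d. \<Sum>k<d. (cmod (P i k))\<^sup>2) = 0"
    using 0(3) sq by simp
  then have "(\<Sum>i<d. \<Sum>k<d. (cmod (P i k))\<^sup>2) = 0" by (simp only: of_real_eq_0_iff)
  then have "\<forall>i<d. (\<Sum>k<d. (cmod (P i k))\<^sup>2) = 0"
    by (subst (asm) sum_nonneg_eq_0_iff) (auto intro: sum_nonneg)
  then have "P i j = 0" if "i < d" "j < d" for i j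
    using that by (subst (asm) sum_nonneg_eq_0_iff) auto
  then show ?case by (simp add: orthonormal_def outer_def)
next
  case (Suc m)
  have "\<exists>k<d. P k k \<noteq> 0"
  proof (rule ccontr)
    assume "\<not> (\<exists>k<d. P k k \<noteq> 0)"
    then have "(\<Sum>i<d. P i i) = 0" by simp
    with Suc.prems(3) show False by (metis of_nat_eq_0_iff nat.distinct(2))
  qed
  then obtain k where k: "k < d" "P k k \<noteq> 0" by blast
  \<comment> \<open>The squared norm of column \<open>k\<close>, which turns out to be
    \<open>P k k\<close>.\<close>
  define r where "r = (\<Sum>i<d. (cmod (P i k))\<^sup>2)"
  have "P k k = (\<Sum>i<d. cnj (P i k) * P i k)" using Suc.prems(1)[OF k(1) k(1)] Suc.prems(2)[OF _ k(1)] by simp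
  then have Pkk: "P k k = of_real r" by (simp add: r_def complex_norm_square[symmetric] mult.commute[of "cnj _"])
  have "r \<ge> 0" unfolding r_def by (intro sum_nonneg) auto
  with k(2) Pkk have r: "r > 0" by (cases "r = 0") auto
  define g where "g = (\<lambda>i. P i k / of_real (sqrt r))"
  have sr: "complex_of_real (sqrt r) * complex_of_real (sqrt r) = of_real r" "complex_of_real (sqrt r) \<noteq> 0"
    using r by (simp_all flip: of_real_mult)
  have gg: "cdot d g g = 1"
  proof -
    have "cdot d g g = (\<Sum>i<d. cnj (P i k) * P i k) / (of_real (sqrt r) * of_real (sqrt r))"
      by (simp add: cdot_def g_def sum_divide_distrib)
    then show ?thesis using \<open>P k k = (\<Sum>i<d. cnj (P i k) * P i k)\<close> Pkk sr r k(2) by simp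
  qed
  have Pg: "(\<Sum>j<d. P i j * g j) = g i" if "i < d" for i
    using Suc.prems(1)[OF that k(1)] by (simp add: g_def sum_divide_distrib[symmetric])
  have gP: "(\<Sum>i<d. cnj (g i) * P i j) = cnj (g j)" if "j < d" for j
  proof -
    have "cnj (\<Sum>i<d. P j i * g i) = (\<Sum>i<d. cnj (g i) * P i j)"
      using Suc.prems(2)[OF that] by (simp add: mult.commute)
    then show ?thesis using Pg[OF that] by simp
  qed
  define P' where "P' = (\<lambda>i j. P i j - g i * cnj (g j))"
  have "\<exists>h. orthonormal d {..<m} h \<and> (\<forall>i<d. \<forall>j<d. P' i j = outer {..<m} h i j)"
  proof (rule Suc.IH)
    fix i j assume ij: "i < d" "j < d"
    have "(\<Sum>l<d. P' i l * P' l j) = (\<Sum>l<d. P i l * P l j) - g i * (\<Sum>l<d. cnj (g l) * P l j)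
        - (\<Sum>l<d. P i l * g l) * cnj (g j) + g i * cnj (g j) * cdot d g g"
      by (simp add: P'_def cdot_def algebra_simps sum_subtractf sum.distrib sum_distrib_left sum_distrib_right)
    then show "(\<Sum>l<d. P' i l * P' l j) = P' i j"
      using ij Suc.prems(1) Pg gP gg by (simp add: P'_def)
    show "cnj (P' i j) = P' j i" using Suc.prems(2) ij by (simp add: P'_def)
  next
    have "(\<Sum>i<d. P' i i) = (\<Sum>i<d. P i i) - cdot d g g"
      by (simp add: P'_def cdot_def sum_subtractf mult.commute)
    then show "(\<Sum>i<d. P' i i) = of_nat m" using Suc.prems(3) gg by simp
  qed
  then obtain h where h: "orthonormal d {..<m} h" and P': "\<And>i j. i < d \<Longrightarrow> j < d \<Longrightarrow> P' i j = outer {..<m} h i j"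
    by blast
  \<comment> \<open>\<open>P'\<close> annihilates \<open>g\<close>, so the vectors spanning the
    range of \<open>P'\<close> are orthogonal to \<open>g\<close>.\<close>
  have hg: "cdot d (h a) g = 0" if "a < m" for a
  proof (rule orthonormal_outer_zero[OF _ h])
    fix i assume i: "i < d"
    have "(\<Sum>j<d. outer {..<m} h i j * g j) = (\<Sum>j<d. P' i j * g j)" using P'[OF i] by simp
    also have "\<dots> = (\<Sum>j<d. P i j * g j) - g i * cdot d g g"
      by (simp add: P'_def cdot_def algebra_simps sum_subtractf sum_distrib_left)
    finally show "(\<Sum>j<d. outer {..<m} h i j * g j) = 0" using Pg[OF i] gg by simp
  qed (use that in auto)
  then have gh: "cdot d g (h a) = 0" if "a < m" for a using that cdot_cnj[of d "h a" g] by simp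
  have "orthonormal d {..<Suc m} (case_nat g h)"
    unfolding orthonormal_def using h hg gh gg by (auto simp: orthonormal_def split: nat.split)
  moreover have "P i j = outer {..<Suc m} (case_nat g h) i j" if "i < d" "j < d" for i j
    using P'[OF that] unfolding outer_def sum.lessThan_Suc_shift by (simp add: P'_def algebra_simps)
  ultimately show ?case by blast
qed

text \<open>The rank-one decomposition of the complementary projection, whose trace is
  \<open>d - card F\<close>.\<close>

lemma orthonormal_complement:
  assumes F: "finite F" "orthonormal d F U" and m: "card F + m = d"
  shows "\<exists>q. orthonormal d {..<m} q \<and> (\<forall>a\<in>F. \<forall>c<m. cdot d (U a) (q c) = 0) \<and>
    (\<forall>i<d. \<forall>j<d. outer F U i j + outer {..<m} q i j = (if i = j then 1 else 0))"
proof -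
  define Q where "Q = (\<lambda>i j. (if i = j then 1 else 0) - outer F U i j)"
  have "\<exists>q. orthonormal d {..<m} q \<and> (\<forall>i<d. \<forall>j<d. Q i j = outer {..<m} q i j)"
  proof (rule projection_rank_one_decomposition)
    fix i j assume ij: "i < d" "j < d"
    have "(\<Sum>k<d. Q i k * Q k j) = (\<Sum>k<d. (if i = k then (if k = j then 1 else 0) - outer F U k j else 0))
        - (\<Sum>k<d. if k = j then outer F U i k else 0) + (\<Sum>k<d. outer F U i k * outer F U k j)"
      unfolding sum_subtractf[symmetric] sum.distrib[symmetric]
      by (intro sum.cong) (auto simp: Q_def algebra_simps)
    also have "\<dots> = Q i j" unfolding outer_idempotent[OF F] using ij by (simp add: Q_def)
    finally show "(\<Sum>k<d. Q i k * Q k j) = Q i j" .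
    show "cnj (Q i j) = Q j i" by (simp add: Q_def outer_cnj)
  next
    have "(\<Sum>a\<in>F. cdot d (U a) (U a)) = of_nat (card F)"
      using F(2) by (simp add: orthonormal_def)
    then have "(\<Sum>i<d. Q i i) = of_nat d - of_nat (card F)"
      by (simp add: Q_def sum_subtractf outer_trace)
    moreover have "of_nat d = of_nat (card F) + (of_nat m :: complex)" using m by (metis of_nat_add)
    ultimately show "(\<Sum>i<d. Q i i) = of_nat m" by simp
  qed
  then obtain q where q: "orthonormal d {..<m} q" and Q: "\<And>i j. i < d \<Longrightarrow> j < d \<Longrightarrow> Q i j = outer {..<m} q i j" by blast
  have "cdot d (q c) (U a) = 0" if "a \<in> F" "c < m" for a c
  proof (rule orthonormal_outer_zero[OF _ q])
    fix i assume i: "i < d"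
    have "(\<Sum>j<d. outer {..<m} q i j * U a j) = (\<Sum>j<d. Q i j * U a j)" using Q[OF i] by simp
    also have "\<dots> = (\<Sum>j<d. if i = j then U a j else 0) - (\<Sum>j<d. outer F U i j * U a j)"
      unfolding sum_subtractf[symmetric] by (intro sum.cong) (auto simp: Q_def algebra_simps)
    also have "\<dots> = 0"
      using i orthonormal_apply[OF F \<open>a \<in> F\<close>] by (simp add: outer_apply)
    finally show "(\<Sum>j<d. outer {..<m} q i j * U a j) = 0" .
  qed (use that in auto)
  then have "cdot d (U a) (q c) = 0" if "a \<in> F" "c < m" for a c
    using that cdot_cnj[of d "q c" "U a"] by simp
  moreover have "outer F U i j + outer {..<m} q i j = (if i = j then 1 else 0)" if "i < d" "j < d" for i j
    using Q[OF that, symmetric] by (simp add: Q_def)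
  ultimately show ?thesis using q by blast
qed

section \<open>Compatible matrix units in the algebra of a Bratteli diagram\<close>

lemma mat_adjoint_entry:
  assumes "M \<in> carrier_mat k k" "i < k" "j < k"
  shows "mat_adjoint M $$ (i, j) = cnj (M $$ (j, i))" and "mat_adjoint M \<in> carrier_mat k k"
  using assms unfolding mat_adjoint_def by (auto simp: mat_of_rows_def)

locale bratteli_algebra = cstar_algebra A + bratteli_diagram E V d
  for A :: "'a cstar" (structure) and E :: "('v, 'e) pre_digraph" and V :: "nat \<Rightarrow> 'v set" and d :: "'v \<Rightarrow> nat" +
  fixes S :: "nat \<Rightarrow> 'a set" and \<phi> :: "nat \<Rightarrow> 'a \<Rightarrow> 'v \<Rightarrow> complex mat"
  assumes subalgebra: "cstar_subalgebra (S n) A"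
    and increasing: "S n \<subseteq> S (Suc n)"
    and dense_union: "norm_closure A (\<Union>n. S n) = carrier A"
    and \<phi>_iso: "\<phi> n \<in> star_iso (A\<lparr>carrier := S n\<rparr>) (matrix_sum (V n) d)"
    and \<phi>_trace: "\<lbrakk>v \<in> V n; w \<in> V (Suc n); a \<in> S n; \<And>u. u \<in> V n - {v} \<Longrightarrow> \<phi> n a u = 0\<^sub>m (d u) (d u)\<rbrakk> \<Longrightarrow>
      mat_trace (\<phi> (Suc n) a w) = of_nat (card (out_arcs E v \<inter> in_arcs E w)) * mat_trace (\<phi> n a v)"
begin

section \<open>Matrix entries of the finite-dimensional subalgebras\<close>

lemma S_closed:
  "x \<in> S n \<Longrightarrow> x \<in> carrier A" "\<zero> \<in> S n" "x \<in> S n \<Longrightarrow> y \<in> S n \<Longrightarrow> x \<oplus> y \<in> S n" "x \<in> S n \<Longrightarrow> c \<odot> x \<in> S n"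
  "x \<in> S n \<Longrightarrow> y \<in> S n \<Longrightarrow> x \<otimes> y \<in> S n" "x \<in> S n \<Longrightarrow> star A x \<in> S n"
  using subalgebra[of n] unfolding cstar_subalgebra_def by auto

lemma S_Suc: "x \<in> S n \<Longrightarrow> x \<in> S (Suc n)"
  using increasing by blast

definition ent :: "nat \<Rightarrow> 'a \<Rightarrow> 'v \<Rightarrow> nat \<Rightarrow> nat \<Rightarrow> complex" where
  "ent n a v i j = \<phi> n a v $$ (i, j)"

lemma \<phi>_props:
  "a \<in> S n \<Longrightarrow> \<phi> n a \<in> (\<Pi>\<^sub>E v\<in>V n. carrier_mat (d v) (d v))"
  "a \<in> S n \<Longrightarrow> b \<in> S n \<Longrightarrow> \<phi> n (a \<oplus> b) = (\<lambda>v\<in>V n. \<phi> n a v + \<phi> n b v)"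
  "a \<in> S n \<Longrightarrow> b \<in> S n \<Longrightarrow> \<phi> n (a \<otimes> b) = (\<lambda>v\<in>V n. \<phi> n a v * \<phi> n b v)"
  "a \<in> S n \<Longrightarrow> \<phi> n (c \<odot> a) = (\<lambda>v\<in>V n. c \<cdot>\<^sub>m \<phi> n a v)"
  "a \<in> S n \<Longrightarrow> \<phi> n (star A a) = (\<lambda>v\<in>V n. mat_adjoint (\<phi> n a v))"
  "bij_betw (\<phi> n) (S n) (\<Pi>\<^sub>E v\<in>V n. carrier_mat (d v) (d v))"
  using \<phi>_iso[of n] unfolding star_iso_def star_hom_def matrix_sum_def by auto

lemma \<phi>_carrier: "a \<in> S n \<Longrightarrow> v \<in> V n \<Longrightarrow> \<phi> n a v \<in> carrier_mat (d v) (d v)"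
  using \<phi>_props(1) by blast

lemma ent_simps:
  assumes "a \<in> S n" "v \<in> V n" "i < d v" "j < d v"
  shows "b \<in> S n \<Longrightarrow> ent n (a \<oplus> b) v i j = ent n a v i j + ent n b v i j"
    "b \<in> S n \<Longrightarrow> ent n (a \<otimes> b) v i j = (\<Sum>k<d v. ent n a v i k * ent n b v k j)"
    "ent n (c \<odot> a) v i j = c * ent n a v i j"
    "ent n (star A a) v i j = cnj (ent n a v j i)"
proof -
  note ca = \<phi>_carrier[OF assms(1,2)]
  show "ent n (c \<odot> a) v i j = c * ent n a v i j"
    using assms ca by (simp add: ent_def \<phi>_props)
  show "ent n (star A a) v i j = cnj (ent n a v j i)"
    using assms ca mat_adjoint_entry[OF ca] by (simp add: ent_def \<phi>_props)
  assume b: "b \<in> S n"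
  note cb = \<phi>_carrier[OF b assms(2)]
  show "ent n (a \<oplus> b) v i j = ent n a v i j + ent n b v i j"
    using assms ca cb b by (simp add: ent_def \<phi>_props)
  show "ent n (a \<otimes> b) v i j = (\<Sum>k<d v. ent n a v i k * ent n b v k j)"
    using assms ca cb b by (simp add: ent_def \<phi>_props scalar_prod_def atLeast0LessThan)
qed

lemma ent_zero: "v \<in> V n \<Longrightarrow> i < d v \<Longrightarrow> j < d v \<Longrightarrow> ent n \<zero> v i j = 0"
  using ent_simps(3)[of \<zero> n v i j 0] S_closed(2) by simp

lemma ent_inj:
  assumes "a \<in> S n" "b \<in> S n" "\<And>v i j. v \<in> V n \<Longrightarrow> i < d v \<Longrightarrow> j < d v \<Longrightarrow> ent n a v i j = ent n b v i j"
  shows "a = b"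
proof -
  have "\<phi> n a = \<phi> n b"
  proof (rule PiE_ext[OF \<phi>_props(1)[OF assms(1)] \<phi>_props(1)[OF assms(2)]])
    fix v assume v: "v \<in> V n"
    show "\<phi> n a v = \<phi> n b v"
      using \<phi>_carrier[OF assms(1) v] \<phi>_carrier[OF assms(2) v] assms(3)[OF v] by (intro eq_matI) (auto simp: ent_def)
  qed
  then show ?thesis using \<phi>_props(6)[of n] assms(1,2) by (auto simp: bij_betw_def inj_on_def)
qed

lemma ent_surj: "\<exists>a\<in>S n. \<forall>v\<in>V n. \<forall>i<d v. \<forall>j<d v. ent n a v i j = M v i j"
proof -
  have "(\<lambda>v\<in>V n. mat (d v) (d v) (\<lambda>(i, j). M v i j)) \<in> \<phi> n ` S n"
    using \<phi>_props(6)[of n] by (auto simp: bij_betw_def)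
  then obtain a where "a \<in> S n" "\<phi> n a = (\<lambda>v\<in>V n. mat (d v) (d v) (\<lambda>(i, j). M v i j))" by auto
  then show ?thesis by (intro bexI[of _ a]) (auto simp: ent_def)
qed

lemma ent_trace:
  assumes "v \<in> V n" "w \<in> V (Suc n)" "a \<in> S n"
    and "\<And>u i j. u \<in> V n \<Longrightarrow> u \<noteq> v \<Longrightarrow> i < d u \<Longrightarrow> j < d u \<Longrightarrow> ent n a u i j = 0"
  shows "(\<Sum>i<d w. ent (Suc n) a w i i) = of_nat (card (out_arcs E v \<inter> in_arcs E w)) * (\<Sum>i<d v. ent n a v i i)"
proof -
  have "\<phi> n a u = 0\<^sub>m (d u) (d u)" if "u \<in> V n - {v}" for u
    using \<phi>_carrier[OF assms(3), of u] assms(4)[of u] that by (intro eq_matI) (auto simp: ent_def)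
  from \<phi>_trace[OF assms(1-3) this]
  show ?thesis
    using \<phi>_carrier[OF assms(3,1)] \<phi>_carrier[OF S_Suc[OF assms(3)] assms(2)]
    by (simp add: mat_trace_def ent_def)
qed

definition block :: "nat \<Rightarrow> 'v \<Rightarrow> (nat \<Rightarrow> nat \<Rightarrow> complex) \<Rightarrow> 'a" where
  "block n v M = (SOME a. a \<in> S n \<and> (\<forall>w\<in>V n. \<forall>i<d w. \<forall>j<d w. ent n a w i j = (if w = v then M i j else 0)))"

lemma block:
  shows block_S: "block n v M \<in> S n"
    and ent_block: "\<lbrakk>w \<in> V n; i < d w; j < d w\<rbrakk> \<Longrightarrow> ent n (block n v M) w i j = (if w = v then M i j else 0)"
proof -
  have "\<exists>a. a \<in> S n \<and> (\<forall>w\<in>V n. \<forall>i<d w. \<forall>j<d w. ent n a w i j = (if w = v then M i j else 0))"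
    using ent_surj[of n "\<lambda>w i j. if w = v then M i j else 0"] by blast
  from someI_ex[OF this]
  show "block n v M \<in> S n" "\<lbrakk>w \<in> V n; i < d w; j < d w\<rbrakk> \<Longrightarrow> ent n (block n v M) w i j = (if w = v then M i j else 0)"
    unfolding block_def by blast+
qed

text \<open>A minimal projection in the block of a sink has trace 0 in every block of the next
  level, and a projection of trace 0 vanishes. The element is then zero, although one of its entries
  on level \<open>n\<close> is 1.\<close>

lemma no_sink_algebra:
  assumes v: "v \<in> verts E" shows "out_arcs E v \<noteq> {}"
proof
  assume none: "out_arcs E v = {}"
  obtain n where n: "v \<in> V n" using v verts_levels by auto
  have dv: "0 < d v" using label_pos[OF v] .
  define M :: "nat \<Rightarrow> nat \<Rightarrow> complex" where "M = (\<lambda>i j. if i = 0 \<and> j = 0 then 1 else 0 :: complex)"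
  define a where "a = block n v M"
  have a: "a \<in> S n" and ea: "\<And>w i j. \<lbrakk>w \<in> V n; i < d w; j < d w\<rbrakk> \<Longrightarrow> ent n a w i j = (if w = v then M i j else 0)"
    using block_S ent_block by (auto simp: a_def)
  have "ent n (a \<otimes> a) w i j = ent n a w i j" if w: "w \<in> V n" "i < d w" "j < d w" for w i j
  proof -
    have "(\<Sum>k<d w. ent n a w i k * ent n a w k j) = (\<Sum>k<d w. if k = 0 then ent n a w i 0 * ent n a w 0 j else 0)"
      using w by (intro sum.cong) (auto simp: ea M_def)
    then show ?thesis
      using w a by (simp add: ent_simps ea) (auto simp: M_def ea intro: gr0I)
  qed
  then have aa: "a \<otimes> a = a" using a S_closed by (intro ent_inj[of _ n]) auto
  have as: "star A a = a"
    using a S_closed by (intro ent_inj[of _ n]) (auto simp: ent_simps ea M_def)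
  have "ent (Suc n) a w i j = 0" if w: "w \<in> V (Suc n)" "i < d w" "j < d w" for w i j
  proof -
    have tr: "(\<Sum>i<d w. ent (Suc n) a w i i) = of_nat 0"
      using ent_trace[OF n w(1) a] ea none by simp
    have "\<exists>g. orthonormal (d w) {..<0} g \<and> (\<forall>i<d w. \<forall>j<d w. ent (Suc n) a w i j = outer {..<0::nat} g i j)"
    proof (rule projection_rank_one_decomposition)
      show "(\<Sum>i<d w. ent (Suc n) a w i i) = of_nat 0" by (rule tr)
      fix i j assume ij: "i < d w" "j < d w"
      show "(\<Sum>k<d w. ent (Suc n) a w i k * ent (Suc n) a w k j) = ent (Suc n) a w i j"
        using ent_simps(2)[OF S_Suc[OF a] w(1) ij S_Suc[OF a]] aa by simp
      show "cnj (ent (Suc n) a w i j) = ent (Suc n) a w j i"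
        using ent_simps(4)[OF S_Suc[OF a] w(1) ij(2,1)] as by simp
    qed
    with w show ?thesis by (auto simp: outer_def)
  qed
  then have "a = \<zero>" using S_Suc[OF a] S_closed ent_zero by (intro ent_inj[of _ "Suc n"]) auto
  then have "ent n a v 0 0 = 0" using ent_zero[OF n dv dv] by simp
  with ea[OF n dv dv] show False by (simp add: M_def)
qed

sublocale bratteli_paths E V d
  using no_sink_algebra by unfold_locales

section \<open>Matrix units from bases indexed by paths\<close>

definition defect :: "'v \<Rightarrow> nat" where
  "defect v = d v - (\<Sum>e\<in>in_arcs E v. d (tail E e))"

text \<open>One label for each fictitious path arriving at \<open>v\<close>. Label 0 is reserved for
  the paths of \<open>E\<close> itself, so that the two kinds of paths give orthogonal
  vectors.\<close>

definition alabels :: "'v \<Rightarrow> nat set" where "alabels v = {1..defect v}"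

definition apaths :: "nat \<Rightarrow> 'v \<Rightarrow> ('v, 'e) path set" where
  "apaths n v = {\<mu> \<in> paths alabels n. path_end \<mu> = v}"

lemma finite_apaths: "finite (apaths n v)"
  unfolding apaths_def using finite_paths[of alabels n] by (simp add: alabels_def)

text \<open>In each block of level \<open>n\<close> the paths ending there index an orthonormal
  basis; completeness is expressed by the projection onto the span being the identity.\<close>

definition good_basis :: "nat \<Rightarrow> (('v, 'e) path \<Rightarrow> nat \<Rightarrow> complex) \<Rightarrow> bool" where
  "good_basis n u \<longleftrightarrow> (\<forall>v\<in>V n. orthonormal (d v) (apaths n v) u \<and>
    (\<forall>i<d v. \<forall>j<d v. outer (apaths n v) u i j = (if i = j then 1 else 0)))"

lemma good_basis_cdot:
  assumes "good_basis n u" "\<mu> \<in> paths alabels n" "\<nu> \<in> paths alabels n" "path_end \<mu> = v" "path_end \<nu> = v"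
  shows "cdot (d v) (u \<mu>) (u \<nu>) = (if \<mu> = \<nu> then 1 else 0)"
proof -
  have "v \<in> V n" using path_end_level assms(2,4) by blast
  then have "orthonormal (d v) (apaths n v) u" using assms(1) unfolding good_basis_def by blast
  moreover have "\<mu> \<in> apaths n v" "\<nu> \<in> apaths n v" using assms unfolding apaths_def by blast+
  ultimately show ?thesis unfolding orthonormal_def by blast
qed

text \<open>Both numbers are the trace of the identity matrix of the block.\<close>

lemma good_basis_card:
  assumes "good_basis n u" "v \<in> V n" shows "card (apaths n v) = d v"
proof -
  have "of_nat (d v) = (\<Sum>i<d v. outer (apaths n v) u i i)"
    using assms by (simp add: good_basis_def)
  also have "\<dots> = (\<Sum>a\<in>apaths n v. 1)"
    unfolding outer_trace using assms by (intro sum.cong) (auto simp: good_basis_def orthonormal_def)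
  also have "\<dots> = of_nat (card (apaths n v))" by simp
  finally show ?thesis by (simp only: of_nat_eq_iff)
qed

text \<open>The rank-one operator taking \<open>u \<nu>\<close> to \<open>u \<mu>\<close>, a matrix
  unit with respect to the basis \<open>u\<close>.\<close>

definition aunit :: "nat \<Rightarrow> (('v, 'e) path \<Rightarrow> nat \<Rightarrow> complex) \<Rightarrow> ('v, 'e) path \<Rightarrow> ('v, 'e) path \<Rightarrow> 'a" where
  "aunit n u \<mu> \<nu> = block n (path_end \<mu>) (\<lambda>i j. u \<mu> i * cnj (u \<nu> j))"

lemma aunit_S: "aunit n u \<mu> \<nu> \<in> S n"
  unfolding aunit_def by (rule block_S)

lemma ent_aunit: "\<lbrakk>w \<in> V n; i < d w; j < d w\<rbrakk> \<Longrightarrow>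
    ent n (aunit n u \<mu> \<nu>) w i j = (if w = path_end \<mu> then u \<mu> i * cnj (u \<nu> j) else 0)"
  unfolding aunit_def by (rule ent_block)

lemma aunit_star: "path_end \<mu> = path_end \<nu> \<Longrightarrow> star A (aunit n u \<mu> \<nu>) = aunit n u \<nu> \<mu>"
  using aunit_S S_closed by (intro ent_inj[of _ n]) (auto simp: ent_simps ent_aunit)

lemma aunit_mult:
  assumes u: "good_basis n u" and m: "\<mu> \<in> paths alabels n" "\<nu> \<in> paths alabels n" "\<rho> \<in> paths alabels n"
    "\<sigma> \<in> paths alabels n" "path_end \<mu> = path_end \<nu>" "path_end \<rho> = path_end \<sigma>"
  shows "aunit n u \<mu> \<nu> \<otimes> aunit n u \<rho> \<sigma> = (if \<nu> = \<rho> then aunit n u \<mu> \<sigma> else \<zero>)"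
proof (rule ent_inj[of _ n])
  fix w i j assume w: "w \<in> V n" "i < d w" "j < d w"
  have "(\<Sum>k<d w. ent n (aunit n u \<mu> \<nu>) w i k * ent n (aunit n u \<rho> \<sigma>) w k j)
      = (if w = path_end \<nu> \<and> w = path_end \<rho> then u \<mu> i * cdot (d w) (u \<nu>) (u \<rho>) * cnj (u \<sigma> j) else 0)"
  proof (cases "w = path_end \<nu> \<and> w = path_end \<rho>")
    case True
    then show ?thesis
      using w m by (simp add: ent_aunit cdot_def sum_distrib_left sum_distrib_right mult.assoc)
  next
    case False
    then show ?thesis using w m by (intro trans[OF sum.neutral]) (auto simp: ent_aunit)
  qed
  also have "\<dots> = (if \<nu> = \<rho> \<and> w = path_end \<nu> then u \<mu> i * cnj (u \<sigma> j) else 0)"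
    using good_basis_cdot[OF u m(2,3), of w] by (cases "w = path_end \<nu> \<and> w = path_end \<rho>") auto
  finally have *: "(\<Sum>k<d w. ent n (aunit n u \<mu> \<nu>) w i k * ent n (aunit n u \<rho> \<sigma>) w k j)
    = (if \<nu> = \<rho> \<and> w = path_end \<nu> then u \<mu> i * cnj (u \<sigma> j) else 0)" .
  have "ent n (if \<nu> = \<rho> then aunit n u \<mu> \<sigma> else \<zero>) w i j
    = (if \<nu> = \<rho> \<and> w = path_end \<nu> then u \<mu> i * cnj (u \<sigma> j) else 0)"
    using ent_aunit[OF w, of u \<mu> \<sigma>] ent_zero[OF w] m(5)
    by (cases "\<nu> = \<rho>"; cases "w = path_end \<nu>") simp_all
  then show "ent n (aunit n u \<mu> \<nu> \<otimes> aunit n u \<rho> \<sigma>) w i j = ent n (if \<nu> = \<rho> then aunit n u \<mu> \<sigma> else \<zero>) w i j"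
    unfolding ent_simps(2)[OF aunit_S w aunit_S] * ..
qed (use aunit_S S_closed in auto)

lemma aunit_nonzero:
  assumes u: "good_basis n u" and m: "\<mu> \<in> paths alabels n" shows "aunit n u \<mu> \<mu> \<noteq> \<zero>"
proof
  assume z: "aunit n u \<mu> \<mu> = \<zero>"
  define v where "v = path_end \<mu>"
  have v: "v \<in> V n" using path_end_level[OF m] by (simp add: v_def)
  have "cdot (d v) (u \<mu>) (u \<mu>) = (\<Sum>i<d v. ent n (aunit n u \<mu> \<mu>) v i i)"
    using v by (simp add: cdot_def ent_aunit v_def mult.commute)
  also have "\<dots> = 0" using v by (simp add: z ent_zero)
  finally show False using good_basis_cdot[OF u m m v_def[symmetric] v_def[symmetric]] by simp
qed

end

section \<open>Compatible bases, level by level\<close>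

context bratteli_algebra
begin

definition long_paths :: "nat \<Rightarrow> 'v \<Rightarrow> ('v, 'e) path set" where
  "long_paths n w = {\<mu> \<in> apaths n w. snd (snd \<mu>) \<noteq> []}"

lemma apaths_split:
  assumes "w \<in> V n"
  shows "apaths n w = long_paths n w \<union> (\<lambda>c. (w, Suc c, [])) ` {..<defect w}"
    "long_paths n w \<inter> (\<lambda>c. (w, Suc c, [])) ` {..<defect w} = {}"
proof -
  have "(w, c, []) \<in> paths alabels n \<longleftrightarrow> c \<in> alabels w" for c
    using assms by (cases n) (auto elim: path_ext.elims)
  moreover have "\<mu> = (w, fst (snd \<mu>), [])" if "path_end \<mu> = w" "snd (snd \<mu>) = []" for \<mu>
    using that by (cases \<mu>) auto
  ultimately have "apaths n w - long_paths n w = (\<lambda>c. (w, c, [])) ` alabels w"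
    unfolding apaths_def long_paths_def by (force simp: image_iff)
  also have "alabels w = Suc ` {..<defect w}"
    unfolding alabels_def by (auto simp: image_iff gr0_conv_Suc Suc_le_eq)
  finally have "apaths n w - long_paths n w = (\<lambda>c. (w, Suc c, [])) ` {..<defect w}"
    by (simp add: image_image)
  then show "apaths n w = long_paths n w \<union> (\<lambda>c. (w, Suc c, [])) ` {..<defect w}"
    unfolding long_paths_def by blast
  show "long_paths n w \<inter> (\<lambda>c. (w, Suc c, [])) ` {..<defect w} = {}"
    by (auto simp: long_paths_def)
qed

text \<open>The vectors of the paths with at least one edge leave a complement of dimension
  \<open>defect w\<close> in the block of \<open>w\<close>, just enough for the fictitious
  paths.\<close>

lemma extend_to_good_basis:
  assumes U: "\<And>w. w \<in> V n \<Longrightarrow> orthonormal (d w) (long_paths n w) U"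
    and card: "\<And>w. w \<in> V n \<Longrightarrow> card (long_paths n w) + defect w = d w"
  shows "\<exists>u. good_basis n u \<and> (\<forall>\<mu>. snd (snd \<mu>) \<noteq> [] \<longrightarrow> u \<mu> = U \<mu>)"
proof -
  have fin: "finite (long_paths n w)" for w
    using finite_apaths[of n w] by (simp add: long_paths_def)
  have "\<forall>w. \<exists>q. w \<in> V n \<longrightarrow> orthonormal (d w) {..<defect w} q \<and>
      (\<forall>a\<in>long_paths n w. \<forall>c<defect w. cdot (d w) (U a) (q c) = 0) \<and>
      (\<forall>i<d w. \<forall>j<d w. outer (long_paths n w) U i j + outer {..<defect w} q i j = (if i = j then 1 else 0))"
    using orthonormal_complement[OF fin U card] by blast
  then obtain q where q: "\<And>w. w \<in> V n \<Longrightarrow> orthonormal (d w) {..<defect w} (q w)"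
      "\<And>w a c. w \<in> V n \<Longrightarrow> a \<in> long_paths n w \<Longrightarrow> c < defect w \<Longrightarrow> cdot (d w) (U a) (q w c) = 0"
      "\<And>w i j. w \<in> V n \<Longrightarrow> i < d w \<Longrightarrow> j < d w \<Longrightarrow>
        outer (long_paths n w) U i j + outer {..<defect w} (q w) i j = (if i = j then 1 else 0)"
    by metis
  define u where "u = (\<lambda>\<mu>. if snd (snd \<mu>) = [] then q (fst \<mu>) (fst (snd \<mu>) - 1) else U \<mu>)"
  have u_long: "u a = U a" if "a \<in> long_paths n w" for a w using that by (simp add: u_def long_paths_def)
  have u_new: "u (w, Suc c, []) = q w c" for w c by (simp add: u_def)
  have "orthonormal (d w) (apaths n w) u" if w: "w \<in> V n" for w
  proof -
    have zero: "cdot (d w) (q w c) (U a) = 0" if "a \<in> long_paths n w" "c < defect w" for a c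
      using q(2)[OF w that] cdot_cnj[of "d w" "U a" "q w c"] by simp
    have ne: "a \<noteq> (w, Suc c, [])" if "a \<in> long_paths n w" for a c using that by (auto simp: long_paths_def)
    show ?thesis
      unfolding orthonormal_def apaths_split(1)[OF w]
      using q(1)[OF w] U[OF w] q(2)[OF w] zero ne ne[symmetric]
      by (auto simp: ball_Un u_long u_new orthonormal_def simp del: split_paired_All split_paired_Ex)
  qed
  moreover have "outer (apaths n w) u i j = (if i = j then 1 else 0)" if w: "w \<in> V n" "i < d w" "j < d w" for w i j
  proof -
    have "outer (apaths n w) u i j = outer (long_paths n w) u i j + outer ((\<lambda>c. (w, Suc c, [])) ` {..<defect w}) u i j"
      unfolding outer_def apaths_split(1)[OF w(1)]
      by (rule sum.union_disjoint) (use fin apaths_split(2)[OF w(1)] in auto)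
    also have "outer (long_paths n w) u i j = outer (long_paths n w) U i j"
      unfolding outer_def by (intro sum.cong) (auto simp: u_long)
    also have "outer ((\<lambda>c. (w, Suc c, [])) ` {..<defect w}) u i j = outer {..<defect w} (q w) i j"
      unfolding outer_def by (subst sum.reindex) (auto simp: inj_on_def u_new)
    finally show ?thesis using q(3)[OF w] by simp
  qed
  ultimately have "good_basis n u" unfolding good_basis_def by blast
  then show ?thesis by (auto simp: u_def)
qed

text \<open>No edge enters the first level, so all \<open>d w\<close> paths are fictitious and there
  is no earlier basis to respect.\<close>

lemma good_basis_0: "\<exists>u. good_basis 0 u"
proof -
  have "long_paths 0 w = {}" for w by (auto simp: long_paths_def apaths_def)
  moreover have "in_arcs E w = {}" if "w \<in> V 0" for w
  proof (rule ccontr)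
    assume "in_arcs E w \<noteq> {}"
    then obtain e where e: "e \<in> arcs E" "head E e = w" by (auto simp: in_arcs_def)
    then obtain m where "tail E e \<in> V m" using verts_levels tail_in_verts by blast
    from arcs_levels[OF e(1) this] e(2) that level_unique show False by blast
  qed
  ultimately show ?thesis
    using extend_to_good_basis[of 0 "\<lambda>_ _. 0"] by (auto simp: orthonormal_def defect_def)
qed

text \<open>Edges \<open>v \<rightarrow> w\<close> number an orthonormal basis of the range, in the block of \<open>w\<close>, of a minimal
  projection of the block of \<open>v\<close>.\<close>

lemma edge_vectors:
  assumes u: "good_basis n u" and m: "\<And>v. v \<in> V n \<Longrightarrow> m v \<in> apaths n v"
  shows "\<exists>G. \<forall>v\<in>V n. \<forall>w\<in>V (Suc n). orthonormal (d w) (out_arcs E v \<inter> in_arcs E w) G \<and>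
    (\<forall>i<d w. \<forall>j<d w. ent (Suc n) (aunit n u (m v) (m v)) w i j = outer (out_arcs E v \<inter> in_arcs E w) G i j)"
proof -
  have "\<forall>v w. \<exists>G. v \<in> V n \<longrightarrow> w \<in> V (Suc n) \<longrightarrow> orthonormal (d w) (out_arcs E v \<inter> in_arcs E w) G \<and>
    (\<forall>i<d w. \<forall>j<d w. ent (Suc n) (aunit n u (m v) (m v)) w i j = outer (out_arcs E v \<inter> in_arcs E w) G i j)"
  proof (intro allI, goal_cases)
    case (1 v w)
    show ?case
    proof (cases "v \<in> V n \<and> w \<in> V (Suc n)")
      case True
      then have v: "v \<in> V n" and w: "w \<in> V (Suc n)" by auto
      define a where "a = aunit n u (m v) (m v)"
      have mp: "m v \<in> paths alabels n" "path_end (m v) = v" using m[OF v] by (auto simp: apaths_def)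
      have a: "a \<in> S n" "star A a = a" "a \<otimes> a = a"
        unfolding a_def using aunit_S aunit_star aunit_mult[OF u mp(1) mp(1) mp(1) mp(1)] by auto
      define I where "I = out_arcs E v \<inter> in_arcs E w"
      have finI: "finite I" using finite_out_arcs[OF v] by (simp add: I_def)
      \<comment> \<open>The trace condition of the diagram, applied to an element with trace 1 in
        its own block and zero in the other blocks of its level.\<close>
      have tr: "(\<Sum>i<d w. ent (Suc n) a w i i) = of_nat (card I)"
      proof -
        have "(\<Sum>i<d v. ent n a v i i) = cdot (d v) (u (m v)) (u (m v))"
          unfolding a_def cdot_def by (intro sum.cong) (use v mp in \<open>auto simp: ent_aunit\<close>)
        also have "\<dots> = 1" using good_basis_cdot[OF u mp(1) mp(1) mp(2) mp(2)] by simp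
        finally show ?thesis
          using ent_trace[OF v w a(1)] mp(2) by (simp add: I_def a_def ent_aunit)
      qed
      have "\<exists>g. orthonormal (d w) {..<card I} g \<and> (\<forall>i<d w. \<forall>j<d w. ent (Suc n) a w i j = outer {..<card I} g i j)"
      proof (rule projection_rank_one_decomposition)
        show "(\<Sum>i<d w. ent (Suc n) a w i i) = of_nat (card I)" by (rule tr)
        fix i j assume ij: "i < d w" "j < d w"
        show "(\<Sum>k<d w. ent (Suc n) a w i k * ent (Suc n) a w k j) = ent (Suc n) a w i j"
          using ent_simps(2)[OF S_Suc[OF a(1)] w ij S_Suc[OF a(1)]] a(3) by simp
        show "cnj (ent (Suc n) a w i j) = ent (Suc n) a w j i"
          using ent_simps(4)[OF S_Suc[OF a(1)] w ij(2,1)] a(2) by simp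
      qed
      then obtain g where g: "orthonormal (d w) {..<card I} g"
          "\<And>i j. i < d w \<Longrightarrow> j < d w \<Longrightarrow> ent (Suc n) a w i j = outer {..<card I} g i j" by blast
      obtain h where h: "bij_betw h I {..<card I}"
        using ex_bij_betw_finite_nat[OF finI] atLeast0LessThan by metis
      have "h b < card I" if "b \<in> I" for b using h that by (auto simp: bij_betw_def)
      moreover have "h a = h b \<longleftrightarrow> a = b" if "a \<in> I" "b \<in> I" for a b
        using h that by (auto simp: bij_betw_def inj_on_def)
      ultimately have "orthonormal (d w) I (g \<circ> h)"
        using g(1) unfolding orthonormal_def by simp
      moreover have "outer {..<card I} g i j = outer I (g \<circ> h) i j" for i j
        unfolding outer_def comp_def by (rule sum.reindex_bij_betw[OF h, symmetric])
      ultimately show ?thesis using g(2) by (auto simp: I_def a_def)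
    qed auto
  qed
  then obtain g where g: "\<And>v w. v \<in> V n \<Longrightarrow> w \<in> V (Suc n) \<Longrightarrow> orthonormal (d w) (out_arcs E v \<inter> in_arcs E w) (g v w)"
      "\<And>v w i j. v \<in> V n \<Longrightarrow> w \<in> V (Suc n) \<Longrightarrow> i < d w \<Longrightarrow> j < d w \<Longrightarrow>
        ent (Suc n) (aunit n u (m v) (m v)) w i j = outer (out_arcs E v \<inter> in_arcs E w) (g v w) i j"
    by metis
  \<comment> \<open>An edge determines its source and its range, so the families for the separate
    pairs of vertices fit together.\<close>
  define G where "G = (\<lambda>e. g (tail E e) (head E e) e)"
  have G: "G e = g v w e" if "e \<in> out_arcs E v \<inter> in_arcs E w" for e v w
    using that by (auto simp: G_def)
  show ?thesis
  proof (intro exI[of _ G] ballI conjI allI impI)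
    fix v w assume vw: "v \<in> V n" "w \<in> V (Suc n)"
    show "orthonormal (d w) (out_arcs E v \<inter> in_arcs E w) G"
      using g(1)[OF vw] unfolding orthonormal_def by (simp add: G del: Int_iff)
    fix i j assume ij: "i < d w" "j < d w"
    have "outer (out_arcs E v \<inter> in_arcs E w) (g v w) i j = outer (out_arcs E v \<inter> in_arcs E w) G i j"
      unfolding outer_def by (rule sum.cong) (simp_all add: G del: Int_iff)
    then show "ent (Suc n) (aunit n u (m v) (m v)) w i j = outer (out_arcs E v \<inter> in_arcs E w) G i j"
      using g(2)[OF vw ij] by simp
  qed
qed

text \<open>The first matrix is moved across the inner product as its adjoint.\<close>

lemma cdot_matrix:
  "cdot k (\<lambda>i. \<Sum>a<k. M i a * x a) (\<lambda>i. \<Sum>b<k. N i b * y b)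
    = cdot k x (\<lambda>a. \<Sum>b<k. (\<Sum>i<k. cnj (M i a) * N i b) * y b)"
proof -
  have "cdot k (\<lambda>i. \<Sum>a<k. M i a * x a) (\<lambda>i. \<Sum>b<k. N i b * y b)
      = (\<Sum>i<k. \<Sum>a<k. \<Sum>b<k. cnj (x a) * (cnj (M i a) * N i b * y b))"
    unfolding cdot_def cnj_sum sum_product by (intro sum.cong refl) (simp add: ac_simps)
  also have "\<dots> = (\<Sum>a<k. \<Sum>i<k. \<Sum>b<k. cnj (x a) * (cnj (M i a) * N i b * y b))" by (rule sum.swap)
  also have "\<dots> = (\<Sum>a<k. \<Sum>b<k. \<Sum>i<k. cnj (x a) * (cnj (M i a) * N i b * y b))"
    by (intro sum.cong refl sum.swap)
  finally show ?thesis by (simp add: cdot_def sum_distrib_left sum_distrib_right)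
qed

lemma finsum_S:
  assumes "finite F" "\<And>e. e \<in> F \<Longrightarrow> f e \<in> S k"
  shows "(\<Oplus>e\<in>F. f e) \<in> S k \<and> (\<forall>w\<in>V k. \<forall>i<d w. \<forall>j<d w. ent k (\<Oplus>e\<in>F. f e) w i j = (\<Sum>e\<in>F. ent k (f e) w i j))"
  using assms
proof (induction F rule: finite_induct)
  case empty
  then show ?case using S_closed(2) ent_zero by simp
next
  case (insert e F)
  then have "(\<Oplus>e\<in>insert e F. f e) = f e \<oplus> (\<Oplus>e\<in>F. f e)"
    using S_closed(1) by (intro M.finsum_insert) auto
  with insert show ?case using S_closed(3)[of "f e" k] by (simp add: ent_simps)
qed

text \<open>Write \<open>\<theta>\<close> for \<open>aunit n u\<close>, let \<open>m\<close> be a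
  reference path to each vertex and \<open>G\<close> the edge vectors of
  \<open>\<theta> m m\<close>. The vector of \<open>\<mu>\<close> extended by \<open>e\<close> is
  \<open>\<theta> \<mu> m\<close> applied to \<open>G e\<close>. Orthonormality follows since
  \<open>\<theta> m \<mu> \<otimes> \<theta> \<nu> m\<close> is zero unless
  \<open>\<mu> = \<nu>\<close>, when it is \<open>\<theta> m m\<close>. The refinement follows from
  \<open>\<theta> \<mu> \<nu> = \<theta> \<mu> m \<otimes> \<theta> m m \<otimes> \<theta> m
  \<nu>\<close>, whose middle factor is the sum of the rank-one projections onto the vectors
  \<open>G e\<close>.\<close>

lemma good_basis_step:
  assumes u: "good_basis n u"
  shows "\<exists>u'. good_basis (Suc n) u' \<and> (\<forall>\<mu>\<in>paths alabels n. \<forall>\<nu>\<in>paths alabels n. path_end \<mu> = path_end \<nu> \<longrightarrow>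
    aunit n u \<mu> \<nu> = (\<Oplus>e\<in>out_arcs E (path_end \<mu>). aunit (Suc n) u' (path_ext \<mu> e) (path_ext \<nu> e)))"
proof -
  have "apaths n v \<noteq> {}" if "v \<in> V n" for v
    using good_basis_card[OF u that] label_pos[OF level_verts[OF that]] by auto
  then have "\<exists>m. \<forall>v\<in>V n. m v \<in> apaths n v"
    by (intro bchoice) blast
  then obtain m where m: "\<And>v. v \<in> V n \<Longrightarrow> m v \<in> apaths n v" by blast
  then have mp: "m v \<in> paths alabels n" "path_end (m v) = v" if "v \<in> V n" for v
    using that by (auto simp: apaths_def)
  obtain G where G: "\<And>v w. v \<in> V n \<Longrightarrow> w \<in> V (Suc n) \<Longrightarrow> orthonormal (d w) (out_arcs E v \<inter> in_arcs E w) G"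
    "\<And>v w i j. v \<in> V n \<Longrightarrow> w \<in> V (Suc n) \<Longrightarrow> i < d w \<Longrightarrow> j < d w \<Longrightarrow>
      ent (Suc n) (aunit n u (m v) (m v)) w i j = outer (out_arcs E v \<inter> in_arcs E w) G i j"
    using edge_vectors[OF u m] by blast
  \<comment> \<open>The matrix, in the block of \<open>w\<close> one level up, of the unit leading
    from the reference path to \<open>\<mu>\<close>.\<close>
  define T where "T = (\<lambda>\<mu> w i. ent (Suc n) (aunit n u \<mu> (m (path_end \<mu>))) w i)"
  \<comment> \<open>The head of the list is the last edge, so \<open>\<kappa>\<close> is taken apart
    as \<open>path_ext \<mu> e\<close>.\<close>
  define U where "U = (\<lambda>\<kappa>. let e = hd (snd (snd \<kappa>)); \<mu> = (fst \<kappa>, fst (snd \<kappa>), tl (snd (snd \<kappa>)))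
    in (\<lambda>i. \<Sum>k<d (head E e). T \<mu> (head E e) i k * G e k))"
  have U_ext: "U (path_ext \<mu> e) = (\<lambda>i. \<Sum>k<d (head E e). T \<mu> (head E e) i k * G e k)" for \<mu> e
    by (cases \<mu>) (simp add: U_def)
  have long: "long_paths (Suc n) w = (\<lambda>(e, \<mu>). path_ext \<mu> e) ` (SIGMA e:in_arcs E w. apaths n (tail E e))" for w
  proof
    show "long_paths (Suc n) w \<subseteq> (\<lambda>(e, \<mu>). path_ext \<mu> e) ` (SIGMA e:in_arcs E w. apaths n (tail E e))"
    proof
      fix \<kappa> assume "\<kappa> \<in> long_paths (Suc n) w"
      then obtain \<mu> e where *: "\<kappa> = path_ext \<mu> e" "\<mu> \<in> paths alabels n" "e \<in> out_arcs E (path_end \<mu>)" "path_end \<kappa> = w"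
        unfolding long_paths_def apaths_def paths.simps by auto
      then have "(e, \<mu>) \<in> (SIGMA e:in_arcs E w. apaths n (tail E e))" by (auto simp: apaths_def)
      with *(1) show "\<kappa> \<in> (\<lambda>(e, \<mu>). path_ext \<mu> e) ` (SIGMA e:in_arcs E w. apaths n (tail E e))"
        by (intro image_eqI[of _ _ "(e, \<mu>)"]) auto
    qed
    show "(\<lambda>(e, \<mu>). path_ext \<mu> e) ` (SIGMA e:in_arcs E w. apaths n (tail E e)) \<subseteq> long_paths (Suc n) w"
    proof
      fix \<kappa> assume "\<kappa> \<in> (\<lambda>(e, \<mu>). path_ext \<mu> e) ` (SIGMA e:in_arcs E w. apaths n (tail E e))"
      then obtain e \<mu> where *: "\<kappa> = path_ext \<mu> e" "e \<in> in_arcs E w" "\<mu> \<in> apaths n (tail E e)" by auto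
      then have "path_ext \<mu> e \<in> paths alabels (Suc n)"
        by (intro path_ext_paths) (auto simp: apaths_def)
      moreover have "snd (snd (path_ext \<mu> e)) \<noteq> []" by (cases \<mu>) simp
      ultimately show "\<kappa> \<in> long_paths (Suc n) w" using * by (simp add: long_paths_def apaths_def)
    qed
  qed
  have tail_level: "tail E e \<in> V n" if "e \<in> in_arcs E w" "w \<in> V (Suc n)" for e w
  proof -
    have e: "e \<in> arcs E" "head E e = w" using that by auto
    obtain k where k: "tail E e \<in> V k" using e verts_levels tail_in_verts by blast
    then have "w \<in> V (Suc k)" using arcs_levels e by blast
    with that(2) level_unique k show ?thesis by blast
  qed
  have U_cdot: "cdot (d w) (U (path_ext \<mu> e)) (U (path_ext \<nu> f)) = (if \<mu> = \<nu> \<and> e = f then 1 else 0)"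
    if w: "w \<in> V (Suc n)" and e: "e \<in> in_arcs E w" "f \<in> in_arcs E w" and \<mu>: "\<mu> \<in> apaths n (tail E e)" and \<nu>: "\<nu> \<in> apaths n (tail E f)"
    for w e f \<mu> \<nu>
  proof -
    have he: "head E e = w" "head E f = w" using e by auto
    have \<mu>p: "\<mu> \<in> paths alabels n" "path_end \<mu> = tail E e" and \<nu>p: "\<nu> \<in> paths alabels n" "path_end \<nu> = tail E f"
      using \<mu> \<nu> by (auto simp: apaths_def)
    note te = tail_level[OF e(1) w] and tf = tail_level[OF e(2) w]
    note me = mp[OF te] and mf = mp[OF tf]
    define a where "a = aunit n u \<mu> (m (tail E e))"
    define b where "b = aunit n u \<nu> (m (tail E f))"
    have ab: "a \<in> S n" "b \<in> S n" by (simp_all add: a_def b_def aunit_S)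
    have sa: "star A a = aunit n u (m (tail E e)) \<mu>" unfolding a_def using me \<mu>p by (intro aunit_star) simp
    have prod: "star A a \<otimes> b = (if \<mu> = \<nu> then aunit n u (m (tail E e)) (m (tail E f)) else \<zero>)"
      unfolding sa b_def using me mf \<mu>p \<nu>p by (intro aunit_mult[OF u]) auto
    have entry: "(\<Sum>i<d w. cnj (T \<mu> w i k) * T \<nu> w i l) = ent (Suc n) (star A a \<otimes> b) w k l" if "k < d w" "l < d w" for k l
      using that w ent_simps[OF S_Suc[OF S_closed(6)[OF ab(1)]] w that] ent_simps(4)[OF S_Suc[OF ab(1)] w] S_Suc[OF ab(2)]
      by (simp add: T_def a_def b_def \<mu>p \<nu>p)
    have "cdot (d w) (U (path_ext \<mu> e)) (U (path_ext \<nu> f))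
        = cdot (d w) (G e) (\<lambda>k. \<Sum>l<d w. (\<Sum>i<d w. cnj (T \<mu> w i k) * T \<nu> w i l) * G f l)"
      unfolding U_ext he by (rule cdot_matrix)
    also have "\<dots> = cdot (d w) (G e) (\<lambda>k. \<Sum>l<d w. ent (Suc n) (star A a \<otimes> b) w k l * G f l)"
      by (intro cdot_cong) (simp_all add: entry)
    also have "\<dots> = (if \<mu> = \<nu> \<and> e = f then 1 else 0)"
    proof (cases "\<mu> = \<nu>")
      case False
      then show ?thesis using ent_zero[OF w] by (simp add: prod cdot_def)
    next
      case True
      define I where "I = out_arcs E (tail E e) \<inter> in_arcs E w"
      have tt: "tail E f = tail E e" using True \<mu>p \<nu>p by simp
      have I: "e \<in> I" "f \<in> I" "finite I" using e tt finite_out_arcs[OF te] by (auto simp: I_def)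
      have oG: "orthonormal (d w) I G" using G(1)[OF te w] by (simp add: I_def)
      have "cdot (d w) (G e) (\<lambda>k. \<Sum>l<d w. ent (Suc n) (star A a \<otimes> b) w k l * G f l)
          = cdot (d w) (G e) (\<lambda>k. \<Sum>l<d w. outer I G k l * G f l)"
        by (intro cdot_cong) (simp_all add: prod True tt G(2)[OF te w] I_def)
      also have "\<dots> = cdot (d w) (G e) (G f)"
        unfolding outer_apply using orthonormal_apply[OF I(3) oG I(2)] by simp
      finally show ?thesis using oG I True by (auto simp: orthonormal_def)
    qed
    finally show ?thesis .
  qed
  have "\<exists>u'. good_basis (Suc n) u' \<and> (\<forall>\<mu>. snd (snd \<mu>) \<noteq> [] \<longrightarrow> u' \<mu> = U \<mu>)"
  proof (rule extend_to_good_basis)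
    fix w assume w: "w \<in> V (Suc n)"
    show "orthonormal (d w) (long_paths (Suc n) w) U"
      unfolding orthonormal_def long using U_cdot[OF w] by (auto simp: path_ext_inject simp del: split_paired_All split_paired_Ex in_in_arcs_conv)
    have "inj_on (\<lambda>(e, \<mu>). path_ext \<mu> e) (SIGMA e:in_arcs E w. apaths n (tail E e))"
      by (auto simp: inj_on_def path_ext_inject simp del: split_paired_All)
    \<comment> \<open>The sources of the entering edges carry \<open>d (tail E e)\<close> paths
      each, and the label inequality leaves exactly \<open>defect w\<close> dimensions.\<close>
    then have "card (long_paths (Suc n) w) = card (SIGMA e:in_arcs E w. apaths n (tail E e))"
      unfolding long by (rule card_image)
    also have "\<dots> = (\<Sum>e\<in>in_arcs E w. card (apaths n (tail E e)))"
      using finite_in_arcs[OF level_verts[OF w]] finite_apaths by (intro card_SigmaI) auto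
    also have "\<dots> = (\<Sum>e\<in>in_arcs E w. d (tail E e))"
      using good_basis_card[OF u] tail_level[OF _ w] by (intro sum.cong) auto
    finally show "card (long_paths (Suc n) w) + defect w = d w"
      using label_ge[OF level_verts[OF w]] by (simp add: defect_def)
  qed
  then obtain u' where u': "good_basis (Suc n) u'" "\<And>\<mu>. snd (snd \<mu>) \<noteq> [] \<Longrightarrow> u' \<mu> = U \<mu>" by blast
  have u'_ext: "u' (path_ext \<mu> e) = U (path_ext \<mu> e)" for \<mu> e by (rule u'(2)) (cases \<mu>; simp)
  have "aunit n u \<mu> \<nu> = (\<Oplus>e\<in>out_arcs E (path_end \<mu>). aunit (Suc n) u' (path_ext \<mu> e) (path_ext \<nu> e))"
    if \<mu>: "\<mu> \<in> paths alabels n" and \<nu>: "\<nu> \<in> paths alabels n" and e: "path_end \<mu> = path_end \<nu>" for \<mu> \<nu>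
  proof (rule ent_inj[of _ "Suc n"])
    define v where "v = path_end \<mu>"
    have v: "v \<in> V n" "path_end \<mu> = v" "path_end \<nu> = v" using path_end_level[OF \<mu>] e by (simp_all add: v_def)
    have fin: "finite (out_arcs E (path_end \<mu>))" using finite_out_arcs v by simp
    note fs = finsum_S[OF fin, of "\<lambda>e. aunit (Suc n) u' (path_ext \<mu> e) (path_ext \<nu> e)" "Suc n", OF aunit_S]
    show "aunit n u \<mu> \<nu> \<in> S (Suc n)" by (intro S_Suc aunit_S)
    show "(\<Oplus>e\<in>out_arcs E (path_end \<mu>). aunit (Suc n) u' (path_ext \<mu> e) (path_ext \<nu> e)) \<in> S (Suc n)"
      using fs by blast
    fix w i j assume w: "w \<in> V (Suc n)" "i < d w" "j < d w"
    define I where "I = out_arcs E v \<inter> in_arcs E w"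
    have "ent (Suc n) (\<Oplus>e\<in>out_arcs E (path_end \<mu>). aunit (Suc n) u' (path_ext \<mu> e) (path_ext \<nu> e)) w i j
        = (\<Sum>e\<in>out_arcs E v. if w = head E e then U (path_ext \<mu> e) i * cnj (U (path_ext \<nu> e) j) else 0)"
      using fs w by (simp add: ent_aunit u'_ext v cong: if_cong)
    also have "\<dots> = (\<Sum>e\<in>I. U (path_ext \<mu> e) i * cnj (U (path_ext \<nu> e) j))"
      using fin v by (intro sum.mono_neutral_cong_right) (auto simp: I_def)
    also have "\<dots> = (\<Sum>e\<in>I. (\<Sum>k<d w. T \<mu> w i k * G e k) * (\<Sum>l<d w. cnj (T \<nu> w j l) * cnj (G e l)))"
      by (intro sum.cong refl) (auto simp: I_def U_ext)
    also have "\<dots> = (\<Sum>e\<in>I. \<Sum>k<d w. \<Sum>l<d w. T \<mu> w i k * (G e k * cnj (G e l)) * cnj (T \<nu> w j l))"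
      unfolding sum_product by (intro sum.cong refl) (simp add: ac_simps)
    also have "\<dots> = (\<Sum>k<d w. \<Sum>e\<in>I. \<Sum>l<d w. T \<mu> w i k * (G e k * cnj (G e l)) * cnj (T \<nu> w j l))"
      by (rule sum.swap)
    also have "\<dots> = (\<Sum>k<d w. \<Sum>l<d w. \<Sum>e\<in>I. T \<mu> w i k * (G e k * cnj (G e l)) * cnj (T \<nu> w j l))"
      by (intro sum.cong refl sum.swap)
    also have "\<dots> = (\<Sum>k<d w. \<Sum>l<d w. T \<mu> w i k * outer I G k l * cnj (T \<nu> w j l))"
      by (simp add: outer_def sum_distrib_left sum_distrib_right)
    also have "\<dots> = (\<Sum>k<d w. \<Sum>l<d w. T \<mu> w i k * ent (Suc n) (aunit n u (m v) (m v)) w k l * cnj (T \<nu> w j l))"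
      using w v by (intro sum.cong refl) (simp add: G(2) I_def)
    also have "\<dots> = (\<Sum>l<d w. (\<Sum>k<d w. T \<mu> w i k * ent (Suc n) (aunit n u (m v) (m v)) w k l) * cnj (T \<nu> w j l))"
      by (subst sum.swap) (simp add: sum_distrib_right)
    also have "\<dots> = (\<Sum>l<d w. ent (Suc n) (aunit n u \<mu> (m v) \<otimes> aunit n u (m v) (m v)) w i l * ent (Suc n) (aunit n u (m v) \<nu>) w l j)"
    proof (intro sum.cong refl arg_cong2[where f = "(*)"])
      fix l assume l: "l \<in> {..<d w}"
      show "(\<Sum>k<d w. T \<mu> w i k * ent (Suc n) (aunit n u (m v) (m v)) w k l)
          = ent (Suc n) (aunit n u \<mu> (m v) \<otimes> aunit n u (m v) (m v)) w i l"
        using l w S_Suc[OF aunit_S] by (simp add: ent_simps T_def v)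
      have "aunit n u (m v) \<nu> = star A (aunit n u \<nu> (m v))"
        using mp[OF v(1)] v by (intro aunit_star[symmetric]) simp
      then show "cnj (T \<nu> w j l) = ent (Suc n) (aunit n u (m v) \<nu>) w l j"
        using l w S_Suc[OF aunit_S] by (simp add: ent_simps T_def v)
    qed
    also have "\<dots> = ent (Suc n) (aunit n u \<mu> (m v) \<otimes> aunit n u (m v) (m v) \<otimes> aunit n u (m v) \<nu>) w i j"
      using ent_simps(2)[OF S_Suc[OF S_closed(5)[OF aunit_S aunit_S]] w S_Suc[OF aunit_S]] by simp
    also have "aunit n u \<mu> (m v) \<otimes> aunit n u (m v) (m v) = aunit n u \<mu> (m v)"
      using mp[OF v(1)] v \<mu> by (simp add: aunit_mult[OF u])
    also have "aunit n u \<mu> (m v) \<otimes> aunit n u (m v) \<nu> = aunit n u \<mu> \<nu>"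
      using mp[OF v(1)] v \<mu> \<nu> by (simp add: aunit_mult[OF u])
    finally show "ent (Suc n) (aunit n u \<mu> \<nu>) w i j =
      ent (Suc n) (\<Oplus>e\<in>out_arcs E (path_end \<mu>). aunit (Suc n) u' (path_ext \<mu> e) (path_ext \<nu> e)) w i j" ..
  qed
  then show ?thesis using u'(1) by blast
qed

text \<open>The basis of the block of \<open>v\<close> has \<open>d v > 0\<close> members. Such
  paths later make the bimodule full over the graph algebra.\<close>

lemma ex_apath:
  assumes v: "v \<in> V n" shows "\<exists>\<mu>\<in>paths alabels n. path_end \<mu> = v"
proof -
  have "\<exists>u. good_basis n u"
  proof (induction n)
    case 0
    show ?case by (rule good_basis_0)
  next
    case (Suc n)
    then obtain u where "good_basis n u" ..
    from good_basis_step[OF this] show ?case by blast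
  qed
  then obtain u where "good_basis n u" ..
  then have "card (apaths n v) = d v" using v by (rule good_basis_card)
  then have "apaths n v \<noteq> {}" using label_pos[OF level_verts[OF v]] by auto
  then show ?thesis unfolding apaths_def by blast
qed

text \<open>Expansion on both sides in the basis \<open>u\<close>: the coefficient at
  \<open>(\<mu>, \<nu>)\<close> is the inner product of \<open>u \<mu>\<close> with \<open>a\<close>
  applied to \<open>u \<nu>\<close>.\<close>

lemma aunit_span:
  assumes u: "good_basis n u" and a: "a \<in> S n"
  shows "\<exists>c. a = (\<Oplus>x\<in>{(\<mu>, \<nu>). \<mu> \<in> paths alabels n \<and> \<nu> \<in> paths alabels n \<and> path_end \<mu> = path_end \<nu>}.
    c x \<odot> aunit n u (fst x) (snd x))"
proof -
  define I where "I = {(\<mu>, \<nu>). \<mu> \<in> paths alabels n \<and> \<nu> \<in> paths alabels n \<and> path_end \<mu> = path_end \<nu>}"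
  have finP: "finite (paths alabels n)" by (rule finite_paths) (simp add: alabels_def)
  have finI: "finite I" unfolding I_def by (rule finite_subset[of _ "paths alabels n \<times> paths alabels n"]) (auto simp: finP)
  define y where "y = (\<lambda>\<nu> k. \<Sum>l<d (path_end \<nu>). ent n a (path_end \<nu>) k l * u \<nu> l)"
  define c where "c = (\<lambda>x. cdot (d (path_end (snd x))) (u (fst x)) (y (snd x)))"
  have "a = (\<Oplus>x\<in>I. c x \<odot> aunit n u (fst x) (snd x))"
  proof (rule ent_inj[OF a])
    have cS: "c x \<odot> aunit n u (fst x) (snd x) \<in> S n" for x by (intro S_closed aunit_S)
    note fs = finsum_S[OF finI, of "\<lambda>x. c x \<odot> aunit n u (fst x) (snd x)", OF cS]
    show "(\<Oplus>x\<in>I. c x \<odot> aunit n u (fst x) (snd x)) \<in> S n" using fs by blast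
    fix w i j assume w: "w \<in> V n" "i < d w" "j < d w"
    have outer: "outer (apaths n w) u k l = (if k = l then 1 else 0)" if "k < d w" "l < d w" for k l
      using u w that by (simp add: good_basis_def)
    have "ent n (\<Oplus>x\<in>I. c x \<odot> aunit n u (fst x) (snd x)) w i j
        = (\<Sum>x\<in>I. if path_end (fst x) = w then c x * (u (fst x) i * cnj (u (snd x) j)) else 0)"
      using fs w aunit_S by (simp add: ent_simps) (auto simp: ent_aunit intro!: sum.cong)
    also have "\<dots> = (\<Sum>x\<in>apaths n w \<times> apaths n w. c x * (u (fst x) i * cnj (u (snd x) j)))"
      using finI by (intro sum.mono_neutral_cong_right) (auto simp: I_def apaths_def simp del: split_paired_All split_paired_Ex)
    also have "\<dots> = (\<Sum>\<mu>\<in>apaths n w. \<Sum>\<nu>\<in>apaths n w. c (\<mu>, \<nu>) * (u \<mu> i * cnj (u \<nu> j)))"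
      by (simp add: sum.cartesian_product case_prod_beta)
    also have "\<dots> = (\<Sum>\<nu>\<in>apaths n w. \<Sum>\<mu>\<in>apaths n w. c (\<mu>, \<nu>) * (u \<mu> i * cnj (u \<nu> j)))" by (rule sum.swap)
    also have "\<dots> = (\<Sum>\<nu>\<in>apaths n w. (\<Sum>\<mu>\<in>apaths n w. u \<mu> i * cdot (d w) (u \<mu>) (y \<nu>)) * cnj (u \<nu> j))"
      unfolding sum_distrib_right by (intro sum.cong refl) (auto simp: c_def apaths_def)
    also have "\<dots> = (\<Sum>\<nu>\<in>apaths n w. y \<nu> i * cnj (u \<nu> j))"
    proof (intro sum.cong refl arg_cong2[where f = "(*)"])
      fix \<nu>
      have "(\<Sum>k<d w. outer (apaths n w) u i k * y \<nu> k) = (\<Sum>k<d w. if i = k then y \<nu> k else 0)"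
        using w by (intro sum.cong refl) (auto simp: outer)
      then show "(\<Sum>\<mu>\<in>apaths n w. u \<mu> i * cdot (d w) (u \<mu>) (y \<nu>)) = y \<nu> i"
        unfolding outer_apply using w by simp
    qed
    also have "\<dots> = (\<Sum>\<nu>\<in>apaths n w. \<Sum>l<d w. ent n a w i l * (u \<nu> l * cnj (u \<nu> j)))"
      by (intro sum.cong refl) (auto simp: y_def apaths_def sum_distrib_right mult.assoc)
    also have "\<dots> = (\<Sum>l<d w. \<Sum>\<nu>\<in>apaths n w. ent n a w i l * (u \<nu> l * cnj (u \<nu> j)))" by (rule sum.swap)
    also have "\<dots> = (\<Sum>l<d w. ent n a w i l * outer (apaths n w) u l j)"
      by (simp add: outer_def sum_distrib_left)
    also have "\<dots> = (\<Sum>l<d w. if l = j then ent n a w i j else 0)"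
      using w by (intro sum.cong refl) (auto simp: outer)
    also have "\<dots> = ent n a w i j" using w by simp
    finally show "ent n a w i j = ent n (\<Oplus>x\<in>I. c x \<odot> aunit n u (fst x) (snd x)) w i j" ..
  qed
  then show ?thesis unfolding I_def by blast
qed

lemma subalgebra_finsum:
  assumes "cstar_subalgebra S' A" "finite F" "\<And>i. i \<in> F \<Longrightarrow> f i \<in> S'" shows "(\<Oplus>i\<in>F. f i) \<in> S'"
  using assms(2,3)
proof (induction F rule: finite_induct)
  case empty
  then show ?case using assms(1) by (simp add: cstar_subalgebra_def)
next
  case (insert i F)
  then have "(\<Oplus>i\<in>insert i F. f i) = f i \<oplus> (\<Oplus>i\<in>F. f i)"
    using assms(1) by (intro M.finsum_insert) (auto simp: cstar_subalgebra_def)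
  with insert show ?case using assms(1) by (simp add: cstar_subalgebra_def)
qed

text \<open>The bases of successive levels are chosen dependently, each compatible with its
  predecessor. The units generate because they span every \<open>S n\<close>, and the union of these
  is dense.\<close>

theorem algebra_unit_system:
  "\<exists>\<theta>. unit_system A (paths alabels) path_end (out_arcs E) path_ext \<theta> \<and>
    (\<forall>S'. cstar_subalgebra S' A \<longrightarrow>
      (\<forall>n. \<forall>\<mu>\<in>paths alabels n. \<forall>\<nu>\<in>paths alabels n. path_end \<mu> = path_end \<nu> \<longrightarrow> \<theta> \<mu> \<nu> \<in> S') \<longrightarrow> S' = carrier A)"
proof -
  have "\<exists>u. \<forall>n. good_basis n (u n) \<and> (\<forall>\<mu>\<in>paths alabels n. \<forall>\<nu>\<in>paths alabels n. path_end \<mu> = path_end \<nu> \<longrightarrow>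
    aunit n (u n) \<mu> \<nu> = (\<Oplus>e\<in>out_arcs E (path_end \<mu>). aunit (Suc n) (u (Suc n)) (path_ext \<mu> e) (path_ext \<nu> e)))"
    by (rule dependent_nat_choice) (use good_basis_0 good_basis_step in blast)+
  then obtain u where u: "\<And>n. good_basis n (u n)"
    and refine: "\<And>n \<mu> \<nu>. \<mu> \<in> paths alabels n \<Longrightarrow> \<nu> \<in> paths alabels n \<Longrightarrow> path_end \<mu> = path_end \<nu> \<Longrightarrow>
      aunit n (u n) \<mu> \<nu> = (\<Oplus>e\<in>out_arcs E (path_end \<mu>). aunit (Suc n) (u (Suc n)) (path_ext \<mu> e) (path_ext \<nu> e))"
    by blast
  \<comment> \<open>Units must be indexed by paths alone; the level is recovered from the end of the
    path, as levels are disjoint.\<close>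
  define lev where "lev = (\<lambda>\<mu>. THE n. path_end \<mu> \<in> V n)"
  have lev: "lev \<mu> = n" if "\<mu> \<in> paths alabels n" for \<mu> n
    unfolding lev_def using path_end_level[OF that] level_unique by blast
  define \<theta> where "\<theta> = (\<lambda>\<mu>. aunit (lev \<mu>) (u (lev \<mu>)) \<mu>)"
  have \<theta>: "\<theta> \<mu> = aunit n (u n) \<mu>" if "\<mu> \<in> paths alabels n" for \<mu> n
    using lev[OF that] by (simp add: \<theta>_def)
  have "unit_system A (paths alabels) path_end (out_arcs E) path_ext \<theta>"
  proof (unfold_locales)
    fix n \<mu> \<nu> assume \<mu>: "\<mu> \<in> paths alabels n"
    show fin: "finite (out_arcs E (path_end \<mu>))" using finite_out_arcs path_end_level[OF \<mu>] by blast
    show "\<theta> \<mu> \<mu> \<noteq> \<zero>" using aunit_nonzero[OF u \<mu>] \<theta>[OF \<mu>] by simp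
    show ext: "path_ext \<mu> e \<in> paths alabels (Suc n)" if "e \<in> out_arcs E (path_end \<mu>)" for e
      using path_ext_paths[OF \<mu> that] .
    assume \<nu>: "\<nu> \<in> paths alabels n" and e: "path_end \<mu> = path_end \<nu>"
    show "\<theta> \<mu> \<nu> \<in> carrier A" using S_closed(1)[OF aunit_S] \<theta>[OF \<mu>] by simp
    show "star A (\<theta> \<mu> \<nu>) = \<theta> \<nu> \<mu>" using aunit_star[OF e] \<theta>[OF \<mu>] \<theta>[OF \<nu>] by simp
    show "\<theta> \<mu> \<nu> = (\<Oplus>e\<in>out_arcs E (path_end \<mu>). \<theta> (path_ext \<mu> e) (path_ext \<nu> e))"
      unfolding \<theta>[OF \<mu>] refine[OF \<mu> \<nu> e]
      using \<theta>[OF ext] S_closed(1)[OF aunit_S] by (intro M.finsum_cong') auto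
    fix \<rho> \<sigma> assume \<rho>: "\<rho> \<in> paths alabels n" and \<sigma>: "\<sigma> \<in> paths alabels n" and e': "path_end \<rho> = path_end \<sigma>"
    show "\<theta> \<mu> \<nu> \<otimes> \<theta> \<rho> \<sigma> = (if \<nu> = \<rho> then \<theta> \<mu> \<sigma> else \<zero>)"
      unfolding \<theta>[OF \<mu>] \<theta>[OF \<rho>] by (rule aunit_mult[OF u \<mu> \<nu> \<rho> \<sigma> e e'])
  qed (use finite_paths[of alabels] in \<open>auto simp: alabels_def\<close>)
  moreover have "S' = carrier A"
    if S': "cstar_subalgebra S' A" and mem: "\<And>n \<mu> \<nu>. \<mu> \<in> paths alabels n \<Longrightarrow> \<nu> \<in> paths alabels n \<Longrightarrow> path_end \<mu> = path_end \<nu> \<Longrightarrow> \<theta> \<mu> \<nu> \<in> S'"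
    for S'
  proof -
    have "a \<in> S'" if a: "a \<in> S n" for a n
    proof -
      define I where "I = {(\<mu>, \<nu>). \<mu> \<in> paths alabels n \<and> \<nu> \<in> paths alabels n \<and> path_end \<mu> = path_end \<nu>}"
      have "finite (paths alabels n)" by (rule finite_paths) (simp add: alabels_def)
      then have "finite (paths alabels n \<times> paths alabels n)" by blast
      moreover have "I \<subseteq> paths alabels n \<times> paths alabels n" unfolding I_def by blast
      ultimately have fin: "finite I" by (rule finite_subset[rotated])
      from aunit_span[OF u a, folded I_def]
      obtain c where a_eq: "a = (\<Oplus>x\<in>I. c x \<odot> aunit n (u n) (fst x) (snd x))" ..
      have "c x \<odot> aunit n (u n) (fst x) (snd x) \<in> S'" if "x \<in> I" for x
      proof -
        have "\<theta> (fst x) (snd x) \<in> S'" using that by (intro mem[of _ n]) (auto simp: I_def simp del: split_paired_All)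
        moreover have "fst x \<in> paths alabels n" using that by (auto simp: I_def simp del: split_paired_All)
        ultimately show ?thesis using S' \<theta>[of "fst x" n] by (simp add: cstar_subalgebra_def)
      qed
      then show "a \<in> S'" unfolding a_eq by (rule subalgebra_finsum[OF S' fin])
    qed
    then have sub: "(\<Union>n. S n) \<subseteq> S'" by (rule UN_least[OF subsetI])
    have "a \<in> norm_closure A S'" if "a \<in> norm_closure A (\<Union>n. S n)" for a
    proof -
      have "\<exists>y\<in>S'. nrm A (a \<ominus> y) < e" if e: "0 < e" for e
      proof -
        have "\<exists>y\<in>\<Union>n. S n. nrm A (a \<ominus> y) < e"
          using \<open>a \<in> norm_closure A (\<Union>n. S n)\<close> e unfolding norm_closure_def by simp
        then show ?thesis using sub by blast
      qed
      then show ?thesis using that by (simp add: norm_closure_def)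
    qed
    then have "carrier A \<subseteq> norm_closure A S'" using dense_union by blast
    moreover have "norm_closure A S' \<subseteq> S'" "S' \<subseteq> carrier A" using S' by (simp_all add: cstar_subalgebra_def)
    ultimately show "S' = carrier A" by (intro subset_antisym) (blast, blast)
  qed
  ultimately show ?thesis by blast
qed

end

section \<open>The graph algebra\<close>

text \<open>\<open>p_nonzero\<close> is the consequence of universality that keeps the matrix units
  from collapsing.\<close>

locale ck_algebra = cstar_algebra B + bratteli_paths E V d
  for B :: "'b cstar" (structure) and E :: "('v, 'e) pre_digraph" and V :: "nat \<Rightarrow> 'v set" and d :: "'v \<Rightarrow> nat" +
  fixes p :: "'v \<Rightarrow> 'b" and s :: "'e \<Rightarrow> 'b"
  assumes ck: "ck_family E B p s"
    and generated: "\<And>S. cstar_subalgebra S B \<Longrightarrow> p ` verts E \<subseteq> S \<Longrightarrow> s ` arcs E \<subseteq> S \<Longrightarrow> S = carrier B"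
    and p_nonzero: "v \<in> verts E \<Longrightarrow> p v \<noteq> \<zero>"
begin

section \<open>Consequences of the Cuntz-Krieger relations\<close>

lemma p_props:
  assumes "v \<in> verts E" shows "p v \<in> carrier B" "p v \<otimes> p v = p v" "star B (p v) = p v"
  using ck assms by (auto simp: ck_family_def)

lemma p_orthogonal: "v \<in> verts E \<Longrightarrow> w \<in> verts E \<Longrightarrow> v \<noteq> w \<Longrightarrow> p v \<otimes> p w = \<zero>"
  using ck by (auto simp: ck_family_def)

lemma s_props:
  assumes "e \<in> arcs E"
  shows "s e \<in> carrier B" "s e \<otimes> star B (s e) \<otimes> s e = s e" "star B (s e) \<otimes> s e = p (head E e)"
  using ck assms by (auto simp: ck_family_def)

lemma p_sum: "v \<in> verts E \<Longrightarrow> p v = (\<Oplus>e\<in>out_arcs E v. s e \<otimes> star B (s e))"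
  using ck no_sink by (auto simp: ck_family_def)

lemma finite_out: "v \<in> verts E \<Longrightarrow> finite (out_arcs E v)"
  using finite_out_arcs verts_levels by blast

lemma out_arcs_props: "e \<in> out_arcs E v \<Longrightarrow> e \<in> arcs E \<and> tail E e = v \<and> head E e \<in> verts E \<and> v \<in> verts E"
  using head_in_verts tail_in_verts by auto

definition range_proj :: "'e \<Rightarrow> 'b" where "range_proj e = s e \<otimes> star B (s e)"

lemma range_proj: "e \<in> arcs E \<Longrightarrow> projection (range_proj e)"
  using s_props[of e] unfolding projection_def range_proj_def
  by (simp add: star_mult star_star mult_assoc[symmetric])

lemma range_proj_s: "e \<in> arcs E \<Longrightarrow> range_proj e \<otimes> s e = s e"
  using s_props by (simp add: range_proj_def)

text \<open>The range projections of the edges leaving \<open>v\<close> add up to the projection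
  \<open>p v\<close>, which forces them to be orthogonal.\<close>

lemma range_proj_orthogonal:
  assumes e: "e \<in> out_arcs E v" and f: "f \<in> out_arcs E v" and "e \<noteq> f"
  shows "range_proj e \<otimes> range_proj f = \<zero>"
proof -
  have v: "v \<in> verts E" using out_arcs_props[OF e] by simp
  have "projection (\<Oplus>e\<in>out_arcs E v. range_proj e)"
    using p_props[OF v] p_sum[OF v] by (simp add: projection_def range_proj_def)
  from projections_orthogonal[OF finite_out[OF v] range_proj this e f \<open>e \<noteq> f\<close>] show ?thesis
    using out_arcs_props by blast
qed

text \<open>In the expansion of \<open>p v\<close> over the edges leaving \<open>v\<close>, every
  term except that of \<open>e\<close> annihilates \<open>s e\<close>.\<close>

lemma p_s: assumes e: "e \<in> arcs E" shows "p (tail E e) \<otimes> s e = s e"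
proof -
  define v where "v = tail E e"
  have ev: "e \<in> out_arcs E v" using e by (simp add: v_def)
  have v: "v \<in> verts E" using out_arcs_props[OF ev] by simp
  have fc: "range_proj f \<in> carrier B" "s f \<in> carrier B" if "f \<in> out_arcs E v" for f
    using range_proj[of f] s_props(1)[of f] out_arcs_props[OF that] by (auto simp: projection_def)
  have "p v \<otimes> s e = (\<Oplus>f\<in>out_arcs E v. range_proj f \<otimes> s e)"
    unfolding p_sum[OF v] range_proj_def[symmetric] using finite_out[OF v] fc ev by (intro finsum_mult_r) auto
  also have "\<dots> = range_proj e \<otimes> s e"
  proof (rule finsum_single[OF finite_out[OF v] ev])
    fix f assume f: "f \<in> out_arcs E v" "f \<noteq> e"
    have "range_proj f \<otimes> s e = range_proj f \<otimes> range_proj e \<otimes> s e"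
      using fc[OF f(1)] fc[OF ev] range_proj_s[OF e] by (simp add: mult_assoc)
    then show "range_proj f \<otimes> s e = \<zero>"
      using range_proj_orthogonal[OF f(1) ev f(2)] fc[OF ev] by simp
  qed (use fc[OF ev] in auto)
  finally show ?thesis using range_proj_s[OF e] by (simp add: v_def)
qed

lemma s_p: assumes e: "e \<in> arcs E" shows "s e \<otimes> p (head E e) = s e"
  using s_props[OF e] mult_assoc[of "s e" "star B (s e)" "s e"] by simp

text \<open>Edges with a common source have orthogonal range projections; for different sources
  these lie under orthogonal vertex projections.\<close>

lemma star_s_s:
  assumes e: "e \<in> arcs E" and f: "f \<in> arcs E"
  shows "star B (s e) \<otimes> s f = (if e = f then p (head E e) else \<zero>)"
proof (cases "e = f")
  case True
  then show ?thesis using s_props(3)[OF e] by simp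
next
  case ne: False
  note c = s_props(1)[OF e] s_props(1)[OF f]
  show ?thesis
  proof (cases "tail E e = tail E f")
    case True
    have "star B (s e) = star B (s e) \<otimes> range_proj e"
      using s_props[OF e] by (metis range_proj_def mult_assoc mult_closed star_closed star_mult star_star)
    then have "star B (s e) \<otimes> s f = star B (s e) \<otimes> range_proj e \<otimes> (range_proj f \<otimes> s f)"
      using range_proj_s[OF f] by simp
    also have "\<dots> = star B (s e) \<otimes> (range_proj e \<otimes> range_proj f) \<otimes> s f"
      using c by (simp add: range_proj_def mult_assoc)
    also have "\<dots> = \<zero>"
      using range_proj_orthogonal[of e "tail E e" f] e f True ne c by simp
    finally show ?thesis using ne by simp
  next
    case False
    have v: "tail E e \<in> verts E" "tail E f \<in> verts E" using e f by auto
    have "star B (s e) \<otimes> s f = star B (p (tail E e) \<otimes> s e) \<otimes> (p (tail E f) \<otimes> s f)"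
      using p_s[OF e] p_s[OF f] by simp
    also have "\<dots> = star B (s e) \<otimes> (p (tail E e) \<otimes> p (tail E f)) \<otimes> s f"
      using c p_props[OF v(1)] p_props[OF v(2)] by (simp add: star_mult mult_assoc)
    also have "\<dots> = \<zero>" using p_orthogonal[OF v False] c by simp
    finally show ?thesis using ne by simp
  qed
qed

text \<open>The product of the edges in the order in which the path runs: the last edge stands first
  in the list and is the right factor.\<close>

fun path_elem :: "('v, 'e) path \<Rightarrow> 'b" where
  "path_elem (v, c, []) = p v"
| "path_elem (v, c, e # l) = path_elem (v, c, l) \<otimes> s e"

lemma path_elem_ext: "path_elem (path_ext \<mu> e) = path_elem \<mu> \<otimes> s e"
  by (cases \<mu>) simp

text \<open>A single label, so these are the paths of \<open>E\<close>, with arbitrary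
  start.\<close>

definition blabels :: "'v \<Rightarrow> nat set" where "blabels v = {0}"

lemma bpath_cases:
  assumes "\<mu> \<in> paths blabels n"
  obtains v where "\<mu> = (v, 0, [])" "v \<in> V n"
    | m \<nu> e where "n = Suc m" "\<mu> = path_ext \<nu> e" "\<nu> \<in> paths blabels m" "e \<in> out_arcs E (path_end \<nu>)"
  using assms by (cases n) (auto simp: blabels_def)

lemma path_elem_closed: "\<mu> \<in> paths blabels n \<Longrightarrow> path_elem \<mu> \<in> carrier B"
proof (induction n arbitrary: \<mu>)
  case 0
  then show ?case using p_props level_verts by auto
next
  case (Suc n)
  from Suc.prems show ?case
    by (cases rule: bpath_cases) (use Suc.IH p_props(1) level_verts s_props(1) in \<open>auto simp: path_elem_ext\<close>)
qed

lemma path_elem_end: assumes "\<mu> \<in> paths blabels n" shows "path_elem \<mu> \<otimes> p (path_end \<mu>) = path_elem \<mu>"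
  using assms
proof (cases rule: bpath_cases)
  case 1
  then show ?thesis using p_props level_verts by simp
next
  case (2 m \<nu> e)
  have e: "e \<in> arcs E" "head E e \<in> verts E" using 2 by auto
  show ?thesis
    using 2 path_elem_closed[OF 2(3)] s_props(1)[OF e(1)] p_props(1)[OF e(2)] s_p[OF e(1)]
    by (simp add: path_elem_ext mult_assoc)
qed

lemma path_elem_start: "\<mu> \<in> paths blabels n \<Longrightarrow> p (fst \<mu>) \<otimes> path_elem \<mu> = path_elem \<mu> \<and> fst \<mu> \<in> verts E"
proof (induction n arbitrary: \<mu>)
  case 0
  then show ?case using p_props level_verts by auto
next
  case (Suc n)
  from Suc.prems show ?case
  proof (cases rule: bpath_cases)
    case 1
    then show ?thesis using p_props level_verts by auto
  next
    case (2 m \<nu> e)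
    have "fst \<mu> = fst \<nu>" using 2 by (cases \<nu>) simp
    moreover have "\<nu> \<in> paths blabels n" using 2 by simp
    moreover have "s e \<in> carrier B" using 2 s_props(1) by auto
    ultimately show ?thesis
      using Suc.IH[of \<nu>] 2 path_elem_closed[of \<nu> n] p_props(1)[of "fst \<nu>"]
      by (simp add: path_elem_ext mult_assoc[symmetric])
  qed
qed

text \<open>Induction on the level. Removing the last edges leads to
  \<open>star B (s e) \<otimes> s f\<close> if the shortened paths agree and to zero otherwise. A
  trivial path and a proper one start on different levels, hence under orthogonal vertex
  projections.\<close>

lemma path_elem_star_mult:
  "\<mu> \<in> paths blabels n \<Longrightarrow> \<nu> \<in> paths blabels n \<Longrightarrow>
    star B (path_elem \<mu>) \<otimes> path_elem \<nu> = (if \<mu> = \<nu> then p (path_end \<mu>) else \<zero>)"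
proof (induction n arbitrary: \<mu> \<nu>)
  case 0
  then obtain v w where "\<mu> = (v, 0, [])" "\<nu> = (w, 0, [])" "v \<in> verts E" "w \<in> verts E"
    using level_verts by (auto simp: blabels_def)
  then show ?case using p_props[of v] p_orthogonal[of v w] by (cases "v = w") auto
next
  case (Suc n)
  have start: "star B (path_elem \<kappa>) \<otimes> path_elem \<kappa>' = \<zero>"
    if "\<kappa> \<in> paths blabels (Suc n)" "\<kappa>' \<in> paths blabels (Suc n)" "fst \<kappa> \<noteq> fst \<kappa>'" for \<kappa> \<kappa>'
  proof -
    note * = path_elem_start[OF that(1)] path_elem_start[OF that(2)] path_elem_closed[OF that(1)] path_elem_closed[OF that(2)]
    have "star B (path_elem \<kappa>) \<otimes> path_elem \<kappa>' = star B (p (fst \<kappa>) \<otimes> path_elem \<kappa>) \<otimes> (p (fst \<kappa>') \<otimes> path_elem \<kappa>')"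
      using * by simp
    also have "\<dots> = star B (path_elem \<kappa>) \<otimes> (p (fst \<kappa>) \<otimes> p (fst \<kappa>')) \<otimes> path_elem \<kappa>'"
    proof -
      have q: "p (fst \<kappa>) \<in> carrier B" "star B (p (fst \<kappa>)) = p (fst \<kappa>)" "p (fst \<kappa>') \<in> carrier B"
        using * p_props by auto
      show ?thesis using q *(3,4) by (simp add: star_mult mult_assoc)
    qed
    also have "\<dots> = \<zero>" using * p_orthogonal[of "fst \<kappa>" "fst \<kappa>'"] that by simp
    finally show ?thesis .
  qed
  have level: "fst \<kappa> \<notin> V (Suc n)" if "\<kappa> \<in> paths blabels n" for \<kappa>
    using path_length[of "fst \<kappa>" "fst (snd \<kappa>)" "snd (snd \<kappa>)" blabels n] that level_unique by fastforce
  have fst_ext: "fst (path_ext \<kappa> e) = fst \<kappa>" for \<kappa> e by (cases \<kappa>) simp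
  from Suc.prems(1) show ?case
  proof (cases rule: bpath_cases)
    case (1 v)
    from Suc.prems(2) show ?thesis
    proof (cases rule: bpath_cases)
      case (1 w)
      then show ?thesis using \<open>\<mu> = (v, 0, [])\<close> \<open>v \<in> V (Suc n)\<close> p_props p_orthogonal level_verts by auto
    next
      case (2 m \<kappa> e)
      then have "fst \<mu> \<noteq> fst \<nu>" using level[of \<kappa>] \<open>\<mu> = (v, 0, [])\<close> \<open>v \<in> V (Suc n)\<close> by (auto simp: fst_ext)
      with start[OF Suc.prems] show ?thesis by auto
    qed
  next
    case (2 m \<kappa> e)
    then have \<kappa>: "\<kappa> \<in> paths blabels n" by simp
    from Suc.prems(2) show ?thesis
    proof (cases rule: bpath_cases)
      case (1 w)
      then have "fst \<mu> \<noteq> fst \<nu>" using level[OF \<kappa>] 2 by (auto simp: fst_ext)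
      with start[OF Suc.prems] show ?thesis by auto
    next
      case (2 m' \<tau> f)
      then have \<tau>: "\<tau> \<in> paths blabels n" by simp
      have ef: "e \<in> arcs E" "f \<in> arcs E" "tail E e = path_end \<kappa>" "tail E f = path_end \<tau>"
        using \<open>e \<in> out_arcs E (path_end \<kappa>)\<close> 2 by auto
      note c = path_elem_closed[OF \<kappa>] path_elem_closed[OF \<tau>] s_props(1)[OF ef(1)] s_props(1)[OF ef(2)]
      have "star B (path_elem \<mu>) \<otimes> path_elem \<nu> = star B (s e) \<otimes> (star B (path_elem \<kappa>) \<otimes> path_elem \<tau>) \<otimes> s f"
        using \<open>\<mu> = path_ext \<kappa> e\<close> 2 c by (simp add: path_elem_ext star_mult mult_assoc)
      also have "\<dots> = (if \<kappa> = \<tau> then star B (s e) \<otimes> s f else \<zero>)"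
      proof (cases "\<kappa> = \<tau>")
        case True
        have "p (path_end \<tau>) \<otimes> s f = s f" using p_s[OF ef(2)] ef(4) by simp
        moreover have "p (path_end \<tau>) \<in> carrier B" using p_props(1) level_verts path_end_level[OF \<tau>] by blast
        ultimately show ?thesis using Suc.IH[OF \<kappa> \<tau>] True c by (simp add: mult_assoc)
      qed (use Suc.IH[OF \<kappa> \<tau>] c in simp)
      also have "\<dots> = (if \<mu> = \<nu> then p (path_end \<mu>) else \<zero>)"
        using star_s_s[OF ef(1,2)] \<open>\<mu> = path_ext \<kappa> e\<close> 2 by (auto simp: path_ext_inject simp del: split_paired_All)
      finally show ?thesis .
    qed
  qed
qed

definition bunit :: "('v, 'e) path \<Rightarrow> ('v, 'e) path \<Rightarrow> 'b" where
  "bunit \<mu> \<nu> = path_elem \<mu> \<otimes> star B (path_elem \<nu>)"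

text \<open>Refinement comes from inserting the Cuntz-Krieger sum for
  \<open>p (path_end \<mu>)\<close> between the two factors. A vanishing unit would force
  \<open>path_elem \<mu> = \<zero>\<close> and with it
  \<open>p (path_end \<mu>) = \<zero>\<close>.\<close>

lemma unit_system_bunit: "unit_system B (paths blabels) path_end (out_arcs E) path_ext bunit"
proof (unfold_locales)
  fix n \<mu> \<nu> assume \<mu>: "\<mu> \<in> paths blabels n"
  have v: "path_end \<mu> \<in> V n" "path_end \<mu> \<in> verts E" using path_end_level[OF \<mu>] level_verts by auto
  note c\<mu> = path_elem_closed[OF \<mu>]
  show fin: "finite (out_arcs E (path_end \<mu>))" using finite_out_arcs v by blast
  show "bunit \<mu> \<mu> \<noteq> \<zero>"
  proof
    assume "bunit \<mu> \<mu> = \<zero>"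
    then have "star B (star B (path_elem \<mu>)) \<otimes> star B (path_elem \<mu>) = \<zero>"
      using c\<mu> by (simp add: bunit_def star_star)
    then have "star B (path_elem \<mu>) = \<zero>"
      by (rule star_mult_self_eq_zero[rotated]) (use c\<mu> in simp)
    then have "star B (path_elem \<mu>) \<otimes> path_elem \<mu> = \<zero>" using c\<mu> by simp
    then show False using path_elem_star_mult[OF \<mu> \<mu>] p_nonzero[OF v(2)] by simp
  qed
  show "path_ext \<mu> e \<in> paths blabels (Suc n)" if "e \<in> out_arcs E (path_end \<mu>)" for e
    using path_ext_paths[OF \<mu> that] .
  assume \<nu>: "\<nu> \<in> paths blabels n" and e: "path_end \<mu> = path_end \<nu>"
  note c\<nu> = path_elem_closed[OF \<nu>]
  show "bunit \<mu> \<nu> \<in> carrier B" using c\<mu> c\<nu> by (simp add: bunit_def)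
  show "star B (bunit \<mu> \<nu>) = bunit \<nu> \<mu>" using c\<mu> c\<nu> by (simp add: bunit_def star_mult star_star)
  show "bunit \<mu> \<nu> = (\<Oplus>e\<in>out_arcs E (path_end \<mu>). bunit (path_ext \<mu> e) (path_ext \<nu> e))"
  proof -
    have sc: "s f \<in> carrier B" if "f \<in> out_arcs E (path_end \<mu>)" for f using that s_props(1) by auto
    have "bunit \<mu> \<nu> = path_elem \<mu> \<otimes> p (path_end \<mu>) \<otimes> star B (path_elem \<nu>)"
      using path_elem_end[OF \<mu>] by (simp add: bunit_def)
    also have "\<dots> = (\<Oplus>f\<in>out_arcs E (path_end \<mu>). path_elem \<mu> \<otimes> (s f \<otimes> star B (s f)) \<otimes> star B (path_elem \<nu>))"
      unfolding p_sum[OF v(2)] using fin sc c\<mu> c\<nu> by (simp add: finsum_mult_l finsum_mult_r del: in_out_arcs_conv)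
    also have "\<dots> = (\<Oplus>e\<in>out_arcs E (path_end \<mu>). bunit (path_ext \<mu> e) (path_ext \<nu> e))"
      using sc c\<mu> c\<nu> by (intro M.finsum_cong') (auto simp: bunit_def path_elem_ext star_mult mult_assoc simp del: in_out_arcs_conv)
    finally show ?thesis .
  qed
  fix \<rho> \<sigma> assume \<rho>: "\<rho> \<in> paths blabels n" and \<sigma>: "\<sigma> \<in> paths blabels n" and e': "path_end \<rho> = path_end \<sigma>"
  note c\<rho> = path_elem_closed[OF \<rho>] and c\<sigma> = path_elem_closed[OF \<sigma>]
  have "bunit \<mu> \<nu> \<otimes> bunit \<rho> \<sigma> = path_elem \<mu> \<otimes> (star B (path_elem \<nu>) \<otimes> path_elem \<rho>) \<otimes> star B (path_elem \<sigma>)"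
    using c\<mu> c\<nu> c\<rho> c\<sigma> by (simp add: bunit_def mult_assoc)
  also have "\<dots> = (if \<nu> = \<rho> then bunit \<mu> \<sigma> else \<zero>)"
  proof (cases "\<nu> = \<rho>")
    case True
    then have "star B (path_elem \<nu>) \<otimes> path_elem \<rho> = p (path_end \<mu>)"
      using path_elem_star_mult[OF \<nu> \<rho>] e by simp
    then show ?thesis using True path_elem_end[OF \<mu>] by (simp add: bunit_def)
  qed (use path_elem_star_mult[OF \<nu> \<rho>] c\<mu> c\<sigma> in simp)
  finally show "bunit \<mu> \<nu> \<otimes> bunit \<rho> \<sigma> = (if \<nu> = \<rho> then bunit \<mu> \<sigma> else \<zero>)" .
qed (use finite_paths[of blabels] in \<open>auto simp: blabels_def\<close>)

text \<open>\<open>p v\<close> is the unit of the trivial path at \<open>v\<close>, and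
  \<open>s e\<close> is the unit of the path \<open>e\<close> against the trivial path at its
  head.\<close>

lemma generated_by_bunit:
  assumes S: "cstar_subalgebra S B"
    and mem: "\<And>n \<mu> \<nu>. \<mu> \<in> paths blabels n \<Longrightarrow> \<nu> \<in> paths blabels n \<Longrightarrow> path_end \<mu> = path_end \<nu> \<Longrightarrow> bunit \<mu> \<nu> \<in> S"
  shows "S = carrier B"
proof (rule generated[OF S])
  show "p ` verts E \<subseteq> S"
  proof
    fix x assume "x \<in> p ` verts E"
    then obtain v where v: "v \<in> verts E" "x = p v" by blast
    then obtain n where "v \<in> V n" using verts_levels by auto
    then have "(v, 0, []) \<in> paths blabels n" by (intro trivial_path) (auto simp: blabels_def)
    from mem[OF this this] show "x \<in> S" using p_props[OF v(1)] v(2) by (simp add: bunit_def)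
  qed
  show "s ` arcs E \<subseteq> S"
  proof
    fix x assume "x \<in> s ` arcs E"
    then obtain e where e: "e \<in> arcs E" "x = s e" by blast
    then obtain n where n: "tail E e \<in> V n" using verts_levels tail_in_verts by blast
    then have m: "(tail E e, 0, []) \<in> paths blabels n" "(head E e, 0, []) \<in> paths blabels (Suc n)"
      using arcs_levels[OF e(1)] by (auto intro!: trivial_path simp: blabels_def)
    have "path_ext (tail E e, 0, []) e \<in> paths blabels (Suc n)"
      using e(1) by (intro path_ext_paths[OF m(1)]) simp
    from mem[OF this m(2)] have "bunit (path_ext (tail E e, 0, []) e) (head E e, 0, []) \<in> S" by simp
    moreover have "head E e \<in> verts E" using e(1) by simp
    ultimately show "x \<in> S"
      using e p_s[OF e(1)] s_p[OF e(1)] p_props by (simp add: bunit_def)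
  qed
qed

end

text \<open>By universality the vertex projections of the graph algebra do not vanish, because they do not
  vanish in the representation on infinite paths.\<close>

lemma (in bratteli_paths) ck_family_op_algebra:
  assumes j: "inj j"
  shows "ck_family E (op_algebra j) (\<lambda>v. j (punit (v, 0, []) (v, 0, [])))
    (\<lambda>e. j (punit (path_ext (tail E e, 0, []) e) (head E e, 0, [])))"
proof -
  let ?cs = "\<lambda>_. {0}"
  have triv: "\<exists>n. (v, 0, []) \<in> paths ?cs n" if "v \<in> verts E" for v
    using that verts_levels trivial_path[of v _ 0 ?cs] by auto
  have edge: "\<exists>n. path_ext (tail E e, 0, []) e \<in> paths ?cs (Suc n)" if e: "e \<in> arcs E" for e
  proof -
    obtain n where "(tail E e, 0, []) \<in> paths ?cs n" using triv[of "tail E e"] e by auto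
    from path_ext_paths[OF this, of e] e show ?thesis by auto
  qed
  note simps = op_algebra_simps[OF j]
  show ?thesis
    unfolding ck_family_def
  proof (intro conjI ballI impI)
    fix v assume v: "v \<in> verts E"
    obtain n where n: "(v, 0, []) \<in> paths ?cs n" using triv[OF v] by blast
    show "j (punit (v, 0, []) (v, 0, [])) \<in> carrier (op_algebra j)" by (simp add: simps)
    show "j (punit (v, 0, []) (v, 0, [])) \<otimes>\<^bsub>op_algebra j\<^esub> j (punit (v, 0, []) (v, 0, [])) = j (punit (v, 0, []) (v, 0, []))"
      using punit_mult[OF n n n] by (simp add: simps)
    show "star (op_algebra j) (j (punit (v, 0, []) (v, 0, []))) = j (punit (v, 0, []) (v, 0, []))"
      using punit_adj[OF n n] by (simp add: simps)
    show "j (punit (v, 0, []) (v, 0, [])) \<otimes>\<^bsub>op_algebra j\<^esub> j (punit (w, 0, []) (w, 0, [])) = \<zero>\<^bsub>op_algebra j\<^esub>"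
      if w: "w \<in> verts E" "v \<noteq> w" for w
    proof -
      obtain m where m: "(w, 0, []) \<in> paths ?cs m" using triv[OF w(1)] by blast
      show ?thesis using punit_mult_zero[OF n n m m] w(2) by (simp add: simps)
    qed
    show "j (punit (v, 0, []) (v, 0, [])) = (\<Oplus>\<^bsub>op_algebra j\<^esub>e\<in>out_arcs E v.
      j (punit (path_ext (tail E e, 0, []) e) (head E e, 0, [])) \<otimes>\<^bsub>op_algebra j\<^esub>
      star (op_algebra j) (j (punit (path_ext (tail E e, 0, []) e) (head E e, 0, []))))"
    proof -
      have fin: "finite (out_arcs E v)" using finite_out_arcs path_end_level[OF n] by simp
      have "punit (path_ext (tail E e, 0, []) e) (head E e, 0, []) * adj (punit (path_ext (tail E e, 0, []) e) (head E e, 0, []))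
          = punit (path_ext (v, 0, []) e) (path_ext (v, 0, []) e)" if e: "e \<in> out_arcs E v" for e
      proof -
        have e': "e \<in> arcs E" "tail E e = v" using e by auto
        obtain m where m: "path_ext (tail E e, 0, []) e \<in> paths ?cs (Suc m)" using edge[OF e'(1)] by blast
        obtain k where k: "(head E e, 0, []) \<in> paths ?cs k" using triv[of "head E e"] e'(1) by auto
        show ?thesis using punit_adj[OF m k] punit_mult[OF m k m] e'(2) by simp
      qed
      then have "(\<Sum>e\<in>out_arcs E v. punit (path_ext (tail E e, 0, []) e) (head E e, 0, []) *
          adj (punit (path_ext (tail E e, 0, []) e) (head E e, 0, []))) = punit (v, 0, []) (v, 0, [])"
        using punit_refine[OF n n] by simp
      then show ?thesis by (simp add: simps op_algebra_finsum[OF j fin])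
    qed
  next
    fix e assume e: "e \<in> arcs E"
    obtain m where m: "path_ext (tail E e, 0, []) e \<in> paths ?cs (Suc m)" using edge[OF e] by blast
    obtain k where k: "(head E e, 0, []) \<in> paths ?cs k" using triv[of "head E e"] e by auto
    let ?s = "punit (path_ext (tail E e, 0, []) e) (head E e, 0, [])"
    have adj: "adj ?s = punit (head E e, 0, []) (path_ext (tail E e, 0, []) e)"
      using punit_adj[OF m k] by simp
    have sss: "?s * adj ?s * ?s = ?s" "adj ?s * ?s = punit (head E e, 0, []) (head E e, 0, [])"
      unfolding adj using punit_mult[OF m k m] punit_mult[OF m m k] punit_mult[OF k m k] by simp_all
    show "j ?s \<in> carrier (op_algebra j)" by (simp add: simps)
    show "j ?s \<otimes>\<^bsub>op_algebra j\<^esub> star (op_algebra j) (j ?s) \<otimes>\<^bsub>op_algebra j\<^esub> j ?s = j ?s"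
      using sss(1) by (simp add: simps)
    show "star (op_algebra j) (j ?s) \<otimes>\<^bsub>op_algebra j\<^esub> j ?s = j (punit (head E e, 0, []) (head E e, 0, []))"
      using sss(2) by (simp add: simps)
  qed
qed

lemma (in bratteli_paths) graph_algebra_projection_nonzero:
  fixes B :: "'b cstar"
  assumes ga: "graph_algebra E B p s" and v: "v \<in> verts E"
  shows "p v \<noteq> \<zero>\<^bsub>B\<^esub>"
proof
  assume zero: "p v = \<zero>\<^bsub>B\<^esub>"
  interpret B: cstar_algebra B using ga by (simp add: graph_algebra_def)
  \<comment> \<open>Operators are coded by their action on sequences, which puts them into the type
    over which universality ranges. \<open>Abs_ell2\<close> is unspecified on sequences that are not
    square-summable, but every vector is \<open>Abs_ell2\<close> of some sequence.\<close>
  define j :: "cop \<Rightarrow> cstar_universe" where "j = (\<lambda>T x. Rep_ell2 (capp T (Abs_ell2 x)))"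
  have j: "inj j"
  proof (rule injI)
    fix S T assume "j S = j T"
    then have "Rep_ell2 (capp S (Abs_ell2 (Rep_ell2 x))) = Rep_ell2 (capp T (Abs_ell2 (Rep_ell2 x)))" for x
      unfolding j_def by metis
    then show "S = T" by (intro cop_eqI) (simp add: Rep_ell2_inverse Rep_ell2_inject)
  qed
  have "\<forall>(C :: cstar_universe cstar) q t. cstar_algebra C \<and> ck_family E C q t \<longrightarrow>
      (\<exists>\<pi>\<in>star_hom B C. (\<forall>v\<in>verts E. \<pi> (p v) = q v) \<and> (\<forall>e\<in>arcs E. \<pi> (s e) = t e))"
    using ga unfolding graph_algebra_def by (elim conjE)
  from this[rule_format, OF conjI[OF cstar_algebra_op_algebra[OF j] ck_family_op_algebra[OF j]]]
  obtain \<pi> where \<pi>: "\<pi> \<in> star_hom B (op_algebra j)" "\<forall>v\<in>verts E. \<pi> (p v) = j (punit (v, 0, []) (v, 0, []))"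
    by auto
  have zc: "\<zero>\<^bsub>B\<^esub> \<in> carrier B" by simp
  \<comment> \<open>Zero is preserved because \<open>\<pi>\<close> commutes with multiplication by
    the scalar 0.\<close>
  have "\<pi> (0 \<odot>\<^bsub>B\<^esub> \<zero>\<^bsub>B\<^esub>) = 0 \<odot>\<^bsub>op_algebra j\<^esub> \<pi> \<zero>\<^bsub>B\<^esub>"
    using \<pi>(1) zc unfolding star_hom_def by blast
  moreover have "\<pi> \<zero>\<^bsub>B\<^esub> \<in> carrier (op_algebra j)"
    using \<pi>(1) zc unfolding star_hom_def by blast
  then obtain T where "\<pi> \<zero>\<^bsub>B\<^esub> = j T"
    unfolding op_algebra_simps(1)[OF j] by blast
  ultimately have "\<pi> \<zero>\<^bsub>B\<^esub> = j 0" by (simp add: op_algebra_simps[OF j])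
  then have "j (punit (v, 0, []) (v, 0, [])) = j 0" using \<pi>(2) v zero by metis
  then have "punit (v, 0, []) (v, 0, []) = 0" using j by (simp add: inj_eq)
  moreover obtain n where "v \<in> V n" using v verts_levels by auto
  ultimately show False using punit_nonzero[OF trivial_path[of v n 0 "\<lambda>_. {0}"]] by simp
qed

section \<open>Imprimitivity bimodules of operators\<close>

text \<open>With \<open>q = capp (adj T) r\<close>, the square of
  \<open>\<parallel>t r - T q\<parallel>\<close> is \<open>t^2 \<parallel>r\<parallel>^2 - 2 t
  \<parallel>q\<parallel>^2 + \<parallel>T q\<parallel>^2\<close>, whose last term is at most
  \<open>t \<parallel>q\<parallel>^2\<close>. This is the bound that \<open>pos\<close> asks of
  \<open>T * adj T\<close>.\<close>

lemma norm_scaled_minus_le: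
  assumes t: "(norm T)\<^sup>2 \<le> t"
  shows "norm (cscale (complex_of_real t) R - T * adj T * R) \<le> t * norm R"
proof (rule norm_cop_bound)
  have t0: "0 \<le> t" using t by (meson order_trans zero_le_power2)
  then show "0 \<le> t * norm R" by simp
  fix x
  define r where "r = capp R x"
  define q where "q = capp (adj T) r"
  have "(norm (t *\<^sub>R r - capp T q))\<^sup>2 = t\<^sup>2 * (norm r)\<^sup>2 - 2 * t * (norm q)\<^sup>2 + (norm (capp T q))\<^sup>2"
  proof -
    have "capp T q \<bullet> r = (norm q)\<^sup>2" by (simp add: inner_adj power2_norm_eq_inner flip: q_def)
    moreover have "(norm (t *\<^sub>R r - capp T q))\<^sup>2 = t\<^sup>2 * (norm r)\<^sup>2 - 2 * t * (capp T q \<bullet> r) + (norm (capp T q))\<^sup>2"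
      unfolding power2_norm_eq_inner
      by (simp add: inner_diff_left inner_diff_right inner_commute[of r "capp T q"] power2_eq_square algebra_simps)
    ultimately show ?thesis by simp
  qed
  also have "(norm (capp T q))\<^sup>2 \<le> (norm T * norm q)\<^sup>2"
    by (intro power_mono norm_capp) simp
  also have "(norm T * norm q)\<^sup>2 \<le> t * (norm q)\<^sup>2"
    using t by (simp add: power_mult_distrib mult_right_mono)
  finally have "(norm (t *\<^sub>R r - capp T q))\<^sup>2 \<le> t\<^sup>2 * (norm r)\<^sup>2 - t * (norm q)\<^sup>2"
    by simp
  also have "\<dots> \<le> (t * norm r)\<^sup>2" using t0 by (simp add: power_mult_distrib)
  finally have "norm (t *\<^sub>R r - capp T q) \<le> t * norm r"
    by (rule power2_le_imp_le) (use t0 in simp)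
  also have "\<dots> \<le> t * (norm R * norm x)"
    unfolding r_def by (intro mult_left_mono norm_capp t0)
  finally show "norm (capp (cscale (complex_of_real t) R - T * adj T * R) x) \<le> t * norm R * norm x"
    by (simp add: cscale_def capp_simps r_def q_def mult.assoc)
qed

locale operator_copy = cstar_algebra A for A :: "'a cstar" (structure) +
  fixes \<psi> :: "'a \<Rightarrow> cop"
  assumes emb: "isometric_embedding A \<psi>"
begin

lemma emb_simps:
  "\<lbrakk>x \<in> carrier A; y \<in> carrier A\<rbrakk> \<Longrightarrow> \<psi> (x \<oplus> y) = \<psi> x + \<psi> y"
  "\<lbrakk>x \<in> carrier A; y \<in> carrier A\<rbrakk> \<Longrightarrow> \<psi> (x \<otimes> y) = \<psi> x * \<psi> y"
  "x \<in> carrier A \<Longrightarrow> \<psi> (c \<odot> x) = cscale c (\<psi> x)"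
  "x \<in> carrier A \<Longrightarrow> \<psi> (star A x) = adj (\<psi> x)"
  "x \<in> carrier A \<Longrightarrow> norm (\<psi> x) = nrm A x"
  using emb by (simp_all add: isometric_embedding_def)

lemma emb_minus: "\<lbrakk>x \<in> carrier A; y \<in> carrier A\<rbrakk> \<Longrightarrow> \<psi> (x \<ominus> y) = \<psi> x - \<psi> y"
  by (simp add: minus_eq_smul emb_simps)

lemma emb_inj: "inj_on \<psi> (carrier A)"
proof (rule inj_onI)
  fix x y assume xy: "x \<in> carrier A" "y \<in> carrier A" "\<psi> x = \<psi> y"
  then have "nrm A (x \<ominus> y) = 0" using emb_simps(5)[of "x \<ominus> y"] by (simp add: emb_minus)
  then show "x = y" using xy nrm_eq_0_iff[of "x \<ominus> y"] by (simp add: minus_eq_zero_iff)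
qed

definition pre :: "cop \<Rightarrow> 'a" where "pre = inv_into (carrier A) \<psi>"

lemma pre: "T \<in> \<psi> ` carrier A \<Longrightarrow> pre T \<in> carrier A \<and> \<psi> (pre T) = T"
  unfolding pre_def by (simp add: inv_into_into f_inv_into_f)

lemma pre_eqI: "a \<in> carrier A \<Longrightarrow> \<psi> a = T \<Longrightarrow> pre T = a"
  unfolding pre_def using inv_into_f_f[OF emb_inj] by blast

lemma emb_zero: "\<psi> \<zero> = 0"
  using emb_simps(5)[of \<zero>] by simp

lemma pre_simps:
  assumes "S \<in> \<psi> ` carrier A" "T \<in> \<psi> ` carrier A"
  shows "pre (S + T) = pre S \<oplus> pre T" "pre (S * T) = pre S \<otimes> pre T" "pre (cscale c T) = c \<odot> pre T"
    "pre (adj T) = star A (pre T)" "nrm A (pre T) = norm T"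
  using pre[OF assms(1)] pre[OF assms(2)] emb_simps(5)[of "pre T"] by (auto intro!: pre_eqI simp: emb_simps)

lemma pre_zero: "pre 0 = \<zero>"
  by (rule pre_eqI) (simp_all add: emb_zero)

text \<open>\<open>T\<close> itself need not come from \<open>A\<close>. The operator bound yields
  \<open>pos\<close> for the preimage of \<open>T * adj T\<close>, and its self-adjoint square root
  in \<open>A\<close> is the required factor. Adding 1 to the squared norm keeps the constant
  positive when \<open>T = 0\<close>.\<close>

lemma positive_elem_pre:
  assumes T: "T * adj T \<in> \<psi> ` carrier A" shows "positive_elem A (pre (T * adj T))"
proof -
  define a where "a = pre (T * adj T)"
  have a: "a \<in> carrier A" "\<psi> a = T * adj T" using pre[OF T] by (auto simp: a_def)
  have "star A a = a"
    using a by (intro inj_onD[OF emb_inj]) (auto simp: emb_simps adj_mult adj_adj)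
  moreover have "nrm A (complex_of_real ((norm T)\<^sup>2 + 1) \<odot> y \<ominus> a \<otimes> y) \<le> ((norm T)\<^sup>2 + 1) * nrm A y"
    if y: "y \<in> carrier A" for y
    using norm_scaled_minus_le[of T "(norm T)\<^sup>2 + 1" "\<psi> y"] y a
      emb_simps(5)[of "complex_of_real ((norm T)\<^sup>2 + 1) \<odot> y \<ominus> a \<otimes> y"]
    by (simp add: emb_minus emb_simps del: of_real_add of_real_power)
  ultimately have "pos a"
    unfolding pos_def using a(1) by (auto intro!: exI[of _ "(norm T)\<^sup>2 + 1"] add_nonneg_pos simp del: of_real_add of_real_power)
  from pos_sqrt[OF this] show ?thesis
    unfolding positive_elem_def a_def by metis
qed

lemma norm_closure_span:
  assumes Y: "\<And>y. y \<in> Y \<Longrightarrow> y \<in> \<psi> ` carrier A" and dense: "\<psi> ` carrier A \<subseteq> closure (cop.span Y)"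
  shows "norm_closure A (LinearCombinations.module.span class_ring A (pre ` Y)) = carrier A"
proof -
  let ?sp = "LinearCombinations.module.span class_ring A (pre ` Y)"
  have preY: "pre ` Y \<subseteq> carrier A" using Y pre by blast
  have sub: "submodule class_ring ?sp A" by (rule span_is_submodule[OF preY])
  have inc: "pre ` Y \<subseteq> ?sp" by (rule in_own_span[OF preY])
  have spc: "?sp \<subseteq> carrier A" by (rule span_is_subset2[OF preY])
  have "T \<in> \<psi> ` carrier A \<and> pre T \<in> ?sp" if "T \<in> cop.span Y" for T
    using that
  proof (induction rule: cop.span_induct_alt)
    case base
    have "0 \<in> \<psi> ` carrier A" by (intro image_eqI[of _ _ \<zero>]) (simp_all add: emb_zero)
    then show ?case using submodule.zero_closed[OF sub] by (simp add: pre_zero)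
  next
    case (step c x y)
    have x: "x \<in> \<psi> ` carrier A" using Y step(1) .
    have cx: "cscale c x \<in> \<psi> ` carrier A"
      using pre[OF x] by (intro image_eqI[of _ _ "c \<odot> pre x"]) (auto simp: emb_simps)
    have y: "y \<in> \<psi> ` carrier A" "pre y \<in> ?sp" using step(2) by auto
    have "cscale c x + y \<in> \<psi> ` carrier A"
      using pre[OF cx] pre[OF y(1)] by (intro image_eqI[of _ _ "pre (cscale c x) \<oplus> pre y"]) (auto simp: emb_simps)
    moreover have "c \<odot> pre x \<oplus> pre y \<in> ?sp"
      using inc step(1) y(2) submodule.m_closed[OF sub] submodule.smult_closed[OF sub] by auto
    ultimately show ?case using pre_simps(1)[OF cx y(1)] pre_simps(3)[OF x x] by simp
  qed
  note sp = this
  have "a \<in> norm_closure A ?sp" if a: "a \<in> carrier A" for a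
  proof -
    have "\<exists>y\<in>?sp. nrm A (a \<ominus> y) < e" if e: "e > 0" for e
    proof -
      have "\<psi> a \<in> closure (cop.span Y)" using dense a by blast
      then obtain T where T: "T \<in> cop.span Y" "dist T (\<psi> a) < e"
        using e unfolding closure_approachable by blast
      note p = sp[OF T(1)]
      have "nrm A (a \<ominus> pre T) = norm (\<psi> a - T)"
        using emb_simps(5)[of "a \<ominus> pre T"] pre[of T] p a by (simp add: emb_minus)
      then have "nrm A (a \<ominus> pre T) < e" using T(2) by (simp add: dist_norm norm_minus_commute)
      with p show ?thesis by blast
    qed
    then show ?thesis using a by (simp add: norm_closure_def)
  qed
  then show ?thesis by (auto simp: norm_closure_def)
qed

end

text \<open>\<open>W\<close> is an off-diagonal corner between the operator copies of
  \<open>A\<close> and \<open>B\<close>; the inner products are \<open>x * adj y\<close> and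
  \<open>adj x * y\<close>. The injection \<open>j\<close> allows the bimodule to live in a
  prescribed type.\<close>

locale op_bimodule = A: operator_copy A \<psi> + B: operator_copy B \<eta>
  for A :: "'a cstar" and \<psi> and B :: "'b cstar" and \<eta> +
  fixes W :: "cop set" and j :: "cop \<Rightarrow> 'x"
  assumes W_subspace: "cop.subspace W" and W_closed: "closed W" and j_inj: "inj_on j W"
    and W_left: "\<lbrakk>x \<in> W; y \<in> W\<rbrakk> \<Longrightarrow> x * adj y \<in> \<psi> ` carrier A"
    and W_right: "\<lbrakk>x \<in> W; y \<in> W\<rbrakk> \<Longrightarrow> adj x * y \<in> \<eta> ` carrier B"
    and W_lact: "\<lbrakk>a \<in> carrier A; x \<in> W\<rbrakk> \<Longrightarrow> \<psi> a * x \<in> W"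
    and W_ract: "\<lbrakk>x \<in> W; b \<in> carrier B\<rbrakk> \<Longrightarrow> x * \<eta> b \<in> W"
    and full_left: "\<psi> ` carrier A \<subseteq> closure (cop.span {x * adj y | x y. x \<in> W \<and> y \<in> W})"
    and full_right: "\<eta> ` carrier B \<subseteq> closure (cop.span {adj x * y | x y. x \<in> W \<and> y \<in> W})"
begin

definition un :: "'x \<Rightarrow> cop" where "un = inv_into W j"

lemma un_j [simp]: "T \<in> W \<Longrightarrow> un (j T) = T"
  unfolding un_def using j_inj by simp

definition bimod :: "('a, 'b, 'x) bimodule" where
  "bimod = \<lparr>carrier = j ` W, mult = (\<lambda>x y. x), one = j 0, zero = j 0,
    add = (\<lambda>x y. j (un x + un y)), smult = (\<lambda>c x. j (cscale c (un x))),
    lact = (\<lambda>a x. j (\<psi> a * un x)), ract = (\<lambda>x b. j (un x * \<eta> b)),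
    linner = (\<lambda>x y. A.pre (un x * adj (un y))), rinner = (\<lambda>x y. B.pre (adj (un x) * un y))\<rparr>"

sublocale X: op_copy W j bimod
  by unfold_locales (simp_all add: W_subspace j_inj bimod_def)

lemma bimod_simps:
  "S \<in> W \<Longrightarrow> T \<in> W \<Longrightarrow> j S \<oplus>\<^bsub>bimod\<^esub> j T = j (S + T)"
  "T \<in> W \<Longrightarrow> c \<odot>\<^bsub>bimod\<^esub> j T = j (cscale c T)"
  "T \<in> W \<Longrightarrow> lact bimod a (j T) = j (\<psi> a * T)"
  "T \<in> W \<Longrightarrow> ract bimod (j T) b = j (T * \<eta> b)"
  "S \<in> W \<Longrightarrow> T \<in> W \<Longrightarrow> linner bimod (j S) (j T) = A.pre (S * adj T)"
  "S \<in> W \<Longrightarrow> T \<in> W \<Longrightarrow> rinner bimod (j S) (j T) = B.pre (adj S * T)"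
  by (simp_all add: bimod_def)

lemma left_hilbert: "full_left_hilbert_module A bimod (lact bimod) (linner bimod)"
proof (intro full_left_hilbert_module.intro full_left_hilbert_module_axioms.intro)
  show "cstar_algebra A" ..
  show "vectorspace class_ring bimod" by (rule X.vectorspace_copy)
  note [simp] = bimod_simps X.W_closed W_lact A.emb_simps
  have elim: "\<exists>T\<in>W. x = j T" if "x \<in> carrier bimod" for x using that by (auto simp: X.carrier_copy)
  fix x assume "x \<in> carrier bimod"
  then obtain S where S: "S \<in> W" "x = j S" using elim by blast
  note [simp] = S
  show "positive_elem A (linner bimod x x)"
    using A.positive_elem_pre[OF W_left[OF S(1) S(1)]] by simp
  show "x = \<zero>\<^bsub>bimod\<^esub>" if "linner bimod x x = \<zero>\<^bsub>A\<^esub>"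
  proof -
    have "S * adj S = 0"
      using that A.pre[OF W_left[OF S(1) S(1)]] A.emb_zero by simp
    then have "norm (adj S) = 0" using norm_adj_mult[of "adj S"] by (simp add: adj_adj)
    then have "S = 0" by (simp add: norm_adj)
    then show ?thesis by (simp add: X.zero_copy)
  qed
  { fix a assume a: "a \<in> carrier A"
  note [simp] = a
  show "lact bimod a x \<in> carrier bimod" by (simp add: X.carrier_copy)
  show "lact bimod (k \<odot>\<^bsub>A\<^esub> a) x = k \<odot>\<^bsub>bimod\<^esub> lact bimod a x" for k by (simp add: cscale_mult_left)
  show "lact bimod a (k \<odot>\<^bsub>bimod\<^esub> x) = k \<odot>\<^bsub>bimod\<^esub> lact bimod a x" for k by (simp add: cscale_mult_right)
  { fix b assume "b \<in> carrier A"
    then show "lact bimod (a \<oplus>\<^bsub>A\<^esub> b) x = lact bimod a x \<oplus>\<^bsub>bimod\<^esub> lact bimod b x"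
      "lact bimod (a \<otimes>\<^bsub>A\<^esub> b) x = lact bimod a (lact bimod b x)"
      by (simp_all add: distrib_right mult.assoc) }
  }
  fix y assume "y \<in> carrier bimod"
  then obtain T where T: "T \<in> W" "y = j T" using elim by blast
  note [simp] = T
  note ST = W_left[OF S(1) T(1)]
  show "linner bimod x y \<in> carrier A" using A.pre[OF ST] by simp
  show "star A (linner bimod x y) = linner bimod y x"
    using A.pre_simps(4)[OF ST ST] by (simp add: adj_mult adj_adj)
  show "linner bimod (k \<odot>\<^bsub>bimod\<^esub> x) y = k \<odot>\<^bsub>A\<^esub> linner bimod x y" for k
    using A.pre_simps(3)[OF ST ST] by (simp add: cscale_mult_left)
  { fix a assume a: "a \<in> carrier A"
    note [simp] = a
    show "lact bimod a (x \<oplus>\<^bsub>bimod\<^esub> y) = lact bimod a x \<oplus>\<^bsub>bimod\<^esub> lact bimod a y" by (simp add: distrib_left)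
    show "linner bimod (lact bimod a x) y = a \<otimes>\<^bsub>A\<^esub> linner bimod x y"
    using A.pre_simps(2)[of "\<psi> a" "S * adj T"] ST A.pre_eqI[of a "\<psi> a"] by (simp add: mult.assoc)
  }
  fix z assume "z \<in> carrier bimod"
  then obtain R where R: "R \<in> W" "z = j R" using elim by blast
  show "linner bimod (x \<oplus>\<^bsub>bimod\<^esub> y) z = linner bimod x z \<oplus>\<^bsub>A\<^esub> linner bimod y z"
    using A.pre_simps(1)[OF W_left[OF S(1) R(1)] W_left[OF T(1) R(1)]] R by (simp add: distrib_right)
next
  \<comment> \<open>The norm of an inner square is the square of the operator norm, so completeness
    reduces to \<open>W\<close> being closed.\<close>
  show "complete_wrt bimod (\<lambda>x. sqrt (nrm A (linner bimod x x)))"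
  proof (rule X.complete_copy[OF W_closed])
    fix T assume T: "T \<in> W"
    show "sqrt (nrm A (linner bimod (j T) (j T))) = norm T"
      using T A.pre_simps(5)[OF W_left[OF T T] W_left[OF T T]] norm_adj_mult[of "adj T"]
      by (simp add: bimod_simps adj_adj norm_adj)
  qed
  have eq: "{linner bimod x y | x y. x \<in> carrier bimod \<and> y \<in> carrier bimod} = A.pre ` {x * adj y | x y. x \<in> W \<and> y \<in> W}"
    unfolding X.carrier_copy by (auto simp: bimod_simps image_iff) (metis bimod_simps(5))+
  show "norm_closure A (LinearCombinations.module.span class_ring A
      {linner bimod x y | x y. x \<in> carrier bimod \<and> y \<in> carrier bimod}) = carrier A"
    unfolding eq using W_left full_left by (intro A.norm_closure_span) auto
qed

lemma right_hilbert: "full_right_hilbert_module B bimod (ract bimod) (rinner bimod)"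
proof (intro full_right_hilbert_module.intro full_right_hilbert_module_axioms.intro)
  show "cstar_algebra B" ..
  show "vectorspace class_ring bimod" by (rule X.vectorspace_copy)
  note [simp] = bimod_simps X.W_closed W_ract B.emb_simps
  have elim: "\<exists>T\<in>W. x = j T" if "x \<in> carrier bimod" for x using that by (auto simp: X.carrier_copy)
  fix x assume "x \<in> carrier bimod"
  then obtain S where S: "S \<in> W" "x = j S" using elim by blast
  note [simp] = S
  show "positive_elem B (rinner bimod x x)"
    using B.positive_elem_pre[of "adj S"] W_right[OF S(1) S(1)] by (simp add: adj_adj)
  show "x = \<zero>\<^bsub>bimod\<^esub>" if "rinner bimod x x = \<zero>\<^bsub>B\<^esub>"
  proof -
    have "adj S * S = 0"
      using that B.pre[OF W_right[OF S(1) S(1)]] B.emb_zero by simp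
    then have "S = 0" using norm_adj_mult[of S] by simp
    then show ?thesis by (simp add: X.zero_copy)
  qed
  { fix b assume b: "b \<in> carrier B"
  note [simp] = b
  show "ract bimod x b \<in> carrier bimod" by (simp add: X.carrier_copy)
  show "ract bimod (k \<odot>\<^bsub>bimod\<^esub> x) b = k \<odot>\<^bsub>bimod\<^esub> ract bimod x b" for k by (simp add: cscale_mult_left)
  show "ract bimod x (k \<odot>\<^bsub>B\<^esub> b) = k \<odot>\<^bsub>bimod\<^esub> ract bimod x b" for k by (simp add: cscale_mult_right)
  { fix c assume "c \<in> carrier B"
    then show "ract bimod x (b \<oplus>\<^bsub>B\<^esub> c) = ract bimod x b \<oplus>\<^bsub>bimod\<^esub> ract bimod x c"
      "ract bimod x (b \<otimes>\<^bsub>B\<^esub> c) = ract bimod (ract bimod x b) c"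
      by (simp_all add: distrib_left mult.assoc) }
  }
  fix y assume "y \<in> carrier bimod"
  then obtain T where T: "T \<in> W" "y = j T" using elim by blast
  note [simp] = T
  note ST = W_right[OF S(1) T(1)]
  show "rinner bimod x y \<in> carrier B" using B.pre[OF ST] by simp
  show "star B (rinner bimod x y) = rinner bimod y x"
    using B.pre_simps(4)[OF ST ST] by (simp add: adj_mult adj_adj)
  show "rinner bimod x (k \<odot>\<^bsub>bimod\<^esub> y) = k \<odot>\<^bsub>B\<^esub> rinner bimod x y" for k
    using B.pre_simps(3)[OF ST ST] by (simp add: cscale_mult_right)
  { fix b assume b: "b \<in> carrier B"
    note [simp] = b
    show "ract bimod (x \<oplus>\<^bsub>bimod\<^esub> y) b = ract bimod x b \<oplus>\<^bsub>bimod\<^esub> ract bimod y b" by (simp add: distrib_right)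
    show "rinner bimod x (ract bimod y b) = rinner bimod x y \<otimes>\<^bsub>B\<^esub> b"
    using B.pre_simps(2)[of "adj S * T" "\<eta> b"] ST B.pre_eqI[of b "\<eta> b"] by (simp add: mult.assoc)
  }
  fix z assume "z \<in> carrier bimod"
  then obtain R where R: "R \<in> W" "z = j R" using elim by blast
  show "rinner bimod x (y \<oplus>\<^bsub>bimod\<^esub> z) = rinner bimod x y \<oplus>\<^bsub>B\<^esub> rinner bimod x z"
    using B.pre_simps(1)[OF ST W_right[OF S(1) R(1)]] R by (simp add: distrib_left)
next
  show "complete_wrt bimod (\<lambda>x. sqrt (nrm B (rinner bimod x x)))"
  proof (rule X.complete_copy[OF W_closed])
    fix T assume T: "T \<in> W"
    show "sqrt (nrm B (rinner bimod (j T) (j T))) = norm T"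
      using T B.pre_simps(5)[OF W_right[OF T T] W_right[OF T T]]
      by (simp add: bimod_simps norm_adj_mult)
  qed
  have eq: "{rinner bimod x y | x y. x \<in> carrier bimod \<and> y \<in> carrier bimod} = B.pre ` {adj x * y | x y. x \<in> W \<and> y \<in> W}"
    unfolding X.carrier_copy by (auto simp: bimod_simps image_iff) (metis bimod_simps(6))+
  show "norm_closure B (LinearCombinations.module.span class_ring B
      {rinner bimod x y | x y. x \<in> carrier bimod \<and> y \<in> carrier bimod}) = carrier B"
    unfolding eq using W_right full_right by (intro B.norm_closure_span) auto
qed

theorem imprimitivity: "imprimitivity_bimodule A B bimod"
  unfolding imprimitivity_bimodule_def
proof (intro conjI left_hilbert right_hilbert ballI)
  note [simp] = bimod_simps W_lact W_ract A.emb_simps B.emb_simps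
  have elim: "\<exists>T\<in>W. x = j T" if "x \<in> carrier bimod" for x using that by (auto simp: X.carrier_copy)
  fix x y assume "x \<in> carrier bimod" "y \<in> carrier bimod"
  then obtain S T where [simp]: "S \<in> W" "x = j S" "T \<in> W" "y = j T" using elim by metis
  { fix a assume "a \<in> carrier A"
    then show "rinner bimod (lact bimod a x) y = rinner bimod x (lact bimod (star A a) y)"
      using W_lact[of "star A a" T] by (simp add: adj_mult mult.assoc) }
  { fix b assume "b \<in> carrier B"
    then show "linner bimod (ract bimod x b) y = linner bimod x (ract bimod y (star B b))"
      using W_ract[of T "star B b"] by (simp add: adj_mult adj_adj mult.assoc) }
  fix z assume "z \<in> carrier bimod"
  then obtain R where [simp]: "R \<in> W" "z = j R" using elim by blast
  \<comment> \<open>Associativity of the product of three operators.\<close>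
  show "lact bimod (linner bimod x y) z = ract bimod x (rinner bimod y z)"
    using A.pre[OF W_left[of S T]] B.pre[OF W_right[of T R]] by (simp add: mult.assoc)
next
  fix a b x assume "a \<in> carrier A" "b \<in> carrier B" "x \<in> carrier bimod"
  then show "ract bimod (lact bimod a x) b = lact bimod a (ract bimod x b)"
    by (auto simp: X.carrier_copy bimod_simps W_lact W_ract mult.assoc)
qed

end

section \<open>Rectangular blocks of the path algebra\<close>

context bratteli_paths
begin

definition units :: "('v \<Rightarrow> nat set) \<Rightarrow> ('v \<Rightarrow> nat set) \<Rightarrow> nat \<Rightarrow> cop set" where
  "units cs cs' n = {punit \<mu> \<nu> | \<mu> \<nu>. \<mu> \<in> paths cs n \<and> \<nu> \<in> paths cs' n \<and> path_end \<mu> = path_end \<nu>}"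

text \<open>Finite matrices with rows indexed by paths labelled in \<open>cs\<close> and columns by
  paths labelled in \<open>cs'\<close>. By refinement the spans increase with \<open>n\<close>, so
  the union is again a subspace.\<close>

definition rect :: "('v \<Rightarrow> nat set) \<Rightarrow> ('v \<Rightarrow> nat set) \<Rightarrow> cop set" where
  "rect cs cs' = (\<Union>n. cop.span (units cs cs' n))"

lemma units_mem:
  "\<mu> \<in> paths cs n \<Longrightarrow> \<nu> \<in> paths cs' n \<Longrightarrow> path_end \<mu> = path_end \<nu> \<Longrightarrow> punit \<mu> \<nu> \<in> units cs cs' n"
  unfolding units_def by blast

lemma units_closure_rect: assumes "T \<in> units cs cs' n" shows "T \<in> closure (rect cs cs')"
proof -
  have "T \<in> rect cs cs'" unfolding rect_def using cop.span_base[OF assms] by blast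
  then show ?thesis using closure_subset by blast
qed

lemma span_units_Suc: "cop.span (units cs cs' n) \<subseteq> cop.span (units cs cs' (Suc n))"
proof (rule cop.span_minimal[OF _ cop.subspace_span], rule subsetI)
  fix T assume "T \<in> units cs cs' n"
  then obtain \<mu> \<nu> where T: "T = punit \<mu> \<nu>" and \<mu>: "\<mu> \<in> paths cs n" and \<nu>: "\<nu> \<in> paths cs' n" and e: "path_end \<mu> = path_end \<nu>"
    by (auto simp: units_def simp del: split_paired_Ex)
  show "T \<in> cop.span (units cs cs' (Suc n))"
    unfolding T punit_refine[OF \<mu> \<nu> e]
  proof (rule cop.span_sum, rule cop.span_base)
    fix f assume f: "f \<in> out_arcs E (path_end \<mu>)"
    have "path_ext \<mu> f \<in> paths cs (Suc n)" "path_ext \<nu> f \<in> paths cs' (Suc n)"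
      using path_ext_paths[OF \<mu> f] path_ext_paths[OF \<nu>] f e by simp_all
    then show "punit (path_ext \<mu> f) (path_ext \<nu> f) \<in> units cs cs' (Suc n)"
      unfolding units_def by (intro CollectI exI[of _ "path_ext \<mu> f"] exI[of _ "path_ext \<nu> f"]) simp
  qed
qed

lemma span_units_mono: "m \<le> n \<Longrightarrow> cop.span (units cs cs' m) \<subseteq> cop.span (units cs cs' n)"
  by (rule lift_Suc_mono_le[of "\<lambda>n. cop.span (units cs cs' n)"]) (rule span_units_Suc)

lemma rect_common:
  assumes "S \<in> rect cs1 cs2" "T \<in> rect cs3 cs4"
  obtains n where "S \<in> cop.span (units cs1 cs2 n)" "T \<in> cop.span (units cs3 cs4 n)"
proof -
  obtain m k where "S \<in> cop.span (units cs1 cs2 m)" "T \<in> cop.span (units cs3 cs4 k)"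
    using assms by (auto simp: rect_def)
  then have "S \<in> cop.span (units cs1 cs2 (max m k))" "T \<in> cop.span (units cs3 cs4 (max m k))"
    using span_units_mono[of m "max m k" cs1 cs2] span_units_mono[of k "max m k" cs3 cs4] by auto
  then show thesis by (rule that)
qed

lemma rect_subspace: "cop.subspace (rect cs cs')"
  unfolding cop.subspace_def
proof (intro conjI ballI allI)
  show "0 \<in> rect cs cs'" by (auto simp: rect_def cop.span_zero)
  fix x assume x: "x \<in> rect cs cs'"
  show "cscale c x \<in> rect cs cs'" for c using x cop.span_scale unfolding rect_def by blast
  fix y assume "y \<in> rect cs cs'"
  from rect_common[OF x this] obtain n where "x \<in> cop.span (units cs cs' n)" "y \<in> cop.span (units cs cs' n)" .
  then have "x + y \<in> cop.span (units cs cs' n)" by (rule cop.span_add)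
  then show "x + y \<in> rect cs cs'" by (auto simp: rect_def)
qed

lemma rect_adj: "T \<in> rect cs cs' \<Longrightarrow> adj T \<in> rect cs' cs"
proof -
  assume "T \<in> rect cs cs'"
  then obtain n where n: "T \<in> cop.span (units cs cs' n)" by (auto simp: rect_def)
  have "adj ` units cs cs' n \<subseteq> units cs' cs n"
  proof
    fix S assume "S \<in> adj ` units cs cs' n"
    then obtain \<mu> \<nu> where S: "S = adj (punit \<mu> \<nu>)" and m: "\<mu> \<in> paths cs n" "\<nu> \<in> paths cs' n" "path_end \<mu> = path_end \<nu>"
      by (auto simp: units_def simp del: split_paired_Ex)
    show "S \<in> units cs' cs n"
      unfolding S punit_adj[OF m] units_def using m by (intro CollectI exI[of _ \<nu>] exI[of _ \<mu>]) simp
  qed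
  then have "adj T \<in> cop.span (units cs' cs n)" using cspan_adj[OF n] cop.span_mono by blast
  then show "adj T \<in> rect cs' cs" by (auto simp: rect_def)
qed

lemma rect_mult: "S \<in> rect cs1 cs2 \<Longrightarrow> T \<in> rect cs2 cs3 \<Longrightarrow> S * T \<in> rect cs1 cs3"
proof -
  assume "S \<in> rect cs1 cs2" "T \<in> rect cs2 cs3"
  from rect_common[OF this] obtain n where n: "S \<in> cop.span (units cs1 cs2 n)" "T \<in> cop.span (units cs2 cs3 n)" .
  have "S * T \<in> cop.span (units cs1 cs3 n)"
  proof (rule cspan_mult[OF n])
    fix u w assume "u \<in> units cs1 cs2 n" "w \<in> units cs2 cs3 n"
    then obtain \<mu> \<nu> \<rho> \<sigma> where u: "u = punit \<mu> \<nu>" and w: "w = punit \<rho> \<sigma>" and m: "\<mu> \<in> paths cs1 n" "\<nu> \<in> paths cs2 n"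
        "\<rho> \<in> paths cs2 n" "\<sigma> \<in> paths cs3 n" "path_end \<mu> = path_end \<nu>" "path_end \<rho> = path_end \<sigma>"
      by (auto simp: units_def simp del: split_paired_Ex)
    show "u * w \<in> cop.span (units cs1 cs3 n)"
    proof (cases "\<nu> = \<rho>")
      case True
      then have "u * w = punit \<mu> \<sigma>" unfolding u w using punit_mult[OF m(1,2,4)] m by simp
      moreover have "punit \<mu> \<sigma> \<in> units cs1 cs3 n"
        unfolding units_def using m True by (intro CollectI exI[of _ \<mu>] exI[of _ \<sigma>]) simp
      ultimately show ?thesis by (simp add: cop.span_base)
    next
      case False
      then have "u * w = 0" unfolding u w using punit_mult_zero[OF m] by blast
      then show ?thesis by (simp add: cop.span_zero)
    qed
  qed
  then show "S * T \<in> rect cs1 cs3" by (auto simp: rect_def)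
qed

lemma closure_rect_subspace: "cop.subspace (closure (rect cs cs'))"
  unfolding cop.subspace_def
proof (intro conjI ballI allI)
  show "0 \<in> closure (rect cs cs')"
    using cop.subspace_0[OF rect_subspace] closure_subset by blast
  fix x assume "x \<in> closure (rect cs cs')"
  then obtain X where X: "\<And>n. X n \<in> rect cs cs'" "X \<longlonglongrightarrow> x" unfolding closure_sequential by blast
  show "cscale c x \<in> closure (rect cs cs')" for c
    unfolding closure_sequential
    by (rule exI[of _ "\<lambda>n. cscale c (X n)"]) (simp add: X tendsto_cscale cop.subspace_scale[OF rect_subspace])
  fix y assume "y \<in> closure (rect cs cs')"
  then obtain Y where Y: "\<And>n. Y n \<in> rect cs cs'" "Y \<longlonglongrightarrow> y" unfolding closure_sequential by blast
  show "x + y \<in> closure (rect cs cs')"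
    unfolding closure_sequential
    by (rule exI[of _ "\<lambda>n. X n + Y n"]) (simp add: X Y tendsto_add cop.subspace_add[OF rect_subspace])
qed

lemma closure_rect_mult:
  assumes "x \<in> closure (rect cs1 cs2)" "y \<in> closure (rect cs2 cs3)" shows "x * y \<in> closure (rect cs1 cs3)"
proof -
  obtain X where X: "\<And>n. X n \<in> rect cs1 cs2" "X \<longlonglongrightarrow> x" using assms(1) unfolding closure_sequential by blast
  obtain Y where Y: "\<And>n. Y n \<in> rect cs2 cs3" "Y \<longlonglongrightarrow> y" using assms(2) unfolding closure_sequential by blast
  have "X n * Y n \<in> rect cs1 cs3" for n by (rule rect_mult[OF X(1) Y(1)])
  moreover have "(\<lambda>n. X n * Y n) \<longlonglongrightarrow> x * y" by (intro tendsto_mult X Y)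
  ultimately show ?thesis
    unfolding closure_sequential by (intro exI[of _ "\<lambda>n. X n * Y n"] conjI allI)
qed

lemma closure_rect_adj:
  assumes "x \<in> closure (rect cs1 cs2)" shows "adj x \<in> closure (rect cs2 cs1)"
proof -
  obtain X where X: "\<And>n. X n \<in> rect cs1 cs2" "X \<longlonglongrightarrow> x" using assms unfolding closure_sequential by blast
  have "adj (X n) \<in> rect cs2 cs1" for n by (rule rect_adj[OF X(1)])
  with tendsto_adj[OF X(2)] show ?thesis
    unfolding closure_sequential by (intro exI[of _ "\<lambda>n. adj (X n)"] conjI allI)
qed

text \<open>Any path \<open>\<kappa>\<close> of the second kind with the same end factors
  \<open>punit \<mu> \<nu>\<close> as
  \<open>punit \<mu> \<kappa> * punit \<kappa> \<nu>\<close>.\<close>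

lemma rect_full:
  assumes ex: "\<And>n v. v \<in> V n \<Longrightarrow> \<exists>\<kappa>\<in>paths cs' n. path_end \<kappa> = v"
  shows "closure (rect cs cs) \<subseteq>
    closure (cop.span {x * y | x y. x \<in> closure (rect cs cs') \<and> y \<in> closure (rect cs' cs)})"
proof (rule closure_mono)
  have "units cs cs n \<subseteq> {x * y | x y. x \<in> closure (rect cs cs') \<and> y \<in> closure (rect cs' cs)}" for n
  proof
    fix T assume "T \<in> units cs cs n"
    then obtain \<mu> \<nu> where T: "T = punit \<mu> \<nu>" and m: "\<mu> \<in> paths cs n" "\<nu> \<in> paths cs n" "path_end \<mu> = path_end \<nu>"
      by (auto simp: units_def simp del: split_paired_Ex)
    obtain \<kappa> where k: "\<kappa> \<in> paths cs' n" "path_end \<kappa> = path_end \<mu>"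
      using ex[OF path_end_level[OF m(1)]] by blast
    have "punit \<mu> \<kappa> \<in> units cs cs' n" "punit \<kappa> \<nu> \<in> units cs' cs n"
      using m k by (auto intro!: units_mem)
    then have "punit \<mu> \<kappa> \<in> closure (rect cs cs')" "punit \<kappa> \<nu> \<in> closure (rect cs' cs)"
      by (blast intro: units_closure_rect)+
    moreover have "T = punit \<mu> \<kappa> * punit \<kappa> \<nu>" unfolding T using punit_mult[OF m(1) k(1) m(2)] k m by simp
    ultimately show "T \<in> {x * y | x y. x \<in> closure (rect cs cs') \<and> y \<in> closure (rect cs' cs)}" by blast
  qed
  then show "rect cs cs \<subseteq> cop.span {x * y | x y. x \<in> closure (rect cs cs') \<and> y \<in> closure (rect cs' cs)}"
    unfolding rect_def using cop.span_mono by blast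
qed

text \<open>\<open>x\<close> is a limit of combinations of units, so \<open>x * adj x\<close> is a
  limit of zeros. When the units are countable, \<open>x\<close> can thus be coded by a sequence of
  products.\<close>

lemma rect_separating:
  assumes x: "x \<in> closure (rect cs cs')" and z: "\<And>n u. u \<in> units cs cs' n \<Longrightarrow> x * adj u = 0"
  shows "x = 0"
proof -
  have span: "x * adj T = 0" if "T \<in> cop.span (units cs cs' n)" for T n
    using that
  proof (induction rule: cop.span_induct_alt)
    case base
    then show ?case by (simp add: adj_zero)
  next
    case (step c u y)
    then show ?case using z[OF step(1)] by (simp add: adj_add adj_cscale distrib_left cscale_mult_right)
  qed
  obtain X where X: "\<And>n. X n \<in> rect cs cs'" "X \<longlonglongrightarrow> x" using x unfolding closure_sequential by blast
  have "x * adj (X n) = 0" for n using X(1)[of n] span by (auto simp: rect_def)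
  moreover have "(\<lambda>n. x * adj (X n)) \<longlonglongrightarrow> x * adj x" by (intro tendsto_mult tendsto_const tendsto_adj X)
  ultimately have "x * adj x = 0" by (simp add: LIMSEQ_const_iff)
  then have "adj x = 0" using norm_adj_mult[of "adj x"] by (simp add: adj_adj)
  then show ?thesis by (metis adj_adj adj_zero)
qed

lemma countable_units:
  assumes "\<And>v. v \<in> verts E \<Longrightarrow> finite (cs v)" "\<And>v. v \<in> verts E \<Longrightarrow> finite (cs' v)"
  shows "countable (\<Union>n. units cs cs' n)"
proof -
  have "finite (units cs cs' n)" for n
  proof (rule finite_subset)
    show "units cs cs' n \<subseteq> (\<lambda>(\<mu>, \<nu>). punit \<mu> \<nu>) ` (paths cs n \<times> paths cs' n)" unfolding units_def by blast
    show "finite ((\<lambda>(\<mu>, \<nu>). punit \<mu> \<nu>) ` (paths cs n \<times> paths cs' n))"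
      using finite_paths[of cs n] finite_paths[of cs' n] assms by blast
  qed
  then show ?thesis by (simp add: countable_finite)
qed

end

theorem mainTheorem2:
  fixes A :: "'a cstar" and B :: "'b cstar"
    and E :: "('v, 'e) pre_digraph" and V :: "nat \<Rightarrow> 'v set" and d :: "'v \<Rightarrow> nat"
    and p :: "'v \<Rightarrow> 'b" and s :: "'e \<Rightarrow> 'b"
  assumes "af_algebra A"
    and "bratteli_diagram_for E V d A"
    and "graph_algebra E B p s"
  shows "morita_equivalent A B"
proof -
  have A: "cstar_algebra A" using assms(1) by (simp add: af_algebra_def)
  have B: "cstar_algebra B" using assms(3) by (simp add: graph_algebra_def)
  obtain S where S: "\<And>n. cstar_subalgebra (S n) A" "\<And>n. S n \<subseteq> S (Suc n)" "norm_closure A (\<Union>n. S n) = carrier A"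
    and seq: "bratteli_diagram_for_seq E V d (\<lambda>n. A\<lparr>carrier := S n\<rparr>)"
    using assms(2) unfolding bratteli_diagram_for_def by blast
  have bd: "bratteli_diagram E V d" using seq by (simp add: bratteli_diagram_for_seq_def)
  obtain \<phi> where \<phi>: "\<And>n. \<phi> n \<in> star_iso (A\<lparr>carrier := S n\<rparr>) (matrix_sum (V n) d)"
    and tr: "\<forall>n. \<forall>v\<in>V n. \<forall>w\<in>V (Suc n). \<forall>a\<in>carrier (A\<lparr>carrier := S n\<rparr>).
           (\<forall>u\<in>V n - {v}. \<phi> n a u = 0\<^sub>m (d u) (d u)) \<longrightarrow>
           mat_trace (\<phi> (Suc n) a w) =
             of_nat (card (out_arcs E v \<inter> in_arcs E w)) * mat_trace (\<phi> n a v)"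
    using seq unfolding bratteli_diagram_for_seq_def by blast
  interpret BA: bratteli_algebra A E V d S \<phi>
    by (intro bratteli_algebra.intro bratteli_algebra_axioms.intro A bd) (use S \<phi> tr in auto)
  interpret CK: ck_algebra B E V d p s
  proof (intro ck_algebra.intro ck_algebra_axioms.intro B BA.bratteli_paths_axioms)
    show "p v \<noteq> \<zero>\<^bsub>B\<^esub>" if "v \<in> verts E" for v
      by (rule BA.graph_algebra_projection_nonzero[OF assms(3) that])
  qed (use assms(3) in \<open>auto simp: graph_algebra_def\<close>)
  have fin: "finite (BA.alabels v)" "finite (CK.blabels v)" for v
    by (simp_all add: BA.alabels_def CK.blabels_def)
  obtain \<theta> where \<theta>: "unit_system A (BA.paths BA.alabels) BA.path_end (out_arcs E) path_ext \<theta>"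
    and gen: "\<forall>S'. cstar_subalgebra S' A \<longrightarrow>
      (\<forall>n. \<forall>\<mu>\<in>BA.paths BA.alabels n. \<forall>\<nu>\<in>BA.paths BA.alabels n. BA.path_end \<mu> = BA.path_end \<nu> \<longrightarrow> \<theta> \<mu> \<nu> \<in> S') \<longrightarrow>
      S' = carrier A"
    using BA.algebra_unit_system by (elim exE conjE)
  interpret UA: unit_system_pair A "BA.paths BA.alabels" BA.path_end "out_arcs E" path_ext \<theta> BA.punit
    by (intro unit_system_pair.intro unit_system_pair_axioms.intro \<theta> BA.unit_system_punit fin gen[rule_format])
      (assumption | simp)+
  interpret UB: unit_system_pair B "BA.paths CK.blabels" BA.path_end "out_arcs E" path_ext CK.bunit BA.punit
    by (intro unit_system_pair.intro unit_system_pair_axioms.intro CK.unit_system_bunit BA.unit_system_punit fin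
        CK.generated_by_bunit)
  have rect_eq: "BA.rect cs cs = (\<Union>n. cop.span {BA.punit \<mu> \<nu> | \<mu> \<nu>. \<mu> \<in> BA.paths cs n \<and> \<nu> \<in> BA.paths cs n \<and> BA.path_end \<mu> = BA.path_end \<nu>})" for cs
    by (simp only: BA.rect_def BA.units_def)
  obtain \<psi> where \<psi>: "isometric_embedding A \<psi>" "\<psi> ` carrier A = closure (BA.rect BA.alabels BA.alabels)"
    using UA.ex_isometric_embedding unfolding rect_eq by blast
  obtain \<eta> where \<eta>: "isometric_embedding B \<eta>" "\<eta> ` carrier B = closure (BA.rect CK.blabels CK.blabels)"
    using UB.ex_isometric_embedding unfolding rect_eq by blast
  interpret OA: operator_copy A \<psi> by (intro operator_copy.intro A operator_copy_axioms.intro \<psi>(1))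
  interpret OB: operator_copy B \<eta> by (intro operator_copy.intro B operator_copy_axioms.intro \<eta>(1))
  define W where "W = closure (BA.rect BA.alabels CK.blabels)"
  define U where "U = (\<Union>n. BA.units BA.alabels CK.blabels n)"
  \<comment> \<open>An operator is coded by its left inner products with an enumeration of the units
    in the corner, the second component being constant. This has the type that
    \<open>morita_equivalent\<close> prescribes, and it is injective since the units separate
    \<open>W\<close>.\<close>
  define j :: "cop \<Rightarrow> nat \<Rightarrow> 'a \<times> 'b" where
    "j = (\<lambda>x k. (OA.pre (x * adj (from_nat_into U k)), undefined))"
  have UW: "U \<subseteq> W"
    unfolding U_def W_def by (rule UN_least) (blast intro: BA.units_closure_rect)
  have left: "x * adj y \<in> \<psi> ` carrier A" if "x \<in> W" "y \<in> W" for x y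
    unfolding \<psi>(2) using that BA.closure_rect_mult BA.closure_rect_adj unfolding W_def by blast
  have right: "adj x * y \<in> \<eta> ` carrier B" if "x \<in> W" "y \<in> W" for x y
    unfolding \<eta>(2) using that BA.closure_rect_mult BA.closure_rect_adj unfolding W_def by blast
  have W_subspace: "cop.subspace W" unfolding W_def by (rule BA.closure_rect_subspace)
  have j_inj: "inj_on j W"
  proof (rule inj_onI)
    fix x y assume xy: "x \<in> W" "y \<in> W" "j x = j y"
    have "(x - y) * adj u = 0" if u: "u \<in> U" for u
    proof -
      have "countable U" unfolding U_def by (rule BA.countable_units) (rule fin)+
      then obtain k where "from_nat_into U k = u" using u by (metis from_nat_into_surj)
      then have "OA.pre (x * adj u) = OA.pre (y * adj u)"
        using fun_cong[OF xy(3), of k] by (simp add: j_def)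
      then have "x * adj u = y * adj u"
        using OA.pre[OF left[OF xy(1)]] OA.pre[OF left[OF xy(2)]] u UW by (metis subsetD)
      then show ?thesis by (simp add: left_diff_distrib)
    qed
    then have "x - y = 0"
      using BA.rect_separating[of "x - y" BA.alabels CK.blabels] cop.subspace_diff[OF W_subspace xy(1,2)]
      unfolding U_def W_def by blast
    then show "x = y" by simp
  qed
  \<comment> \<open>Trivial paths serve here; the counterpart for extended paths is
    \<open>BA.ex_apath\<close>. These two facts give fullness on both sides.\<close>
  have exB: "\<exists>\<kappa>\<in>BA.paths CK.blabels n. BA.path_end \<kappa> = v" if "v \<in> V n" for n v
    using BA.trivial_path[OF that, of 0 CK.blabels] by (intro bexI[of _ "(v, 0, [])"]) (simp_all add: CK.blabels_def)
  \<comment> \<open>The opposite corner consists of the adjoints of elements of \<open>W\<close>,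
    which turns the products in \<open>BA.rect_full\<close> into inner products.\<close>
  have adjW: "x \<in> closure (BA.rect CK.blabels BA.alabels) \<longleftrightarrow> adj x \<in> W" for x
    unfolding W_def using BA.closure_rect_adj by (metis adj_adj)
  have fullA: "\<psi> ` carrier A \<subseteq> closure (cop.span {x * adj y | x y. x \<in> W \<and> y \<in> W})"
  proof -
    have "{x * y | x y. x \<in> W \<and> y \<in> closure (BA.rect CK.blabels BA.alabels)} = {x * adj y | x y. x \<in> W \<and> y \<in> W}"
      unfolding adjW by (metis adj_adj)
    then show ?thesis
      using BA.rect_full[of CK.blabels BA.alabels, OF exB] unfolding \<psi>(2) W_def by simp
  qed
  have fullB: "\<eta> ` carrier B \<subseteq> closure (cop.span {adj x * y | x y. x \<in> W \<and> y \<in> W})"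
  proof -
    have "{x * y | x y. x \<in> closure (BA.rect CK.blabels BA.alabels) \<and> y \<in> W} = {adj x * y | x y. x \<in> W \<and> y \<in> W}"
      unfolding adjW by (metis adj_adj)
    then show ?thesis
      using BA.rect_full[of BA.alabels CK.blabels, OF BA.ex_apath] unfolding \<eta>(2) W_def by simp
  qed
  interpret op_bimodule A \<psi> B \<eta> W j
  proof
    show "closed W" by (simp add: W_def)
    show "\<psi> a * x \<in> W" if "a \<in> carrier A" "x \<in> W" for a x
      using that \<psi>(2) BA.closure_rect_mult unfolding W_def by blast
    show "x * \<eta> b \<in> W" if "x \<in> W" "b \<in> carrier B" for x b
      using that \<eta>(2) BA.closure_rect_mult unfolding W_def by blast
  qed (use W_subspace j_inj left right fullA fullB in auto)
  show ?thesis
    unfolding morita_equivalent_def using imprimitivity by blast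
qed



end
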